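(* Let $m,p\ge 1$ and let $x:M^m\to\mathbb{R}^{m+p}$ be a properly immersed, complete and $W$-stable self-shrinker (with $M$ connected) whose normal bundle is flat. Then $x(M^m)$ is an $m$-plane passing through the origin.
   Context: For a smooth immersion $x:M^m\to\mathbb{R}^{m+p}$ of a smooth manifold: $\langle\cdot,\cdot\rangle$ is the Euclidean inner product, $D$ the flat connection of $\mathbb{R}^{m+p}$, $g$ the induced metric, $dV$ its volume element, $h(X,Y)=(D_XY)^\perp$ the second fundamental form, $H=\mathrm{tr}_g h$ the (unnormalized) mean curvature vector, and $D^\perp$ the normal connection. $x^\perp$ is the normal component of the position vector $x$. $x$ is a self-shrinker if $H+x^\perp=0$; this is a $\xi$-submanifold (i.e. $H+x^\perp=\xi$ with $\xi$ a parallel normal field) with $\xi=0$. For an immersion $y:M\to\mathbb{R}^{m+p}$ put $V_0(y)=\int_M e^{-\frac12|y|^2}dV_y$, where $dV_y$ is the volume element induced by $y$. A variation of $x$ is a smooth map $F:M\times(-\varepsilon,\varepsilon)\to\mathbb{R}^{m+p}$ such that each $x_t=F(\cdot,t)$ is an immersion and $x_0=x$; its variation vector field is $\eta=\partial F/\partial t|_{t=0}$. It is compact if there is a relatively compact open $B\subset M$ containing the support of $\partial F/\partial t(\cdot,t)$ for every $t$; normal if $\eta$ is a normal field along $x$; $SN$ if it is normal and $\partial^2F/\partial t^2|_{t=0}=0$. An $SN$-variation is $VP$ if $\int_M\langle\eta,N\rangle e^{-\frac12|x|^2}dV=0$ for every normal field $N$ on $M$ with $D^\perp N\equiv 0$.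 A self-shrinker $x$ is $W$-stable if $V_0(x)<+\infty$ and $\frac{d^2}{dt^2}\big|_{t=0}V_0(x_t)\ge 0$ for every compact $VP$-variation. An $m$-plane is an affine $m$-dimensional subspace of $\mathbb{R}^{m+p}$. *)

theory Defs
  imports "HOL-Analysis.Analysis"
begin

section \<open>Smooth manifolds given by atlases\<close>

abbreviation dird :: "('e::real_normed_vector \<Rightarrow> 'f::real_normed_vector) \<Rightarrow> 'e \<Rightarrow> 'e \<Rightarrow> 'f" where
  "dird f z v \<equiv> frechet_derivative f (at z) v"

text \<open>To be used on open sets only: the derivatives are taken with respect to the full space.\<close>

primrec Ck_on :: "nat \<Rightarrow> ('e::real_normed_vector \<Rightarrow> 'f::real_normed_vector) \<Rightarrow> 'e set \<Rightarrow> bool" where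
  "Ck_on 0 f S \<longleftrightarrow> continuous_on S f"
| "Ck_on (Suc k) f S \<longleftrightarrow>
     (\<forall>z\<in>S. f differentiable (at z)) \<and> (\<forall>v. Ck_on k (\<lambda>z. dird f z v) S)"

definition smooth_on :: "('e::real_normed_vector \<Rightarrow> 'f::real_normed_vector) \<Rightarrow> 'e set \<Rightarrow> bool" where
  "smooth_on f S \<longleftrightarrow> (\<forall>k. Ck_on k f S)"

text \<open>The manifold is a whole type, Hausdorff and second countable by its type class. A chart
  \<open>(U, \<phi>)\<close> is a domain together with a coordinate map, whose values outside \<open>U\<close> are irrelevant.
  An atlas need not be maximal: all notions below depend only on the smooth structure
  that it generates.\<close>

type_synonym ('a, 'm) chart = "'a set \<times> ('a \<Rightarrow> real^'m)"

definition smooth_atlas :: "('a::topological_space, 'm::finite) chart set \<Rightarrow> bool" where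
  "smooth_atlas A \<longleftrightarrow>
     (\<Union>(U, \<phi>)\<in>A. U) = UNIV \<and>
     (\<forall>(U, \<phi>)\<in>A. open U \<and> open (\<phi> ` U) \<and> homeomorphism U (\<phi> ` U) \<phi> (inv_into U \<phi>)) \<and>
     (\<forall>(U, \<phi>)\<in>A. \<forall>(V, \<psi>)\<in>A. smooth_on (\<psi> \<circ> inv_into U \<phi>) (\<phi> ` (U \<inter> V)))"

text \<open>The coordinate representation \<open>f \<circ> \<phi>\<inverse>\<close>, meaningful on \<open>\<phi> ` U\<close>.\<close>

abbreviation loc :: "'a set \<Rightarrow> ('a \<Rightarrow> real^'m::finite) \<Rightarrow> ('a \<Rightarrow> 'f) \<Rightarrow> real^'m \<Rightarrow> 'f" where
  "loc U \<phi> f \<equiv> f \<circ> inv_into U \<phi>"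

definition smooth_map ::
  "('a::topological_space, 'm::finite) chart set \<Rightarrow> ('a \<Rightarrow> 'b::real_normed_vector) \<Rightarrow> bool" where
  "smooth_map A f \<longleftrightarrow> (\<forall>(U, \<phi>)\<in>A. smooth_on (loc U \<phi> f) (\<phi> ` U))"

definition immersion ::
  "('a::topological_space, 'm::finite) chart set \<Rightarrow> ('a \<Rightarrow> 'b::euclidean_space) \<Rightarrow> bool" where
  "immersion A x \<longleftrightarrow> smooth_map A x \<and>
     (\<forall>(U, \<phi>)\<in>A. \<forall>z\<in>\<phi> ` U. inj (dird (loc U \<phi> x) z))"


section \<open>Geometry of an immersion in coordinates\<close>

text \<open>Here \<open>f\<close> is the coordinate representation of an immersion. Vector fields on the coordinate
  domain are functions \<open>X\<close> with values in \<open>real^'m\<close>, pushed forward to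
  \<open>\<lambda>z. dird f z (X z)\<close>; fields along \<open>f\<close> are functions \<open>N\<close> with values in the ambient space,
  and the flat connection differentiates them componentwise.\<close>

definition tangent_at :: "(real^'m::finite \<Rightarrow> 'b::euclidean_space) \<Rightarrow> real^'m \<Rightarrow> 'b set" where
  "tangent_at f z = range (dird f z)"

definition normal_part :: "(real^'m::finite \<Rightarrow> 'b::euclidean_space) \<Rightarrow> real^'m \<Rightarrow> 'b \<Rightarrow> 'b" where
  "normal_part f z w = (THE n. n \<in> (tangent_at f z)\<^sup>\<bottom> \<and> w - n \<in> tangent_at f z)"

definition metric_at :: "(real^'m::finite \<Rightarrow> 'b::euclidean_space) \<Rightarrow> real^'m \<Rightarrow> real^'m^'m" where
  "metric_at f z = (\<chi> i j. dird f z (axis i 1) \<bullet> dird f z (axis j 1))"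

definition second_ff ::
  "(real^'m::finite \<Rightarrow> 'b::euclidean_space) \<Rightarrow> (real^'m \<Rightarrow> real^'m) \<Rightarrow> (real^'m \<Rightarrow> real^'m)
    \<Rightarrow> real^'m \<Rightarrow> 'b" where
  "second_ff f X Y z = normal_part f z (dird (\<lambda>y. dird f y (Y y)) z (X z))"

text \<open>The trace \<open>g\<^sup>i\<^sup>j h(\<partial>\<^sub>i, \<partial>\<^sub>j)\<close>.\<close>

definition mean_curvature ::
  "(real^'m::finite \<Rightarrow> 'b::euclidean_space) \<Rightarrow> real^'m \<Rightarrow> 'b" where
  "mean_curvature f z =
     (\<Sum>i\<in>UNIV. \<Sum>j\<in>UNIV. (matrix_inv (metric_at f z) $ i $ j) *\<^sub>R
        second_ff f (\<lambda>_. axis i 1) (\<lambda>_. axis j 1) z)"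

definition normal_conn ::
  "(real^'m::finite \<Rightarrow> 'b::euclidean_space) \<Rightarrow> (real^'m \<Rightarrow> real^'m) \<Rightarrow> (real^'m \<Rightarrow> 'b)
    \<Rightarrow> real^'m \<Rightarrow> 'b" where
  "normal_conn f X N z = normal_part f z (dird N z (X z))"

definition lie_bracket ::
  "(real^'m::finite \<Rightarrow> real^'m) \<Rightarrow> (real^'m \<Rightarrow> real^'m) \<Rightarrow> real^'m \<Rightarrow> real^'m" where
  "lie_bracket X Y z = dird Y z (X z) - dird X z (Y z)"

definition normal_curvature ::
  "(real^'m::finite \<Rightarrow> 'b::euclidean_space) \<Rightarrow> (real^'m \<Rightarrow> real^'m) \<Rightarrow> (real^'m \<Rightarrow> real^'m)
    \<Rightarrow> (real^'m \<Rightarrow> 'b) \<Rightarrow> real^'m \<Rightarrow> 'b" where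
  "normal_curvature f X Y N z =
     normal_conn f X (normal_conn f Y N) z - normal_conn f Y (normal_conn f X N) z
     - normal_conn f (lie_bracket X Y) N z"


section \<open>Immersed submanifolds\<close>

definition flat_normal_bundle ::
  "('a::topological_space, 'm::finite) chart set \<Rightarrow> ('a \<Rightarrow> 'b::euclidean_space) \<Rightarrow> bool" where
  "flat_normal_bundle A x \<longleftrightarrow>
     (\<forall>(U, \<phi>)\<in>A. \<forall>X Y N.
        smooth_on X (\<phi> ` U) \<and> smooth_on Y (\<phi> ` U) \<and> smooth_on N (\<phi> ` U) \<and>
        (\<forall>z\<in>\<phi> ` U. N z \<in> (tangent_at (loc U \<phi> x) z)\<^sup>\<bottom>) \<longrightarrow>
        (\<forall>z\<in>\<phi> ` U. normal_curvature (loc U \<phi> x) X Y N z = 0))"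

definition normal_field ::
  "('a::topological_space, 'm::finite) chart set \<Rightarrow> ('a \<Rightarrow> 'b::euclidean_space) \<Rightarrow> ('a \<Rightarrow> 'b)
    \<Rightarrow> bool" where
  "normal_field A x N \<longleftrightarrow> smooth_map A N \<and>
     (\<forall>(U, \<phi>)\<in>A. \<forall>z\<in>\<phi> ` U. loc U \<phi> N z \<in> (tangent_at (loc U \<phi> x) z)\<^sup>\<bottom>)"

definition parallel_normal_field ::
  "('a::topological_space, 'm::finite) chart set \<Rightarrow> ('a \<Rightarrow> 'b::euclidean_space) \<Rightarrow> ('a \<Rightarrow> 'b)
    \<Rightarrow> bool" where
  "parallel_normal_field A x N \<longleftrightarrow> normal_field A x N \<and>
     (\<forall>(U, \<phi>)\<in>A. \<forall>z\<in>\<phi> ` U. \<forall>v. normal_conn (loc U \<phi> x) (\<lambda>_. v) (loc U \<phi> N) z = 0)"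

definition self_shrinker ::
  "('a::topological_space, 'm::finite) chart set \<Rightarrow> ('a \<Rightarrow> 'b::euclidean_space) \<Rightarrow> bool" where
  "self_shrinker A x \<longleftrightarrow> immersion A x \<and>
     (\<forall>(U, \<phi>)\<in>A. \<forall>z\<in>\<phi> ` U.
        mean_curvature (loc U \<phi> x) z + normal_part (loc U \<phi> x) z (loc U \<phi> x z) = 0)"

text \<open>The Borel measure that is \<open>sqrt (det g) dz\<close> in every chart. For an immersion \<open>y\<close> of a
  second countable manifold it exists and is unique.\<close>

definition vol :: "('a::topological_space, 'm::finite) chart set \<Rightarrow> ('a \<Rightarrow> 'b::euclidean_space)
    \<Rightarrow> 'a measure" where
  "vol A y = (THE \<mu>. sets \<mu> = sets borel \<and>
     (\<forall>(U, \<phi>)\<in>A. \<forall>B\<in>sets borel. B \<subseteq> U \<longrightarrow>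
        emeasure \<mu> B =
          (\<integral>\<^sup>+z\<in>\<phi> ` B. ennreal (sqrt (det (metric_at (loc U \<phi> y) z))) \<partial>lborel)))"

definition V0 :: "('a::topological_space, 'm::finite) chart set \<Rightarrow> ('a \<Rightarrow> 'b::euclidean_space)
    \<Rightarrow> ennreal" where
  "V0 A y = (\<integral>\<^sup>+q. ennreal (exp (- (1/2) * (norm (y q))\<^sup>2)) \<partial>vol A y)"


section \<open>Completeness of the induced metric\<close>

definition piecewise_C1_curve ::
  "('a::topological_space, 'm::finite) chart set \<Rightarrow> (real \<Rightarrow> 'a) \<Rightarrow> bool" where
  "piecewise_C1_curve A \<gamma> \<longleftrightarrow> path \<gamma> \<and>
     (\<forall>(U, \<phi>)\<in>A. \<forall>a b. 0 \<le> a \<and> a < b \<and> b \<le> 1 \<and> \<gamma> ` {a..b} \<subseteq> U \<longrightarrow>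
        (\<phi> \<circ> \<gamma>) piecewise_C1_differentiable_on {a..b})"

text \<open>Since \<open>g\<close> is induced by \<open>x\<close>, the speed \<open>sqrt (g (\<gamma>', \<gamma>'))\<close> is the norm of \<open>(x \<circ> \<gamma>)'\<close>.
  The length is a nonnegative integral because the library's piecewise \<open>C\<^sup>1\<close> curves may have
  unbounded speed near the exceptional points, hence infinite length.\<close>

definition curve_length :: "('a \<Rightarrow> 'b::euclidean_space) \<Rightarrow> (real \<Rightarrow> 'a) \<Rightarrow> ennreal" where
  "curve_length x \<gamma> =
     (\<integral>\<^sup>+t\<in>{0..1}. ennreal (norm (vector_derivative (x \<circ> \<gamma>) (at t))) \<partial>lborel)"

text \<open>On a connected manifold any two points are joined by a curve of finite length, so the
  conversion to a real number is harmless.\<close>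

definition riem_dist ::
  "('a::topological_space, 'm::finite) chart set \<Rightarrow> ('a \<Rightarrow> 'b::euclidean_space)
    \<Rightarrow> 'a \<Rightarrow> 'a \<Rightarrow> real" where
  "riem_dist A x q r = enn2real
     (INF \<gamma>\<in>{\<gamma>. piecewise_C1_curve A \<gamma> \<and> pathstart \<gamma> = q \<and> pathfinish \<gamma> = r}.
        curve_length x \<gamma>)"

definition complete_immersion ::
  "('a::topological_space, 'm::finite) chart set \<Rightarrow> ('a \<Rightarrow> 'b::euclidean_space) \<Rightarrow> bool" where
  "complete_immersion A x \<longleftrightarrow> Metric_space.mcomplete UNIV (riem_dist A x)"


section \<open>Variations and stability\<close>

definition var_vel :: "('a \<Rightarrow> real \<Rightarrow> 'b::real_normed_vector) \<Rightarrow> 'a \<Rightarrow> real \<Rightarrow> 'b" where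
  "var_vel F q t = vector_derivative (F q) (at t)"

definition variation ::
  "('a::topological_space, 'm::finite) chart set \<Rightarrow> ('a \<Rightarrow> 'b::euclidean_space) \<Rightarrow> real
    \<Rightarrow> ('a \<Rightarrow> real \<Rightarrow> 'b) \<Rightarrow> bool" where
  "variation A x \<epsilon> F \<longleftrightarrow> \<epsilon> > 0 \<and>
     (\<forall>(U, \<phi>)\<in>A. smooth_on (\<lambda>(z, t). F (inv_into U \<phi> z) t) (\<phi> ` U \<times> {-\<epsilon><..<\<epsilon>})) \<and>
     (\<forall>t\<in>{-\<epsilon><..<\<epsilon>}. immersion A (\<lambda>q. F q t)) \<and>
     (\<forall>q. F q 0 = x q)"

definition compact_variation :: "real \<Rightarrow> ('a::topological_space \<Rightarrow> real \<Rightarrow> 'b::euclidean_space) \<Rightarrow> bool"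
  where
  "compact_variation \<epsilon> F \<longleftrightarrow>
     (\<exists>B. open B \<and> compact (closure B) \<and>
        (\<forall>t\<in>{-\<epsilon><..<\<epsilon>}. closure {q. var_vel F q t \<noteq> 0} \<subseteq> B))"

definition SN_variation ::
  "('a::topological_space, 'm::finite) chart set \<Rightarrow> ('a \<Rightarrow> 'b::euclidean_space) \<Rightarrow> real
    \<Rightarrow> ('a \<Rightarrow> real \<Rightarrow> 'b) \<Rightarrow> bool" where
  "SN_variation A x \<epsilon> F \<longleftrightarrow> variation A x \<epsilon> F \<and>
     normal_field A x (\<lambda>q. var_vel F q 0) \<and>
     (\<forall>q. vector_derivative (var_vel F q) (at 0) = 0)"

definition VP_variation ::
  "('a::topological_space, 'm::finite) chart set \<Rightarrow> ('a \<Rightarrow> 'b::euclidean_space) \<Rightarrow> real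
    \<Rightarrow> ('a \<Rightarrow> real \<Rightarrow> 'b) \<Rightarrow> bool" where
  "VP_variation A x \<epsilon> F \<longleftrightarrow> SN_variation A x \<epsilon> F \<and>
     (\<forall>N. parallel_normal_field A x N \<longrightarrow>
        (\<integral>q. (var_vel F q 0 \<bullet> N q) * exp (- (1/2) * (norm (x q))\<^sup>2) \<partial>vol A x) = 0)"

text \<open>Along a compact variation \<open>V0\<close> stays finite and depends smoothly on \<open>t\<close>, so \<open>enn2real\<close> and
  \<open>deriv\<close> take their intended values.\<close>

definition W_stable ::
  "('a::topological_space, 'm::finite) chart set \<Rightarrow> ('a \<Rightarrow> 'b::euclidean_space) \<Rightarrow> bool" where
  "W_stable A x \<longleftrightarrow> V0 A x < \<infinity> \<and>
     (\<forall>\<epsilon> F. VP_variation A x \<epsilon> F \<and> compact_variation \<epsilon> F \<longrightarrow>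
        (deriv ^^ 2) (\<lambda>t. enn2real (V0 A (\<lambda>q. F q t))) 0 \<ge> 0)"

end

theory Submission
  imports Defs
begin

text \<open>Write \<open>a\<^sup>\<bottom>\<close> for the normal part of a fixed vector \<open>a\<close>, and test stability with
  \<open>\<phi> (a\<^sup>\<bottom> + N)\<close>, where \<open>\<phi>\<close> is a radial cutoff and the parallel normal field \<open>N\<close> makes the
  variation orthogonal to all parallel normal fields. By the shrinker equation the second
  variation is, up to a weighted divergence, at most \<open>- \<phi>\<^sup>2 |a\<^sup>\<bottom> + N|\<^sup>2\<close> plus a constant times
  \<open>|\<nabla>\<phi>|\<^sup>2\<close>. The length of \<open>N\<close> is constant and bounded independently of \<open>\<phi>\<close>, and \<open>|a\<^sup>\<bottom> + N|\<close> is at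
  least the difference of the lengths of \<open>a\<^sup>\<bottom>\<close> and \<open>N\<close>. Since the weighted volume is finite, letting
  the cutoff radius grow shows that \<open>|a\<^sup>\<bottom>|\<close> is constant, for every \<open>a\<close>. Hence the tangent spaces do not
  vary, the mean curvature vanishes, and the position vector is tangential. The image is
  open in the fixed tangent space because \<open>x\<close> is an immersion, and closed because \<open>x\<close> is proper.\<close>

section \<open>Smooth functions on open sets\<close>

text \<open>With \<open>N = 0\<close> and no cutoff the second variation along
  \<open>a\<^sup>\<bottom>\<close> is minus its square norm, up to a divergence: translating the
  ambient space lowers the weighted volume to second order. The obstacle is the constraint on
  VP-variations. Adding \<open>N\<close> repairs the constraint but brings in the shape operator of
  \<open>N\<close>, and \<open>N\<close> itself changes with the cutoff. Two choices overcome this.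
  The auxiliary tangential field carries the weight 2 on \<open>N\<close>, so that after its
  divergence is removed the shape operator of \<open>N\<close> survives only as a negative square
  and in one term linear in the gradient of \<phi>; completing the square bounds both by the
  gradient alone. And only the constant length of \<open>N\<close> is compared with the length of
  \<open>a\<^sup>\<bottom>\<close>, so a different \<open>N\<close> for each radius does no harm.
  Since these lengths determine a \<bullet> P a for the tangential projection P, polarisation
  recovers P. No local frames are used. Every trace runs over the fixed \<open>Basis\<close> of the
  ambient space, composed with P, and the derivative of P holds the second fundamental form and all
  shape operators at once.\<close>

lemma Ck_on_imp_continuous_on: "Ck_on k f S \<Longrightarrow> continuous_on S f"
  by (cases k) (auto intro!: continuous_at_imp_continuous_on differentiable_imp_continuous_within)

lemma Ck_on_Suc_imp: "Ck_on (Suc k) f S \<Longrightarrow> Ck_on k f S"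
proof (induction k arbitrary: f)
  case 0
  then show ?case using Ck_on_imp_continuous_on[of "Suc 0" f S] by simp
next
  case (Suc k)
  then show ?case by (metis Ck_on.simps(2))
qed

lemma Ck_on_subset: "Ck_on k f S \<Longrightarrow> T \<subseteq> S \<Longrightarrow> Ck_on k f T"
  by (induction k arbitrary: f) (auto intro: continuous_on_subset)

text \<open>\<open>frechet_derivative\<close> is a choice among the maps satisfying
  \<open>has_derivative\<close>. Functions that agree near \<open>z\<close> admit the same such
  maps, hence share the choice, also at points where no derivative exists.\<close>

lemma dird_cong:
  assumes "open S" "z \<in> S" "\<And>y. y \<in> S \<Longrightarrow> f y = g y"
  shows "dird f z = dird g z"
proof -
  have "\<And>f'. (f has_derivative f') (at z) \<longleftrightarrow> (g has_derivative f') (at z)"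
    using assms by (metis has_derivative_transform_within_open)
  then show ?thesis by (simp add: frechet_derivative_def)
qed

lemma differentiable_cong_open:
  assumes "open S" "z \<in> S" "\<And>y. y \<in> S \<Longrightarrow> f y = g y" "f differentiable (at z)"
  shows "g differentiable (at z)"
  using assms by (metis differentiable_def has_derivative_transform_within_open)

lemma Ck_on_cong:
  assumes "open S" "\<And>z. z \<in> S \<Longrightarrow> f z = g z" "Ck_on k f S"
  shows "Ck_on k g S"
  using assms(2,3)
proof (induction k arbitrary: f g)
  case 0
  then show ?case by (simp cong: continuous_on_cong)
next
  case (Suc k)
  have "Ck_on k (\<lambda>z. dird g z v) S" for v
  proof (rule Suc.IH)
    show "dird f z v = dird g z v" if "z \<in> S" for z
      using dird_cong[OF assms(1) that, of f g] Suc.prems(1) by simp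
    show "Ck_on k (\<lambda>z. dird f z v) S"
      using Suc.prems(2) by simp
  qed
  moreover have "g differentiable (at z)" if "z \<in> S" for z
    using differentiable_cong_open[OF assms(1) that, of f g] Suc.prems that by auto
  ultimately show ?case by simp
qed

lemma Ck_on_local:
  assumes "\<And>z. z \<in> S \<Longrightarrow> \<exists>T. open T \<and> z \<in> T \<and> Ck_on k f T"
  shows "Ck_on k f S"
  using assms
proof (induction k arbitrary: f)
  case 0
  have "isCont f z" if "z \<in> S" for z
    using 0[OF that] continuous_on_eq_continuous_at by auto
  then show ?case
    by (simp add: continuous_at_imp_continuous_on)
next
  case (Suc k)
  then show ?case by (metis Ck_on.simps(2))
qed

lemma dird_eqI: "(f has_derivative f') (at z) \<Longrightarrow> dird f z = f'"
  by (metis frechet_derivative_at)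

lemma Ck_on_const [simp]: "Ck_on k (\<lambda>z. c) S"
  by (induction k arbitrary: c) (auto simp: dird_eqI[OF has_derivative_const])

lemma Ck_on_bounded_linear: "bounded_linear f \<Longrightarrow> Ck_on k f S"
  by (cases k) (auto simp: dird_eqI[OF bounded_linear_imp_has_derivative] differentiable_def
      linear_continuous_on intro!: exI bounded_linear_imp_has_derivative)

lemma has_derivative_dird: "f differentiable (at z) \<Longrightarrow> (f has_derivative dird f z) (at z)"
  by (simp add: frechet_derivative_works)

lemma dird_add:
  assumes "f differentiable (at z)" "g differentiable (at z)"
  shows "dird (\<lambda>z. f z + g z) z v = dird f z v + dird g z v"
  by (subst dird_eqI[OF has_derivative_add]) (use assms in \<open>auto intro: has_derivative_dird\<close>)

lemma Ck_on_add:
  assumes "open S" "Ck_on k f S" "Ck_on k g S"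
  shows "Ck_on k (\<lambda>z. f z + g z) S"
  using assms(2,3)
proof (induction k arbitrary: f g)
  case 0
  then show ?case by (simp add: continuous_on_add)
next
  case (Suc k)
  have "Ck_on k (\<lambda>z. dird (\<lambda>z. f z + g z) z v) S" for v
    by (rule Ck_on_cong[OF assms(1), of "\<lambda>z. dird f z v + dird g z v"])
      (use Suc in \<open>auto simp: dird_add\<close>)
  then show ?case using Suc.prems by auto
qed

lemma Ck_on_bilinear:
  assumes p: "bounded_bilinear p" and "open S" "Ck_on k f S" "Ck_on k g S"
  shows "Ck_on k (\<lambda>z. p (f z) (g z)) S"
  using assms(3,4)
proof (induction k arbitrary: f g)
  case 0
  then show ?case by (simp add: bounded_bilinear.continuous_on[OF p])
next
  case (Suc k)
  have d: "((\<lambda>z. p (f z) (g z)) has_derivative (\<lambda>v. p (f z) (dird g z v) + p (dird f z v) (g z))) (at z)"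
    if "z \<in> S" for z
    by (rule bounded_bilinear.FDERIV[OF p]) (use Suc.prems that in \<open>auto intro: has_derivative_dird\<close>)
  have "Ck_on k (\<lambda>z. dird (\<lambda>z. p (f z) (g z)) z v) S" for v
  proof (rule Ck_on_cong[OF \<open>open S\<close>])
    show "p (f z) (dird g z v) + p (dird f z v) (g z) = dird (\<lambda>z. p (f z) (g z)) z v" if "z \<in> S" for z
      using dird_eqI[OF d[OF that]] by simp
    have "Ck_on k f S" "Ck_on k g S" using Suc.prems by (auto intro: Ck_on_Suc_imp)
    then show "Ck_on k (\<lambda>z. p (f z) (dird g z v) + p (dird f z v) (g z)) S"
      using Suc by (intro Ck_on_add \<open>open S\<close>) auto
  qed
  then show ?case using d by (auto simp: differentiable_def)
qed

lemma Ck_on_sum: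
  assumes "open S" "\<And>i. i \<in> I \<Longrightarrow> Ck_on k (f i) S"
  shows "Ck_on k (\<lambda>z. \<Sum>i\<in>I. f i z) S"
  using assms(2) by (induction I rule: infinite_finite_induct) (auto intro: Ck_on_add assms(1))

lemma dird_compose:
  assumes "f differentiable (at z)" "g differentiable (at (f z))"
  shows "dird (\<lambda>z. g (f z)) z v = dird g (f z) (dird f z v)"
  using frechet_derivative_compose[OF assms] by (simp add: o_def)

text \<open>\<open>Ck_on\<close> speaks of derivatives in fixed directions only. This expansion
  reduces a direction that moves with the point, as in the chain rule, to finitely many fixed
  ones.\<close>

lemma dird_euclidean_sum:
  assumes "f differentiable (at (z::'a::euclidean_space))"
  shows "dird f z v = (\<Sum>b\<in>Basis. (v \<bullet> b) *\<^sub>R dird f z b)"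
proof -
  interpret linear "dird f z" by (rule linear_frechet_derivative[OF assms])
  have "dird f z v = dird f z (\<Sum>b\<in>Basis. (v \<bullet> b) *\<^sub>R b)" by (simp add: euclidean_representation)
  also have "\<dots> = (\<Sum>b\<in>Basis. (v \<bullet> b) *\<^sub>R dird f z b)" by (simp add: sum scale)
  finally show ?thesis .
qed

lemma Ck_on_compose:
  fixes g :: "'b::euclidean_space \<Rightarrow> 'c::real_normed_vector"
  assumes "open S" "Ck_on k g T" "Ck_on k f S" "f ` S \<subseteq> T"
  shows "Ck_on k (\<lambda>z. g (f z)) S"
  using assms(2,3)
proof (induction k arbitrary: g)
  case 0
  then show ?case using assms(4) by (auto intro: continuous_on_compose2)
next
  case (Suc k)
  have "Ck_on k (\<lambda>z. dird (\<lambda>z. g (f z)) z v) S" for v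
  proof (rule Ck_on_cong[OF \<open>open S\<close>])
    show "(\<Sum>b\<in>Basis. (dird f z v \<bullet> b) *\<^sub>R dird g (f z) b) = dird (\<lambda>z. g (f z)) z v" if "z \<in> S" for z
      using that Suc.prems assms(4) by (subst dird_compose) (auto simp flip: dird_euclidean_sum)
    have "Ck_on k (\<lambda>z. dird g (f z) b) S" for b
      using Suc.prems by (intro Suc.IH[of "\<lambda>y. dird g y b"]) (auto intro: Ck_on_Suc_imp)
    moreover have "Ck_on k (\<lambda>z. dird f z v \<bullet> b) S" for b
      using Suc.prems by (intro Ck_on_bilinear[OF bounded_bilinear_inner] \<open>open S\<close>) auto
    ultimately show "Ck_on k (\<lambda>z. (\<Sum>b\<in>Basis. (dird f z v \<bullet> b) *\<^sub>R dird g (f z) b)) S"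
      by (intro Ck_on_sum Ck_on_bilinear[OF bounded_bilinear_scaleR] \<open>open S\<close>)
  qed
  moreover have "(\<lambda>z. g (f z)) differentiable (at z)" if "z \<in> S" for z
    using differentiable_chain_at[of f z g] Suc.prems assms(4) that by (auto simp: o_def)
  ultimately show ?case by auto
qed

section \<open>Closure properties of smooth functions\<close>

named_theorems smooth_intros

lemma smooth_on_const [smooth_intros]: "smooth_on (\<lambda>z. c) S"
  and smooth_on_bounded_linear: "bounded_linear f \<Longrightarrow> smooth_on f S"
  and smooth_on_subset: "smooth_on f S \<Longrightarrow> T \<subseteq> S \<Longrightarrow> smooth_on f T"
  by (auto simp: smooth_on_def Ck_on_bounded_linear intro: Ck_on_subset)

lemma smooth_on_id [smooth_intros]: "smooth_on (\<lambda>z. z) S"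
  by (intro smooth_on_bounded_linear bounded_linear_ident)

lemma smooth_on_fst [smooth_intros]: "smooth_on fst S"
  and smooth_on_snd [smooth_intros]: "smooth_on snd S"
  by (auto intro!: smooth_on_bounded_linear bounded_linear_fst bounded_linear_snd)

lemma smooth_on_imp_differentiable: "smooth_on f S \<Longrightarrow> z \<in> S \<Longrightarrow> f differentiable (at z)"
  by (metis Ck_on.simps(2) smooth_on_def)

lemma smooth_on_has_derivative:
  "smooth_on f S \<Longrightarrow> z \<in> S \<Longrightarrow> (f has_derivative dird f z) (at z)"
  by (simp add: has_derivative_dird smooth_on_imp_differentiable)

lemma smooth_on_imp_continuous_on: "smooth_on f S \<Longrightarrow> continuous_on S f"
  by (metis Ck_on_imp_continuous_on smooth_on_def)

lemma smooth_on_dird [smooth_intros]: "smooth_on f S \<Longrightarrow> smooth_on (\<lambda>z. dird f z v) S"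
  by (metis Ck_on.simps(2) smooth_on_def)

lemma smooth_on_cong:
  "open S \<Longrightarrow> (\<And>z. z \<in> S \<Longrightarrow> f z = g z) \<Longrightarrow> smooth_on f S \<Longrightarrow> smooth_on g S"
  by (metis Ck_on_cong smooth_on_def)

lemma smooth_on_local:
  assumes "\<And>z. z \<in> S \<Longrightarrow> \<exists>T. open T \<and> z \<in> T \<and> smooth_on f T"
  shows "smooth_on f S"
  unfolding smooth_on_def using assms by (metis Ck_on_local smooth_on_def)

lemma smooth_on_add [smooth_intros]:
  "open S \<Longrightarrow> smooth_on f S \<Longrightarrow> smooth_on g S \<Longrightarrow> smooth_on (\<lambda>z. f z + g z) S"
  by (simp add: smooth_on_def Ck_on_add)

lemma smooth_on_bilinear:
  "bounded_bilinear p \<Longrightarrow> open S \<Longrightarrow> smooth_on f S \<Longrightarrow> smooth_on g S \<Longrightarrow> smooth_on (\<lambda>z. p (f z) (g z)) S"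
  by (simp add: smooth_on_def Ck_on_bilinear)

lemmas smooth_on_scaleR [smooth_intros] = smooth_on_bilinear[OF bounded_bilinear_scaleR]
lemmas smooth_on_inner [smooth_intros] = smooth_on_bilinear[OF bounded_bilinear_inner]

lemma smooth_on_mult [smooth_intros]:
  fixes f g :: "'a::real_normed_vector \<Rightarrow> real"
  shows "open S \<Longrightarrow> smooth_on f S \<Longrightarrow> smooth_on g S \<Longrightarrow> smooth_on (\<lambda>z. f z * g z) S"
  by (rule smooth_on_bilinear[OF bounded_bilinear_mult])

lemma smooth_on_uminus [smooth_intros]:
  "open S \<Longrightarrow> smooth_on f S \<Longrightarrow> smooth_on (\<lambda>z. - f z) S"
  using smooth_on_scaleR[OF _ smooth_on_const, of S f "-1"] by simp

lemma smooth_on_diff [smooth_intros]: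
  "open S \<Longrightarrow> smooth_on f S \<Longrightarrow> smooth_on g S \<Longrightarrow> smooth_on (\<lambda>z. f z - g z) S"
  using smooth_on_add[of S f "\<lambda>z. - g z"] smooth_on_uminus by auto

lemma smooth_on_sum [smooth_intros]:
  "open S \<Longrightarrow> (\<And>i. i \<in> I \<Longrightarrow> smooth_on (f i) S) \<Longrightarrow> smooth_on (\<lambda>z. \<Sum>i\<in>I. f i z) S"
  by (simp add: smooth_on_def Ck_on_sum)

lemma smooth_on_prod [smooth_intros]:
  fixes f :: "'i \<Rightarrow> 'a::real_normed_vector \<Rightarrow> real"
  shows "open S \<Longrightarrow> (\<And>i. i \<in> I \<Longrightarrow> smooth_on (f i) S) \<Longrightarrow> smooth_on (\<lambda>z. \<Prod>i\<in>I. f i z) S"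
  by (induction I rule: infinite_finite_induct) (auto intro: smooth_intros)

lemma smooth_on_compose:
  fixes g :: "'b::euclidean_space \<Rightarrow> 'c::real_normed_vector"
  shows "open S \<Longrightarrow> smooth_on g T \<Longrightarrow> smooth_on f S \<Longrightarrow> (\<And>z. z \<in> S \<Longrightarrow> f z \<in> T) \<Longrightarrow> smooth_on (\<lambda>z. g (f z)) S"
  unfolding smooth_on_def by (blast intro: Ck_on_compose)

lemma smooth_on_linear:
  "bounded_linear L \<Longrightarrow> open S \<Longrightarrow> smooth_on f S \<Longrightarrow> smooth_on (\<lambda>z. L (f z)) S"
  for L :: "'b::euclidean_space \<Rightarrow> 'c::real_normed_vector"
  by (rule smooth_on_compose[OF _ smooth_on_bounded_linear]) auto

lemma smooth_on_dird_vector [smooth_intros]: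
  fixes f :: "'a::euclidean_space \<Rightarrow> 'c::real_normed_vector"
  assumes "open S" "smooth_on f S" "smooth_on X S"
  shows "smooth_on (\<lambda>z. dird f z (X z)) S"
proof (rule smooth_on_cong[OF assms(1)])
  show "smooth_on (\<lambda>z. \<Sum>b\<in>Basis. (X z \<bullet> b) *\<^sub>R dird f z b) S"
    using assms by (intro smooth_intros)
  show "(\<Sum>b\<in>Basis. (X z \<bullet> b) *\<^sub>R dird f z b) = dird f z (X z)" if "z \<in> S" for z
    using dird_euclidean_sum[of f z "X z"] smooth_on_imp_differentiable[OF assms(2) that] by simp
qed

lemma smooth_on_vec_lambda [smooth_intros]:
  fixes f :: "'i::finite \<Rightarrow> 'c::real_normed_vector \<Rightarrow> 'a::euclidean_space"
  assumes "open S" "\<And>i. smooth_on (f i) S"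
  shows "smooth_on (\<lambda>z. \<chi> i. f i z) S"
proof -
  have *: "bounded_linear (\<lambda>y::'a. axis i y)" for i :: 'i
    by (intro linear_conv_bounded_linear[THEN iffD1] linearI) (auto simp: vec_eq_iff axis_def)
  have "smooth_on (\<lambda>z. \<Sum>i\<in>UNIV. axis i (f i z)) S"
    using assms by (intro smooth_on_sum smooth_on_linear[OF *])
  moreover have "(\<Sum>i\<in>UNIV. axis i (f i z)) = (\<chi> i. f i z)" for z
    by (simp add: vec_eq_iff axis_def sum.delta')
  ultimately show ?thesis by simp
qed

text \<open>One more order of differentiability is gained from a formula for the derivative. For
  \<open>exp\<close>, \<open>inverse\<close>, \<open>sqrt\<close> and the bump family that formula
  stays within functions already under control, so an induction on \<open>k\<close> closes.\<close>

lemma Ck_on_real_function: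
  assumes "open S" "\<And>z. z \<in> S \<Longrightarrow> (f has_real_derivative f' z) (at z)" "Ck_on k f' S"
  shows "Ck_on (Suc k) f S"
proof -
  have d: "(f has_derivative (\<lambda>v. f' z * v)) (at z)" if "z \<in> S" for z
    using assms(2)[OF that] by (simp add: has_field_derivative_def)
  have "Ck_on k (\<lambda>z. dird f z v) S" for v
    by (rule Ck_on_cong[OF assms(1), of "\<lambda>z. f' z * v"])
      (use d assms in \<open>auto simp: dird_eqI[OF d] intro!: Ck_on_bilinear[OF bounded_bilinear_mult]\<close>)
  then show ?thesis using d by (auto simp: differentiable_def)
qed

lemma smooth_on_exp_UNIV: "smooth_on (exp :: real \<Rightarrow> real) UNIV"
  unfolding smooth_on_def
proof
  show "Ck_on k (exp :: real \<Rightarrow> real) UNIV" for k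
    by (induction k) (auto intro!: Ck_on_real_function continuous_intros DERIV_exp simp del: Ck_on.simps(2))
qed

lemma smooth_on_exp [smooth_intros]:
  "open S \<Longrightarrow> smooth_on f S \<Longrightarrow> smooth_on (\<lambda>z. exp (f z :: real)) S"
  by (rule smooth_on_compose[OF _ smooth_on_exp_UNIV]) auto

lemma smooth_on_inverse_nonzero: "smooth_on (inverse :: real \<Rightarrow> real) (- {0})"
  unfolding smooth_on_def
proof
  fix k show "Ck_on k (inverse :: real \<Rightarrow> real) (- {0})"
  proof (induction k)
    case 0 then show ?case by (auto intro!: continuous_intros)
  next
    case (Suc k)
    show ?case
    proof (rule Ck_on_real_function)
      show "(inverse has_real_derivative (- 1) * (inverse z * inverse z)) (at z)" if "z \<in> - {0}" for z :: real
        using that by (auto intro!: derivative_eq_intros)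
      show "Ck_on k (\<lambda>z::real. (- 1) * (inverse z * inverse z)) (- {0})"
        by (intro Ck_on_bilinear[OF bounded_bilinear_mult] Suc Ck_on_const) auto
    qed auto
  qed
qed

lemma smooth_on_inverse [smooth_intros]:
  "open S \<Longrightarrow> smooth_on f S \<Longrightarrow> (\<And>z. z \<in> S \<Longrightarrow> f z \<noteq> 0) \<Longrightarrow> smooth_on (\<lambda>z. inverse (f z :: real)) S"
  by (rule smooth_on_compose[OF _ smooth_on_inverse_nonzero]) auto

lemma smooth_on_divide [smooth_intros]:
  fixes f g :: "'a::real_normed_vector \<Rightarrow> real"
  shows "open S \<Longrightarrow> smooth_on f S \<Longrightarrow> smooth_on g S \<Longrightarrow> (\<And>z. z \<in> S \<Longrightarrow> g z \<noteq> 0) \<Longrightarrow> smooth_on (\<lambda>z. f z / g z) S"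
  unfolding divide_inverse by (intro smooth_intros)

lemma smooth_on_sqrt_pos: "smooth_on sqrt {0<..}"
  unfolding smooth_on_def
proof
  fix k show "Ck_on k sqrt {0<..}"
  proof (induction k)
    case 0 then show ?case by (auto intro!: continuous_intros)
  next
    case (Suc k)
    show ?case
    proof (rule Ck_on_real_function)
      show "(sqrt has_real_derivative (1/2) * inverse (sqrt z)) (at z)" if "z \<in> {0<..}" for z :: real
        using that by (auto intro!: derivative_eq_intros)
      have "Ck_on k (\<lambda>z. inverse (sqrt z)) {0<..}"
        by (rule Ck_on_compose[OF _ _ Suc, of inverse "-{0}"])
          (use smooth_on_inverse_nonzero in \<open>auto simp: smooth_on_def\<close>)
      then show "Ck_on k (\<lambda>z. (1/2) * inverse (sqrt z)) {0<..}"
        by (intro Ck_on_bilinear[OF bounded_bilinear_mult] Ck_on_const) auto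
    qed auto
  qed
qed

lemma smooth_on_sqrt [smooth_intros]:
  "open S \<Longrightarrow> smooth_on f S \<Longrightarrow> (\<And>z. z \<in> S \<Longrightarrow> 0 < f z) \<Longrightarrow> smooth_on (\<lambda>z. sqrt (f z :: real)) S"
  by (rule smooth_on_compose[OF _ smooth_on_sqrt_pos]) auto

lemma smooth_on_det [smooth_intros]:
  fixes M :: "'a::real_normed_vector \<Rightarrow> real^'m^'m::finite"
  assumes "open S" "\<And>i j. smooth_on (\<lambda>z. M z $ i $ j) S"
  shows "smooth_on (\<lambda>z. det (M z)) S"
  unfolding det_def using assms by (intro smooth_intros) auto

text \<open>Cramer's rule applied to the columns of the identity. The entries of the inverse become
  quotients of determinants, for which smoothness is already known.\<close>

lemma matrix_inv_component:
  fixes M :: "real^'m^'m::finite"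
  assumes "det M \<noteq> 0"
  shows "matrix_inv M $ k $ l = det (\<chi> i j. if j = k then axis l 1 $ i else M $ i $ j) / det M"
proof -
  have "M ** matrix_inv M = mat 1"
    using assms unfolding invertible_det_nz[symmetric] invertible_def matrix_inv_def by (rule someI2_ex) auto
  then have "M *v (matrix_inv M *v axis l 1) = axis l 1"
    by (simp add: matrix_vector_mul_assoc)
  then have "matrix_inv M *v axis l 1 = (\<chi> k. det (\<chi> i j. if j = k then axis l 1 $ i else M $ i $ j) / det M)"
    using cramer[OF assms] by blast
  then have "(matrix_inv M *v axis l 1) $ k = det (\<chi> i j. if j = k then axis l 1 $ i else M $ i $ j) / det M"
    by simp
  then show ?thesis by (simp add: matrix_vector_mult_basis column_def)
qed

lemma smooth_on_matrix_inv:
  fixes M :: "'a::real_normed_vector \<Rightarrow> real^'m^'m::finite"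
  assumes "open S" "\<And>i j. smooth_on (\<lambda>z. M z $ i $ j) S" "\<And>z. z \<in> S \<Longrightarrow> det (M z) \<noteq> 0"
  shows "smooth_on (\<lambda>z. matrix_inv (M z) $ k $ l) S"
proof (rule smooth_on_cong[OF assms(1)])
  show "smooth_on (\<lambda>z. det (\<chi> i j. if j = k then axis l 1 $ i else M z $ i $ j) / det (M z)) S"
  proof (intro smooth_intros assms)
    show "smooth_on (\<lambda>z. (\<chi> i j. if j = k then axis l 1 $ i else M z $ i $ j) $ i $ j) S" for i j
      using assms(2) by (cases "j = k") (auto intro: smooth_intros)
  qed
qed (use assms in \<open>auto simp: matrix_inv_component\<close>)

text \<open>The derivative of the function with exponent \<open>k\<close> combines those with
  exponents \<open>k + 1\<close> and \<open>k + 2\<close>. The family is thus closed under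
  differentiation, which the single function with \<open>k = 0\<close> is not, and the induction on
  \<open>n\<close> runs with \<open>k\<close> arbitrary.\<close>

lemma smooth_bump_family:
  "Ck_on n (\<lambda>s. if s > 0 then (1/s)^k * exp (- (1/s)) else 0 :: real) UNIV"
proof -
  let ?h = "\<lambda>k s. if s > 0 then (1/s)^k * exp (- (1/s)) else 0 :: real"
  have d: "(?h k has_real_derivative ?h (k + 2) s - real k * ?h (k + 1) s) (at s)" for k s
  proof -
    consider "s > 0" | "s < 0" | "s = 0" by linarith
    then show ?thesis
    proof cases
      case 1
      have "((\<lambda>s. (1/s)^k * exp (- (1/s))) has_real_derivative ?h (k + 2) s - real k * ?h (k + 1) s) (at s)"
      proof -
        have 1: "((\<lambda>s. 1/s) has_real_derivative - ((1/s)^2)) (at s)"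
          using 1 by (auto intro!: derivative_eq_intros simp: power2_eq_square)
        have 2: "((\<lambda>s. exp (- (1/s))) has_real_derivative (1/s)^2 * exp (- (1/s))) (at s)"
          using DERIV_fun_exp[OF DERIV_minus[OF 1]] by (simp add: mult.commute)
        have 3: "((\<lambda>s. (1/s)^k) has_real_derivative - real k * (1/s)^(k + 1)) (at s)"
          using DERIV_power[OF 1, of k] by (cases k) (simp_all add: power2_eq_square mult_ac minus_mult_left algebra_simps add_divide_distrib diff_divide_distrib)
        show ?thesis
          using DERIV_mult[OF 3 2] \<open>0 < s\<close> by (simp add: algebra_simps power_add power2_eq_square)
      qed
      then show ?thesis
        by (rule has_field_derivative_transform_within_open[of _ _ _ "{0<..}"]) (use 1 in auto)
    next
      case 2
      have "((\<lambda>s. 0) has_real_derivative 0) (at s)" by simp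
      then have "(?h k has_real_derivative 0) (at s)"
        by (rule has_field_derivative_transform_within_open[of _ _ _ "{..<0}"]) (use 2 in auto)
      then show ?thesis using 2 by simp
    next
      case 3
      \<comment> \<open>The difference quotient at the flat point is u^(k+1) / exp u with u = 1/s,
        which tends to 0 as u grows.\<close>
      have lim: "((\<lambda>s. (1/s)^(Suc k) * exp (- (1/s))) \<longlongrightarrow> 0) (at_right (0::real))"
      proof -
        have "((\<lambda>u. u ^ Suc k / exp u) \<longlongrightarrow> (0::real)) at_top"
          by (rule tendsto_power_div_exp_0)
        then have "((\<lambda>s. (inverse s) ^ Suc k / exp (inverse s)) \<longlongrightarrow> (0::real)) (at_right 0)"
          by (rule filterlim_compose) (rule filterlim_inverse_at_top_right)
        then show ?thesis by (simp add: exp_minus divide_inverse)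
      qed
      have "((\<lambda>h. (?h k (0 + h) - ?h k 0) / h) \<longlongrightarrow> 0) (at 0)"
      proof (rule filterlim_split_at)
        show "((\<lambda>h. (?h k (0 + h) - ?h k 0) / h) \<longlongrightarrow> 0) (at_left 0)"
          by (rule tendsto_eventually) (simp add: eventually_at_filter)
        show "((\<lambda>h. (?h k (0 + h) - ?h k 0) / h) \<longlongrightarrow> 0) (at_right 0)"
        proof (rule Lim_transform_eventually[OF lim])
          have "(1/h)^Suc k * exp (- (1/h)) = (?h k (0 + h) - ?h k 0) / h" if "h > 0" for h
            using that by simp
          then show "\<forall>\<^sub>F h in at_right 0. (1/h)^Suc k * exp (- (1/h)) = (?h k (0 + h) - ?h k 0) / h"
            by (simp only: eventually_at_filter greaterThan_iff) (rule always_eventually, blast)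
        qed
      qed
      then have "(?h k has_real_derivative 0) (at 0)"
        by (simp only: DERIV_def)
      then show ?thesis using 3 by simp
    qed
  qed
  show ?thesis
  proof (induction n arbitrary: k)
    case 0
    show ?case
      using d[of k] by (auto intro!: continuous_at_imp_continuous_on DERIV_isCont)
  next
    case (Suc n)
    have "Ck_on n (\<lambda>s. ?h (k + 2) s + (- real k) * ?h (k + 1) s) UNIV"
      by (intro Ck_on_add Ck_on_bilinear[OF bounded_bilinear_mult] Suc Ck_on_const) auto
    then show ?case
      by (intro Ck_on_real_function[OF _ d]) auto
  qed
qed

definition bump :: "real \<Rightarrow> real" where
  "bump s = (if s > 0 then exp (- (1/s)) else 0)"

lemma smooth_on_bump_UNIV: "smooth_on bump UNIV"
  unfolding smooth_on_def unfolding bump_def[abs_def] using smooth_bump_family[of _ 0, unfolded power_0 mult_1] by (rule allI)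

lemma smooth_on_bump [smooth_intros]:
  "open S \<Longrightarrow> smooth_on f S \<Longrightarrow> smooth_on (\<lambda>z. bump (f z)) S"
  by (rule smooth_on_compose[OF _ smooth_on_bump_UNIV]) auto

lemma bump_pos_iff [simp]: "0 < bump s \<longleftrightarrow> 0 < s"
  and bump_nonneg [simp]: "0 \<le> bump s"
  and bump_nonpos [simp]: "s \<le> 0 \<Longrightarrow> bump s = 0"
  and bump_mono: "s \<le> t \<Longrightarrow> bump s \<le> bump t"
  by (auto simp: bump_def divide_simps)

text \<open>Two mean value steps, first along \<open>u\<close>, then along \<open>v\<close>, express
  the second difference over a parallelogram as a mixed derivative at an inner point. The second
  difference is symmetric in \<open>u\<close> and \<open>v\<close>, and this is where the symmetry
  of second derivatives comes from.\<close>

lemma second_dird_mean_value: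
  fixes g :: "'a::real_normed_vector \<Rightarrow> real"
  assumes "Ck_on 2 g S" "s > 0"
    and S: "\<And>r r'. 0 \<le> r \<Longrightarrow> r \<le> s \<Longrightarrow> 0 \<le> r' \<Longrightarrow> r' \<le> s \<Longrightarrow> z + r *\<^sub>R u + r' *\<^sub>R v \<in> S"
  obtains r r' where "0 < r" "r < s" "0 < r'" "r' < s"
    "g (z + s *\<^sub>R u + s *\<^sub>R v) - g (z + s *\<^sub>R u) - g (z + s *\<^sub>R v) + g z
      = s * s * dird (\<lambda>y. dird g y u) (z + r *\<^sub>R u + r' *\<^sub>R v) v"
proof -
  have diff: "g differentiable (at y)" "(\<lambda>y. dird g y u) differentiable (at y)" if "y \<in> S" for y
    using assms(1) that by (auto simp: numeral_2_eq_2)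
  define \<psi> where "\<psi> r = g (z + r *\<^sub>R u + s *\<^sub>R v) - g (z + r *\<^sub>R u + 0 *\<^sub>R v)" for r
  have 1: "((\<lambda>r. g (z + r *\<^sub>R u + r' *\<^sub>R v)) has_real_derivative dird g (z + r *\<^sub>R u + r' *\<^sub>R v) u) (at r)"
    if "0 \<le> r" "r \<le> s" "0 \<le> r'" "r' \<le> s" for r r'
  proof -
    have dg: "(g has_derivative dird g (z + r *\<^sub>R u + r' *\<^sub>R v)) (at (z + r *\<^sub>R u + r' *\<^sub>R v))"
      by (intro has_derivative_dird diff S that)
    interpret linear "dird g (z + r *\<^sub>R u + r' *\<^sub>R v)"
      by (intro linear_frechet_derivative diff S that)
    have "((\<lambda>r. g (z + r *\<^sub>R u + r' *\<^sub>R v)) has_derivative (\<lambda>h. dird g (z + r *\<^sub>R u + r' *\<^sub>R v) (h *\<^sub>R u))) (at r)"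
      by (rule has_derivative_compose[where g = g and f = "\<lambda>r. z + r *\<^sub>R u + r' *\<^sub>R v", OF _ dg]) (auto intro!: derivative_eq_intros)
    then show ?thesis by (simp add: has_field_derivative_def scale mult.commute[of _ "dird _ _ _"] mult_commute_abs)
  qed
  have 2: "((\<lambda>r'. dird g (z + r *\<^sub>R u + r' *\<^sub>R v) u) has_real_derivative
      dird (\<lambda>y. dird g y u) (z + r *\<^sub>R u + r' *\<^sub>R v) v) (at r')"
    if "0 \<le> r" "r \<le> s" "0 \<le> r'" "r' \<le> s" for r r'
  proof -
    have dg: "((\<lambda>y. dird g y u) has_derivative dird (\<lambda>y. dird g y u) (z + r *\<^sub>R u + r' *\<^sub>R v))
        (at (z + r *\<^sub>R u + r' *\<^sub>R v))"
      by (intro has_derivative_dird diff S that)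
    interpret linear "dird (\<lambda>y. dird g y u) (z + r *\<^sub>R u + r' *\<^sub>R v)"
      by (intro linear_frechet_derivative diff S that)
    have "((\<lambda>r'. dird g (z + r *\<^sub>R u + r' *\<^sub>R v) u) has_derivative
        (\<lambda>h. dird (\<lambda>y. dird g y u) (z + r *\<^sub>R u + r' *\<^sub>R v) (h *\<^sub>R v))) (at r')"
      by (rule has_derivative_compose[where f = "\<lambda>r'. z + r *\<^sub>R u + r' *\<^sub>R v" and g = "\<lambda>y. dird g y u", OF _ dg])
        (auto intro!: derivative_eq_intros)
    then show ?thesis by (simp add: has_field_derivative_def scale mult.commute[of _ "dird _ _ _"] mult_commute_abs)
  qed
  have d\<psi>: "(\<psi> has_real_derivative (dird g (z + r *\<^sub>R u + s *\<^sub>R v) u - dird g (z + r *\<^sub>R u + 0 *\<^sub>R v) u)) (at r)"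
    if "0 \<le> r" "r \<le> s" for r
    unfolding \<psi>_def by (intro DERIV_diff 1 that) (use \<open>s > 0\<close> in auto)
  obtain r where r: "0 < r" "r < s"
    "\<psi> s - \<psi> 0 = (s - 0) * (dird g (z + r *\<^sub>R u + s *\<^sub>R v) u - dird g (z + r *\<^sub>R u + 0 *\<^sub>R v) u)"
    using MVT2[OF \<open>s > 0\<close>, of \<psi> "\<lambda>r. dird g (z + r *\<^sub>R u + s *\<^sub>R v) u - dird g (z + r *\<^sub>R u + 0 *\<^sub>R v) u"] d\<psi>
    by blast
  obtain r' where r': "0 < r'" "r' < s"
    "dird g (z + r *\<^sub>R u + s *\<^sub>R v) u - dird g (z + r *\<^sub>R u + 0 *\<^sub>R v) u
      = (s - 0) * dird (\<lambda>y. dird g y u) (z + r *\<^sub>R u + r' *\<^sub>R v) v"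
    using MVT2[OF \<open>s > 0\<close>, of "\<lambda>r'. dird g (z + r *\<^sub>R u + r' *\<^sub>R v) u"
        "\<lambda>r'. dird (\<lambda>y. dird g y u) (z + r *\<^sub>R u + r' *\<^sub>R v) v"] 2[of r] less_imp_le[OF r(1)] less_imp_le[OF r(2)]
    by blast
  show thesis
    by (rule that[OF r(1,2) r'(1,2)]) (use r(3) r'(3) in \<open>simp add: \<psi>_def algebra_simps\<close>)
qed

text \<open>If the mixed derivatives differed at \<open>z\<close>, continuity would separate all
  their values on a small parallelogram. But each of them represents the same second difference at
  some inner point, so one value of the first equals one value of the second.\<close>

lemma dird_dird_commute_real:
  fixes g :: "'a::real_normed_vector \<Rightarrow> real"
  assumes "open S" "z \<in> S" "smooth_on g S"
  shows "dird (\<lambda>y. dird g y u) z v = dird (\<lambda>y. dird g y v) z u"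
proof (rule ccontr)
  define F where "F y = dird (\<lambda>y. dird g y u) y v" for y
  define G where "G y = dird (\<lambda>y. dird g y v) y u" for y
  assume "\<not> ?thesis"
  then have neq: "0 < dist (F z) (G z) / 2" by (simp add: F_def G_def)
  have C2: "Ck_on 2 g S" using assms(3) by (simp add: smooth_on_def)
  have "smooth_on F S" "smooth_on G S"
    unfolding F_def G_def by (intro smooth_on_dird assms)+
  then have "isCont F z" "isCont G z"
    using assms smooth_on_imp_continuous_on continuous_on_eq_continuous_at by blast+
  then obtain d1 d2 where d1: "d1 > 0" "\<And>y. dist y z < d1 \<Longrightarrow> dist (F y) (F z) < dist (F z) (G z) / 2"
    and d2: "d2 > 0" "\<And>y. dist y z < d2 \<Longrightarrow> dist (G y) (G z) < dist (F z) (G z) / 2"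
    unfolding continuous_at_eps_delta using neq by (metis dist_commute)
  obtain d3 where d3: "d3 > 0" "ball z d3 \<subseteq> S" using assms open_contains_ball by blast
  define d where "d = Min {d1, d2, d3}"
  have "d > 0" using d1 d2 d3 by (simp add: d_def)
  \<comment> \<open>The parallelogram with sides s u and s v then stays within distance
    \<open>d\<close> of \<open>z\<close>; the summand 1 keeps the denominator positive when both
    vectors vanish.\<close>
  define s where "s = d / (2 * (norm u + norm v + 1))"
  have "s > 0" using \<open>d > 0\<close> by (auto simp: s_def intro!: divide_pos_pos add_nonneg_pos)
  have sd: "s * (norm u + norm v) < d"
  proof -
    have "2 * (s * (norm u + norm v + 1)) = d"
    proof -
      have "2 * (d / (2 * c) * c) = d" if "c \<noteq> 0" for c :: real
        using that by simp
      moreover have "norm u + norm v + 1 \<noteq> 0" using norm_ge_zero[of u] norm_ge_zero[of v] by linarith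
      ultimately show ?thesis unfolding s_def by blast
    qed
    moreover have "s * (norm u + norm v + 1) = s * (norm u + norm v) + s" by (simp add: algebra_simps)
    ultimately show ?thesis using \<open>s > 0\<close> \<open>d > 0\<close> by linarith
  qed
  have near: "dist (z + r *\<^sub>R u + r' *\<^sub>R v) z < d" if "0 \<le> r" "r \<le> s" "0 \<le> r'" "r' \<le> s" for r r'
  proof -
    have "dist (z + r *\<^sub>R u + r' *\<^sub>R v) z = norm (r *\<^sub>R u + r' *\<^sub>R v)" by (simp add: dist_norm add.assoc)
    also have "\<dots> \<le> r * norm u + r' * norm v"
      using norm_triangle_ineq[of "r *\<^sub>R u" "r' *\<^sub>R v"] that by simp
    also have "\<dots> \<le> s * norm u + s * norm v" using that by (intro add_mono mult_right_mono) auto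
    also have "\<dots> < d" using sd by (simp add: algebra_simps)
    finally show ?thesis .
  qed
  have inS: "z + r *\<^sub>R u + r' *\<^sub>R v \<in> S" if "0 \<le> r" "r \<le> s" "0 \<le> r'" "r' \<le> s" for r r'
  proof (rule subsetD[OF d3(2)])
    show "z + r *\<^sub>R u + r' *\<^sub>R v \<in> ball z d3"
      using near[OF that] by (simp add: d_def dist_commute)
  qed
  obtain r r' where r: "0 < r" "r < s" "0 < r'" "r' < s"
    "g (z + s *\<^sub>R u + s *\<^sub>R v) - g (z + s *\<^sub>R u) - g (z + s *\<^sub>R v) + g z
      = s * s * F (z + r *\<^sub>R u + r' *\<^sub>R v)"
    unfolding F_def by (rule second_dird_mean_value[of g S s z u v, OF C2 \<open>s > 0\<close> inS])
  have inS': "z + r *\<^sub>R v + r' *\<^sub>R u \<in> S" if "0 \<le> r" "r \<le> s" "0 \<le> r'" "r' \<le> s" for r r'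
    using inS[OF that(3,4,1,2)] by (simp add: add.assoc add.commute[of "r *\<^sub>R v"])
  obtain t t' where t: "0 < t" "t < s" "0 < t'" "t' < s"
    "g (z + s *\<^sub>R v + s *\<^sub>R u) - g (z + s *\<^sub>R v) - g (z + s *\<^sub>R u) + g z
      = s * s * G (z + t *\<^sub>R v + t' *\<^sub>R u)"
    unfolding G_def by (rule second_dird_mean_value[of g S s z v u, OF C2 \<open>s > 0\<close> inS'])
  have swap: "z + b *\<^sub>R v + a *\<^sub>R u = z + a *\<^sub>R u + b *\<^sub>R v" for a b :: real
    by (simp add: add.assoc add.commute[of "b *\<^sub>R v"])
  have "s * s * F (z + r *\<^sub>R u + r' *\<^sub>R v) = s * s * G (z + t' *\<^sub>R u + t *\<^sub>R v)"
    using r(5) t(5) unfolding swap by linarith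
  then have eq: "F (z + r *\<^sub>R u + r' *\<^sub>R v) = G (z + t' *\<^sub>R u + t *\<^sub>R v)"
    using \<open>s > 0\<close> by simp
  have "dist (F (z + r *\<^sub>R u + r' *\<^sub>R v)) (F z) < dist (F z) (G z) / 2"
    using near[of r r'] r by (intro d1(2)) (simp add: d_def)
  moreover have "dist (G (z + t' *\<^sub>R u + t *\<^sub>R v)) (G z) < dist (F z) (G z) / 2"
    using near[of t' t] t by (intro d2(2)) (simp add: d_def)
  moreover have "dist (F z) (G z) \<le> dist (F (z + r *\<^sub>R u + r' *\<^sub>R v)) (F z) + dist (G (z + t' *\<^sub>R u + t *\<^sub>R v)) (G z)"
    unfolding eq by (rule dist_triangle3)
  ultimately show False by linarith
qed

lemma dird_inner_const:
  assumes "f differentiable (at z)"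
  shows "dird (\<lambda>y. f y \<bullet> c) z v = dird f z v \<bullet> c"
proof -
  have "((\<lambda>y. f y \<bullet> c) has_derivative (\<lambda>v. dird f z v \<bullet> c)) (at z)"
    by (rule has_derivative_inner_left[OF has_derivative_dird[OF assms]])
  from dird_eqI[OF this] show ?thesis by (rule fun_cong)
qed

lemma dird_dird_commute:
  fixes f :: "'a::real_normed_vector \<Rightarrow> 'b::euclidean_space"
  assumes "open S" "z \<in> S" "smooth_on f S"
  shows "dird (\<lambda>y. dird f y u) z v = dird (\<lambda>y. dird f y v) z u"
proof (rule euclidean_eqI)
  fix c :: 'b assume "c \<in> Basis"
  have sm: "smooth_on (\<lambda>y. f y \<bullet> c) S" by (intro smooth_intros assms)
  have *: "dird (\<lambda>y. dird (\<lambda>y. f y \<bullet> c) y u) z v = dird (\<lambda>y. dird f y u) z v \<bullet> c" for u v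
  proof -
    have "dird (\<lambda>y. dird (\<lambda>y. f y \<bullet> c) y u) z v = dird (\<lambda>y. dird f y u \<bullet> c) z v"
    proof (rule fun_cong[OF dird_cong[OF assms(1,2)]])
      show "dird (\<lambda>y. f y \<bullet> c) y u = dird f y u \<bullet> c" if "y \<in> S" for y
        by (rule dird_inner_const[OF smooth_on_imp_differentiable[OF assms(3) that]])
    qed
    also have "\<dots> = dird (\<lambda>y. dird f y u) z v \<bullet> c"
      by (rule dird_inner_const[OF smooth_on_imp_differentiable[OF smooth_on_dird[OF assms(3)] assms(2)]])
    finally show ?thesis .
  qed
  show "dird (\<lambda>y. dird f y u) z v \<bullet> c = dird (\<lambda>y. dird f y v) z u \<bullet> c"
    by (rule trans[OF *[symmetric] trans[OF dird_dird_commute_real[OF assms(1,2) sm] *]])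
qed

section \<open>Change of variables\<close>

text \<open>The change of variables theorem of the library asks for a well-ordered index type.\<close>

typedef (overloaded) 'a::finite idx = "{..<CARD('a)} :: nat set"
  by (rule exI[of _ 0]) simp

instantiation idx :: (finite) linorder
begin
definition less_eq_idx :: "'a idx \<Rightarrow> 'a idx \<Rightarrow> bool" where "i \<le> j \<longleftrightarrow> Rep_idx i \<le> Rep_idx j"
definition less_idx :: "'a idx \<Rightarrow> 'a idx \<Rightarrow> bool" where "i < j \<longleftrightarrow> Rep_idx i < Rep_idx j"
instance by standard (auto simp: less_eq_idx_def less_idx_def Rep_idx_inject)
end

instance idx :: (finite) wellorder
proof (rule wf_wellorderI)
  have "{(x::'a idx, y). x < y} = inv_image less_than Rep_idx"
    by (auto simp: less_idx_def)
  then show "wf {(x::'a idx, y). x < y}" by simp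
qed intro_classes

lemma card_idx: "card (UNIV :: 'a::finite idx set) = CARD('a)"
  using type_definition.card[OF type_definition_idx] by simp

instance idx :: (finite) finite
proof
  have "card (UNIV :: 'a idx set) \<noteq> 0" unfolding card_idx by simp
  then show "finite (UNIV :: 'a idx set)" using card_ge_0_finite by blast
qed

definition reindex :: "('j \<Rightarrow> 'i) \<Rightarrow> real^'i::finite \<Rightarrow> real^'j::finite" where
  "reindex \<sigma> x = (\<chi> j. x $ \<sigma> j)"

lemma reindex_nth [simp]: "reindex \<sigma> x $ j = x $ \<sigma> j"
  by (simp add: reindex_def)

lemma bounded_linear_reindex: "bounded_linear (reindex \<sigma>)"
  by (intro linear_conv_bounded_linear[THEN iffD1] linearI) (auto simp: vec_eq_iff)

lemma reindex_inverse:
  assumes "bij \<sigma>"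
  shows "reindex (inv \<sigma>) (reindex \<sigma> x) = x" "reindex \<sigma> (reindex (inv \<sigma>) y) = y"
  using assms by (auto simp: vec_eq_iff bij_inv_eq_iff surj_f_inv_f bij_is_surj inv_f_f bij_is_inj)

lemma prod_Basis_cart: "(\<Prod>b\<in>Basis. (x::real^'i::finite) \<bullet> b) = (\<Prod>i\<in>UNIV. x $ i)"
proof -
  have B: "(Basis :: (real^'i) set) = (\<lambda>i. axis i 1) ` UNIV"
    by (auto simp: Basis_vec_def)
  show ?thesis
    unfolding B by (subst prod.reindex) (auto simp: inj_on_def axis_eq_axis inner_axis)
qed

text \<open>Reindexing maps boxes to boxes and permutes their side lengths, so the product is the
  same; Lebesgue measure is determined by its values on boxes.\<close>

lemma distr_lborel_reindex:
  fixes \<sigma> :: "'j::finite \<Rightarrow> 'i::finite"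
  assumes "bij \<sigma>"
  shows "distr lborel borel (reindex \<sigma>) = lborel"
proof (rule lborel_eqI[symmetric])
  fix l u :: "real^'j" assume le: "\<And>b. b \<in> Basis \<Longrightarrow> l \<bullet> b \<le> u \<bullet> b"
  have le': "l $ j \<le> u $ j" for j
    using le[of "axis j 1"] by (simp add: inner_axis axis_in_Basis_iff)
  have m: "reindex \<sigma> \<in> borel_measurable borel"
    by (intro borel_measurable_continuous_onI linear_continuous_on bounded_linear_reindex)
  have "reindex \<sigma> -` box l u = box (reindex (inv \<sigma>) l) (reindex (inv \<sigma>) u)"
    using bij_is_surj[OF assms] bij_is_inj[OF assms]
    by (auto simp: mem_box_cart) (metis inv_f_f surj_f_inv_f)+
  then have "emeasure (distr lborel borel (reindex \<sigma>)) (box l u)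
      = emeasure lborel (box (reindex (inv \<sigma>) l) (reindex (inv \<sigma>) u))"
    using m by (subst emeasure_distr) (auto simp: measurable_def)
  also have "\<dots> = (\<Prod>b\<in>Basis. (reindex (inv \<sigma>) u - reindex (inv \<sigma>) l) \<bullet> b)"
    by (rule emeasure_lborel_box) (auto simp: Basis_vec_def inner_axis le')
  also have "\<dots> = (\<Prod>i\<in>UNIV. (u - l) $ inv \<sigma> i)"
    by (simp add: prod_Basis_cart)
  also have "\<dots> = (\<Prod>j\<in>UNIV. (u - l) $ j)"
    by (rule arg_cong[OF prod.reindex_bij_betw]) (rule bij_imp_bij_inv[OF assms])
  also have "\<dots> = (\<Prod>b\<in>Basis. (u - l) \<bullet> b)"
    by (simp add: prod_Basis_cart)
  finally show "emeasure (distr lborel borel (reindex \<sigma>)) (box l u) = (\<Prod>b\<in>Basis. (u - l) \<bullet> b)" .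
qed simp

text \<open>Conjugation with \<sigma> is a sign-preserving bijection between the permutations of the
  two index types, so the Leibniz sums agree term by term.\<close>

lemma det_reindex:
  fixes \<sigma> :: "'j::finite \<Rightarrow> 'i::finite" and A :: "real^'i^'i"
  assumes "bij \<sigma>"
  shows "det (\<chi> i j. A $ \<sigma> i $ \<sigma> j) = det A"
proof -
  note [simp] = surj_f_inv_f[OF bij_is_surj[OF assms]] inv_f_f[OF bij_is_inj[OF assms]]
  have mp: "map_permutation UNIV \<sigma> p = \<sigma> \<circ> p \<circ> inv \<sigma>" for p
    using bij_is_surj[OF assms] by (simp add: map_permutation_def restrict_id_def fun_eq_iff)
  have "det A = (\<Sum>p\<in>{p. p permutes (UNIV::'i set)}. of_int (sign p) * (\<Prod>i\<in>UNIV. A $ i $ p i))"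
    by (simp add: det_def)
  also have "\<dots> = (\<Sum>p\<in>{p. p permutes (UNIV::'j set)}. of_int (sign p) * (\<Prod>i\<in>UNIV. A $ \<sigma> i $ \<sigma> (p i)))"
  proof (rule sum.reindex_bij_witness[where j = "\<lambda>p. inv \<sigma> \<circ> p \<circ> \<sigma>" and i = "\<lambda>p. \<sigma> \<circ> p \<circ> inv \<sigma>"])
    fix p :: "'i \<Rightarrow> 'i" assume p: "p \<in> {p. p permutes UNIV}"
    define q where "q = inv \<sigma> \<circ> p \<circ> \<sigma>"
    have pq: "p = \<sigma> \<circ> q \<circ> inv \<sigma>" by (simp add: q_def fun_eq_iff)
    have "bij q"
      unfolding q_def using permutes_bij[of p UNIV] p assms by (simp add: bij_comp bij_imp_bij_inv)
    then have q: "q permutes UNIV" by (simp add: permutes_def bij_iff)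
    then show "inv \<sigma> \<circ> p \<circ> \<sigma> \<in> {p. p permutes UNIV}" by (simp add: q_def)
    have "sign p = sign q"
      unfolding pq mp[symmetric] by (rule sign_map_permutation) (use assms q in \<open>auto simp: bij_def\<close>)
    moreover have "(\<Prod>i\<in>UNIV. A $ i $ p i) = (\<Prod>i\<in>UNIV. A $ \<sigma> i $ p (\<sigma> i))"
      by (rule prod.reindex_bij_betw[symmetric, of \<sigma>, where g = "\<lambda>i. A $ i $ p i"]) (rule assms)
    ultimately show "of_int (sign (inv \<sigma> \<circ> p \<circ> \<sigma>)) * (\<Prod>i\<in>UNIV. A $ \<sigma> i $ \<sigma> ((inv \<sigma> \<circ> p \<circ> \<sigma>) i))
        = of_int (sign p) * (\<Prod>i\<in>UNIV. A $ i $ p i)"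
      by (simp add: q_def)
  next
    fix q :: "'j \<Rightarrow> 'j" assume q: "q \<in> {p. p permutes UNIV}"
    have "bij (\<sigma> \<circ> q \<circ> inv \<sigma>)"
      using permutes_bij[of q UNIV] q assms by (simp add: bij_comp bij_imp_bij_inv)
    then show "\<sigma> \<circ> q \<circ> inv \<sigma> \<in> {p. p permutes UNIV}"
      by (simp add: permutes_def bij_iff)
  qed (auto simp: fun_eq_iff)
  also have "\<dots> = det (\<chi> i j. A $ \<sigma> i $ \<sigma> j)"
    by (simp add: det_def)
  finally show ?thesis by simp
qed

text \<open>\<open>has_measure_differentiable_image\<close> relates finite measure to a real-valued
  integral. If the nonnegative integral is finite, it applies directly; if it is infinite, an image
  of finite measure would make it finite, a contradiction.\<close>

lemma emeasure_image_wellorder: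
  fixes g :: "real^'n::{finite,wellorder} \<Rightarrow> real^'n::_"
  assumes S: "S \<in> sets borel" "g ` S \<in> sets borel"
    and der: "\<And>x. x \<in> S \<Longrightarrow> (g has_derivative g' x) (at x within S)"
    and inj: "inj_on g S"
    and meas: "(\<lambda>x. indicator S x * \<bar>det (matrix (g' x))\<bar>) \<in> borel_measurable borel"
  shows "emeasure lborel (g ` S) = (\<integral>\<^sup>+x. ennreal (indicator S x * \<bar>det (matrix (g' x))\<bar>) \<partial>lborel)"
proof -
  let ?d = "\<lambda>x. \<bar>det (matrix (g' x))\<bar>"
  have SL: "S \<in> sets lebesgue" using S by simp
  have UN: "(?d has_integral r) S \<longleftrightarrow> ((\<lambda>x. indicator S x * ?d x) has_integral r) UNIV" for r
  proof -
    have "(\<lambda>x. indicator S x * ?d x) = (\<lambda>x. if x \<in> S then ?d x else 0)" by (auto simp: indicator_def)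
    then show ?thesis by (simp only: has_integral_restrict_UNIV)
  qed
  show ?thesis
  proof (cases "(\<integral>\<^sup>+x. ennreal (indicator S x * ?d x) \<partial>lborel) = \<infinity>")
    case False
    then obtain r where r: "(\<integral>\<^sup>+x. ennreal (indicator S x * ?d x) \<partial>lborel) = ennreal r" "0 \<le> r"
      by (cases "(\<integral>\<^sup>+x. ennreal (indicator S x * ?d x) \<partial>lborel)") auto
    have "((\<lambda>x. indicator S x * ?d x) has_integral r) UNIV"
      by (rule nn_integral_has_integral[OF meas _ r]) auto
    then have "g ` S \<in> lmeasurable \<and> measure lebesgue (g ` S) = r"
      using has_measure_differentiable_image[OF SL der inj] UN by blast
    then have "emeasure lebesgue (g ` S) = ennreal r"
      using emeasure_eq_measure2[of "g ` S" lebesgue] by simp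
    then show ?thesis using r S by simp
  next
    case True
    have "emeasure lborel (g ` S) = \<infinity>"
    proof (rule ccontr)
      assume "\<not> ?thesis"
      then have "g ` S \<in> lmeasurable" using S by (auto simp: fmeasurable_def top.not_eq_extremum)
      then have "(?d has_integral measure lebesgue (g ` S)) S"
        using has_measure_differentiable_image[OF SL der inj] by blast
      then have "((\<lambda>x. indicator S x * ?d x) has_integral measure lebesgue (g ` S)) UNIV" using UN by blast
      then have "(\<integral>\<^sup>+x. ennreal (indicator S x * ?d x) \<partial>lborel) = ennreal (measure lebesgue (g ` S))"
        by (intro nn_integral_has_integral_lborel[OF meas]) auto
      then show False using True by simp
    qed
    then show ?thesis using True by simp
  qed
qed

lemma reindex_vimage_eq:
  assumes "bij \<sigma>"
  shows "reindex \<sigma> ` S = reindex (inv \<sigma>) -` S"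
  using reindex_inverse[OF assms] by (auto simp: image_iff) metis

lemma borel_measurable_reindex [measurable]: "reindex \<sigma> \<in> borel_measurable borel"
  by (intro borel_measurable_continuous_onI linear_continuous_on bounded_linear_reindex)

text \<open>Conjugating \<open>g\<close> with a reindexing to \<open>'m idx\<close> changes neither
  Lebesgue measure nor the determinant of the derivative.\<close>

lemma emeasure_image_det:
  fixes g :: "real^'m::finite \<Rightarrow> real^'m"
  assumes S [measurable]: "S \<in> sets borel" "g ` S \<in> sets borel"
    and der: "\<And>x. x \<in> S \<Longrightarrow> (g has_derivative g' x) (at x within S)"
    and inj: "inj_on g S"
    and meas [measurable]: "(\<lambda>x. indicator S x * \<bar>det (matrix (g' x))\<bar>) \<in> borel_measurable borel"
  shows "emeasure lborel (g ` S) = (\<integral>\<^sup>+x. ennreal (indicator S x * \<bar>det (matrix (g' x))\<bar>) \<partial>lborel)"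
proof -
  obtain \<sigma> :: "'m idx \<Rightarrow> 'm" where \<sigma>: "bij \<sigma>"
    using finite_same_card_bij[of "UNIV :: 'm idx set" "UNIV :: 'm set"] card_idx[where 'a='m] by auto
  define \<tau> where "\<tau> = inv \<sigma>"
  have \<tau>: "bij \<tau>" "inv \<tau> = \<sigma>" using \<sigma> by (auto simp: \<tau>_def bij_imp_bij_inv inv_inv_eq)
  have r[simp]: "reindex \<tau> (reindex \<sigma> x) = x" "reindex \<sigma> (reindex \<tau> y) = y" for x :: "real^'m" and y :: "real^'m idx"
    using reindex_inverse[OF \<sigma>] by (auto simp: \<tau>_def)
  note lin = bounded_linear_reindex
  define G where "G = (\<lambda>y. reindex \<sigma> (g (reindex \<tau> y)))"
  define G' where "G' y = (\<lambda>v. reindex \<sigma> (g' (reindex \<tau> y) (reindex \<tau> v)))" for y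
  let ?S = "reindex \<tau> -` S"
  have imS: "reindex \<sigma> ` A = reindex \<tau> -` A" for A
    using reindex_vimage_eq[OF \<sigma>] by (simp add: \<tau>_def)
  have GS: "G ` ?S = reindex \<tau> -` (g ` S)"
    unfolding imS[symmetric] by (simp add: G_def image_comp o_def)
  have meas_vimage: "reindex \<tau> -` A \<in> sets borel" if "A \<in> sets borel" for A :: "(real^'m) set"
    using measurable_sets[OF borel_measurable_reindex that] by simp
  have em: "emeasure lborel (reindex \<tau> -` A) = emeasure lborel A" if "A \<in> sets borel" for A :: "(real^'m) set"
    using emeasure_distr[of "reindex \<tau>" lborel borel A] that distr_lborel_reindex[OF \<tau>(1)]
    by (simp add: measurable_lborel2)
  have dG: "(G has_derivative G' y) (at y within ?S)" if "y \<in> ?S" for y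
  proof -
    have 1: "(reindex \<tau> has_derivative reindex \<tau>) (at y within ?S)"
      by (rule bounded_linear_imp_has_derivative[OF lin])
    have 2: "(g has_derivative g' (reindex \<tau> y)) (at (reindex \<tau> y) within reindex \<tau> ` ?S)"
      using der[of "reindex \<tau> y"] that by (auto intro: has_derivative_subset)
    show ?thesis
      unfolding G_def G'_def
      by (rule bounded_linear.has_derivative[OF lin])
        (rule has_derivative_in_compose[OF 1 2])
  qed
  have detG: "det (matrix (G' y)) = det (matrix (g' (reindex \<tau> y)))" for y
  proof -
    have ax: "reindex \<tau> (axis j 1 :: real^'m idx) = axis (\<sigma> j) 1" for j
      by (auto simp: vec_eq_iff axis_def \<tau>_def inv_f_f[OF bij_is_inj[OF \<sigma>]] surj_f_inv_f[OF bij_is_surj[OF \<sigma>]])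
    have "matrix (G' y) = (\<chi> i j. matrix (g' (reindex \<tau> y)) $ \<sigma> i $ \<sigma> j)"
      by (simp add: matrix_def G'_def ax vec_eq_iff)
    then show ?thesis using det_reindex[OF \<sigma>, of "matrix (g' (reindex \<tau> y))"] by simp
  qed
  have eq: "indicator ?S y * \<bar>det (matrix (G' y))\<bar> = (\<lambda>x. indicator S x * \<bar>det (matrix (g' x))\<bar>) (reindex \<tau> y)" for y
    by (simp add: detG indicator_def)
  have "emeasure lborel (g ` S) = emeasure lborel (G ` ?S)"
    by (simp add: GS em S)
  also have "\<dots> = (\<integral>\<^sup>+y. ennreal (indicator ?S y * \<bar>det (matrix (G' y))\<bar>) \<partial>lborel)"
  proof (rule emeasure_image_wellorder)
    show "inj_on G ?S"
      unfolding G_def using inj by (auto simp: inj_on_def) (metis r)+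
    show "(\<lambda>y. indicator ?S y * \<bar>det (matrix (G' y))\<bar>) \<in> borel_measurable borel"
      unfolding eq by (rule measurable_compose[OF borel_measurable_reindex meas])
  qed (use dG meas_vimage GS S in auto)
  also have "\<dots> = (\<integral>\<^sup>+y. ennreal ((\<lambda>x. indicator S x * \<bar>det (matrix (g' x))\<bar>) (reindex \<tau> y)) \<partial>lborel)"
    unfolding eq ..
  also have "\<dots> = (\<integral>\<^sup>+x. ennreal (indicator S x * \<bar>det (matrix (g' x))\<bar>) \<partial>distr lborel borel (reindex \<tau>))"
    by (subst nn_integral_distr) (auto simp: measurable_lborel2)
  finally show ?thesis unfolding distr_lborel_reindex[OF \<tau>(1)] .
qed

section \<open>Tangential calculus in a chart\<close>

text \<open>The inverse of the differential composed with the orthogonal projection onto the tangent space.\<close>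

definition pinv :: "(real^'m::finite \<Rightarrow> 'b::euclidean_space) \<Rightarrow> real^'m \<Rightarrow> 'b \<Rightarrow> real^'m" where
  "pinv f z b = matrix_inv (metric_at f z) *v (\<chi> i. dird f z (axis i 1) \<bullet> b)"

text \<open>The derivative of \<open>W\<close> in the direction of the tangential part of \<open>b\<close>; it does not
  depend on the chart.\<close>

definition tder :: "(real^'m::finite \<Rightarrow> 'b::euclidean_space) \<Rightarrow> (real^'m \<Rightarrow> 'c::real_normed_vector)
    \<Rightarrow> real^'m \<Rightarrow> 'b \<Rightarrow> 'c" where
  "tder f W z b = dird W z (pinv f z b)"

text \<open>Differentiating the immersion along the tangential part of \<open>b\<close> returns that
  tangential part, so this instance of \<open>tder\<close> is the orthogonal projection onto the
  tangent space.\<close>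

abbreviation tproj :: "(real^'m::finite \<Rightarrow> 'b::euclidean_space) \<Rightarrow> real^'m \<Rightarrow> 'b \<Rightarrow> 'b" where
  "tproj f z b \<equiv> tder f f z b"

text \<open>The segment from the identity to \<open>G\<close> consists of positive definite
  matrices, so the determinant has no zero on it; it starts at 1 and therefore stays
  positive.\<close>

lemma det_pos_of_pos_def:
  fixes G :: "real^'m^'m::finite"
  assumes "\<And>v. v \<noteq> 0 \<Longrightarrow> 0 < v \<bullet> (G *v v)"
  shows "0 < det G"
proof (rule ccontr)
  assume neg: "\<not> 0 < det G"
  define h where "h t = det ((1 - t) *\<^sub>R mat 1 + t *\<^sub>R G)" for t :: real
  have "continuous_on {0..1} h"
    unfolding h_def det_def by (intro continuous_intros)
  moreover have "h 0 = 1" "h 1 \<le> 0" using neg by (auto simp: h_def)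
  ultimately obtain t where t: "0 \<le> t" "t \<le> 1" "h t = 0"
    using IVT2'[of h 1 0 0] by auto
  then have "\<not> invertible ((1 - t) *\<^sub>R mat 1 + t *\<^sub>R G)"
    by (simp add: h_def invertible_det_nz)
  then obtain v where v: "v \<noteq> 0" "((1 - t) *\<^sub>R mat 1 + t *\<^sub>R G) *v v = 0"
    by (auto simp: invertible_left_inverse matrix_left_invertible_ker)
  then have "0 = v \<bullet> (((1 - t) *\<^sub>R mat 1 + t *\<^sub>R G) *v v)" by simp
  also have "\<dots> = (1 - t) * (v \<bullet> v) + t * (v \<bullet> (G *v v))"
    by (simp add: matrix_vector_mult_add_rdistrib inner_add_right flip: scaleR_matrix_vector_assoc)
  finally have 0: "(1 - t) * (v \<bullet> v) + t * (v \<bullet> (G *v v)) = 0" by simp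
  have "0 < v \<bullet> v" "0 < v \<bullet> (G *v v)" using v assms by auto
  then have "0 \<le> (1 - t) * (v \<bullet> v)" "0 \<le> t * (v \<bullet> (G *v v))" "t = 0 \<or> 0 < t * (v \<bullet> (G *v v))"
    using t by (auto simp: less_le)
  then show False using 0 \<open>0 < v \<bullet> v\<close> by auto
qed

section \<open>The tangential projection at one point of an immersion\<close>

context
  fixes f :: "real^'m::finite \<Rightarrow> 'b::euclidean_space" and z
  assumes lin: "linear (dird f z)" and inj: "inj (dird f z)"
begin

lemma metric_at_inner: "v \<bullet> (metric_at f z *v w) = dird f z v \<bullet> dird f z w"
proof -
  interpret linear "dird f z" by (rule lin)
  have ex: "dird f z u = (\<Sum>i\<in>UNIV. u $ i *\<^sub>R dird f z (axis i 1))" for u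
  proof -
    have "dird f z u = dird f z (\<Sum>i\<in>UNIV. u $ i *\<^sub>R axis i 1)"
      by (simp add: basis_expansion flip: scalar_mult_eq_scaleR)
    then show ?thesis by (simp add: sum scale)
  qed
  show ?thesis
    unfolding ex[of v] ex[of w]
    by (simp add: inner_vec_def matrix_vector_mult_def metric_at_def inner_sum_left inner_sum_right
        sum_distrib_left sum_distrib_right mult_ac) (rule sum.swap)
qed

lemma metric_at_pos: "0 < det (metric_at f z)"
proof (rule det_pos_of_pos_def)
  fix v :: "real^'m" assume "v \<noteq> 0"
  then have "dird f z v \<noteq> 0" using linear_injective_0[OF lin] inj by blast
  then show "0 < v \<bullet> (metric_at f z *v v)" by (simp add: metric_at_inner)
qed

lemma metric_at_inv:
  "metric_at f z ** matrix_inv (metric_at f z) = mat 1"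
  "matrix_inv (metric_at f z) ** metric_at f z = mat 1"
proof -
  have "invertible (metric_at f z)" using metric_at_pos by (simp add: invertible_det_nz)
  then show "metric_at f z ** matrix_inv (metric_at f z) = mat 1"
    "matrix_inv (metric_at f z) ** metric_at f z = mat 1"
    unfolding invertible_def matrix_inv_def by (rule someI2_ex, blast)+
qed

lemma metric_at_pinv: "metric_at f z *v pinv f z b = (\<chi> i. dird f z (axis i 1) \<bullet> b)"
  by (simp add: pinv_def matrix_vector_mul_assoc metric_at_inv)

lemma tproj_inner: "dird f z (pinv f z b) \<bullet> dird f z v = b \<bullet> dird f z v"
proof -
  interpret linear "dird f z" by (rule lin)
  have "dird f z (pinv f z b) \<bullet> dird f z v = v \<bullet> (metric_at f z *v pinv f z b)"
    by (simp add: metric_at_inner inner_commute)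
  also have "\<dots> = (\<Sum>i\<in>UNIV. v $ i *\<^sub>R dird f z (axis i 1)) \<bullet> b"
    by (simp add: metric_at_pinv inner_vec_def inner_sum_left)
  also have "(\<Sum>i\<in>UNIV. v $ i *\<^sub>R dird f z (axis i 1)) = dird f z (\<Sum>i\<in>UNIV. v $ i *\<^sub>R axis i 1)"
    by (simp add: sum scale)
  also have "(\<Sum>i\<in>UNIV. v $ i *\<^sub>R axis i 1) = v"
    by (simp add: basis_expansion flip: scalar_mult_eq_scaleR)
  finally show ?thesis by (simp add: inner_commute)
qed

lemma pinv_dird: "pinv f z (dird f z v) = v"
proof -
  have "dird f z (pinv f z (dird f z v)) \<bullet> dird f z w = dird f z v \<bullet> dird f z w" for w
    by (rule tproj_inner)
  then have "dird f z (pinv f z (dird f z v) - v) \<bullet> dird f z w = 0" for w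
    by (simp add: linear_diff[OF lin] inner_diff_left)
  then have "dird f z (pinv f z (dird f z v) - v) = 0" by (metis inner_eq_zero_iff)
  then show ?thesis using linear_injective_0[OF lin] inj by force
qed

lemma linear_pinv: "linear (pinv f z)"
  by (rule linearI)
    (auto simp: pinv_def inner_add_right vec_eq_iff matrix_vector_mult_def sum.distrib algebra_simps
      sum_distrib_left intro!: sum.cong)

lemma tproj_eq: "tproj f z b = dird f z (pinv f z b)"
  by (simp add: tder_def)

lemma pinv_tproj: "pinv f z (tproj f z b) = pinv f z b"
  by (simp add: tproj_eq pinv_dird)

lemma tproj_tproj: "tproj f z (tproj f z b) = tproj f z b"
  by (simp add: tder_def pinv_dird)

lemma tproj_dird: "tproj f z (dird f z v) = dird f z v"
  by (simp add: tder_def pinv_dird)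

lemma tproj_sym: "tproj f z a \<bullet> b = a \<bullet> tproj f z b"
  using tproj_inner[of a "pinv f z b"] tproj_inner[of b "pinv f z a"] by (simp add: tproj_eq inner_commute)

lemma tder_tproj: "tder f W z (tproj f z b) = tder f W z b"
  unfolding tder_def[of f W] pinv_tproj ..

lemma linear_tproj: "linear (tproj f z)"
  using linear_compose[OF linear_pinv lin] by (simp add: tder_def[abs_def] o_def)

lemma tangent_at_iff: "w \<in> tangent_at f z \<longleftrightarrow> tproj f z w = w"
  unfolding tangent_at_def by (metis (no_types) rangeE rangeI tproj_dird tproj_eq)

lemma normal_iff: "n \<in> (tangent_at f z)\<^sup>\<bottom> \<longleftrightarrow> tproj f z n = 0"
proof
  assume n: "n \<in> (tangent_at f z)\<^sup>\<bottom>"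
  have "tproj f z n \<in> tangent_at f z" by (simp add: tangent_at_iff tproj_tproj)
  then have "n \<bullet> tproj f z n = 0" using n by (auto simp: orthogonal_comp_def orthogonal_def inner_commute)
  moreover have "n \<bullet> tproj f z n = tproj f z n \<bullet> tproj f z n"
    by (metis tproj_sym tproj_tproj)
  ultimately show "tproj f z n = 0" by simp
next
  assume n: "tproj f z n = 0"
  have "w \<bullet> n = 0" if "w \<in> tangent_at f z" for w
    using that n tproj_sym[of w n] by (simp add: tangent_at_iff)
  then show "n \<in> (tangent_at f z)\<^sup>\<bottom>" by (simp add: orthogonal_comp_def orthogonal_def)
qed

lemma normal_part_eq: "normal_part f z w = w - tproj f z w"
  unfolding normal_part_def
proof (rule the_equality)
  interpret linear "tproj f z" by (rule linear_tproj)
  show "w - tproj f z w \<in> (tangent_at f z)\<^sup>\<bottom> \<and> w - (w - tproj f z w) \<in> tangent_at f z"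
    unfolding normal_iff tangent_at_iff by (simp add: diff tproj_tproj)
  fix n assume n: "n \<in> (tangent_at f z)\<^sup>\<bottom> \<and> w - n \<in> tangent_at f z"
  then show "n = w - tproj f z w"
    unfolding normal_iff tangent_at_iff by (simp add: diff algebra_simps)
qed

text \<open>Inserting the definition of \<open>pinv\<close> and summing over the orthonormal basis
  rebuilds the metric between two copies of its inverse, and the product collapses to the
  inverse.\<close>

lemma sum_pinv_pinv:
  "(\<Sum>e\<in>Basis. pinv f z e $ i * pinv f z e $ j) = matrix_inv (metric_at f z) $ i $ j"
proof -
  let ?G = "metric_at f z" and ?I = "matrix_inv (metric_at f z)"
  have "(\<Sum>e\<in>Basis. pinv f z e $ i * pinv f z e $ j)
      = (\<Sum>e\<in>Basis. \<Sum>k\<in>UNIV. \<Sum>l\<in>UNIV. ?I $ i $ k * ?I $ j $ l * ((dird f z (axis k 1) \<bullet> e) * (dird f z (axis l 1) \<bullet> e)))"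
    by (simp add: pinv_def matrix_vector_mult_def sum_product mult_ac)
  also have "\<dots> = (\<Sum>k\<in>UNIV. \<Sum>l\<in>UNIV. ?I $ i $ k * ?I $ j $ l * (\<Sum>e\<in>Basis. (dird f z (axis k 1) \<bullet> e) * (dird f z (axis l 1) \<bullet> e)))"
    by (subst sum.swap, rule sum.cong[OF refl], subst sum.swap) (simp add: sum_distrib_left)
  also have "\<dots> = (\<Sum>k\<in>UNIV. \<Sum>l\<in>UNIV. ?I $ i $ k * ?I $ j $ l * ?G $ k $ l)"
    by (simp add: metric_at_def flip: euclidean_inner)
  also have "\<dots> = (\<Sum>l\<in>UNIV. ?I $ j $ l * (?I ** ?G) $ i $ l)"
    by (subst sum.swap) (simp add: matrix_matrix_mult_def sum_distrib_left mult_ac)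
  also have "\<dots> = ?I $ j $ i"
    by (simp add: metric_at_inv mat_def mult_delta_right)
  finally have *: "(\<Sum>e\<in>Basis. pinv f z e $ i * pinv f z e $ j) = ?I $ j $ i" .
  have tr: "transpose ?I = ?I"
  proof -
    have "transpose ?G = ?G" by (simp add: transpose_def metric_at_def inner_commute vec_eq_iff)
    then have "transpose ?I ** ?G = mat 1"
      using arg_cong[OF metric_at_inv(1), of transpose] by (simp add: matrix_transpose_mul)
    then show ?thesis
      by (metis metric_at_inv(1) matrix_mul_assoc matrix_mul_lid matrix_mul_rid)
  qed
  have "?I $ j $ i = transpose ?I $ i $ j" by (simp add: transpose_def)
  then show ?thesis unfolding * tr .
qed

end

lemma bilinear_axis_expand:
  fixes C :: "real^'m::finite \<Rightarrow> real^'m \<Rightarrow> 'c::real_vector"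
  assumes "bilinear C"
  shows "C u v = (\<Sum>i\<in>UNIV. \<Sum>j\<in>UNIV. (u $ i * v $ j) *\<^sub>R C (axis i 1) (axis j 1))"
proof -
  have ex: "w = (\<Sum>i\<in>UNIV. w $ i *\<^sub>R axis i 1)" for w :: "real^'m"
    by (simp add: basis_expansion flip: scalar_mult_eq_scaleR)
  have "C u v = C (\<Sum>i\<in>UNIV. u $ i *\<^sub>R axis i 1) (\<Sum>j\<in>UNIV. v $ j *\<^sub>R axis j 1)"
    using ex[of u] ex[of v] by simp
  also have "\<dots> = (\<Sum>i\<in>UNIV. \<Sum>j\<in>UNIV. (u $ i * v $ j) *\<^sub>R C (axis i 1) (axis j 1))"
    by (simp add: bilinear_sum[OF assms] sum.cartesian_product bilinear_lmul[OF assms] bilinear_rmul[OF assms] split_def mult.commute)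
  finally show ?thesis .
qed

text \<open>Coordinate traces with the inverse metric become sums over the fixed ambient basis.
  These sums replace local orthonormal frames, so no frame vectors ever have to be
  differentiated.\<close>

lemma trace_metric:
  fixes C :: "real^'m::finite \<Rightarrow> real^'m \<Rightarrow> 'c::real_vector" and f :: "real^'m \<Rightarrow> 'b::euclidean_space"
  assumes "linear (dird f z)" "inj (dird f z)" "bilinear C"
  shows "(\<Sum>i\<in>UNIV. \<Sum>j\<in>UNIV. (matrix_inv (metric_at f z) $ i $ j) *\<^sub>R C (axis i 1) (axis j 1))
    = (\<Sum>e\<in>Basis. C (pinv f z e) (pinv f z e))"
proof -
  have "(\<Sum>e\<in>Basis. C (pinv f z e) (pinv f z e))
      = (\<Sum>e\<in>Basis. \<Sum>i\<in>UNIV. \<Sum>j\<in>UNIV. (pinv f z e $ i * pinv f z e $ j) *\<^sub>R C (axis i 1) (axis j 1))"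
    by (intro sum.cong refl bilinear_axis_expand assms(3))
  also have "\<dots> = (\<Sum>i\<in>UNIV. \<Sum>j\<in>UNIV. \<Sum>e\<in>Basis. (pinv f z e $ i * pinv f z e $ j) *\<^sub>R C (axis i 1) (axis j 1))"
    by (subst sum.swap, rule sum.cong[OF refl], rule sum.swap)
  also have "\<dots> = (\<Sum>i\<in>UNIV. \<Sum>j\<in>UNIV. (matrix_inv (metric_at f z) $ i $ j) *\<^sub>R C (axis i 1) (axis j 1))"
    by (simp add: sum_pinv_pinv[OF assms(1,2)] flip: scaleR_left.sum)
  finally show ?thesis ..
qed

text \<open>In the basis the symmetric map \<open>p\<close> has a symmetric matrix, and exchanging
  the two summations moves it to the other slot.\<close>

lemma trace_move:
  fixes \<beta> :: "'b::euclidean_space \<Rightarrow> 'b \<Rightarrow> real"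
  assumes "bilinear \<beta>" "linear p" "\<And>a b. p a \<bullet> b = a \<bullet> p b"
  shows "(\<Sum>e\<in>Basis. \<beta> (p e) e) = (\<Sum>e\<in>Basis. \<beta> e (p e))"
proof -
  interpret l: linear "\<lambda>y. \<beta> y x" for x using assms(1) by (simp add: bilinear_def)
  interpret r: linear "\<lambda>y. \<beta> x y" for x using assms(1) by (simp add: bilinear_def)
  have "(\<Sum>e\<in>Basis. \<beta> (p e) e) = (\<Sum>e\<in>Basis. \<beta> (\<Sum>d\<in>Basis. (p e \<bullet> d) *\<^sub>R d) e)"
    by (simp add: euclidean_representation)
  also have "\<dots> = (\<Sum>e\<in>Basis. \<Sum>d\<in>Basis. (p e \<bullet> d) * \<beta> d e)"
    by (simp add: l.sum l.scale)
  also have "\<dots> = (\<Sum>d\<in>Basis. \<Sum>e\<in>Basis. (p d \<bullet> e) * \<beta> d e)"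
  proof (subst sum.swap, intro sum.cong refl)
    show "(p e \<bullet> d) * \<beta> d e = (p d \<bullet> e) * \<beta> d e" for d e
      using assms(3)[of e d] by (simp add: inner_commute)
  qed
  also have "\<dots> = (\<Sum>d\<in>Basis. \<beta> d (\<Sum>e\<in>Basis. (p d \<bullet> e) *\<^sub>R e))"
    by (simp add: r.sum r.scale)
  finally show ?thesis by (simp add: euclidean_representation)
qed

lemma tder_cong:
  assumes "open \<Omega>" "z \<in> \<Omega>" "\<And>y. y \<in> \<Omega> \<Longrightarrow> V y = W y"
  shows "tder f V z b = tder f W z b"
  unfolding tder_def using dird_cong[OF assms] by simp

text \<open>The product rule for a moving linear map applied to a moving vector. Expanding the
  vector in a fixed basis leaves only products of scalar functions with the vectors
  \<open>T y b\<close>.\<close>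

lemma dird_apply:
  fixes T :: "'a::real_normed_vector \<Rightarrow> 'b::euclidean_space \<Rightarrow> 'c::real_normed_vector"
  assumes "open \<Omega>" "z \<in> \<Omega>" and lin: "\<And>y. y \<in> \<Omega> \<Longrightarrow> linear (T y)"
    and sm: "\<And>c. smooth_on (\<lambda>y. T y c) \<Omega>" "smooth_on \<kappa> \<Omega>"
  shows "dird (\<lambda>y. T y (\<kappa> y)) z v = dird (\<lambda>y. T y (\<kappa> z)) z v + T z (dird \<kappa> z v)"
proof -
  interpret z: linear "T z" by (rule lin[OF \<open>z \<in> \<Omega>\<close>])
  have ex: "T y c = (\<Sum>b\<in>Basis. (c \<bullet> b) *\<^sub>R T y b)" if "y \<in> \<Omega>" for y c
  proof -
    interpret linear "T y" by (rule lin[OF that])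
    have "T y c = T y (\<Sum>b\<in>Basis. (c \<bullet> b) *\<^sub>R b)" by (simp add: euclidean_representation)
    then show ?thesis by (simp add: sum scale)
  qed
  have d\<kappa>: "(\<kappa> has_derivative dird \<kappa> z) (at z)"
    by (rule smooth_on_has_derivative[OF sm(2) \<open>z \<in> \<Omega>\<close>])
  have dT: "((\<lambda>y. T y b) has_derivative dird (\<lambda>y. T y b) z) (at z)" for b
    by (rule smooth_on_has_derivative[OF sm(1) \<open>z \<in> \<Omega>\<close>])
  have d1: "((\<lambda>y. \<Sum>b\<in>Basis. (\<kappa> y \<bullet> b) *\<^sub>R T y b) has_derivative
      (\<lambda>v. \<Sum>b\<in>Basis. (\<kappa> z \<bullet> b) *\<^sub>R dird (\<lambda>y. T y b) z v + (dird \<kappa> z v \<bullet> b) *\<^sub>R T z b)) (at z)"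
    by (intro has_derivative_sum has_derivative_scaleR has_derivative_inner_left d\<kappa> dT)
  have d2: "((\<lambda>y. \<Sum>b\<in>Basis. (\<kappa> z \<bullet> b) *\<^sub>R T y b) has_derivative
      (\<lambda>v. \<Sum>b\<in>Basis. (\<kappa> z \<bullet> b) *\<^sub>R dird (\<lambda>y. T y b) z v)) (at z)"
    by (intro has_derivative_sum has_derivative_scaleR_right dT)
  have "dird (\<lambda>y. T y (\<kappa> y)) z = dird (\<lambda>y. \<Sum>b\<in>Basis. (\<kappa> y \<bullet> b) *\<^sub>R T y b) z"
    by (rule dird_cong[OF assms(1,2)]) (rule ex)
  also have "\<dots> = (\<lambda>v. \<Sum>b\<in>Basis. (\<kappa> z \<bullet> b) *\<^sub>R dird (\<lambda>y. T y b) z v + (dird \<kappa> z v \<bullet> b) *\<^sub>R T z b)"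
    by (rule dird_eqI[OF d1])
  finally have A: "dird (\<lambda>y. T y (\<kappa> y)) z v
      = (\<Sum>b\<in>Basis. (\<kappa> z \<bullet> b) *\<^sub>R dird (\<lambda>y. T y b) z v) + (\<Sum>b\<in>Basis. (dird \<kappa> z v \<bullet> b) *\<^sub>R T z b)"
    by (simp add: sum.distrib)
  have "dird (\<lambda>y. T y (\<kappa> z)) z = dird (\<lambda>y. \<Sum>b\<in>Basis. (\<kappa> z \<bullet> b) *\<^sub>R T y b) z"
    by (rule dird_cong[OF assms(1,2)]) (rule ex)
  also have "\<dots> = (\<lambda>v. \<Sum>b\<in>Basis. (\<kappa> z \<bullet> b) *\<^sub>R dird (\<lambda>y. T y b) z v)"
    by (rule dird_eqI[OF d2])
  finally have B: "dird (\<lambda>y. T y (\<kappa> z)) z v = (\<Sum>b\<in>Basis. (\<kappa> z \<bullet> b) *\<^sub>R dird (\<lambda>y. T y b) z v)"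
    by simp
  show ?thesis unfolding A B ex[OF \<open>z \<in> \<Omega>\<close>, of "dird \<kappa> z v"] ..
qed

section \<open>The second fundamental form through the derivative of the projection\<close>

locale immersed_chart =
  fixes f :: "real^'m::finite \<Rightarrow> 'b::euclidean_space" and \<Omega> :: "(real^'m) set"
  assumes open_O: "open \<Omega>" and smooth_f: "smooth_on f \<Omega>"
    and inj_f: "\<And>z. z \<in> \<Omega> \<Longrightarrow> inj (dird f z)"
begin

lemma lin_f: "z \<in> \<Omega> \<Longrightarrow> linear (dird f z)"
  by (intro linear_frechet_derivative smooth_on_imp_differentiable[OF smooth_f])

lemma
  assumes "z \<in> \<Omega>"
  shows metric_pos: "0 < det (metric_at f z)"
    and pinv_dird': "pinv f z (dird f z v) = v"
    and lin_pinv: "linear (pinv f z)"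
    and lin_tproj: "linear (tproj f z)"
    and tproj_idem: "tproj f z (tproj f z b) = tproj f z b"
    and tproj_symm: "tproj f z b \<bullet> c = b \<bullet> tproj f z c"
    and tder_tproj': "tder f W z (tproj f z b) = tder f W z b"
    and tproj_dird': "tproj f z (dird f z v) = dird f z v"
    and normal_iff': "n \<in> (tangent_at f z)\<^sup>\<bottom> \<longleftrightarrow> tproj f z n = 0"
    and normal_part_eq': "normal_part f z w = w - tproj f z w"
  by (rule metric_at_pos[OF lin_f[OF assms] inj_f[OF assms]]
      pinv_dird[OF lin_f[OF assms] inj_f[OF assms]]
      linear_pinv[OF lin_f[OF assms] inj_f[OF assms]]
      linear_tproj[OF lin_f[OF assms] inj_f[OF assms]]
      tproj_tproj[OF lin_f[OF assms] inj_f[OF assms]]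
      tproj_sym[OF lin_f[OF assms] inj_f[OF assms]]
      tder_tproj[OF lin_f[OF assms] inj_f[OF assms]]
      tproj_dird[OF lin_f[OF assms] inj_f[OF assms]]
      normal_iff[OF lin_f[OF assms] inj_f[OF assms]]
      normal_part_eq[OF lin_f[OF assms] inj_f[OF assms]])+

lemma smooth_metric: "smooth_on (\<lambda>z. metric_at f z $ i $ j) \<Omega>"
  unfolding metric_at_def using open_O smooth_f by (simp, intro smooth_intros) auto

lemma smooth_pinv [smooth_intros]:
  assumes "smooth_on b \<Omega>"
  shows "smooth_on (\<lambda>z. pinv f z (b z)) \<Omega>"
  unfolding pinv_def matrix_vector_mult_def
proof (intro smooth_intros open_O)
  fix i j :: 'm
  show "smooth_on (\<lambda>z. matrix_inv (metric_at f z) $ i $ j) \<Omega>"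
    by (intro smooth_on_matrix_inv open_O smooth_metric) (use metric_pos in force)
  have "smooth_on (\<lambda>z. dird f z (axis j 1) \<bullet> b z) \<Omega>"
    by (intro smooth_intros open_O smooth_f assms)
  then show "smooth_on (\<lambda>z. (\<chi> i. dird f z (axis i 1) \<bullet> b z) $ j) \<Omega>" by simp
qed

lemma smooth_tder [smooth_intros]:
  "smooth_on W \<Omega> \<Longrightarrow> smooth_on b \<Omega> \<Longrightarrow> smooth_on (\<lambda>z. tder f W z (b z)) \<Omega>"
  unfolding tder_def by (intro smooth_intros open_O)

lemma linear_tder:
  assumes "smooth_on W \<Omega>" "z \<in> \<Omega>"
  shows "linear (tder f W z)"
  using linear_compose[OF lin_pinv[OF assms(2)] linear_frechet_derivative[OF smooth_on_imp_differentiable[OF assms]]]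
  by (simp add: tder_def[abs_def] o_def)

lemma tder_apply:
  fixes T :: "real^'m \<Rightarrow> 'd::euclidean_space \<Rightarrow> 'e::real_normed_vector"
  assumes "z \<in> \<Omega>" "\<And>y. y \<in> \<Omega> \<Longrightarrow> linear (T y)" "\<And>c. smooth_on (\<lambda>y. T y c) \<Omega>" "smooth_on \<kappa> \<Omega>"
  shows "tder f (\<lambda>y. T y (\<kappa> y)) z b = tder f (\<lambda>y. T y (\<kappa> z)) z b + T z (tder f \<kappa> z b)"
  unfolding tder_def by (rule dird_apply[OF open_O assms])

lemma tder_bilinear:
  assumes "bounded_bilinear p" "z \<in> \<Omega>" "smooth_on V \<Omega>" "smooth_on W \<Omega>"
  shows "tder f (\<lambda>y. p (V y) (W y)) z b = p (V z) (tder f W z b) + p (tder f V z b) (W z)"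
  unfolding tder_def
  using dird_eqI[OF bounded_bilinear.FDERIV[OF assms(1) smooth_on_has_derivative[OF assms(3,2)]
        smooth_on_has_derivative[OF assms(4,2)]]] by simp

lemmas tder_inner = tder_bilinear[OF bounded_bilinear_inner]
lemmas tder_scaleR = tder_bilinear[OF bounded_bilinear_scaleR]

lemma tder_add:
  assumes "z \<in> \<Omega>" "smooth_on V \<Omega>" "smooth_on W \<Omega>"
  shows "tder f (\<lambda>y. V y + W y) z b = tder f V z b + tder f W z b"
  unfolding tder_def using assms by (intro dird_add smooth_on_imp_differentiable)

lemma tder_linear:
  assumes "bounded_linear L" "z \<in> \<Omega>" "smooth_on V \<Omega>"
  shows "tder f (\<lambda>y. L (V y)) z b = L (tder f V z b)"
  unfolding tder_def
  using dird_eqI[OF bounded_linear.has_derivative[OF assms(1) smooth_on_has_derivative[OF assms(3,2)]]] by simp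

lemma tder_diff:
  assumes "z \<in> \<Omega>" "smooth_on V \<Omega>" "smooth_on W \<Omega>"
  shows "tder f (\<lambda>y. V y - W y) z b = tder f V z b - tder f W z b"
  unfolding tder_def
  using dird_eqI[OF has_derivative_diff[OF smooth_on_has_derivative[OF assms(2,1)] smooth_on_has_derivative[OF assms(3,1)]]]
  by simp

lemma tder_const: "tder f (\<lambda>y. c) z b = 0"
  by (simp add: tder_def)

lemma tder_sum:
  assumes "z \<in> \<Omega>" "\<And>i. i \<in> I \<Longrightarrow> smooth_on (V i) \<Omega>"
  shows "tder f (\<lambda>y. \<Sum>i\<in>I. V i y) z b = (\<Sum>i\<in>I. tder f (V i) z b)"
  unfolding tder_def
  using dird_eqI[OF has_derivative_sum[of I V "\<lambda>i. dird (V i) z"]] assms smooth_on_has_derivative by force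

text \<open>The derivative of the projection. For tangential \<open>b\<close>, \<open>c\<close> the normal part of
  \<open>shape z b c\<close> is the second fundamental form, for normal \<open>c\<close> the vector \<open>- shape z b c\<close>
  is the tangential part of \<open>D\<^sub>b c\<close>.\<close>

definition shape :: "real^'m \<Rightarrow> 'b \<Rightarrow> 'b \<Rightarrow> 'b" where
  "shape z b c = tder f (\<lambda>y. tproj f y c) z b"

lemma smooth_tproj [smooth_intros]: "smooth_on b \<Omega> \<Longrightarrow> smooth_on (\<lambda>z. tproj f z (b z)) \<Omega>"
  by (intro smooth_intros smooth_f)

lemma smooth_tproj_const [smooth_intros]: "smooth_on (\<lambda>z. tproj f z c) \<Omega>"
  by (intro smooth_intros smooth_f)

lemma linear_shape_left: "z \<in> \<Omega> \<Longrightarrow> linear (\<lambda>b. shape z b c)"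
  unfolding shape_def by (intro linear_tder smooth_intros)

lemma linear_shape_right: "z \<in> \<Omega> \<Longrightarrow> linear (\<lambda>c. shape z b c)"
proof (rule linearI)
  assume z: "z \<in> \<Omega>"
  note sm = smooth_tproj_const
  show "shape z b (c + d) = shape z b c + shape z b d" for c d
  proof -
    have "shape z b (c + d) = tder f (\<lambda>y. tproj f y c + tproj f y d) z b"
      unfolding shape_def by (rule tder_cong[OF open_O z]) (simp add: linear_add[OF lin_tproj])
    then show ?thesis by (simp add: shape_def tder_add[OF z sm sm])
  qed
  show "shape z b (r *\<^sub>R c) = r *\<^sub>R shape z b c" for r c
  proof -
    have "shape z b (r *\<^sub>R c) = tder f (\<lambda>y. r *\<^sub>R tproj f y c) z b"
      unfolding shape_def by (rule tder_cong[OF open_O z]) (simp add: linear_scale[OF lin_tproj])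
    then show ?thesis by (simp add: shape_def tder_linear[OF bounded_linear_scaleR_right z sm])
  qed
qed

lemma smooth_shape [smooth_intros]:
  assumes "smooth_on b \<Omega>" "smooth_on c \<Omega>"
  shows "smooth_on (\<lambda>z. shape z (b z) (c z)) \<Omega>"
proof (rule smooth_on_cong[OF open_O])
  show "smooth_on (\<lambda>z. \<Sum>d\<in>Basis. (c z \<bullet> d) *\<^sub>R shape z (b z) d) \<Omega>"
    unfolding shape_def by (intro smooth_intros open_O assms)
  fix z assume z: "z \<in> \<Omega>"
  interpret linear "\<lambda>c. shape z (b z) c" by (rule linear_shape_right[OF z])
  have "shape z (b z) (c z) = shape z (b z) (\<Sum>d\<in>Basis. (c z \<bullet> d) *\<^sub>R d)" by (simp add: euclidean_representation)
  then show "(\<Sum>d\<in>Basis. (c z \<bullet> d) *\<^sub>R shape z (b z) d) = shape z (b z) (c z)" by (simp add: sum scale)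
qed

lemma shape_symm:
  assumes "z \<in> \<Omega>"
  shows "shape z b c \<bullet> d = c \<bullet> shape z b d"
proof -
  note sm = smooth_tproj_const
  have "shape z b c \<bullet> d = tder f (\<lambda>y. tproj f y c \<bullet> d) z b"
    by (simp add: shape_def tder_linear[OF bounded_linear_inner_left assms sm])
  also have "\<dots> = tder f (\<lambda>y. c \<bullet> tproj f y d) z b"
    by (rule tder_cong[OF open_O assms]) (rule tproj_symm)
  also have "\<dots> = c \<bullet> shape z b d"
    by (simp add: shape_def tder_linear[OF bounded_linear_inner_right assms sm])
  finally show ?thesis .
qed

lemma tder_tproj_apply:
  assumes "z \<in> \<Omega>" "smooth_on W \<Omega>"
  shows "tder f (\<lambda>y. tproj f y (W y)) z b = shape z b (W z) + tproj f z (tder f W z b)"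
  unfolding shape_def by (rule tder_apply[OF assms(1) lin_tproj smooth_tproj_const assms(2)])

text \<open>Differentiate P P = P for the projection P. Consequently the derivative of P sends
  tangential vectors to normal ones and normal vectors to tangential ones.\<close>

lemma tproj_shape:
  assumes "z \<in> \<Omega>"
  shows "shape z b (tproj f z c) + tproj f z (shape z b c) = shape z b c"
proof -
  have "shape z b c = tder f (\<lambda>y. tproj f y (tproj f y c)) z b"
    unfolding shape_def by (rule tder_cong[OF open_O assms]) (simp add: tproj_idem)
  also have "\<dots> = shape z b (tproj f z c) + tproj f z (shape z b c)"
    unfolding shape_def[of z b c] by (rule tder_tproj_apply[OF assms smooth_tproj_const])
  finally show ?thesis by simp
qed

lemma shape_tproj_left: "z \<in> \<Omega> \<Longrightarrow> shape z (tproj f z b) c = shape z b c"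
  unfolding shape_def by (rule tder_tproj')

text \<open>The Weingarten formula, obtained by differentiating the identity P N = 0.\<close>

lemma tder_normal:
  assumes "z \<in> \<Omega>" "smooth_on N \<Omega>" "\<And>y. y \<in> \<Omega> \<Longrightarrow> tproj f y (N y) = 0"
  shows "tproj f z (tder f N z b) = - shape z b (N z)"
proof -
  have "tder f (\<lambda>y. tproj f y (N y)) z b = tder f (\<lambda>y. 0) z b"
    by (rule tder_cong[OF open_O assms(1)]) (rule assms(3))
  then show ?thesis
    by (simp add: tder_tproj_apply[OF assms(1,2)] tder_const add_eq_0_iff)
qed

text \<open>Second coordinate derivatives of \<open>W\<close> commute, so only derivatives of the
  coefficients remain: the right side differentiates \<open>W\<close> along the Lie bracket of the
  fields \<open>pinv f y b\<close> and \<open>pinv f y e\<close>.\<close>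

lemma tder_commutator:
  fixes W :: "real^'m \<Rightarrow> 'd::euclidean_space"
  assumes z: "z \<in> \<Omega>" and W: "smooth_on W \<Omega>"
  shows "tder f (\<lambda>y. tder f W y e) z b - tder f (\<lambda>y. tder f W y b) z e
    = dird W z (dird (\<lambda>y. pinv f y e) z (pinv f z b) - dird (\<lambda>y. pinv f y b) z (pinv f z e))"
proof -
  interpret linear "dird W z"
    by (intro linear_frechet_derivative smooth_on_imp_differentiable[OF W z])
  have 1: "tder f (\<lambda>y. tder f W y e) z b
      = dird (\<lambda>y. dird W y (pinv f z e)) z (pinv f z b) + dird W z (dird (\<lambda>y. pinv f y e) z (pinv f z b))" for e b
    unfolding tder_def
    by (rule dird_apply[OF open_O z]) (intro linear_frechet_derivative smooth_on_imp_differentiable[OF W] smooth_intros W | assumption)+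
  have 2: "dird (\<lambda>y. dird W y (pinv f z e)) z (pinv f z b) = dird (\<lambda>y. dird W y (pinv f z b)) z (pinv f z e)"
    by (rule dird_dird_commute[OF open_O z W])
  show ?thesis unfolding 1 2 by (simp add: diff)
qed

text \<open>For \<open>W = f\<close> the commutator is the bracket pushed forward to the ambient
  space, which is \<open>shape z b c - shape z c b\<close>. So this difference is tangential, and it
  names the bracket without coordinates when other functions \<open>W\<close> are
  differentiated.\<close>

lemma
  fixes W :: "real^'m \<Rightarrow> 'd::euclidean_space"
  assumes z: "z \<in> \<Omega>"
  shows tproj_shape_diff: "tproj f z (shape z b c - shape z c b) = shape z b c - shape z c b"
    and tder_swap: "smooth_on W \<Omega> \<Longrightarrow> tder f (\<lambda>y. tder f W y c) z b
      = tder f (\<lambda>y. tder f W y b) z c + tder f W z (shape z b c - shape z c b)"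
proof -
  define \<xi> where "\<xi> = dird (\<lambda>y. pinv f y c) z (pinv f z b) - dird (\<lambda>y. pinv f y b) z (pinv f z c)"
  have 1: "shape z b c - shape z c b = dird f z \<xi>"
    unfolding shape_def \<xi>_def by (rule tder_commutator[OF z smooth_f])
  show "tproj f z (shape z b c - shape z c b) = shape z b c - shape z c b"
    unfolding 1 by (rule tproj_dird'[OF z])
  assume W: "smooth_on W \<Omega>"
  have "tder f W z (shape z b c - shape z c b) = dird W z \<xi>"
    unfolding 1 by (simp add: tder_def pinv_dird'[OF z])
  then show "tder f (\<lambda>y. tder f W y c) z b
      = tder f (\<lambda>y. tder f W y b) z c + tder f W z (shape z b c - shape z c b)"
    using tder_commutator[OF z W, of c b] unfolding \<xi>_def[symmetric] by (simp add: algebra_simps)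
qed

lemma normal_inner_tangent:
  "z \<in> \<Omega> \<Longrightarrow> tproj f z n = 0 \<Longrightarrow> tproj f z t = t \<Longrightarrow> n \<bullet> t = 0"
  by (metis inner_zero_left tproj_symm)

text \<open>The symmetry of the second fundamental form: the two sides differ by a tangential
  vector, which a normal \<open>n\<close> does not see.\<close>

lemma normal_shape_commute:
  assumes "z \<in> \<Omega>" "tproj f z n = 0"
  shows "n \<bullet> shape z b c = n \<bullet> shape z c b"
  using normal_inner_tangent[OF assms tproj_shape_diff[OF assms(1)]] by (simp add: inner_diff_right)

lemma shape_normal_tangent:
  "z \<in> \<Omega> \<Longrightarrow> tproj f z n = 0 \<Longrightarrow> tproj f z (shape z b n) = shape z b n"
  using tproj_shape[of z b n] linear_0[OF linear_shape_right] by simp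

lemma shape_tangent_normal:
  "z \<in> \<Omega> \<Longrightarrow> tproj f z (shape z b (tproj f z c)) = 0"
  using tproj_shape[of z b "tproj f z c"] by (simp add: tproj_idem)

text \<open>The form sees only the tangential part of its first argument. The projection inserted
  there for free moves to the second argument by \<open>trace_move\<close>, which restricts a trace
  to tangential vectors.\<close>

lemma trace_tproj:
  fixes \<beta> :: "'b \<Rightarrow> 'b \<Rightarrow> real"
  assumes "z \<in> \<Omega>" "bilinear \<beta>" "\<And>b c. \<beta> (tproj f z b) c = \<beta> b c"
  shows "(\<Sum>e\<in>Basis. \<beta> e e) = (\<Sum>e\<in>Basis. \<beta> e (tproj f z e))"
  using trace_move[OF assms(2) lin_tproj[OF assms(1)] tproj_symm[OF assms(1)]] by (simp add: assms(3))

lemma bilinear_shape_inner: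
  fixes \<phi> :: "real^'m \<Rightarrow> real"
  assumes "z \<in> \<Omega>"
  shows "bilinear (\<lambda>b c. shape z b n \<bullet> shape z a c)" "bilinear (\<lambda>b c. shape z b c \<bullet> d)"
    "smooth_on \<phi> \<Omega> \<Longrightarrow> bilinear (\<lambda>b c. tder f \<phi> z b * (n \<bullet> shape z a c))"
  by (auto simp: bilinear_def linear_iff inner_add_left inner_add_right algebra_simps
      linear_add[OF linear_shape_left[OF assms]] linear_add[OF linear_shape_right[OF assms]]
      linear_scale[OF linear_shape_left[OF assms]] linear_scale[OF linear_shape_right[OF assms]]
      linear_add[OF linear_tder[OF _ assms]] linear_scale[OF linear_tder[OF _ assms]])

text \<open>\<open>shape\<close> ignores the normal part of its first argument, so this trace over
  the ambient basis is really one over the tangent space, namely the mean curvature vector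
  (\<open>mean_curvature_eq\<close>).\<close>

definition mean :: "real^'m \<Rightarrow> 'b" where
  "mean z = (\<Sum>e\<in>Basis. shape z e e)"

lemma tproj_mean:
  assumes z: "z \<in> \<Omega>"
  shows "tproj f z (mean z) = 0"
proof (rule euclidean_eqI)
  fix d :: 'b
  have "tproj f z (mean z) \<bullet> d = (\<Sum>e\<in>Basis. tproj f z (shape z e e) \<bullet> d)"
    by (simp add: mean_def linear_sum[OF lin_tproj[OF z]] inner_sum_left)
  also have "\<dots> = (\<Sum>e\<in>Basis. (shape z e e - shape z e (tproj f z e)) \<bullet> d)"
    by (intro sum.cong refl) (metis tproj_shape[OF z] add_diff_cancel_left')
  also have "\<dots> = (\<Sum>e\<in>Basis. shape z e e \<bullet> d) - (\<Sum>e\<in>Basis. shape z e (tproj f z e) \<bullet> d)"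
    by (simp add: inner_diff_left sum_subtractf)
  also have "\<dots> = 0"
    using trace_tproj[OF z bilinear_shape_inner(2)[OF z], of d] by (simp add: shape_tproj_left[OF z])
  finally show "tproj f z (mean z) \<bullet> d = 0 \<bullet> d" by simp
qed

lemma mean_curvature_eq:
  assumes z: "z \<in> \<Omega>"
  shows "mean_curvature f z = mean z"
proof -
  interpret p: linear "tproj f z" by (rule lin_tproj[OF z])
  define C where "C u v = normal_part f z (dird (\<lambda>y. dird f y v) z u)" for u v
  have dd: "linear (dird (\<lambda>y. dird f y v) z)" for v
    by (intro linear_frechet_derivative smooth_on_imp_differentiable[OF _ z] smooth_intros smooth_f)
  have np: "linear (normal_part f z)"
    unfolding normal_part_eq'[OF z] by (rule linearI) (auto simp: p.add p.scale algebra_simps)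
  have sm: "smooth_on (\<lambda>y. dird f y v) \<Omega>" for v by (intro smooth_intros smooth_f)
  have "bilinear C"
    unfolding bilinear_def
  proof (intro conjI allI)
    show "linear (\<lambda>u. C u v)" for v
      using linear_compose[OF dd np] by (simp add: C_def o_def)
    show "linear (C u)" for u
    proof -
      have "linear (\<lambda>v. dird (\<lambda>y. dird f y v) z u)"
      proof (rule linearI)
        fix v w :: "real^'m" and r :: real
        have "dird (\<lambda>y. dird f y (v + w)) z = dird (\<lambda>y. dird f y v + dird f y w) z"
          by (rule dird_cong[OF open_O z]) (rule linear_add[OF lin_f])
        then show "dird (\<lambda>y. dird f y (v + w)) z u = dird (\<lambda>y. dird f y v) z u + dird (\<lambda>y. dird f y w) z u"
          by (simp add: dird_add smooth_on_imp_differentiable[OF sm z])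
        have "dird (\<lambda>y. dird f y (r *\<^sub>R v)) z = dird (\<lambda>y. r *\<^sub>R dird f y v) z"
          by (rule dird_cong[OF open_O z]) (rule linear_scale[OF lin_f])
        also have "\<dots> = (\<lambda>u. r *\<^sub>R dird (\<lambda>y. dird f y v) z u)"
          by (rule dird_eqI, rule has_derivative_scaleR_right, rule smooth_on_has_derivative[OF sm z])
        finally show "dird (\<lambda>y. dird f y (r *\<^sub>R v)) z u = r *\<^sub>R dird (\<lambda>y. dird f y v) z u" by simp
      qed
      from linear_compose[OF this np] show ?thesis by (simp add: C_def[abs_def] o_def)
    qed
  qed
  then have "mean_curvature f z = (\<Sum>e\<in>Basis. C (pinv f z e) (pinv f z e))"
    unfolding mean_curvature_def second_ff_def
    using trace_metric[OF lin_f[OF z] inj_f[OF z], of C] by (simp add: C_def)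
  also have "\<dots> = (\<Sum>e\<in>Basis. shape z e e - tproj f z (shape z e e))"
  proof (rule sum.cong[OF refl])
    fix e :: 'b
    \<comment> \<open>\<open>shape\<close> also differentiates the coefficients
      \<open>pinv f y e\<close>. That extra term lies in the image of \<open>dird f z\<close> and is
      removed by the normal projection.\<close>
    have 1: "shape z e e = dird (\<lambda>y. dird f y (pinv f z e)) z (pinv f z e)
        + dird f z (dird (\<lambda>y. pinv f y e) z (pinv f z e))"
      unfolding shape_def tder_def
      by (rule dird_apply[OF open_O z lin_f sm]) (assumption, rule smooth_pinv[OF smooth_on_const])
    then show "C (pinv f z e) (pinv f z e) = shape z e e - tproj f z (shape z e e)"
      by (simp add: C_def normal_part_eq'[OF z] p.add tproj_dird'[OF z])
  qed
  also have "\<dots> = mean z - tproj f z (mean z)"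
    by (simp add: mean_def p.sum sum_subtractf)
  finally show ?thesis by (simp add: tproj_mean[OF z])
qed

lemma tder_shape_symm:
  assumes "z \<in> \<Omega>"
  shows "tder f (\<lambda>y. shape y a c) z b \<bullet> d = c \<bullet> tder f (\<lambda>y. shape y a d) z b"
proof -
  have sm: "smooth_on (\<lambda>y. shape y a c) \<Omega>" for c by (intro smooth_intros)
  have "tder f (\<lambda>y. shape y a c) z b \<bullet> d = tder f (\<lambda>y. shape y a c \<bullet> d) z b"
    by (simp add: tder_linear[OF bounded_linear_inner_left assms sm])
  also have "\<dots> = tder f (\<lambda>y. c \<bullet> shape y a d) z b"
    by (rule tder_cong[OF open_O assms]) (rule shape_symm)
  also have "\<dots> = c \<bullet> tder f (\<lambda>y. shape y a d) z b"
    by (simp add: tder_linear[OF bounded_linear_inner_right assms sm])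
  finally show ?thesis .
qed

text \<open>Once the trace is restricted to tangential vectors in the second factor, that factor is
  normal while \<open>shape z e n\<close> is tangential, and every summand vanishes.\<close>

lemma sum_shape_normal_eq_0:
  assumes z: "z \<in> \<Omega>" and n: "tproj f z n = 0"
  shows "(\<Sum>e\<in>Basis. shape z e n \<bullet> shape z a e) = 0"
proof -
  have "(\<Sum>e\<in>Basis. shape z e n \<bullet> shape z a e) = (\<Sum>e\<in>Basis. shape z e n \<bullet> shape z a (tproj f z e))"
    by (rule trace_tproj[OF z bilinear_shape_inner(1)[OF z]]) (simp add: shape_tproj_left[OF z])
  also have "\<dots> = 0"
    using normal_inner_tangent[OF z shape_tangent_normal[OF z] shape_normal_tangent[OF z n]]
    by (simp add: inner_commute)
  finally show ?thesis .
qed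

lemma normal_shape_shape:
  assumes z: "z \<in> \<Omega>" and n: "tproj f z n = 0"
  shows "n \<bullet> shape z b e = shape z e n \<bullet> b"
  using normal_shape_commute[OF assms, of b e] shape_symm[OF z, of e n b] by simp

text \<open>\<open>tder\<close> sees only the tangential part of \<open>e\<close>, so this is the
  trace over the tangent space also for a \<open>W\<close> with normal components.\<close>

definition divergence :: "(real^'m \<Rightarrow> 'b) \<Rightarrow> real^'m \<Rightarrow> real" where
  "divergence W z = (\<Sum>e\<in>Basis. tder f W z e \<bullet> e)"

end

section \<open>Consequences of the shrinker equation in a chart\<close>

locale shrinker_chart = immersed_chart f \<Omega>
  for f :: "real^'m::finite \<Rightarrow> 'b::euclidean_space" and \<Omega> +
  assumes shrinker: "\<And>z. z \<in> \<Omega> \<Longrightarrow> mean_curvature f z + normal_part f z (f z) = 0"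
begin

lemma mean_eq: "z \<in> \<Omega> \<Longrightarrow> mean z = tproj f z (f z) - f z"
  using shrinker[of z] by (simp add: mean_curvature_eq normal_part_eq' algebra_simps add_eq_0_iff2)

text \<open>The derivative of \<open>f\<close> is the projection itself, so in the derivative of
  \<open>tproj f y (f y) - f y\<close> everything but the \<open>shape\<close> term cancels.\<close>

lemma tder_mean:
  assumes z: "z \<in> \<Omega>"
  shows "tder f mean z a = shape z a (f z)"
proof -
  have "tder f mean z a = tder f (\<lambda>y. tproj f y (f y) - f y) z a"
    by (rule tder_cong[OF open_O z]) (rule mean_eq)
  also have "\<dots> = shape z a (f z) + tproj f z (tproj f z a) - tproj f z a"
    by (subst tder_diff[OF z]) (auto intro!: smooth_intros smooth_f simp: tder_tproj_apply[OF z smooth_f])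
  finally show ?thesis by (simp add: tproj_idem[OF z])
qed

text \<open>A traced Codazzi equation. Exchanging the two derivatives with \<open>tder_swap\<close>
  turns the traced second derivative of the projection into the derivative of the mean curvature,
  which \<open>tder_mean\<close> evaluates for a shrinker, plus terms quadratic in
  \<open>shape\<close>.\<close>

lemma divergence_shape:
  assumes z: "z \<in> \<Omega>" and \<kappa>: "smooth_on \<kappa> \<Omega>" "\<And>y. y \<in> \<Omega> \<Longrightarrow> tproj f y (\<kappa> y) = 0"
  shows "divergence (\<lambda>y. shape y a (\<kappa> y)) z
    = shape z a (\<kappa> z) \<bullet> f z + (\<Sum>e\<in>Basis. shape z e (\<kappa> z) \<bullet> shape z e a)
      + (\<Sum>e\<in>Basis. shape z a (tder f \<kappa> z e) \<bullet> e)"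
proof -
  note \<kappa>z = \<kappa>(2)[OF z]
  have 1: "tder f (\<lambda>y. shape y a (\<kappa> y)) z e \<bullet> e
      = \<kappa> z \<bullet> tder f (\<lambda>y. shape y a e) z e + shape z a (tder f \<kappa> z e) \<bullet> e" for e
    by (subst tder_apply[OF z linear_shape_right _ \<kappa>(1)])
      (auto intro!: smooth_intros simp: inner_add_left tder_shape_symm[OF z])
  have 2: "tder f (\<lambda>y. shape y a e) z e = tder f (\<lambda>y. shape y e e) z a + shape z (shape z e a - shape z a e) e" for e
    using tder_swap[OF z smooth_tproj_const, of e a e] unfolding shape_def[symmetric] .
  have 3: "(\<Sum>e\<in>Basis. tder f (\<lambda>y. shape y e e) z a) = shape z a (f z)"
    unfolding tder_mean[OF z, symmetric] mean_def[abs_def]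
    by (rule tder_sum[OF z, symmetric]) (intro smooth_intros)
  have 4: "\<kappa> z \<bullet> shape z (shape z e a - shape z a e) e
      = shape z e (\<kappa> z) \<bullet> shape z e a - shape z e (\<kappa> z) \<bullet> shape z a e" for e
    by (simp add: normal_shape_shape[OF z \<kappa>z] inner_diff_right)
  have "divergence (\<lambda>y. shape y a (\<kappa> y)) z
      = \<kappa> z \<bullet> (\<Sum>e\<in>Basis. tder f (\<lambda>y. shape y e e) z a)
        + (\<Sum>e\<in>Basis. shape z e (\<kappa> z) \<bullet> shape z e a) - (\<Sum>e\<in>Basis. shape z e (\<kappa> z) \<bullet> shape z a e)
        + (\<Sum>e\<in>Basis. shape z a (tder f \<kappa> z e) \<bullet> e)"
    by (simp add: divergence_def 1 2 4 inner_add_right sum.distrib inner_sum_right sum_subtractf)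
  then show ?thesis
    using sum_shape_normal_eq_0[OF z \<kappa>z, of a] shape_symm[OF z, of a "\<kappa> z" "f z"] unfolding 3 by linarith
qed

text \<open>The field \<open>\<phi>\<^sup>2 A\<^bsub>a\<^sup>\<bottom> + 2N\<^esub> a\<^sup>\<top>\<close> is chosen so that its weighted divergence absorbs all
  terms of the second variation along \<open>\<phi> (a\<^sup>\<bottom> + N)\<close> that have no sign.\<close>

lemma second_variation_le:
  fixes N :: "real^'m \<Rightarrow> 'b" and a :: 'b and \<phi> :: "real^'m \<Rightarrow> real"
  assumes z: "z \<in> \<Omega>" and N: "smooth_on N \<Omega>" "\<And>y. y \<in> \<Omega> \<Longrightarrow> tproj f y (N y) = 0"
    and par: "\<And>y b. y \<in> \<Omega> \<Longrightarrow> tder f N y b = - shape y b (N y)"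
    and \<phi>: "smooth_on \<phi> \<Omega>"
  defines "\<zeta> \<equiv> \<lambda>y. a - tproj f y a + N y"
    and "\<kappa> \<equiv> \<lambda>y. a - tproj f y a + 2 *\<^sub>R N y"
  defines "\<eta> \<equiv> \<lambda>y. \<phi> y *\<^sub>R \<zeta> y"
    and "W \<equiv> \<lambda>y. (\<phi> y)\<^sup>2 *\<^sub>R shape y a (\<kappa> y)"
  shows "(\<Sum>e\<in>Basis. (norm (tder f \<eta> z e))\<^sup>2 - 2 * (norm (shape z e (\<eta> z)))\<^sup>2) - (norm (\<eta> z))\<^sup>2
    \<le> (\<Sum>e\<in>Basis. (tder f \<phi> z e)\<^sup>2) * ((norm (\<zeta> z))\<^sup>2 + (norm a)\<^sup>2) - (\<phi> z)\<^sup>2 * (norm (\<zeta> z))\<^sup>2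
      - (divergence W z - f z \<bullet> W z)"
proof -
  interpret l: linear "\<lambda>b. shape z b c" for c by (rule linear_shape_left[OF z])
  interpret r: linear "\<lambda>c. shape z b c" for b by (rule linear_shape_right[OF z])
  have sm: "smooth_on \<zeta> \<Omega>" "smooth_on \<kappa> \<Omega>" "smooth_on (\<lambda>y. a - tproj f y a) \<Omega>"
    unfolding \<zeta>_def \<kappa>_def by (intro smooth_intros open_O N)+
  have normal: "tproj f y (\<zeta> y) = 0" "tproj f y (\<kappa> y) = 0" "tproj f y (a - tproj f y a) = 0" if "y \<in> \<Omega>" for y
    using that N(2)[OF that] by (auto simp: \<zeta>_def \<kappa>_def linear_add[OF lin_tproj] linear_diff[OF lin_tproj]
        linear_scale[OF lin_tproj] tproj_idem)
  note nz = normal[OF z] N(2)[OF z]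
  \<comment> \<open>\<open>A e\<close> and \<open>B e\<close> are the shape operators of the normal
    part of \<open>a\<close> and of \<open>N\<close>, applied to \<open>e\<close>, and are
    tangential. \<open>C e\<close> is the second fundamental form of \<open>e\<close> and the
    tangential part of \<open>a\<close>, and is normal. Mixed products of the two kinds vanish,
    which is what keeps the computation short.\<close>
  define A where "A e = shape z e (a - tproj f z a)" for e
  define B where "B e = shape z e (N z)" for e
  define C where "C e = shape z e (tproj f z a)" for e
  define d where "d e = tder f \<phi> z e" for e
  have tA: "tproj f z (A e) = A e" and tB: "tproj f z (B e) = B e" and nC: "tproj f z (C e) = 0" for e
    unfolding A_def B_def C_def
    by (auto intro: shape_normal_tangent z nz shape_tangent_normal)
  have AC: "shape z e a = A e + C e" for e
    by (simp add: A_def C_def r.diff)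
  have CA: "C e \<bullet> A e' = 0" and CB: "C e \<bullet> B e' = 0" for e e'
    using normal_inner_tangent[OF z nC tA] normal_inner_tangent[OF z nC tB] by auto
  have \<zeta>A: "\<zeta> z \<bullet> A e = 0" and \<zeta>B: "\<zeta> z \<bullet> B e = 0" for e
    using normal_inner_tangent[OF z nz(1) tA] normal_inner_tangent[OF z nz(1) tB] by auto
  have da: "tder f (\<lambda>y. a - tproj f y a) z e = - (A e + C e)" for e
    using tder_diff[OF z smooth_on_const smooth_tproj_const, of a a e]
    by (simp add: tder_const flip: shape_def AC)
  have d\<zeta>: "tder f \<zeta> z e = - (A e + C e) - B e" for e
    unfolding \<zeta>_def by (simp add: tder_add[OF z sm(3) N(1)] da par[OF z] B_def)
  have d\<kappa>: "tder f \<kappa> z e = - (A e + C e) - 2 *\<^sub>R B e" for e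
  proof -
    have "smooth_on (\<lambda>y. 2 *\<^sub>R N y) \<Omega>" by (intro smooth_intros open_O N)
    then show ?thesis
      unfolding \<kappa>_def
      by (simp add: tder_add[OF z sm(3)] da tder_linear[OF bounded_linear_scaleR_right z N(1)] par[OF z] B_def)
  qed
  have d\<eta>: "tder f \<eta> z e = d e *\<^sub>R \<zeta> z - \<phi> z *\<^sub>R (A e + C e + B e)" for e
    unfolding \<eta>_def by (simp add: tder_scaleR[OF z \<phi> sm(1)] d\<zeta> d_def algebra_simps)
  have s\<eta>: "shape z e (\<eta> z) = \<phi> z *\<^sub>R (A e + B e)" for e
    by (simp add: \<eta>_def r.scale \<zeta>_def r.add A_def B_def)
  have s\<kappa>: "shape z e (\<kappa> z) = A e + 2 *\<^sub>R B e" for e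
    by (simp add: \<kappa>_def r.scale r.add A_def B_def)
  have q: "(norm (tder f \<eta> z e))\<^sup>2 - 2 * (norm (shape z e (\<eta> z)))\<^sup>2
      = (d e)\<^sup>2 * (norm (\<zeta> z))\<^sup>2 - 2 * \<phi> z * d e * (\<zeta> z \<bullet> C e)
        + (\<phi> z)\<^sup>2 * (C e \<bullet> C e - A e \<bullet> A e - 2 * (A e \<bullet> B e) - B e \<bullet> B e)" for e
    unfolding d\<eta> s\<eta> power2_norm_eq_inner
    using CA[of e e] CB[of e e] \<zeta>A[of e] \<zeta>B[of e]
    by (simp add: inner_add_left inner_add_right inner_diff_left inner_diff_right inner_commute
        power2_eq_square algebra_simps)
  have sumC: "(\<Sum>e\<in>Basis. shape z e a \<bullet> shape z a e) = (\<Sum>e\<in>Basis. C e \<bullet> C e)"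
  proof -
    \<comment> \<open>Both vectors are normal and their difference is tangential, so they coincide:
      again the symmetry of the second fundamental form.\<close>
    have C_eq: "shape z a (tproj f z e) = C e" for e
    proof -
      have "shape z a (tproj f z e) - C e
          = shape z (tproj f z a) (tproj f z e) - shape z (tproj f z e) (tproj f z a)"
        by (simp add: C_def shape_tproj_left[OF z])
      then have "tproj f z (shape z a (tproj f z e) - C e) = shape z a (tproj f z e) - C e"
        using tproj_shape_diff[OF z] by simp
      then show ?thesis
        using nC[of e] shape_tangent_normal[OF z, of a e] by (simp add: linear_diff[OF lin_tproj[OF z]])
    qed
    have "(\<Sum>e\<in>Basis. shape z e a \<bullet> shape z a e) = (\<Sum>e\<in>Basis. shape z e a \<bullet> shape z a (tproj f z e))"
      by (rule trace_tproj[OF z bilinear_shape_inner(1)[OF z]]) (simp add: shape_tproj_left[OF z])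
    then show ?thesis
      by (simp add: C_eq AC inner_add_left CA inner_commute[of "A _"])
  qed
  have div: "divergence (\<lambda>y. shape y a (\<kappa> y)) z
      = shape z a (\<kappa> z) \<bullet> f z + (\<Sum>e\<in>Basis. A e \<bullet> A e + 2 * (A e \<bullet> B e) - C e \<bullet> C e)"
  proof -
    have "shape z e (\<kappa> z) \<bullet> shape z e a = A e \<bullet> A e + 2 * (A e \<bullet> B e)" for e
      using CA[of e e] CB[of e e] by (simp add: s\<kappa> AC inner_add_left inner_add_right inner_commute)
    moreover have "(\<Sum>e\<in>Basis. shape z a (tder f \<kappa> z e) \<bullet> e) = - (\<Sum>e\<in>Basis. C e \<bullet> C e)"
    proof -
      have "shape z a (tder f \<kappa> z e) \<bullet> e = - (shape z e a \<bullet> shape z a e) - 2 * (shape z e (N z) \<bullet> shape z a e)" for e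
        using shape_symm[OF z, of a "tder f \<kappa> z e" e]
        by (simp add: d\<kappa> AC flip: B_def) (simp add: inner_diff_left inner_add_left)
      then show ?thesis
        using sumC sum_shape_normal_eq_0[OF z nz(4), of a]
        by (simp add: sum_subtractf sum_negf flip: sum_distrib_left)
    qed
    ultimately show ?thesis
      by (simp add: divergence_shape[OF z sm(2) normal(2)] sum.distrib sum_subtractf)
  qed
  \<comment> \<open>The weight 2 on \<open>N\<close> in \<kappa> supplies the whole cross term 2 (A
    e \<bullet> B e). Added to the quadratic form in \<open>q\<close>, this divergence cancels the
    products A \<bullet> A, A \<bullet> B and C \<bullet> C and leaves only minus B \<bullet>
    B.\<close>
  have divW: "divergence W z - f z \<bullet> W z
      = (\<phi> z)\<^sup>2 * (\<Sum>e\<in>Basis. A e \<bullet> A e + 2 * (A e \<bullet> B e) - C e \<bullet> C e)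
        + 2 * \<phi> z * (\<Sum>e\<in>Basis. d e * (\<kappa> z \<bullet> C e))"
  proof -
    have smS: "smooth_on (\<lambda>y. shape y a (\<kappa> y)) \<Omega>" by (intro smooth_intros sm)
    have sm2: "smooth_on (\<lambda>y. \<phi> y * \<phi> y) \<Omega>" by (intro smooth_intros open_O \<phi>)
    have "tder f W z e \<bullet> e = (\<phi> z)\<^sup>2 * (tder f (\<lambda>y. shape y a (\<kappa> y)) z e \<bullet> e)
        + 2 * \<phi> z * (d e * (\<kappa> z \<bullet> shape z a e))" for e
      unfolding W_def power2_eq_square
      by (simp add: tder_scaleR[OF z sm2 smS] tder_bilinear[OF bounded_bilinear_mult z \<phi> \<phi>]
          inner_add_left d_def shape_symm[OF z] algebra_simps)
    then have 1: "divergence W z = (\<phi> z)\<^sup>2 * divergence (\<lambda>y. shape y a (\<kappa> y)) z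
        + 2 * \<phi> z * (\<Sum>e\<in>Basis. d e * (\<kappa> z \<bullet> shape z a e))"
      by (simp add: divergence_def sum.distrib sum_distrib_left)
    have "(\<Sum>e\<in>Basis. d e * (\<kappa> z \<bullet> shape z a e)) = (\<Sum>e\<in>Basis. d e * (\<kappa> z \<bullet> shape z a (tproj f z e)))"
      unfolding d_def
      by (rule trace_tproj[OF z bilinear_shape_inner(3)[OF z \<phi>]]) (simp add: tder_tproj'[OF z])
    also have "\<dots> = (\<Sum>e\<in>Basis. d e * (\<kappa> z \<bullet> C e))"
    proof (rule sum.cong[OF refl])
      fix e :: 'b
      have "\<kappa> z \<bullet> shape z a (tproj f z e) = \<kappa> z \<bullet> shape z e a"
        using normal_shape_commute[OF z nz(2), of a "tproj f z e"] by (simp add: shape_tproj_left[OF z])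
      then show "d e * (\<kappa> z \<bullet> shape z a (tproj f z e)) = d e * (\<kappa> z \<bullet> C e)"
        using normal_inner_tangent[OF z nz(2) tA] by (simp add: AC inner_add_right)
    qed
    finally show ?thesis
      unfolding 1 div by (simp add: W_def inner_commute algebra_simps)
  qed
  \<comment> \<open>The extra copy of \<open>N\<close> in \<kappa> meets the gradient of \<phi>
    through N \<bullet> C e. Rewritten in terms of \<open>B e\<close>, this term can be absorbed by
    the negative square of \<open>B e\<close>.\<close>
  have aB: "N z \<bullet> C e = a \<bullet> B e" for e
  proof -
    have "N z \<bullet> C e = B e \<bullet> tproj f z a" by (simp add: C_def B_def shape_symm[OF z])
    also have "\<dots> = a \<bullet> B e" using tproj_symm[OF z, of "B e" a] by (simp add: tB inner_commute)
    finally show ?thesis .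
  qed
  have "(\<Sum>e\<in>Basis. (norm (tder f \<eta> z e))\<^sup>2 - 2 * (norm (shape z e (\<eta> z)))\<^sup>2) - (norm (\<eta> z))\<^sup>2
      + (divergence W z - f z \<bullet> W z)
      = (\<Sum>e\<in>Basis. (d e)\<^sup>2 * (norm (\<zeta> z))\<^sup>2 + 2 * \<phi> z * d e * (a \<bullet> B e) - (\<phi> z)\<^sup>2 * (B e \<bullet> B e))
        - (\<phi> z)\<^sup>2 * (norm (\<zeta> z))\<^sup>2"
  proof -
    have "(norm (\<eta> z))\<^sup>2 = (\<phi> z)\<^sup>2 * (norm (\<zeta> z))\<^sup>2" by (simp add: \<eta>_def power_mult_distrib)
    moreover have "\<kappa> z \<bullet> C e = \<zeta> z \<bullet> C e + a \<bullet> B e" for e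
      by (simp add: \<kappa>_def \<zeta>_def inner_add_left flip: aB)
    ultimately show ?thesis
      unfolding q divW
      by (simp add: sum.distrib sum_subtractf sum_distrib_left algebra_simps)
  qed
  also have "\<dots> \<le> (\<Sum>e\<in>Basis. (d e)\<^sup>2 * ((norm (\<zeta> z))\<^sup>2 + (norm a)\<^sup>2)) - (\<phi> z)\<^sup>2 * (norm (\<zeta> z))\<^sup>2"
  proof -
    \<comment> \<open>Complete the square of d e a - \<phi> B e. This is the origin of the summand
      |a|^2 beside |\<zeta>|^2 in the bound.\<close>
    have "2 * \<phi> z * d e * (a \<bullet> B e) - (\<phi> z)\<^sup>2 * (B e \<bullet> B e) \<le> (d e)\<^sup>2 * (norm a)\<^sup>2" for e
    proof -
      have "0 \<le> (d e *\<^sub>R a - \<phi> z *\<^sub>R B e) \<bullet> (d e *\<^sub>R a - \<phi> z *\<^sub>R B e)" by (rule inner_ge_zero)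
      then have "0 \<le> d e * (d e * (a \<bullet> a)) - 2 * (\<phi> z * (d e * (a \<bullet> B e))) + \<phi> z * (\<phi> z * (B e \<bullet> B e))"
        by (simp add: inner_diff_left inner_diff_right inner_commute algebra_simps)
      then show ?thesis
        unfolding power2_norm_eq_inner power2_eq_square[of "d e"] power2_eq_square[of "\<phi> z"] by (simp add: mult.assoc)
    qed
    then show ?thesis
      by (intro diff_right_mono sum_mono) (simp add: distrib_left algebra_simps)
  qed
  finally show ?thesis by (simp add: d_def flip: sum_distrib_right)
qed

end

section \<open>Volume densities\<close>

text \<open>A permutation other than the identity moves at least two indices. After one factor has
  been differentiated, an off-diagonal zero of the identity matrix remains, so only the trace
  survives.\<close>

lemma has_derivative_det_one:
  fixes M :: "'a::real_normed_vector \<Rightarrow> real^'m^'m::finite"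
  assumes "M z = mat 1" and M: "\<And>i j. ((\<lambda>y. M y $ i $ j) has_derivative M' i j) (at z)"
  shows "((\<lambda>y. det (M y)) has_derivative (\<lambda>v. \<Sum>i\<in>UNIV. M' i i v)) (at z)"
proof -
  let ?P = "{p. p permutes (UNIV::'m set)}"
  have "((\<lambda>y. det (M y)) has_derivative
      (\<lambda>v. \<Sum>p\<in>?P. of_int (sign p) * (\<Sum>i\<in>UNIV. M' i (p i) v * (\<Prod>j\<in>UNIV - {i}. M z $ j $ p j)))) (at z)"
    unfolding det_def
    by (intro has_derivative_sum has_derivative_mult_right has_derivative_prod M)
  moreover have "(\<Sum>p\<in>?P. of_int (sign p) * (\<Sum>i\<in>UNIV. M' i (p i) v * (\<Prod>j\<in>UNIV - {i}. M z $ j $ p j)))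
      = (\<Sum>i\<in>UNIV. M' i i v)" for v
  proof -
    have 0: "(\<Prod>j\<in>UNIV - {i}. M z $ j $ p j) = (if p = id then 1 else 0)" if p: "p permutes UNIV" for p and i :: 'm
    proof (cases "p = id")
      case True
      then show ?thesis by (simp add: assms(1) mat_def)
    next
      case False
      obtain j where j: "j \<noteq> i" "p j \<noteq> j"
      proof -
        obtain k where k: "p k \<noteq> k" using False by (auto simp: fun_eq_iff)
        moreover have "p (p k) \<noteq> p k" using k permutes_inj[OF p] by (auto dest: injD)
        ultimately show thesis using that by (cases "k = i") auto
      qed
      then have "(\<Prod>j\<in>UNIV - {i}. M z $ j $ p j) = 0"
        by (intro prod_zero) (auto simp: assms(1) mat_def intro!: bexI[of _ j])
      with False show ?thesis by simp
    qed
    have "(\<Sum>p\<in>?P. of_int (sign p) * (\<Sum>i\<in>UNIV. M' i (p i) v * (\<Prod>j\<in>UNIV - {i}. M z $ j $ p j)))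
        = (\<Sum>p\<in>?P. if p = id then (\<Sum>i\<in>UNIV. M' i i v) else 0)"
      by (intro sum.cong refl) (auto simp: 0 sign_id)
    then show ?thesis by (simp add: permutes_id)
  qed
  ultimately show ?thesis by simp
qed

text \<open>Jacobi's formula, reduced to the identity matrix by multiplying with the fixed inverse
  of \<open>M z\<close>.\<close>

lemma has_derivative_det:
  fixes M :: "'a::real_normed_vector \<Rightarrow> real^'m^'m::finite"
  assumes nz: "det (M z) \<noteq> 0" and M: "\<And>i j. ((\<lambda>y. M y $ i $ j) has_derivative M' i j) (at z)"
  shows "((\<lambda>y. det (M y)) has_derivative
    (\<lambda>v. det (M z) * (\<Sum>i\<in>UNIV. \<Sum>j\<in>UNIV. matrix_inv (M z) $ i $ j * M' j i v))) (at z)"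
proof -
  let ?I = "matrix_inv (M z)"
  have inv: "M z ** ?I = mat 1" "?I ** M z = mat 1"
  proof -
    have "invertible (M z)" using nz by (simp add: invertible_det_nz)
    then show "M z ** ?I = mat 1" "?I ** M z = mat 1"
      unfolding invertible_def matrix_inv_def by (rule someI2_ex, blast)+
  qed
  have "((\<lambda>y. det (?I ** M y)) has_derivative (\<lambda>v. \<Sum>i\<in>UNIV. \<Sum>j\<in>UNIV. ?I $ i $ j * M' j i v)) (at z)"
  proof (rule has_derivative_det_one[where M' = "\<lambda>i j v. \<Sum>k\<in>UNIV. ?I $ i $ k * M' k j v"])
    show "((\<lambda>y. (?I ** M y) $ i $ j) has_derivative (\<lambda>v. \<Sum>k\<in>UNIV. ?I $ i $ k * M' k j v)) (at z)" for i j
      by (simp add: matrix_matrix_mult_def) (intro has_derivative_sum has_derivative_mult_right M)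
  qed (rule inv)
  then have "((\<lambda>y. det (M z) * det (?I ** M y)) has_derivative
      (\<lambda>v. det (M z) * (\<Sum>i\<in>UNIV. \<Sum>j\<in>UNIV. ?I $ i $ j * M' j i v))) (at z)"
    by (rule has_derivative_mult_right)
  moreover have "det (M z) * det (?I ** M y) = det (M y)" for y
    by (metis det_mul inv(1) matrix_mul_assoc matrix_mul_lid)
  ultimately show ?thesis by simp
qed

text \<open>Differentiate the product of \<open>M s\<close> with its inverse, which is constant.
  That the inverse has a derivative at all comes from Cramer's rule by way of
  \<open>smooth_on_matrix_inv\<close>.\<close>

lemma DERIV_matrix_inv:
  fixes M :: "real \<Rightarrow> real^'m^'m::finite"
  assumes S: "open S" "t \<in> S" and sm: "\<And>i j. smooth_on (\<lambda>s. M s $ i $ j) S"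
    and nz: "\<And>s. s \<in> S \<Longrightarrow> det (M s) \<noteq> 0"
    and M: "\<And>i j. ((\<lambda>s. M s $ i $ j) has_real_derivative M' i j) (at t)"
  shows "((\<lambda>s. matrix_inv (M s) $ i $ j) has_real_derivative
    - (\<Sum>k\<in>UNIV. \<Sum>l\<in>UNIV. matrix_inv (M t) $ i $ k * M' k l * matrix_inv (M t) $ l $ j)) (at t)"
proof -
  let ?I = "\<lambda>s. matrix_inv (M s)"
  have inv: "M s ** ?I s = mat 1" "?I s ** M s = mat 1" if "s \<in> S" for s
  proof -
    have "invertible (M s)" using nz[OF that] by (simp add: invertible_det_nz)
    then show "M s ** ?I s = mat 1" "?I s ** M s = mat 1"
      unfolding invertible_def matrix_inv_def by (rule someI2_ex, blast)+
  qed
  have "\<exists>D. ((\<lambda>s. ?I s $ k $ l) has_real_derivative D) (at t)" for k l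
    using smooth_on_imp_differentiable[OF smooth_on_matrix_inv[OF S(1) sm nz] S(2), of k l]
    by (simp add: real_differentiable_def)
  then obtain D where D: "\<And>k l. ((\<lambda>s. ?I s $ k $ l) has_real_derivative D k l) (at t)" by metis
  have eq: "(\<Sum>l\<in>UNIV. M t $ k $ l * D l j) = - (\<Sum>l\<in>UNIV. M' k l * ?I t $ l $ j)" for k
  proof -
    have "((\<lambda>s. \<Sum>l\<in>UNIV. M s $ k $ l * ?I s $ l $ j) has_real_derivative
        (\<Sum>l\<in>UNIV. M t $ k $ l * D l j + M' k l * ?I t $ l $ j)) (at t)"
      by (auto intro!: derivative_eq_intros M D sum.cong)
    moreover have "((\<lambda>s. \<Sum>l\<in>UNIV. M s $ k $ l * ?I s $ l $ j) has_real_derivative 0) (at t)"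
    proof (rule has_field_derivative_transform_within_open[OF _ S])
      show "((\<lambda>s. (mat 1 :: real^'m^'m) $ k $ j) has_real_derivative 0) (at t)" by simp
      show "(mat 1 :: real^'m^'m) $ k $ j = (\<Sum>l\<in>UNIV. M s $ k $ l * ?I s $ l $ j)" if "s \<in> S" for s
        using inv(1)[OF that] by (simp add: matrix_matrix_mult_def vec_eq_iff)
    qed
    ultimately have "(\<Sum>l\<in>UNIV. M t $ k $ l * D l j + M' k l * ?I t $ l $ j) = 0"
      by (rule DERIV_unique)
    then show ?thesis by (simp add: sum.distrib)
  qed
  have "D i j = (\<Sum>l\<in>UNIV. (?I t ** M t) $ i $ l * D l j)"
    unfolding inv(2)[OF S(2)] by (simp add: mat_def mult_delta_left)
  also have "\<dots> = (\<Sum>k\<in>UNIV. ?I t $ i $ k * (\<Sum>l\<in>UNIV. M t $ k $ l * D l j))"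
    by (simp add: matrix_matrix_mult_def sum_distrib_left sum_distrib_right mult.assoc) (rule sum.swap)
  also have "\<dots> = - (\<Sum>k\<in>UNIV. \<Sum>l\<in>UNIV. ?I t $ i $ k * M' k l * ?I t $ l $ j)"
    unfolding eq by (simp add: sum_distrib_left mult.assoc sum_negf)
  finally show ?thesis using D[of i j] by simp
qed

definition wdensity :: "(real^'m::finite \<Rightarrow> 'b::euclidean_space) \<Rightarrow> real^'m \<Rightarrow> real" where
  "wdensity f z = sqrt (det (metric_at f z)) * exp (- (1/2) * (norm (f z))\<^sup>2)"

section \<open>The weighted density of an immersion and of its linear variations\<close>

context immersed_chart
begin

lemma metric_inv_sym:
  assumes "z \<in> \<Omega>"
  shows "matrix_inv (metric_at f z) $ i $ j = matrix_inv (metric_at f z) $ j $ i"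
  unfolding sum_pinv_pinv[OF lin_f[OF assms] inj_f[OF assms], symmetric] by (simp add: mult.commute)

lemma smooth_wdensity: "smooth_on (wdensity f) \<Omega>"
  unfolding wdensity_def power2_norm_eq_inner
  by (intro smooth_intros open_O smooth_metric smooth_f metric_pos)

text \<open>The logarithmic derivative of the volume density is half the metric trace of the
  derivative of the metric, by Jacobi's formula, and \<open>trace_metric\<close> turns it into an
  ambient trace. The Gaussian factor contributes - f z \<bullet> dird f z v.\<close>

lemma dird_wdensity:
  assumes z: "z \<in> \<Omega>"
  shows "dird (wdensity f) z v
    = wdensity f z * ((\<Sum>e\<in>Basis. dird (\<lambda>y. dird f y (pinv f z e)) z v \<bullet> tproj f z e) - f z \<bullet> dird f z v)"
proof -
  let ?G = "metric_at f" and ?I = "matrix_inv (metric_at f z)"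
  define F where "F u = dird (\<lambda>y. dird f y u) z v" for u
  have smd: "smooth_on (\<lambda>y. dird f y u) \<Omega>" for u by (intro smooth_intros smooth_f)
  have linF: "linear F"
  proof (rule linearI)
    fix u w :: "real^'m" and r :: real
    have "dird (\<lambda>y. dird f y (u + w)) z = dird (\<lambda>y. dird f y u + dird f y w) z"
      by (rule dird_cong[OF open_O z]) (rule linear_add[OF lin_f])
    then show "F (u + w) = F u + F w"
      by (simp add: F_def dird_add smooth_on_imp_differentiable[OF smd z])
    have "dird (\<lambda>y. dird f y (r *\<^sub>R u)) z = dird (\<lambda>y. r *\<^sub>R dird f y u) z"
      by (rule dird_cong[OF open_O z]) (rule linear_scale[OF lin_f])
    also have "\<dots> = (\<lambda>v. r *\<^sub>R dird (\<lambda>y. dird f y u) z v)"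
      by (rule dird_eqI, rule has_derivative_scaleR_right, rule smooth_on_has_derivative[OF smd z])
    finally show "F (r *\<^sub>R u) = r *\<^sub>R F u" by (simp add: F_def)
  qed
  have dG: "((\<lambda>y. ?G y $ i $ j) has_derivative dird (\<lambda>y. ?G y $ i $ j) z) (at z)" for i j
    by (rule smooth_on_has_derivative[OF smooth_metric z])
  have dG_eq: "dird (\<lambda>y. ?G y $ i $ j) z v = F (axis i 1) \<bullet> dird f z (axis j 1) + dird f z (axis i 1) \<bullet> F (axis j 1)" for i j
    unfolding metric_at_def F_def
    using dird_eqI[OF has_derivative_inner[OF smooth_on_has_derivative[OF smd z] smooth_on_has_derivative[OF smd z]]]
    by (simp add: inner_commute)
  define \<tau> where "\<tau> = (\<Sum>i\<in>UNIV. \<Sum>j\<in>UNIV. ?I $ i $ j * dird (\<lambda>y. ?G y $ j $ i) z v)"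
  have pos: "0 < det (?G z)" by (rule metric_pos[OF z])
  have "((\<lambda>y. f y \<bullet> f y) has_derivative (\<lambda>v. f z \<bullet> dird f z v + dird f z v \<bullet> f z)) (at z)"
    by (intro has_derivative_inner smooth_on_has_derivative[OF smooth_f z])
  then have 1: "((\<lambda>y. exp (- (1/2) * (f y \<bullet> f y))) has_derivative
      (\<lambda>v. (- (1/2) * (f z \<bullet> dird f z v + dird f z v \<bullet> f z)) * exp (- (1/2) * (f z \<bullet> f z)))) (at z)"
    by (intro has_derivative_exp has_derivative_mult_right)
  have 2: "((\<lambda>y. sqrt (det (?G y))) has_derivative
      (\<lambda>v. (det (?G z) * (\<Sum>i\<in>UNIV. \<Sum>j\<in>UNIV. ?I $ i $ j * dird (\<lambda>y. ?G y $ j $ i) z v)) * (inverse (sqrt (det (?G z))) / 2))) (at z)"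
    using DERIV_compose_FDERIV[OF DERIV_real_sqrt[OF pos] has_derivative_det[OF _ dG]] pos by simp
  have "dird (wdensity f) z v = sqrt (det (?G z)) * ((- (1/2) * (f z \<bullet> dird f z v + dird f z v \<bullet> f z)) * exp (- (1/2) * (f z \<bullet> f z)))
      + (det (?G z) * \<tau>) * (inverse (sqrt (det (?G z))) / 2) * exp (- (1/2) * (f z \<bullet> f z))"
    unfolding wdensity_def power2_norm_eq_inner \<tau>_def
    by (subst dird_eqI[OF has_derivative_mult[OF 2 1]]) simp
  also have "\<dots> = wdensity f z * (\<tau> / 2 - f z \<bullet> dird f z v)"
  proof -
    have "det (?G z) * inverse (sqrt (det (?G z))) = sqrt (det (?G z))"
      using pos real_sqrt_mult_self[of "det (?G z)"] by (simp add: field_simps)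
    then have "(det (?G z) * \<tau>) * (inverse (sqrt (det (?G z))) / 2) = sqrt (det (?G z)) * \<tau> / 2"
      by (metis (no_types, opaque_lifting) mult.assoc mult.commute times_divide_eq_right)
    then show ?thesis
      unfolding wdensity_def power2_norm_eq_inner by (simp add: inner_commute algebra_simps)
  qed
  also have "\<tau> = (\<Sum>e\<in>Basis. 2 * (F (pinv f z e) \<bullet> tproj f z e))"
  proof -
    have bil: "bilinear (\<lambda>u w. F u \<bullet> dird f z w + dird f z u \<bullet> F w)"
      by (auto simp: bilinear_def linear_iff inner_add_left inner_add_right algebra_simps
          linear_add[OF linF] linear_scale[OF linF] linear_add[OF lin_f[OF z]] linear_scale[OF lin_f[OF z]])
    have "\<tau> = (\<Sum>i\<in>UNIV. \<Sum>j\<in>UNIV. ?I $ i $ j *\<^sub>R (F (axis i 1) \<bullet> dird f z (axis j 1) + dird f z (axis i 1) \<bullet> F (axis j 1)))"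
      by (simp add: \<tau>_def dG_eq inner_commute add.commute)
    also have "\<dots> = (\<Sum>e\<in>Basis. 2 * (F (pinv f z e) \<bullet> tproj f z e))"
      by (subst trace_metric[OF lin_f[OF z] inj_f[OF z] bil]) (simp add: tder_def inner_commute)
    finally show ?thesis .
  qed
  finally show ?thesis by (simp add: F_def sum_distrib_left[symmetric])
qed

text \<open>The weighted divergence of a tangential field is a Euclidean divergence in coordinates.
  For compact support this reduces the divergence theorem to integrals of partial
  derivatives.\<close>

lemma divergence_coordinates:
  assumes z: "z \<in> \<Omega>" and W: "smooth_on W \<Omega>" "\<And>y. y \<in> \<Omega> \<Longrightarrow> tproj f y (W y) = W y"
  shows "(\<Sum>k\<in>Basis. dird (\<lambda>y. wdensity f y * (pinv f y (W y) \<bullet> k)) z k)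
    = wdensity f z * (divergence W z - f z \<bullet> W z)"
proof -
  define Z where "Z y = pinv f y (W y)" for y
  have smZ: "smooth_on Z \<Omega>" unfolding Z_def by (intro smooth_intros W)
  interpret Z': linear "dird Z z" by (intro linear_frechet_derivative smooth_on_imp_differentiable[OF smZ z])
  interpret w: linear "dird (wdensity f) z"
    by (intro linear_frechet_derivative smooth_on_imp_differentiable[OF smooth_wdensity z])
  interpret f': linear "dird f z" by (rule lin_f[OF z])
  interpret P: linear "pinv f z" by (rule lin_pinv[OF z])
  have WZ: "W y = dird f y (Z y)" if "y \<in> \<Omega>" for y
    using W(2)[OF that] by (simp add: Z_def tder_def)
  have "(\<Sum>k\<in>Basis. dird (\<lambda>y. wdensity f y * (Z y \<bullet> k)) z k)
      = (\<Sum>k\<in>Basis. wdensity f z * (dird Z z k \<bullet> k) + dird (wdensity f) z k * (Z z \<bullet> k))"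
  proof (rule sum.cong[OF refl])
    fix k :: "real^'m"
    show "dird (\<lambda>y. wdensity f y * (Z y \<bullet> k)) z k = wdensity f z * (dird Z z k \<bullet> k) + dird (wdensity f) z k * (Z z \<bullet> k)"
      by (subst dird_eqI[OF has_derivative_mult[OF smooth_on_has_derivative[OF smooth_wdensity z]
              has_derivative_inner_left[OF smooth_on_has_derivative[OF smZ z]]]]) simp
  qed
  also have "\<dots> = wdensity f z * (\<Sum>k\<in>Basis. dird Z z k \<bullet> k) + dird (wdensity f) z (\<Sum>k\<in>Basis. (Z z \<bullet> k) *\<^sub>R k)"
    by (simp add: sum.distrib sum_distrib_left w.sum w.scale mult.commute)
  also have "(\<Sum>k\<in>Basis. (Z z \<bullet> k) *\<^sub>R k) = Z z" by (rule euclidean_representation)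
  also have "dird (wdensity f) z (Z z) = wdensity f z *
      ((\<Sum>e\<in>Basis. dird (\<lambda>y. dird f y (pinv f z e)) z (Z z) \<bullet> tproj f z e) - f z \<bullet> W z)"
    by (simp add: dird_wdensity[OF z] WZ[OF z])
  \<comment> \<open>Symmetry of second derivatives exchanges \<open>Z z\<close> with
    \<open>pinv f z e\<close>. The result is the part of the divergence of \<open>W\<close> in which
    the coefficients \<open>Z\<close> are held fixed.\<close>
  also have "(\<Sum>e\<in>Basis. dird (\<lambda>y. dird f y (pinv f z e)) z (Z z) \<bullet> tproj f z e)
      = (\<Sum>e\<in>Basis. dird (\<lambda>y. dird f y (Z z)) z (pinv f z e) \<bullet> e)"
  proof -
    have lin: "linear (dird (\<lambda>y. dird f y (Z z)) z)"
      by (intro linear_frechet_derivative smooth_on_imp_differentiable[OF _ z] smooth_intros smooth_f)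
    have "bilinear (\<lambda>b c. dird (\<lambda>y. dird f y (Z z)) z (pinv f z b) \<bullet> c)"
      by (auto simp: bilinear_def linear_iff inner_add_left inner_add_right P.add P.scale
          linear_add[OF lin] linear_scale[OF lin])
    from trace_tproj[OF z this]
    have "(\<Sum>e\<in>Basis. dird (\<lambda>y. dird f y (Z z)) z (pinv f z e) \<bullet> e)
        = (\<Sum>e\<in>Basis. dird (\<lambda>y. dird f y (Z z)) z (pinv f z e) \<bullet> tproj f z e)"
      by (simp add: pinv_tproj[OF lin_f[OF z] inj_f[OF z]])
    moreover have "dird (\<lambda>y. dird f y (Z z)) z (pinv f z e) = dird (\<lambda>y. dird f y (pinv f z e)) z (Z z)" for e
      by (rule dird_dird_commute[OF open_O z smooth_f])
    ultimately show ?thesis by simp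
  qed
  \<comment> \<open>The trace of \<open>dird Z z\<close> may be taken through the ambient space
    because \<open>pinv f z\<close> is a left inverse of \<open>dird f z\<close>.\<close>
  also have "(\<Sum>k\<in>Basis. dird Z z k \<bullet> k) = (\<Sum>e\<in>Basis. dird f z (dird Z z (pinv f z e)) \<bullet> e)"
  proof -
    have "(\<Sum>e\<in>Basis. dird f z (dird Z z (pinv f z e)) \<bullet> e)
        = (\<Sum>e\<in>Basis. dird f z (\<Sum>k\<in>Basis. (dird Z z (pinv f z e) \<bullet> k) *\<^sub>R k) \<bullet> e)"
      by (simp add: euclidean_representation)
    also have "\<dots> = (\<Sum>k\<in>Basis. \<Sum>e\<in>Basis. (dird Z z (pinv f z e) \<bullet> k) * (dird f z k \<bullet> e))"
      by (simp add: f'.sum f'.scale inner_sum_left) (rule sum.swap)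
    also have "\<dots> = (\<Sum>k\<in>Basis. dird Z z (pinv f z (\<Sum>e\<in>Basis. (dird f z k \<bullet> e) *\<^sub>R e)) \<bullet> k)"
      by (simp add: P.sum P.scale Z'.sum Z'.scale inner_sum_left mult.commute)
    also have "\<dots> = (\<Sum>k\<in>Basis. dird Z z k \<bullet> k)"
      by (simp add: euclidean_representation pinv_dird'[OF z])
    finally show ?thesis ..
  qed
  also have "wdensity f z * (\<Sum>e\<in>Basis. dird f z (dird Z z (pinv f z e)) \<bullet> e) + wdensity f z *
      ((\<Sum>e\<in>Basis. dird (\<lambda>y. dird f y (Z z)) z (pinv f z e) \<bullet> e) - f z \<bullet> W z)
      = wdensity f z * (divergence W z - f z \<bullet> W z)"
  proof -
    have "tder f W z e = dird (\<lambda>y. dird f y (Z z)) z (pinv f z e) + dird f z (dird Z z (pinv f z e))" for e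
    proof -
      have "tder f W z e = tder f (\<lambda>y. dird f y (Z y)) z e"
        by (rule tder_cong[OF open_O z WZ])
      also have "\<dots> = dird (\<lambda>y. dird f y (Z z)) z (pinv f z e) + dird f z (dird Z z (pinv f z e))"
        unfolding tder_def
        by (rule dird_apply[OF open_O z lin_f _ smZ]) (auto intro: smooth_on_dird smooth_f)
      finally show ?thesis .
    qed
    then show ?thesis by (simp add: divergence_def inner_add_left sum.distrib algebra_simps)
  qed
  finally show ?thesis by (simp add: Z_def)
qed

lemma dird_variation:
  assumes "z \<in> \<Omega>" "smooth_on \<eta> \<Omega>"
  shows "dird (\<lambda>y. f y + t *\<^sub>R \<eta> y) z = (\<lambda>v. dird f z v + t *\<^sub>R dird \<eta> z v)"
  by (rule dird_eqI) (intro has_derivative_add has_derivative_scaleR_right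
      smooth_on_has_derivative[OF smooth_f assms(1)] smooth_on_has_derivative[OF assms(2,1)])

text \<open>The sum of norms bounds \<open>dird \<eta> z v\<close> by a multiple of
  \<open>dird f z v\<close>. A vector in the kernel of the varied differential has df v = - t
  d\<eta> v, so smallness of \<open>t\<close> forces df v = 0 and hence v = 0.\<close>

lemma inj_dird_variation:
  assumes z: "z \<in> \<Omega>" and \<eta>: "smooth_on \<eta> \<Omega>"
    and small: "\<bar>t\<bar> * (\<Sum>e\<in>Basis. norm (tder f \<eta> z e)) < 1"
  shows "inj (dird (\<lambda>y. f y + t *\<^sub>R \<eta> y) z)"
proof -
  interpret e: linear "dird \<eta> z"
    by (intro linear_frechet_derivative smooth_on_imp_differentiable[OF \<eta> z])
  interpret f': linear "dird f z" by (rule lin_f[OF z])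
  interpret t: linear "tder f \<eta> z" by (rule linear_tder[OF \<eta> z])
  let ?C = "\<Sum>e\<in>Basis. norm (tder f \<eta> z e)"
  have lin: "linear (dird (\<lambda>y. f y + t *\<^sub>R \<eta> y) z)"
    unfolding dird_variation[OF z \<eta>]
    by (rule linearI) (auto simp: e.add f'.add e.scale f'.scale algebra_simps)
  have bound: "norm (dird \<eta> z v) \<le> ?C * norm (dird f z v)" for v
  proof -
    have "dird \<eta> z v = tder f \<eta> z (\<Sum>e\<in>Basis. (dird f z v \<bullet> e) *\<^sub>R e)"
      unfolding euclidean_representation by (simp add: tder_def pinv_dird'[OF z])
    also have "\<dots> = (\<Sum>e\<in>Basis. (dird f z v \<bullet> e) *\<^sub>R tder f \<eta> z e)" by (simp add: t.sum t.scale)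
    also have "norm \<dots> \<le> (\<Sum>e\<in>Basis. norm (dird f z v) * norm (tder f \<eta> z e))"
      by (rule sum_norm_le) (auto intro!: mult_right_mono Basis_le_norm)
    finally show ?thesis by (simp add: sum_distrib_left mult.commute)
  qed
  show ?thesis
  proof (subst linear_injective_0[OF lin], intro allI impI)
    fix v assume "dird (\<lambda>y. f y + t *\<^sub>R \<eta> y) z v = 0"
    then have "dird f z v = - (t *\<^sub>R dird \<eta> z v)"
      by (simp add: dird_variation[OF z \<eta>] add_eq_0_iff2)
    then have "norm (dird f z v) = \<bar>t\<bar> * norm (dird \<eta> z v)" by simp
    also have "\<dots> \<le> \<bar>t\<bar> * (?C * norm (dird f z v))" by (intro mult_left_mono bound) simp
    finally have "(1 - \<bar>t\<bar> * ?C) * norm (dird f z v) \<le> 0" by (simp add: algebra_simps)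
    then have "norm (dird f z v) \<le> 0" using small by (simp add: mult_le_0_iff)
    then show "v = 0" using linear_injective_0[OF lin_f[OF z]] inj_f[OF z] by simp
  qed
qed

end

section \<open>The second derivative of the weighted density of a shrinker\<close>

context shrinker_chart
begin

text \<open>The density is differentiated as itself times a logarithmic derivative \<theta>. For a
  shrinker and a normal \<eta> the value \<theta> 0 vanishes at every point, so the second
  derivative is the density times the derivative of \<theta>, without the square of a first
  derivative.\<close>

lemma second_derivative_wdensity:
  assumes z: "z \<in> \<Omega>" and \<eta>: "smooth_on \<eta> \<Omega>" and normal: "\<And>y. y \<in> \<Omega> \<Longrightarrow> tproj f y (\<eta> y) = 0"
    and I: "open I" "0 \<in> I" "\<And>t. t \<in> I \<Longrightarrow> inj (dird (\<lambda>y. f y + t *\<^sub>R \<eta> y) z)"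
  obtains \<rho>' where
    "\<And>t. t \<in> I \<Longrightarrow> ((\<lambda>t. wdensity (\<lambda>y. f y + t *\<^sub>R \<eta> y) z) has_real_derivative \<rho>' t) (at t)"
    "(\<rho>' has_real_derivative wdensity f z * ((\<Sum>e\<in>Basis. (norm (tder f \<eta> z e))\<^sup>2
        - 2 * (norm (shape z e (\<eta> z)))\<^sup>2) - (norm (\<eta> z))\<^sup>2)) (at 0)"
proof -
  interpret e: linear "dird \<eta> z"
    by (intro linear_frechet_derivative smooth_on_imp_differentiable[OF \<eta> z])
  interpret f': linear "dird f z" by (rule lin_f[OF z])
  let ?F = "\<lambda>t y. f y + t *\<^sub>R \<eta> y"
  define M where "M t = metric_at (?F t) z" for t
  \<comment> \<open>The metric of a variation linear in \<open>t\<close> is a quadratic polynomial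
    in \<open>t\<close>, with linear coefficient \<open>b\<close> and quadratic coefficient
    \<open>c\<close>.\<close>
  define b where "b u v = dird f z u \<bullet> dird \<eta> z v + dird \<eta> z u \<bullet> dird f z v" for u v
  define c where "c u v = dird \<eta> z u \<bullet> dird \<eta> z v" for u v
  define M' where "M' t i j = b (axis i 1) (axis j 1) + 2 * t * c (axis i 1) (axis j 1)" for t i j
  let ?J = "\<lambda>t. matrix_inv (M t)"
  have bil: "bilinear b" "bilinear c"
    unfolding b_def c_def bilinear_def
    by (auto simp: linear_iff inner_add_left inner_add_right e.add e.scale f'.add f'.scale algebra_simps)
  have M_eq: "M t $ i $ j = metric_at f z $ i $ j + t * b (axis i 1) (axis j 1) + t * t * c (axis i 1) (axis j 1)" for t i j
    by (simp add: M_def metric_at_def dird_variation[OF z \<eta>] b_def c_def inner_add_left inner_add_right algebra_simps)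
  have M0: "M 0 = metric_at f z" by (simp add: M_eq vec_eq_iff)
  have pos: "0 < det (M t)" if "t \<in> I" for t
    unfolding M_def
  proof (rule metric_at_pos)
    show "linear (dird (?F t) z)"
      unfolding dird_variation[OF z \<eta>]
      by (rule linearI) (auto simp: e.add f'.add e.scale f'.scale algebra_simps)
  qed (rule I(3)[OF that])
  have dM: "((\<lambda>t. M t $ i $ j) has_real_derivative M' t i j) (at t)" for i j t
    unfolding M_eq M'_def by (auto intro!: derivative_eq_intros)
  have dM': "((\<lambda>t. M' t i j) has_real_derivative 2 * c (axis i 1) (axis j 1)) (at t)" for i j t
    unfolding M'_def by (auto intro!: derivative_eq_intros)
  define \<tau> where "\<tau> t = (\<Sum>i\<in>UNIV. \<Sum>j\<in>UNIV. ?J t $ i $ j * M' t j i)" for t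
  define \<theta> where "\<theta> t = \<tau> t / 2 - (f z + t *\<^sub>R \<eta> z) \<bullet> \<eta> z" for t
  have wd: "wdensity (?F t) z = sqrt (det (M t)) * exp (- (1/2) * ((f z + t *\<^sub>R \<eta> z) \<bullet> (f z + t *\<^sub>R \<eta> z)))" for t
    by (simp add: wdensity_def M_def power2_norm_eq_inner)
  have first: "((\<lambda>t. wdensity (?F t) z) has_real_derivative wdensity (?F t) z * \<theta> t) (at t)" if t: "t \<in> I" for t
  proof -
    have nz: "det (M t) \<noteq> 0" using pos[OF t] by simp
    have "((\<lambda>t. det (M t)) has_derivative (\<lambda>v. det (M t) * (\<Sum>i\<in>UNIV. \<Sum>j\<in>UNIV. ?J t $ i $ j * (M' t j i * v)))) (at t)"
      by (rule has_derivative_det[where M = M, OF nz]) (use dM in \<open>simp add: has_field_derivative_def\<close>)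
    then have "((\<lambda>t. det (M t)) has_real_derivative det (M t) * \<tau> t) (at t)"
      unfolding has_field_derivative_def \<tau>_def
      by (rule has_derivative_eq_rhs) (simp add: fun_eq_iff sum_distrib_left sum_distrib_right mult.assoc)
    from DERIV_chain2[OF DERIV_real_sqrt[OF pos[OF t]] this]
    have 1: "((\<lambda>t. sqrt (det (M t))) has_real_derivative sqrt (det (M t)) * \<tau> t / 2) (at t)"
    proof (rule DERIV_cong)
      have "inverse (sqrt x) * x = sqrt x" if "x > 0" for x
        using that real_sqrt_mult_self[of x] by (simp add: field_simps)
      from this[OF pos[OF t]] show "inverse (sqrt (det (M t))) / 2 * (det (M t) * \<tau> t) = sqrt (det (M t)) * \<tau> t / 2"
        by (simp add: mult.assoc[symmetric])
    qed
    have 2: "((\<lambda>t. exp (- (1/2) * ((f z + t *\<^sub>R \<eta> z) \<bullet> (f z + t *\<^sub>R \<eta> z)))) has_real_derivative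
        exp (- (1/2) * ((f z + t *\<^sub>R \<eta> z) \<bullet> (f z + t *\<^sub>R \<eta> z))) * (- ((f z + t *\<^sub>R \<eta> z) \<bullet> \<eta> z))) (at t)"
      unfolding inner_add_left inner_add_right inner_scaleR_left inner_scaleR_right
      by (auto intro!: derivative_eq_intros simp: inner_commute algebra_simps)
    show ?thesis
      unfolding wd \<theta>_def by (rule DERIV_cong[OF DERIV_mult[OF 1 2]]) (simp add: algebra_simps)
  qed
  have tr: "(\<Sum>i\<in>UNIV. \<Sum>j\<in>UNIV. ?J 0 $ i $ j * C (axis j 1) (axis i 1)) = (\<Sum>e\<in>Basis. C (pinv f z e) (pinv f z e))"
    if "bilinear C" for C :: "real^'m \<Rightarrow> real^'m \<Rightarrow> real"
  proof -
    have "(\<Sum>i\<in>UNIV. \<Sum>j\<in>UNIV. ?J 0 $ i $ j * C (axis j 1) (axis i 1))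
        = (\<Sum>j\<in>UNIV. \<Sum>i\<in>UNIV. ?J 0 $ j $ i * C (axis j 1) (axis i 1))"
      unfolding M0 by (subst sum.swap) (simp add: metric_inv_sym[OF z])
    then show ?thesis using trace_metric[OF lin_f[OF z] inj_f[OF z] that] by (simp add: M0)
  qed
  \<comment> \<open>Under a normal variation the metric changes to first order by minus twice the
    second fundamental form in the direction \<eta>.\<close>
  have b_eq: "b (pinv f z e) (pinv f z d) = - 2 * (shape z e (\<eta> z) \<bullet> d)" for e d
  proof -
    have "dird f z (pinv f z e) \<bullet> dird \<eta> z (pinv f z d) = - (e \<bullet> shape z d (\<eta> z))" for e d
      using tproj_symm[OF z, of e "tder f \<eta> z d"] tder_normal[OF z \<eta> normal, of d] by (simp add: tder_def)
    then have "b (pinv f z e) (pinv f z d) = - (e \<bullet> shape z d (\<eta> z)) - (shape z e (\<eta> z) \<bullet> d)"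
      by (simp add: b_def inner_commute)
    also have "e \<bullet> shape z d (\<eta> z) = shape z e (\<eta> z) \<bullet> d"
      using normal_shape_commute[OF z normal[OF z], of d e] shape_symm[OF z, of d e "\<eta> z"] shape_symm[OF z, of e "\<eta> z" d]
      by (simp add: inner_commute)
    finally show ?thesis by simp
  qed
  \<comment> \<open>Half the trace of \<open>b\<close> is minus the mean curvature paired with
    \<eta>. The shrinker equation makes it f z \<bullet> \<eta> z, which the Gaussian term
    cancels.\<close>
  have \<theta>0: "\<theta> 0 = 0"
  proof -
    have "\<tau> 0 = (\<Sum>e\<in>Basis. b (pinv f z e) (pinv f z e))"
      using tr[OF bil(1)] by (simp add: \<tau>_def M'_def)
    also have "\<dots> = - 2 * (\<Sum>e\<in>Basis. shape z e e \<bullet> \<eta> z)"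
      unfolding b_eq sum_distrib_left
      by (intro sum.cong refl arg_cong[of _ _ "(*) (- 2)"]) (metis shape_symm[OF z] inner_commute)
    also have "\<dots> = - 2 * (mean z \<bullet> \<eta> z)"
      by (simp add: mean_def inner_sum_left)
    also have "\<dots> = 2 * (f z \<bullet> \<eta> z)"
      using tproj_symm[OF z, of "f z" "\<eta> z"] by (simp add: mean_eq[OF z] inner_diff_left normal[OF z])
    finally show ?thesis by (simp add: \<theta>_def)
  qed
  have dJ: "((\<lambda>t. ?J t $ i $ j) has_real_derivative
      - (\<Sum>k\<in>UNIV. \<Sum>l\<in>UNIV. ?J 0 $ i $ k * M' 0 k l * ?J 0 $ l $ j)) (at 0)" for i j
  proof (rule DERIV_matrix_inv[OF I(1,2) _ _ dM])
    show "smooth_on (\<lambda>s. M s $ i $ j) I" for i j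
      unfolding M_eq by (intro smooth_intros I)
    show "det (M s) \<noteq> 0" if "s \<in> I" for s using pos[OF that] by simp
  qed
  have "(\<tau> has_real_derivative (\<Sum>i\<in>UNIV. \<Sum>j\<in>UNIV.
      - (\<Sum>k\<in>UNIV. \<Sum>l\<in>UNIV. ?J 0 $ i $ k * M' 0 k l * ?J 0 $ l $ j) * M' 0 j i
      + ?J 0 $ i $ j * (2 * c (axis j 1) (axis i 1)))) (at 0)"
    unfolding \<tau>_def
    by (intro DERIV_sum DERIV_cong[OF DERIV_mult[OF dJ dM']]) (simp add: mult.commute)
  moreover have "(\<Sum>i\<in>UNIV. \<Sum>j\<in>UNIV.
      - (\<Sum>k\<in>UNIV. \<Sum>l\<in>UNIV. ?J 0 $ i $ k * M' 0 k l * ?J 0 $ l $ j) * M' 0 j i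
      + ?J 0 $ i $ j * (2 * c (axis j 1) (axis i 1)))
      = 2 * (\<Sum>e\<in>Basis. (norm (tder f \<eta> z e))\<^sup>2 - 2 * (norm (shape z e (\<eta> z)))\<^sup>2)"
  proof -
    let ?b = "\<lambda>i j. b (axis i 1) (axis j 1)"
    \<comment> \<open>The derivative of the inverse metric pairs \<open>b\<close> with itself,
      giving four times the square of the shape operator of \<eta>. Halved in \<theta>, it is the
      source of the coefficient 2 in the quadratic form.\<close>
    have "(\<Sum>i\<in>UNIV. \<Sum>j\<in>UNIV. (\<Sum>k\<in>UNIV. \<Sum>l\<in>UNIV. ?J 0 $ i $ k * ?b k l * ?J 0 $ l $ j) * ?b j i)
        = (\<Sum>e\<in>Basis. \<Sum>d\<in>Basis. b (pinv f z e) (pinv f z d) * b (pinv f z d) (pinv f z e))"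
    proof -
      have bl: "bilinear (\<lambda>u v. b w u * b v w')" for w w'
        using bil(1) by (auto simp: bilinear_def linear_iff algebra_simps)
      have bl2: "bilinear (\<lambda>u v. \<Sum>d\<in>Basis. b v (pinv f z d) * b (pinv f z d) u)"
        using bil(1) by (auto simp: bilinear_def linear_iff algebra_simps sum.distrib sum_distrib_left)
      have "(\<Sum>i\<in>UNIV. \<Sum>j\<in>UNIV. (\<Sum>k\<in>UNIV. \<Sum>l\<in>UNIV. ?J 0 $ i $ k * ?b k l * ?J 0 $ l $ j) * ?b j i)
          = (\<Sum>i\<in>UNIV. \<Sum>j\<in>UNIV. \<Sum>k\<in>UNIV. \<Sum>l\<in>UNIV. ?J 0 $ i $ k * (?J 0 $ l $ j * (?b k l * ?b j i)))"
        by (simp add: sum_distrib_right sum_distrib_left mult_ac)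
      also have "\<dots> = (\<Sum>i\<in>UNIV. \<Sum>k\<in>UNIV. \<Sum>j\<in>UNIV. \<Sum>l\<in>UNIV. ?J 0 $ i $ k * (?J 0 $ l $ j * (?b k l * ?b j i)))"
        by (rule sum.cong[OF refl], rule sum.swap)
      also have "\<dots> = (\<Sum>i\<in>UNIV. \<Sum>k\<in>UNIV. ?J 0 $ i $ k * (\<Sum>l\<in>UNIV. \<Sum>j\<in>UNIV. ?J 0 $ l $ j * (?b k l * ?b j i)))"
        by (simp add: sum_distrib_left) (intro sum.cong refl sum.swap)
      also have "\<dots> = (\<Sum>i\<in>UNIV. \<Sum>k\<in>UNIV. ?J 0 $ i $ k * (\<Sum>d\<in>Basis. b (axis k 1) (pinv f z d) * b (pinv f z d) (axis i 1)))"
        using trace_metric[OF lin_f[OF z] inj_f[OF z] bl] by (simp add: M0)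
      also have "\<dots> = (\<Sum>e\<in>Basis. \<Sum>d\<in>Basis. b (pinv f z e) (pinv f z d) * b (pinv f z d) (pinv f z e))"
        using trace_metric[OF lin_f[OF z] inj_f[OF z] bl2] by (simp add: M0)
      finally show ?thesis .
    qed
    also have "\<dots> = (\<Sum>e\<in>Basis. 4 * (norm (shape z e (\<eta> z)))\<^sup>2)"
    proof (rule sum.cong[OF refl])
      fix e :: 'b
      have "b (pinv f z d) (pinv f z e) = b (pinv f z e) (pinv f z d)" for d
        by (simp add: b_def inner_commute)
      then have "(\<Sum>d\<in>Basis. b (pinv f z e) (pinv f z d) * b (pinv f z d) (pinv f z e))
          = (\<Sum>d\<in>Basis. 4 * ((shape z e (\<eta> z) \<bullet> d) * (shape z e (\<eta> z) \<bullet> d)))"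
        by (simp add: b_eq)
      also have "\<dots> = 4 * (norm (shape z e (\<eta> z)))\<^sup>2"
        unfolding power2_norm_eq_inner by (subst (3) euclidean_inner) (simp add: sum_distrib_left)
      finally show "(\<Sum>d\<in>Basis. b (pinv f z e) (pinv f z d) * b (pinv f z d) (pinv f z e)) = 4 * (norm (shape z e (\<eta> z)))\<^sup>2" .
    qed
    finally have A: "(\<Sum>i\<in>UNIV. \<Sum>j\<in>UNIV. (\<Sum>k\<in>UNIV. \<Sum>l\<in>UNIV. ?J 0 $ i $ k * ?b k l * ?J 0 $ l $ j) * ?b j i)
        = (\<Sum>e\<in>Basis. 4 * (norm (shape z e (\<eta> z)))\<^sup>2)" .
    have B: "(\<Sum>i\<in>UNIV. \<Sum>j\<in>UNIV. ?J 0 $ i $ j * c (axis j 1) (axis i 1)) = (\<Sum>e\<in>Basis. (norm (tder f \<eta> z e))\<^sup>2)"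
      unfolding tr[OF bil(2)] by (simp add: c_def tder_def power2_norm_eq_inner)
    have "(\<Sum>i\<in>UNIV. \<Sum>j\<in>UNIV.
      - (\<Sum>k\<in>UNIV. \<Sum>l\<in>UNIV. ?J 0 $ i $ k * M' 0 k l * ?J 0 $ l $ j) * M' 0 j i
      + ?J 0 $ i $ j * (2 * c (axis j 1) (axis i 1)))
      = - (\<Sum>i\<in>UNIV. \<Sum>j\<in>UNIV. (\<Sum>k\<in>UNIV. \<Sum>l\<in>UNIV. ?J 0 $ i $ k * ?b k l * ?J 0 $ l $ j) * ?b j i)
        + 2 * (\<Sum>i\<in>UNIV. \<Sum>j\<in>UNIV. ?J 0 $ i $ j * c (axis j 1) (axis i 1))"
      by (simp add: M'_def sum.distrib sum_negf sum_subtractf sum_distrib_left mult_ac)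
    then show ?thesis unfolding A B by (simp add: sum_subtractf sum_distrib_left)
  qed
  ultimately have d\<tau>: "(\<tau> has_real_derivative
      2 * (\<Sum>e\<in>Basis. (norm (tder f \<eta> z e))\<^sup>2 - 2 * (norm (shape z e (\<eta> z)))\<^sup>2)) (at 0)" by simp
  have d\<theta>: "(\<theta> has_real_derivative (\<Sum>e\<in>Basis. (norm (tder f \<eta> z e))\<^sup>2
        - 2 * (norm (shape z e (\<eta> z)))\<^sup>2) - (norm (\<eta> z))\<^sup>2) (at 0)"
    unfolding \<theta>_def inner_add_left inner_scaleR_left
    by (auto intro!: derivative_eq_intros d\<tau> simp: power2_norm_eq_inner)
  show thesis
  proof (rule that)
    show "((\<lambda>t. wdensity (?F t) z) has_real_derivative wdensity (?F t) z * \<theta> t) (at t)" if "t \<in> I" for t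
      by (rule first[OF that])
    show "((\<lambda>t. wdensity (?F t) z * \<theta> t) has_real_derivative wdensity f z * ((\<Sum>e\<in>Basis. (norm (tder f \<eta> z e))\<^sup>2
        - 2 * (norm (shape z e (\<eta> z)))\<^sup>2) - (norm (\<eta> z))\<^sup>2)) (at 0)"
      using DERIV_mult[OF first[OF I(2)] d\<theta>] by (simp add: \<theta>0 mult.commute)
  qed
qed

end

section \<open>The volume measure\<close>

lemma dird_compose_eq_on_open:
  assumes "open S" "z \<in> S" "\<And>y. y \<in> S \<Longrightarrow> f y = g (T y)"
    and "T differentiable (at z)" "g differentiable (at (T z))"
  shows "dird f z v = dird g (T z) (dird T z v)"
  using dird_cong[OF assms(1-3)] dird_compose[OF assms(4,5)] by simp

lemma borel_vimage_continuous_on_open: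
  fixes g :: "'x::topological_space \<Rightarrow> 'y::topological_space"
  assumes "open S" "continuous_on S g" "B \<in> sets borel"
  shows "S \<inter> g -` B \<in> sets borel"
proof -
  have "g -` B \<inter> space (restrict_space borel S) \<in> sets (restrict_space borel S)"
    by (rule measurable_sets[OF borel_measurable_continuous_on_restrict[OF assms(2)] assms(3)])
  moreover have "S \<in> sets borel" using assms(1) by simp
  ultimately show ?thesis
    by (auto simp: sets_restrict_space space_restrict_space Int_commute)
qed

lemma borel_measurable_if_continuous_on_open:
  fixes g :: "'x::topological_space \<Rightarrow> 'y::topological_space"
  assumes "open S" "continuous_on S g"
  shows "(\<lambda>x. if x \<in> S then g x else c) \<in> borel_measurable borel"
  by (rule measurable_If_restrict_space_iff[THEN iffD2])
    (use assms in \<open>auto intro: borel_measurable_continuous_on_restrict\<close>)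

locale atlas =
  fixes A :: "('a::{t2_space, second_countable_topology}, 'm::finite) chart set"
  assumes smooth_atlas: "smooth_atlas A"
begin

lemma covers:
  obtains U \<phi> where "(U, \<phi>) \<in> A" "q \<in> U"
proof -
  have "q \<in> (\<Union>(U, \<phi>)\<in>A. U)" using smooth_atlas by (simp add: smooth_atlas_def)
  then show thesis using that by blast
qed

context
  fixes U \<phi> assumes chart: "(U, \<phi>) \<in> A"
begin

lemma open_U: "open U" and open_image: "open (\<phi> ` U)"
  and homeo: "homeomorphism U (\<phi> ` U) \<phi> (inv_into U \<phi>)"
  using smooth_atlas chart by (auto simp: smooth_atlas_def)

lemma cont_chart: "continuous_on U \<phi>" and cont_inv: "continuous_on (\<phi> ` U) (inv_into U \<phi>)"
  and inv_chart: "q \<in> U \<Longrightarrow> inv_into U \<phi> (\<phi> q) = q"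
  and chart_inv: "z \<in> \<phi> ` U \<Longrightarrow> \<phi> (inv_into U \<phi> z) = z"
  and inv_in: "z \<in> \<phi> ` U \<Longrightarrow> inv_into U \<phi> z \<in> U"
  using homeo by (auto simp: homeomorphism_def inv_into_into)

lemma inj_chart: "inj_on \<phi> U"
  by (metis inj_onI inv_chart)

lemma image_chart_eq: "B \<subseteq> U \<Longrightarrow> \<phi> ` B = \<phi> ` U \<inter> inv_into U \<phi> -` B"
  using inv_chart by auto

lemma open_image_chart: "open G \<Longrightarrow> G \<subseteq> U \<Longrightarrow> open (\<phi> ` G)"
  by (subst image_chart_eq, assumption) (rule continuous_open_preimage[OF cont_inv open_image])

lemma borel_image_chart: "B \<in> sets borel \<Longrightarrow> B \<subseteq> U \<Longrightarrow> \<phi> ` B \<in> sets borel"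
  by (subst image_chart_eq, assumption) (rule borel_vimage_continuous_on_open[OF open_image cont_inv])

lemma immersed_chart_loc:
  assumes "immersion A y"
  shows "immersed_chart (loc U \<phi> y) (\<phi> ` U)"
  using assms chart open_image by (auto simp: immersion_def smooth_map_def immersed_chart_def)

lemma smooth_on_loc: "smooth_map A W \<Longrightarrow> smooth_on (loc U \<phi> W) (\<phi> ` U)"
  using chart by (auto simp: smooth_map_def)

lemma loc_eq: "q \<in> U \<Longrightarrow> loc U \<phi> W (\<phi> q) = W q"
  by (simp add: inv_chart)

end

lemma smooth_transition:
  assumes "(U, \<phi>) \<in> A" "(V, \<psi>) \<in> A"
  shows "smooth_on (\<psi> \<circ> inv_into U \<phi>) (\<phi> ` (U \<inter> V))"
  using smooth_atlas assms by (auto simp: smooth_atlas_def)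

section \<open>Two charts at a common point\<close>

context
  fixes U \<phi> V \<psi> and q :: 'a
  assumes charts: "(U, \<phi>) \<in> A" "(V, \<psi>) \<in> A" and q: "q \<in> U" "q \<in> V"
begin

lemma transition_eq: "(\<psi> \<circ> inv_into U \<phi>) (\<phi> q) = \<psi> q"
  by (simp add: inv_chart[OF charts(1) q(1)])

lemma dird_transition:
  assumes "smooth_map A W"
  shows "dird (loc U \<phi> W) (\<phi> q) v = dird (loc V \<psi> W) (\<psi> q) (dird (\<psi> \<circ> inv_into U \<phi>) (\<phi> q) v)"
proof -
  have "dird (loc U \<phi> W) (\<phi> q) v = dird (loc V \<psi> W) ((\<psi> \<circ> inv_into U \<phi>) (\<phi> q)) (dird (\<psi> \<circ> inv_into U \<phi>) (\<phi> q) v)"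
  proof (rule dird_compose_eq_on_open)
    show "open (\<phi> ` (U \<inter> V))"
      using open_U charts by (intro open_image_chart[OF charts(1)]) auto
    show "\<phi> q \<in> \<phi> ` (U \<inter> V)" using q by blast
    show "loc U \<phi> W z = loc V \<psi> W ((\<psi> \<circ> inv_into U \<phi>) z)" if "z \<in> \<phi> ` (U \<inter> V)" for z
      using that inv_chart[OF charts(1)] inv_chart[OF charts(2)] by auto
    show "(\<psi> \<circ> inv_into U \<phi>) differentiable (at (\<phi> q))"
      by (rule smooth_on_imp_differentiable[OF smooth_transition[OF charts]]) (use q in blast)
    show "loc V \<psi> W differentiable (at ((\<psi> \<circ> inv_into U \<phi>) (\<phi> q)))"
      unfolding transition_eq using smooth_on_loc[OF charts(2) assms] q
      by (auto intro: smooth_on_imp_differentiable)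
  qed
  then show ?thesis unfolding transition_eq .
qed

context
  fixes y :: "'a \<Rightarrow> 'b::euclidean_space"
  assumes imm: "immersion A y"
begin

lemma linear_inj_charts:
  "linear (dird (loc U \<phi> y) (\<phi> q))" "inj (dird (loc U \<phi> y) (\<phi> q))"
  "linear (dird (loc V \<psi> y) (\<psi> q))" "inj (dird (loc V \<psi> y) (\<psi> q))"
  using immersed_chart.lin_f[OF immersed_chart_loc[OF charts(1) imm]] immersed_chart.lin_f[OF immersed_chart_loc[OF charts(2) imm]]
    immersed_chart.inj_f[OF immersed_chart_loc[OF charts(1) imm]] immersed_chart.inj_f[OF immersed_chart_loc[OF charts(2) imm]] q
  by blast+

lemma dird_y: "dird (loc U \<phi> y) (\<phi> q) v = dird (loc V \<psi> y) (\<psi> q) (dird (\<psi> \<circ> inv_into U \<phi>) (\<phi> q) v)"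
  using imm by (intro dird_transition) (simp add: immersion_def)

lemma linear_transition: "linear (dird (\<psi> \<circ> inv_into U \<phi>) (\<phi> q))"
  by (intro linear_frechet_derivative smooth_on_imp_differentiable[OF smooth_transition[OF charts]])
    (use q in blast)

lemma bij_transition: "bij (dird (\<psi> \<circ> inv_into U \<phi>) (\<phi> q))"
proof -
  have "inj (dird (\<psi> \<circ> inv_into U \<phi>) (\<phi> q))"
    using linear_inj_charts(2) dird_y by (metis (no_types, lifting) inj_def)
  then show ?thesis
    using linear_injective_imp_surjective[OF linear_transition] by (simp add: bij_def)
qed

lemma tangent_at_transition: "tangent_at (loc U \<phi> y) (\<phi> q) = tangent_at (loc V \<psi> y) (\<psi> q)"
proof -
  have "range (dird (loc U \<phi> y) (\<phi> q)) = dird (loc V \<psi> y) (\<psi> q) ` range (dird (\<psi> \<circ> inv_into U \<phi>) (\<phi> q))"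
    using dird_y by auto
  then show ?thesis using bij_transition by (simp add: tangent_at_def bij_def)
qed

text \<open>The tangential projection depends only on the tangent space, which both charts share.
  The injective differential of the second chart then identifies the coefficient vectors.\<close>

lemma pinv_transition:
  "pinv (loc V \<psi> y) (\<psi> q) b = dird (\<psi> \<circ> inv_into U \<phi>) (\<phi> q) (pinv (loc U \<phi> y) (\<phi> q) b)"
proof -
  have np: "normal_part (loc U \<phi> y) (\<phi> q) b = normal_part (loc V \<psi> y) (\<psi> q) b"
    by (simp add: normal_part_def tangent_at_transition)
  have "tproj (loc U \<phi> y) (\<phi> q) b = tproj (loc V \<psi> y) (\<psi> q) b"
    using np unfolding normal_part_eq[OF linear_inj_charts(1,2)] normal_part_eq[OF linear_inj_charts(3,4)] by simp
  then have "dird (loc V \<psi> y) (\<psi> q) (pinv (loc V \<psi> y) (\<psi> q) b)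
      = dird (loc V \<psi> y) (\<psi> q) (dird (\<psi> \<circ> inv_into U \<phi>) (\<phi> q) (pinv (loc U \<phi> y) (\<phi> q) b))"
    unfolding tder_def by (simp add: dird_y)
  then show ?thesis using linear_inj_charts(4) by (simp add: inj_eq)
qed

lemma tder_transition:
  assumes "smooth_map A W"
  shows "tder (loc U \<phi> y) (loc U \<phi> W) (\<phi> q) b = tder (loc V \<psi> y) (loc V \<psi> W) (\<psi> q) b"
  by (simp add: tder_def pinv_transition dird_transition[OF assms])

text \<open>The metric changes by congruence with the Jacobian matrix of the transition map, so its
  determinant is multiplied by the square of the Jacobian determinant.\<close>

lemma det_metric_transition:
  "sqrt (det (metric_at (loc U \<phi> y) (\<phi> q)))
    = \<bar>det (matrix (dird (\<psi> \<circ> inv_into U \<phi>) (\<phi> q)))\<bar> * sqrt (det (metric_at (loc V \<psi> y) (\<psi> q)))"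
proof -
  let ?T = "dird (\<psi> \<circ> inv_into U \<phi>) (\<phi> q)"
  let ?G = "metric_at (loc V \<psi> y) (\<psi> q)"
  have "metric_at (loc U \<phi> y) (\<phi> q) $ i $ j = (transpose (matrix ?T) ** ?G ** matrix ?T) $ i $ j" for i j
  proof -
    have "metric_at (loc U \<phi> y) (\<phi> q) $ i $ j
        = dird (loc U \<phi> y) (\<phi> q) (axis i 1) \<bullet> dird (loc U \<phi> y) (\<phi> q) (axis j 1)"
      by (simp add: metric_at_def)
    also have "\<dots> = ?T (axis i 1) \<bullet> (?G *v ?T (axis j 1))"
      unfolding metric_at_inner[OF linear_inj_charts(3,4)] dird_y ..
    also have "\<dots> = (matrix ?T *v axis i 1) \<bullet> ((?G ** matrix ?T) *v axis j 1)"
      by (simp add: fun_cong[OF matrix_vector_mul(2)[OF linear_transition]] flip: matrix_vector_mul_assoc)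
    also have "\<dots> = axis i 1 \<bullet> ((transpose (matrix ?T) ** (?G ** matrix ?T)) *v axis j 1)"
      using adjoint_works[OF matrix_vector_mul_linear[of "matrix ?T"], of "axis i 1" "(?G ** matrix ?T) *v axis j 1"]
      unfolding adjoint_matrix matrix_vector_mul_assoc by (rule sym)
    also have "\<dots> = (transpose (matrix ?T) ** ?G ** matrix ?T) $ i $ j"
      by (simp add: matrix_vector_mult_basis column_def inner_axis' matrix_mul_assoc)
    finally show ?thesis .
  qed
  then have "metric_at (loc U \<phi> y) (\<phi> q) = transpose (matrix ?T) ** ?G ** matrix ?T"
    by (simp add: vec_eq_iff)
  then have "det (metric_at (loc U \<phi> y) (\<phi> q)) = (det (matrix ?T))\<^sup>2 * det ?G"
    by (simp add: det_mul power2_eq_square)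
  then show ?thesis by (simp add: real_sqrt_mult)
qed

end
end

text \<open>The inverse chart has to be made total for \<open>distr\<close>. Its arbitrary value
  outside the coordinate image carries no mass, since the density vanishes there.\<close>

definition chart_measure :: "'a set \<Rightarrow> ('a \<Rightarrow> real^'m) \<Rightarrow> ('a \<Rightarrow> 'b::euclidean_space) \<Rightarrow> 'a measure" where
  "chart_measure U \<phi> y = distr
     (density lborel (\<lambda>z. ennreal (indicator (\<phi> ` U) z * sqrt (det (metric_at (loc U \<phi> y) z))))) borel
     (\<lambda>z. if z \<in> \<phi> ` U then inv_into U \<phi> z else undefined)"

lemma sets_chart_measure [simp]: "sets (chart_measure U \<phi> y) = sets borel"
  by (simp add: chart_measure_def)

context
  fixes y :: "'a \<Rightarrow> 'b::euclidean_space"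
  assumes imm: "immersion A y"
begin

lemma chart_density_measurable:
  assumes "(U, \<phi>) \<in> A"
  shows "(\<lambda>z. indicator (\<phi> ` U) z * sqrt (det (metric_at (loc U \<phi> y) z))) \<in> borel_measurable borel"
proof -
  interpret immersed_chart "loc U \<phi> y" "\<phi> ` U" by (rule immersed_chart_loc[OF assms imm])
  have "continuous_on (\<phi> ` U) (\<lambda>z. sqrt (det (metric_at (loc U \<phi> y) z)))"
    by (intro smooth_on_imp_continuous_on smooth_intros open_O smooth_metric metric_pos)
  then show ?thesis
    using borel_measurable_continuous_on_indicator[of "\<phi> ` U" "\<lambda>z. sqrt (det (metric_at (loc U \<phi> y) z))"] open_O
    unfolding real_scaleR_def by simp
qed

lemma inv_measurable:
  assumes "(U, \<phi>) \<in> A"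
  shows "(\<lambda>z. if z \<in> \<phi> ` U then inv_into U \<phi> z else c) \<in> borel_measurable borel"
  by (intro borel_measurable_if_continuous_on_open open_image cont_inv assms)

lemma nn_integral_chart_measure:
  assumes ch: "(U, \<phi>) \<in> A" and [measurable]: "h \<in> borel_measurable borel"
  shows "(\<integral>\<^sup>+q. h q \<partial>chart_measure U \<phi> y)
    = (\<integral>\<^sup>+z. ennreal (indicator (\<phi> ` U) z * sqrt (det (metric_at (loc U \<phi> y) z))) * h (inv_into U \<phi> z) \<partial>lborel)"
proof -
  note [measurable] = chart_density_measurable[OF ch] inv_measurable[OF ch, of undefined]
  have "(\<integral>\<^sup>+q. h q \<partial>chart_measure U \<phi> y)
    = (\<integral>\<^sup>+z. ennreal (indicator (\<phi> ` U) z * sqrt (det (metric_at (loc U \<phi> y) z))) * h (if z \<in> \<phi> ` U then inv_into U \<phi> z else undefined) \<partial>lborel)"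
    unfolding chart_measure_def by (subst nn_integral_distr, measurable, subst nn_integral_density, measurable)
  then show ?thesis by (auto intro!: nn_integral_cong simp: indicator_def)
qed

lemma emeasure_chart_measure:
  assumes ch: "(U, \<phi>) \<in> A" and B: "B \<in> sets borel"
  shows "emeasure (chart_measure U \<phi> y) B
    = (\<integral>\<^sup>+z\<in>\<phi> ` (B \<inter> U). ennreal (sqrt (det (metric_at (loc U \<phi> y) z))) \<partial>lborel)"
proof -
  have "emeasure (chart_measure U \<phi> y) B = (\<integral>\<^sup>+q. indicator B q \<partial>chart_measure U \<phi> y)"
    using B by simp
  also have "\<dots> = (\<integral>\<^sup>+z. ennreal (indicator (\<phi> ` U) z * sqrt (det (metric_at (loc U \<phi> y) z))) * indicator B (inv_into U \<phi> z) \<partial>lborel)"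
    by (rule nn_integral_chart_measure[OF ch]) (use B in simp)
  also have "\<dots> = (\<integral>\<^sup>+z\<in>\<phi> ` (B \<inter> U). ennreal (sqrt (det (metric_at (loc U \<phi> y) z))) \<partial>lborel)"
    by (rule nn_integral_cong) (auto simp: indicator_def inv_chart[OF ch])
  finally show ?thesis .
qed

text \<open>The change of variables for the transition map turns one coordinate integral into the
  other, and its Jacobian is exactly the ratio of the two volume densities.\<close>

lemma chart_measure_transition:
  assumes ch: "(U, \<phi>) \<in> A" "(V, \<psi>) \<in> A" and B: "B \<in> sets borel" "B \<subseteq> U" "B \<subseteq> V"
  shows "emeasure (chart_measure U \<phi> y) B = emeasure (chart_measure V \<psi> y) B"
proof -
  define T where "T = \<psi> \<circ> inv_into U \<phi>"
  define W where "W = \<phi> ` (U \<inter> V)"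
  have W: "open W" unfolding W_def using open_U ch by (intro open_image_chart[OF ch(1)]) auto
  have smT: "smooth_on T W" unfolding T_def W_def by (rule smooth_transition[OF ch])
  have T_chart: "T (\<phi> q) = \<psi> q" if "q \<in> U" for q by (simp add: T_def inv_chart[OF ch(1) that])
  have injT: "inj_on T W"
    using inj_chart[OF ch(2)] by (auto simp: W_def T_chart inj_on_def)
  have TW: "T ` W = \<psi> ` (U \<inter> V)" by (auto simp: W_def T_chart image_iff)
  define J where "J z = \<bar>det (matrix (dird T z))\<bar>" for z
  have "continuous_on W J"
    unfolding J_def det_def matrix_def
    using smooth_on_imp_continuous_on[OF smooth_on_dird[OF smT]]
    by (auto intro!: continuous_intros)
  then have mJ [measurable]: "(\<lambda>z. indicator W z * J z) \<in> borel_measurable borel"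
    using borel_measurable_continuous_on_indicator[of W J] W by simp
  define T' where "T' z = (if z \<in> W then T z else 0)" for z
  have mT [measurable]: "T' \<in> borel_measurable borel"
    unfolding T'_def by (rule borel_measurable_if_continuous_on_open[OF W smooth_on_imp_continuous_on[OF smT]])
  have mI: "T ` W \<in> sets borel"
    unfolding TW using open_U ch by (intro borel_image_chart[OF ch(2)]) (auto intro: borel_open)
  have mW [measurable]: "W \<in> sets borel" using W by simp
  \<comment> \<open>The change of variables formula is about measures of images. Stated for all
    Borel sets as an equality of measures, it can be integrated against the nonconstant density of
    the second chart.\<close>
  have eq: "distr (density lborel (\<lambda>z. ennreal (indicator W z * J z))) borel T'
      = density lborel (indicator (T ` W))" (is "?M = ?N")
  proof (rule measure_eqI)
    fix E :: "(real^'m) set" assume "E \<in> sets ?M"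
    then have E [measurable]: "E \<in> sets borel" by simp
    let ?S = "W \<inter> T' -` E"
    have S [measurable]: "?S \<in> sets borel"
      using measurable_sets[OF mT E] by auto
    have TS: "T ` ?S = T ` W \<inter> E" by (auto simp: T'_def)
    have "emeasure ?M E = (\<integral>\<^sup>+z. ennreal (indicator W z * J z) * indicator (T' -` E) z \<partial>lborel)"
      using measurable_sets[OF mT E] by (simp add: emeasure_distr emeasure_density)
    also have "\<dots> = (\<integral>\<^sup>+z. ennreal (indicator ?S z * J z) \<partial>lborel)"
      by (rule nn_integral_cong) (auto simp: indicator_def)
    also have "\<dots> = emeasure lborel (T ` ?S)"
      unfolding J_def
    proof (rule emeasure_image_det[symmetric])
      show "(T has_derivative dird T z) (at z within ?S)" if "z \<in> ?S" for z
        using smooth_on_has_derivative[OF smT] that has_derivative_at_withinI by blast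
      show "inj_on T ?S" using injT by (rule inj_on_subset) auto
      show "T ` ?S \<in> sets borel" unfolding TS using mI E by simp
      have "(\<lambda>z. indicator ?S z * (indicator W z * J z)) \<in> borel_measurable borel" by measurable
      moreover have "indicator ?S z * (indicator W z * J z) = indicator ?S z * J z" for z :: "real^'m"
        by (simp add: indicator_def)
      ultimately show "(\<lambda>z. indicator ?S z * \<bar>det (matrix (dird T z))\<bar>) \<in> borel_measurable borel"
        unfolding J_def[symmetric] by (simp only:)
    qed (rule S)
    also have "\<dots> = emeasure ?N E"
      unfolding TS using mI E by (simp add: emeasure_density nn_integral_indicator flip: indicator_inter_arith)
    finally show "emeasure ?M E = emeasure ?N E" .
  qed simp
  let ?dU = "\<lambda>z. sqrt (det (metric_at (loc U \<phi> y) z))"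
  let ?dV = "\<lambda>z. sqrt (det (metric_at (loc V \<psi> y) z))"
  define h where "h z = ennreal (indicator (\<psi> ` V) z * ?dV z) * indicator (\<psi> ` B) z" for z
  have [measurable]: "\<psi> ` B \<in> sets borel" "\<phi> ` B \<in> sets borel"
    using B ch by (auto intro: borel_image_chart)
  note [measurable] = chart_density_measurable[OF ch(2)]
  have mh [measurable]: "h \<in> borel_measurable borel" unfolding h_def by measurable
  have "emeasure (chart_measure V \<psi> y) B = (\<integral>\<^sup>+z\<in>\<psi> ` B. ennreal (?dV z) \<partial>lborel)"
    using B by (simp add: emeasure_chart_measure[OF ch(2)] Int_absorb2)
  also have "\<dots> = (\<integral>\<^sup>+z. indicator (T ` W) z * h z \<partial>lborel)"
    unfolding TW h_def using B by (intro nn_integral_cong) (auto simp: indicator_def)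
  also have "\<dots> = (\<integral>\<^sup>+z. h z \<partial>?N)"
    using mI by (subst nn_integral_density) auto
  also have "\<dots> = (\<integral>\<^sup>+z. h z \<partial>?M)" unfolding eq ..
  also have "\<dots> = (\<integral>\<^sup>+z. ennreal (indicator W z * J z) * h (T' z) \<partial>lborel)"
    by (subst nn_integral_distr, measurable, subst nn_integral_density) auto
  also have "\<dots> = (\<integral>\<^sup>+z\<in>\<phi> ` B. ennreal (?dU z) \<partial>lborel)"
  proof (rule nn_integral_cong)
    fix z
    show "ennreal (indicator W z * J z) * h (T' z) = ennreal (?dU z) * indicator (\<phi> ` B) z"
    proof (cases "z \<in> W")
      case True
      then obtain q where q: "q \<in> U" "q \<in> V" "z = \<phi> q" by (auto simp: W_def)
      have iB: "\<psi> q \<in> \<psi> ` B \<longleftrightarrow> q \<in> B" "\<phi> q \<in> \<phi> ` B \<longleftrightarrow> q \<in> B"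
        using inj_on_image_mem_iff[OF inj_chart[OF ch(2)]] inj_on_image_mem_iff[OF inj_chart[OF ch(1)]] q B by auto
      have dU: "?dU (\<phi> q) = J (\<phi> q) * ?dV (\<psi> q)"
        using det_metric_transition[OF ch q(1,2) imm] by (simp add: J_def T_def)
      have "ennreal (indicator W z * J z) * h (T' z) = ennreal (J (\<phi> q)) * (ennreal (?dV (\<psi> q)) * indicator (\<psi> ` B) (\<psi> q))"
        using True q by (simp add: h_def T'_def T_chart)
      also have "\<dots> = ennreal (?dU (\<phi> q)) * indicator (\<phi> ` B) (\<phi> q)"
        unfolding dU by (simp add: indicator_def iB ennreal_mult' J_def mult.assoc)
      finally show ?thesis using q by simp
    next
      case False
      then show ?thesis using B by (auto simp: W_def indicator_def)
    qed
  qed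
  also have "\<dots> = emeasure (chart_measure U \<phi> y) B"
    using B by (simp add: emeasure_chart_measure[OF ch(1)] Int_absorb2)
  finally show ?thesis ..
qed

end

text \<open>Second countability gives countably many charts by the Lindelof property. Making their
  domains disjoint sacrifices openness but keeps them Borel, as needed for gluing measures.\<close>

lemma countable_chart_partition:
  obtains Us :: "nat \<Rightarrow> 'a set" and \<phi>s :: "nat \<Rightarrow> 'a \<Rightarrow> real^'m" and D :: "nat \<Rightarrow> 'a set"
  where "\<And>n. (Us n, \<phi>s n) \<in> A" "\<And>n. D n \<in> sets borel" "\<And>n. D n \<subseteq> Us n"
    "disjoint_family D" "(\<Union>n. D n) = UNIV"
proof -
  have op: "\<And>S. S \<in> fst ` A \<Longrightarrow> open S"
    using open_U by fastforce
  obtain F where F: "F \<subseteq> fst ` A" "countable F" "\<Union>F = \<Union>(fst ` A)"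
    using Lindelof[OF op] by metis
  have "\<Union>(fst ` A) = UNIV"
  proof -
    have "q \<in> \<Union>(fst ` A)" for q by (rule covers[of q]) force
    then show ?thesis by blast
  qed
  with F have cov: "\<Union>F = UNIV" by simp
  then have "F \<noteq> {}" by auto
  define Us where "Us = from_nat_into F"
  have Us: "Us n \<in> F" "range Us = F" for n
    using \<open>F \<noteq> {}\<close> F(2) by (auto simp: Us_def from_nat_into range_from_nat_into)
  have "\<forall>n. \<exists>\<phi>. (Us n, \<phi>) \<in> A"
  proof
    fix n
    have "Us n \<in> fst ` A" using Us(1) F(1) by blast
    then obtain c where "c \<in> A" "Us n = fst c" by blast
    then show "\<exists>\<phi>. (Us n, \<phi>) \<in> A" by (cases c) auto
  qed
  then obtain \<phi>s where \<phi>s: "\<And>n. (Us n, \<phi>s n) \<in> A" using choice[of "\<lambda>n \<phi>. (Us n, \<phi>) \<in> A"] by blast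
  show thesis
  proof (rule that[OF \<phi>s])
    show "disjointed Us n \<in> sets borel" for n
    proof -
      have "range Us \<subseteq> sets borel" using open_U[OF \<phi>s] by auto
      from sets.range_disjointed_sets[OF this] show ?thesis by auto
    qed
    show "disjointed Us n \<subseteq> Us n" for n by (rule disjointed_subset)
    show "disjoint_family (disjointed Us)" by (rule disjoint_family_disjointed)
    show "(\<Union>n. disjointed Us n) = UNIV" using cov Us(2) by (simp add: UN_disjointed_eq)
  qed
qed

text \<open>The property under the definite description in \<open>vol\<close>, named so that
  existence and uniqueness can be stated.\<close>

definition is_vol :: "('a \<Rightarrow> 'b::euclidean_space) \<Rightarrow> 'a measure \<Rightarrow> bool" where
  "is_vol y \<mu> \<longleftrightarrow> sets \<mu> = sets borel \<and> (\<forall>(U, \<phi>)\<in>A. \<forall>B\<in>sets borel. B \<subseteq> U \<longrightarrow>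
        emeasure \<mu> B = (\<integral>\<^sup>+z\<in>\<phi> ` B. ennreal (sqrt (det (metric_at (loc U \<phi> y) z))) \<partial>lborel))"

lemma is_volD:
  "is_vol y \<mu> \<Longrightarrow> (U, \<phi>) \<in> A \<Longrightarrow> B \<in> sets borel \<Longrightarrow> B \<subseteq> U \<Longrightarrow>
    emeasure \<mu> B = (\<integral>\<^sup>+z\<in>\<phi> ` B. ennreal (sqrt (det (metric_at (loc U \<phi> y) z))) \<partial>lborel)"
  by (auto simp: is_vol_def)

lemma emeasure_partition:
  fixes D :: "nat \<Rightarrow> 'a set"
  assumes "sets \<mu> = sets borel" "B \<in> sets borel" "\<And>n. D n \<in> sets borel" "disjoint_family D" "(\<Union>n. D n) = UNIV"
  shows "emeasure \<mu> B = (\<Sum>n. emeasure \<mu> (B \<inter> D n))"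
proof -
  have "(\<Sum>n. emeasure \<mu> (B \<inter> D n)) = emeasure \<mu> (\<Union>n. B \<inter> D n)"
  proof (rule suminf_emeasure)
    show "range (\<lambda>n. B \<inter> D n) \<subseteq> sets \<mu>" using assms by auto
    show "disjoint_family (\<lambda>n. B \<inter> D n)" using assms(4) by (auto simp: disjoint_family_on_def)
  qed
  also have "(\<Union>n. B \<inter> D n) = B" using assms(5) by auto
  finally show ?thesis ..
qed

text \<open>The metric involves one derivative, so immersions that agree on an open set have the
  same metric there, and the partition adds up the pieces. For a single immersion this is uniqueness
  of the volume; for a variation it isolates the part outside the support.\<close>

lemma is_vol_agree:
  assumes "is_vol y \<mu>" "is_vol y' \<nu>" "open G" "\<And>q. q \<in> G \<Longrightarrow> y q = y' q" "B \<in> sets borel" "B \<subseteq> G"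
  shows "emeasure \<mu> B = emeasure \<nu> B"
proof -
  obtain Us :: "nat \<Rightarrow> 'a set" and \<phi>s :: "nat \<Rightarrow> 'a \<Rightarrow> real^'m" and D where D: "\<And>n. (Us n, \<phi>s n) \<in> A" "\<And>n. D n \<in> sets borel" "\<And>n. D n \<subseteq> Us n"
    "disjoint_family D" "(\<Union>n. D n) = UNIV"
    by (rule countable_chart_partition) (rule that)
  have "emeasure \<mu> (B \<inter> D n) = emeasure \<nu> (B \<inter> D n)" for n
  proof -
    note ch = D(1)[of n]
    have BD: "B \<inter> D n \<in> sets borel" "B \<inter> D n \<subseteq> Us n" using D(2,3)[of n] assms(5) by auto
    have "metric_at (loc (Us n) (\<phi>s n) y) z = metric_at (loc (Us n) (\<phi>s n) y') z" if "z \<in> \<phi>s n ` (B \<inter> D n)" for z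
    proof -
      have "dird (loc (Us n) (\<phi>s n) y) z = dird (loc (Us n) (\<phi>s n) y') z"
      proof (rule dird_cong)
        show "open (\<phi>s n ` (Us n \<inter> G))"
          using open_U[OF ch] assms(3) by (intro open_image_chart[OF ch]) auto
        show "z \<in> \<phi>s n ` (Us n \<inter> G)" using that BD(2) assms(6) by auto
        show "loc (Us n) (\<phi>s n) y u = loc (Us n) (\<phi>s n) y' u" if "u \<in> \<phi>s n ` (Us n \<inter> G)" for u
          using that assms(4) inv_chart[OF ch] by auto
      qed
      then show ?thesis by (simp add: metric_at_def)
    qed
    then show ?thesis
      unfolding is_volD[OF assms(1) ch BD] is_volD[OF assms(2) ch BD]
      by (intro nn_integral_cong) (auto simp: indicator_def)
  qed
  then show ?thesis
    using emeasure_partition[of \<mu> B D] emeasure_partition[of \<nu> B D] assms D by (simp add: is_vol_def)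
qed

lemma is_vol_unique:
  assumes "is_vol y \<mu>" "is_vol y \<nu>"
  shows "\<mu> = \<nu>"
proof (rule measure_eqI)
  show "sets \<mu> = sets \<nu>" using assms by (simp add: is_vol_def)
  show "emeasure \<mu> B = emeasure \<nu> B" if "B \<in> sets \<mu>" for B
    using is_vol_agree[OF assms open_UNIV] that assms by (simp add: is_vol_def)
qed

context
  fixes y :: "'a \<Rightarrow> 'b::euclidean_space"
  assumes imm: "immersion A y"
begin

text \<open>Each piece of a countable partition is measured in its own chart. By
  \<open>chart_measure_transition\<close> any other chart gives the same value, which yields the
  defining formula in every chart of the atlas.\<close>

lemma is_vol_exists: "\<exists>\<mu>. is_vol y \<mu>"
proof -
  obtain Us :: "nat \<Rightarrow> 'a set" and \<phi>s :: "nat \<Rightarrow> 'a \<Rightarrow> real^'m" and D where D: "\<And>n. (Us n, \<phi>s n) \<in> A" "\<And>n. D n \<in> sets borel" "\<And>n. D n \<subseteq> Us n"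
    "disjoint_family D" "(\<Union>n. D n) = UNIV"
    by (rule countable_chart_partition) (rule that)
  define m where "m n = chart_measure (Us n) (\<phi>s n) y" for n
  define \<mu>0 where "\<mu>0 B = (\<Sum>n. emeasure (m n) (B \<inter> D n))" for B
  define \<mu> where "\<mu> = measure_of UNIV (sets borel) \<mu>0"
  have [simp]: "sets (m n) = sets borel" for n by (simp add: m_def)
  have em: "emeasure \<mu> B = \<mu>0 B" if "B \<in> sets borel" for B
    unfolding \<mu>_def
  proof (rule emeasure_measure_of_sigma[OF _ _ _ that])
    show "sigma_algebra UNIV (sets (borel :: 'a measure))"
      using sets.sigma_algebra_axioms[of "borel :: 'a measure"] by simp
    show "positive (sets borel) \<mu>0" by (simp add: positive_def \<mu>0_def)
    show "countably_additive (sets borel) \<mu>0"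
    proof (rule countably_additiveI)
      fix B :: "nat \<Rightarrow> 'a set" assume B: "range B \<subseteq> sets borel" "disjoint_family B"
      have "(\<Sum>i. \<mu>0 (B i)) = (\<integral>\<^sup>+i. (\<Sum>n. emeasure (m n) (B i \<inter> D n)) \<partial>count_space UNIV)"
        by (simp add: \<mu>0_def nn_integral_count_space_nat)
      also have "\<dots> = (\<Sum>n. \<integral>\<^sup>+i. emeasure (m n) (B i \<inter> D n) \<partial>count_space UNIV)"
        by (rule nn_integral_suminf) simp
      also have "\<dots> = (\<Sum>n. emeasure (m n) ((\<Union>i. B i) \<inter> D n))"
      proof (rule arg_cong[of _ _ suminf], rule ext)
        fix n
        have "(\<Sum>i. emeasure (m n) (B i \<inter> D n)) = emeasure (m n) (\<Union>i. B i \<inter> D n)"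
        proof (rule suminf_emeasure)
          show "range (\<lambda>i. B i \<inter> D n) \<subseteq> sets (m n)" using B D(2)[of n] by auto
          show "disjoint_family (\<lambda>i. B i \<inter> D n)" using B(2) by (auto simp: disjoint_family_on_def)
        qed
        then show "(\<integral>\<^sup>+i. emeasure (m n) (B i \<inter> D n) \<partial>count_space UNIV) = emeasure (m n) ((\<Union>i. B i) \<inter> D n)"
          by (simp add: nn_integral_count_space_nat)
      qed
      finally show "(\<Sum>i. \<mu>0 (B i)) = \<mu>0 (\<Union>i. B i)" by (simp add: \<mu>0_def)
    qed
  qed
  have "is_vol y \<mu>"
    unfolding is_vol_def
  proof (safe)
    show "B \<in> sets borel" if "B \<in> sets \<mu>" for B
      using that by (simp add: \<mu>_def sets.sigma_sets_eq[of "borel :: 'a measure", simplified])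
    show "B \<in> sets \<mu>" if "B \<in> sets borel" for B
      using that by (simp add: \<mu>_def sets.sigma_sets_eq[of "borel :: 'a measure", simplified])
    fix U \<phi> and B :: "'a set" assume ch: "(U, \<phi>) \<in> A" and B: "B \<in> sets borel" "B \<subseteq> U"
    have "emeasure \<mu> B = (\<Sum>n. emeasure (m n) (B \<inter> D n))"
      using em[OF B(1)] by (simp add: \<mu>0_def)
    also have "\<dots> = (\<Sum>n. emeasure (chart_measure U \<phi> y) (B \<inter> D n))"
    proof (rule arg_cong[of _ _ suminf], rule ext)
      fix n
      show "emeasure (m n) (B \<inter> D n) = emeasure (chart_measure U \<phi> y) (B \<inter> D n)"
        unfolding m_def by (rule chart_measure_transition[OF imm D(1) ch]) (use B D(2,3)[of n] in auto)
    qed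
    also have "\<dots> = emeasure (chart_measure U \<phi> y) B"
      by (rule emeasure_partition[symmetric]) (use B D in auto)
    also have "\<dots> = (\<integral>\<^sup>+z\<in>\<phi> ` B. ennreal (sqrt (det (metric_at (loc U \<phi> y) z))) \<partial>lborel)"
      using B by (simp add: emeasure_chart_measure[OF imm ch] Int_absorb2)
    finally show "emeasure \<mu> B = (\<integral>\<^sup>+z\<in>\<phi> ` B. ennreal (sqrt (det (metric_at (loc U \<phi> y) z))) \<partial>lborel)" .
  qed
  then show ?thesis ..
qed

lemma is_vol_vol: "is_vol y (vol A y)"
proof -
  have "vol A y = (THE \<mu>. is_vol y \<mu>)"
    by (simp add: vol_def is_vol_def)
  then show ?thesis using theI'[of "is_vol y"] is_vol_exists is_vol_unique by metis
qed

lemma sets_vol [simp, measurable_cong]: "sets (vol A y) = sets borel"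
  using is_vol_vol by (simp add: is_vol_def)

lemma space_vol [simp]: "space (vol A y) = UNIV"
  using sets_eq_imp_space_eq[OF sets_vol] by simp

lemma density_vol_chart:
  assumes ch: "(U, \<phi>) \<in> A"
  shows "density (vol A y) (indicator U) = chart_measure U \<phi> y"
proof (rule measure_eqI)
  have U: "U \<in> sets borel" using open_U[OF ch] by simp
  fix B assume "B \<in> sets (density (vol A y) (indicator U))"
  then have B: "B \<in> sets borel" by simp
  have "emeasure (density (vol A y) (indicator U)) B = emeasure (vol A y) (B \<inter> U)"
    using B U by (simp add: emeasure_restricted Int_commute)
  also have "\<dots> = emeasure (chart_measure U \<phi> y) B"
    using B U by (simp add: is_volD[OF is_vol_vol ch] emeasure_chart_measure[OF imm ch])
  finally show "emeasure (density (vol A y) (indicator U)) B = emeasure (chart_measure U \<phi> y) B" .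
qed simp

lemma nn_integral_vol_chart:
  assumes ch: "(U, \<phi>) \<in> A" and B: "B \<in> sets borel" "B \<subseteq> U" and h [measurable]: "h \<in> borel_measurable borel"
  shows "(\<integral>\<^sup>+q\<in>B. h q \<partial>vol A y)
    = (\<integral>\<^sup>+z\<in>\<phi> ` B. ennreal (sqrt (det (metric_at (loc U \<phi> y) z))) * h (inv_into U \<phi> z) \<partial>lborel)"
proof -
  have [measurable]: "U \<in> sets borel" "B \<in> sets borel" using open_U[OF ch] B by auto
  have "(\<integral>\<^sup>+q\<in>B. h q \<partial>vol A y) = (\<integral>\<^sup>+q. indicator U q * (h q * indicator B q) \<partial>vol A y)"
    using B by (intro nn_integral_cong) (auto simp: indicator_def)
  also have "\<dots> = (\<integral>\<^sup>+q. h q * indicator B q \<partial>chart_measure U \<phi> y)"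
    unfolding density_vol_chart[OF ch, symmetric] by (subst nn_integral_density) auto
  also have "\<dots> = (\<integral>\<^sup>+z\<in>\<phi> ` B. ennreal (sqrt (det (metric_at (loc U \<phi> y) z))) * h (inv_into U \<phi> z) \<partial>lborel)"
    unfolding nn_integral_chart_measure[OF imm ch borel_measurable_times_ennreal[OF h borel_measurable_indicator[OF \<open>B \<in> sets borel\<close>]]]
    using B by (intro nn_integral_cong) (auto simp: indicator_def inv_chart[OF ch] mult.assoc)
  finally show ?thesis .
qed

lemma integral_vol_chart:
  fixes h :: "'a \<Rightarrow> real"
  assumes ch: "(U, \<phi>) \<in> A" and B: "B \<in> sets borel" "B \<subseteq> U" and h [measurable]: "h \<in> borel_measurable borel"
  shows "(\<integral>q. indicator B q * h q \<partial>vol A y)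
    = (\<integral>z. indicator (\<phi> ` B) z * (sqrt (det (metric_at (loc U \<phi> y) z)) * h (inv_into U \<phi> z)) \<partial>lborel)"
proof -
  have [measurable]: "U \<in> sets borel" "B \<in> sets borel" using open_U[OF ch] B by auto
  note [measurable] = chart_density_measurable[OF imm ch] inv_measurable[OF imm ch, of undefined]
  let ?d = "\<lambda>z. indicator (\<phi> ` U) z * sqrt (det (metric_at (loc U \<phi> y) z))"
  let ?i = "\<lambda>z. if z \<in> \<phi> ` U then inv_into U \<phi> z else undefined"
  have pos: "0 \<le> ?d z" for z
    using immersed_chart.metric_pos[OF immersed_chart_loc[OF ch imm]] by (auto simp: indicator_def less_imp_le)
  have 1: "density (vol A y) (\<lambda>q. ennreal (indicator U q)) = distr (density lborel (\<lambda>z. ennreal (?d z))) borel ?i"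
    using density_vol_chart[OF ch] by (simp add: chart_measure_def ennreal_indicator)
  have 2: "indicator U q * (indicator B q * h q) = indicator B q * h q" for q
    using B by (auto simp: indicator_def)
  have 3: "?d z *\<^sub>R (indicator B (?i z) * h (?i z))
      = indicator (\<phi> ` B) z * (sqrt (det (metric_at (loc U \<phi> y) z)) * h (inv_into U \<phi> z))" for z
  proof (cases "z \<in> \<phi> ` U")
    case True
    then obtain q where q: "q \<in> U" "z = \<phi> q" by blast
    have "\<phi> q \<in> \<phi> ` B \<longleftrightarrow> q \<in> B"
      by (rule inj_on_image_mem_iff[OF inj_chart[OF ch] q(1) B(2)])
    then show ?thesis using q inv_chart[OF ch q(1)] by (simp add: indicator_def)
  next
    case False
    then show ?thesis using B by (auto simp: indicator_def)
  qed
  have "(\<integral>q. indicator B q * h q \<partial>vol A y) = (\<integral>q. indicator B q * h q \<partial>density (vol A y) (\<lambda>q. ennreal (indicator U q)))"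
    by (subst integral_density) (auto simp: 2)
  also have "\<dots> = (\<integral>z. indicator B (?i z) * h (?i z) \<partial>density lborel (\<lambda>z. ennreal (?d z)))"
    unfolding 1 by (rule integral_distr) measurable
  also have "\<dots> = (\<integral>z. ?d z *\<^sub>R (indicator B (?i z) * h (?i z)) \<partial>lborel)"
    by (rule integral_density) (measurable, use pos in auto)
  finally show "(\<integral>q. indicator B q * h q \<partial>vol A y)
    = (\<integral>z. indicator (\<phi> ` B) z * (sqrt (det (metric_at (loc U \<phi> y) z)) * h (inv_into U \<phi> z)) \<partial>lborel)"
    unfolding 3 .
qed

end

end

section \<open>Smooth functions on the manifold\<close>

context atlas
begin

lemma smooth_map_localI:
  assumes "\<And>U \<phi> q. (U, \<phi>) \<in> A \<Longrightarrow> q \<in> U \<Longrightarrow> \<exists>G. open G \<and> q \<in> G \<and> G \<subseteq> U \<and> smooth_on (loc U \<phi> W) (\<phi> ` G)"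
  shows "smooth_map A W"
  unfolding smooth_map_def
proof safe
  fix U \<phi> assume ch: "(U, \<phi>) \<in> A"
  show "smooth_on (loc U \<phi> W) (\<phi> ` U)"
  proof (rule smooth_on_local)
    fix z assume "z \<in> \<phi> ` U"
    then obtain q where q: "q \<in> U" "z = \<phi> q" by blast
    obtain G where "open G" "q \<in> G" "G \<subseteq> U" "smooth_on (loc U \<phi> W) (\<phi> ` G)"
      using assms[OF ch q(1)] by blast
    then show "\<exists>T. open T \<and> z \<in> T \<and> smooth_on (loc U \<phi> W) T"
      using open_image_chart[OF ch] q by (intro exI[of _ "\<phi> ` G"]) auto
  qed
qed

lemma smooth_map_continuous:
  assumes "smooth_map A W"
  shows "continuous_on UNIV W"
proof (rule continuous_at_imp_continuous_on, rule ballI)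
  fix q :: 'a
  obtain U \<phi> where ch: "(U, \<phi>) \<in> A" "q \<in> U" by (rule covers)
  have "continuous_on U (\<lambda>p. loc U \<phi> W (\<phi> p))"
    by (rule continuous_on_compose2[OF smooth_on_imp_continuous_on[OF smooth_on_loc[OF ch(1) assms]] cont_chart[OF ch(1)]]) auto
  then have "continuous_on U W"
    by (rule continuous_on_cong[THEN iffD1, OF refl, rotated]) (simp add: inv_chart[OF ch(1)])
  then show "isCont W q"
    using open_U[OF ch(1)] ch(2) by (simp add: continuous_on_eq_continuous_at)
qed

lemma smooth_map_measurable: "smooth_map A W \<Longrightarrow> W \<in> borel_measurable borel"
  by (rule borel_measurable_continuous_onI[OF smooth_map_continuous])

named_theorems smooth_map_intros

lemma smooth_map_const [smooth_map_intros]: "smooth_map A (\<lambda>q. c)"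
  by (auto simp: smooth_map_def o_def intro: smooth_intros)

lemma smooth_map_add [smooth_map_intros]: "smooth_map A V \<Longrightarrow> smooth_map A W \<Longrightarrow> smooth_map A (\<lambda>q. V q + W q)"
  by (auto simp: smooth_map_def o_def intro!: smooth_intros open_image)

lemma smooth_map_diff [smooth_map_intros]: "smooth_map A V \<Longrightarrow> smooth_map A W \<Longrightarrow> smooth_map A (\<lambda>q. V q - W q)"
  by (auto simp: smooth_map_def o_def intro!: smooth_intros open_image)

lemma smooth_map_scaleR [smooth_map_intros]: "smooth_map A V \<Longrightarrow> smooth_map A W \<Longrightarrow> smooth_map A (\<lambda>q. V q *\<^sub>R W q)"
  by (auto simp: smooth_map_def o_def intro!: smooth_intros open_image)

lemma smooth_map_mult [smooth_map_intros]:
  fixes V W :: "'a \<Rightarrow> real"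
  shows "smooth_map A V \<Longrightarrow> smooth_map A W \<Longrightarrow> smooth_map A (\<lambda>q. V q * W q)"
  by (auto simp: smooth_map_def o_def intro!: smooth_intros open_image)

lemma smooth_map_inner [smooth_map_intros]: "smooth_map A V \<Longrightarrow> smooth_map A W \<Longrightarrow> smooth_map A (\<lambda>q. V q \<bullet> W q)"
  by (auto simp: smooth_map_def o_def intro!: smooth_intros open_image)

lemma smooth_map_sum [smooth_map_intros]:
  "(\<And>i. i \<in> I \<Longrightarrow> smooth_map A (W i)) \<Longrightarrow> smooth_map A (\<lambda>q. \<Sum>i\<in>I. W i q)"
  by (induction I rule: infinite_finite_induct) (auto intro: smooth_map_intros)

lemma smooth_map_bump [smooth_map_intros]: "smooth_map A V \<Longrightarrow> smooth_map A (\<lambda>q. bump (V q))"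
  by (auto simp: smooth_map_def o_def intro!: smooth_intros open_image)

lemma smooth_map_exp [smooth_map_intros]: "smooth_map A V \<Longrightarrow> smooth_map A (\<lambda>q. exp (V q :: real))"
  by (auto simp: smooth_map_def o_def intro!: smooth_intros open_image)

lemma immersion_smooth: "immersion A y \<Longrightarrow> smooth_map A y"
  by (simp add: immersion_def)

text \<open>The bump function of r^2 minus the squared coordinate distance from the centre, extended
  by zero. The preimage \<open>C\<close> of the closed coordinate ball is compact and contains the
  support.\<close>

lemma smooth_bump_at:
  obtains U \<phi> \<beta> C where "(U, \<phi>) \<in> A" "smooth_map A \<beta>" "\<And>q. 0 \<le> (\<beta> q :: real)" "0 < \<beta> q0"
    "compact C" "C \<subseteq> U" "\<And>q. q \<notin> C \<Longrightarrow> \<beta> q = 0"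
proof -
  obtain U \<phi> where ch: "(U, \<phi>) \<in> A" "q0 \<in> U" by (rule covers)
  obtain r where r: "r > 0" "cball (\<phi> q0) r \<subseteq> \<phi> ` U"
    using open_image[OF ch(1)] ch(2) open_contains_cball by blast
  define C where "C = inv_into U \<phi> ` cball (\<phi> q0) r"
  have C: "compact C"
    unfolding C_def by (intro compact_continuous_image continuous_on_subset[OF cont_inv[OF ch(1)] r(2)]) simp
  have CU: "C \<subseteq> U" using r(2) inv_in[OF ch(1)] by (auto simp: C_def)
  have inC: "q \<in> C \<longleftrightarrow> norm (\<phi> q - \<phi> q0) \<le> r" if "q \<in> U" for q
  proof
    assume "q \<in> C"
    then obtain z where "z \<in> cball (\<phi> q0) r" "q = inv_into U \<phi> z" by (auto simp: C_def)
    then show "norm (\<phi> q - \<phi> q0) \<le> r"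
      using chart_inv[OF ch(1), of z] r(2) by (auto simp: dist_norm norm_minus_commute)
  next
    assume "norm (\<phi> q - \<phi> q0) \<le> r"
    then show "q \<in> C"
      using inv_chart[OF ch(1) that] by (auto simp: C_def dist_norm norm_minus_commute image_iff intro!: bexI[of _ "\<phi> q"])
  qed
  define \<beta> where "\<beta> q = (if q \<in> U then bump (r\<^sup>2 - (\<phi> q - \<phi> q0) \<bullet> (\<phi> q - \<phi> q0)) else 0)" for q
  have out: "\<beta> q = 0" if "q \<notin> C" for q
  proof (cases "q \<in> U")
    case True
    then have "r < norm (\<phi> q - \<phi> q0)" using that inC by auto
    then have "r\<^sup>2 \<le> (norm (\<phi> q - \<phi> q0))\<^sup>2" using r by (intro power_mono) auto
    then show ?thesis by (simp add: \<beta>_def power2_norm_eq_inner)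
  qed (simp add: \<beta>_def)
  have "smooth_map A \<beta>"
  proof (rule smooth_map_localI)
    fix V \<psi> q assume chV: "(V, \<psi>) \<in> A" "q \<in> V"
    show "\<exists>G. open G \<and> q \<in> G \<and> G \<subseteq> V \<and> smooth_on (loc V \<psi> \<beta>) (\<psi> ` G)"
    proof (cases "q \<in> U")
      case True
      let ?G = "V \<inter> U"
      have op: "open (\<psi> ` ?G)"
        using open_U ch(1) chV(1) by (intro open_image_chart[OF chV(1)]) auto
      have sm: "smooth_on (\<lambda>z. (\<phi> \<circ> inv_into V \<psi>) z) (\<psi> ` ?G)"
        by (rule smooth_transition[OF chV(1) ch(1)])
      have "smooth_on (loc V \<psi> \<beta>) (\<psi> ` ?G)"
      proof (rule smooth_on_cong[OF op])
        show "smooth_on (\<lambda>z. bump (r\<^sup>2 - ((\<phi> \<circ> inv_into V \<psi>) z - \<phi> q0) \<bullet> ((\<phi> \<circ> inv_into V \<psi>) z - \<phi> q0))) (\<psi> ` ?G)"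
          by (intro smooth_intros op sm)
      qed (auto simp: \<beta>_def inv_chart[OF chV(1)])
      then show ?thesis using True chV open_U ch(1) by (intro exI[of _ ?G]) auto
    next
      \<comment> \<open>A point outside \<open>U\<close> is outside \<open>C\<close>. As the
        manifold is Hausdorff, \<open>C\<close> is closed, so the function vanishes on a whole
        neighbourhood of the point.\<close>
      case False
      let ?G = "V - C"
      have op: "open ?G" using open_U[OF chV(1)] compact_imp_closed[OF C] by blast
      have "smooth_on (loc V \<psi> \<beta>) (\<psi> ` ?G)"
      proof (rule smooth_on_cong)
        show "open (\<psi> ` ?G)" by (intro open_image_chart[OF chV(1)] op) auto
        show "smooth_on (\<lambda>z. 0) (\<psi> ` ?G)" by (rule smooth_on_const)
      qed (auto simp: out inv_chart[OF chV(1)])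
      then show ?thesis using False CU chV op by (intro exI[of _ ?G]) auto
    qed
  qed
  moreover have "0 < \<beta> q0" using ch(2) r by (simp add: \<beta>_def)
  moreover have "0 \<le> \<beta> q" for q by (simp add: \<beta>_def)
  ultimately show thesis using that ch(1) C CU out by blast
qed

text \<open>Near points of \<open>K\<close> the divisor is positive; near all other points the
  quotient is identically zero, because \<open>K\<close> is closed. This normalises finite families
  of bumps on a compact set.\<close>

lemma smooth_map_divide:
  fixes \<sigma> :: "'a \<Rightarrow> real"
  assumes W: "smooth_map A W" and \<sigma>: "smooth_map A \<sigma>"
    and K: "closed K" "\<And>q. q \<notin> K \<Longrightarrow> W q = 0" "\<And>q. q \<in> K \<Longrightarrow> 0 < \<sigma> q"
  shows "smooth_map A (\<lambda>q. (1 / \<sigma> q) *\<^sub>R W q)"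
proof (rule smooth_map_localI)
  fix U \<phi> q assume ch: "(U, \<phi>) \<in> A" "q \<in> U"
  show "\<exists>G. open G \<and> q \<in> G \<and> G \<subseteq> U \<and> smooth_on (loc U \<phi> (\<lambda>q. (1 / \<sigma> q) *\<^sub>R W q)) (\<phi> ` G)"
  proof (cases "q \<in> K")
    case True
    let ?G = "U \<inter> {q. 0 < \<sigma> q}"
    have "open {q. 0 < \<sigma> q}"
      using smooth_map_continuous[OF \<sigma>] by (intro open_Collect_less continuous_intros) auto
    then have opG: "open ?G" using open_U[OF ch(1)] by blast
    have op: "open (\<phi> ` ?G)" by (rule open_image_chart[OF ch(1) opG]) auto
    have "smooth_on (\<lambda>z. (1 / loc U \<phi> \<sigma> z) *\<^sub>R loc U \<phi> W z) (\<phi> ` ?G)"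
      using inv_chart[OF ch(1)]
      by (intro smooth_intros op smooth_on_subset[OF smooth_on_loc[OF ch(1) W]] smooth_on_subset[OF smooth_on_loc[OF ch(1) \<sigma>]])
        auto
    then show ?thesis using opG True K(3) ch by (intro exI[of _ ?G]) (auto simp: o_def)
  next
    case False
    let ?G = "U - K"
    have opG: "open ?G" using open_U[OF ch(1)] K(1) by blast
    have "smooth_on (loc U \<phi> (\<lambda>q. (1 / \<sigma> q) *\<^sub>R W q)) (\<phi> ` ?G)"
    proof (rule smooth_on_cong)
      show "open (\<phi> ` ?G)" by (intro open_image_chart[OF ch(1)] opG) auto
      show "smooth_on (\<lambda>z. 0) (\<phi> ` ?G)" by (rule smooth_on_const)
    qed (auto simp: K(2) inv_chart[OF ch(1)])
    then show ?thesis using False opG ch by (intro exI[of _ ?G]) auto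
  qed
qed

section \<open>Tangential derivatives on the manifold, compact supports and integrability\<close>

definition chart_at :: "'a \<Rightarrow> ('a, 'm) chart" where
  "chart_at q = (SOME c. c \<in> A \<and> q \<in> fst c)"

lemma chart_at: "(fst (chart_at q), snd (chart_at q)) \<in> A" "q \<in> fst (chart_at q)"
proof -
  obtain U \<phi> where "(U, \<phi>) \<in> A" "q \<in> U" by (rule covers)
  then have "\<exists>c. c \<in> A \<and> q \<in> fst c" by force
  from someI_ex[OF this] show "(fst (chart_at q), snd (chart_at q)) \<in> A" "q \<in> fst (chart_at q)"
    by (auto simp: chart_at_def)
qed

text \<open>An arbitrary chart is fixed at each point; \<open>mder_eq\<close> shows that for smooth
  \<open>W\<close> every chart gives the same value.\<close>

definition mder :: "('a \<Rightarrow> 'b::euclidean_space) \<Rightarrow> ('a \<Rightarrow> 'c::real_normed_vector) \<Rightarrow> 'a \<Rightarrow> 'b \<Rightarrow> 'c" where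
  "mder y W q b = tder (loc (fst (chart_at q)) (snd (chart_at q)) y)
     (loc (fst (chart_at q)) (snd (chart_at q)) W) (snd (chart_at q) q) b"

context
  fixes y :: "'a \<Rightarrow> 'b::euclidean_space"
  assumes imm: "immersion A y"
begin

lemma mder_eq:
  assumes "(U, \<phi>) \<in> A" "q \<in> U" "smooth_map A W"
  shows "mder y W q b = tder (loc U \<phi> y) (loc U \<phi> W) (\<phi> q) b"
  unfolding mder_def by (rule tder_transition[OF chart_at(1) assms(1) chart_at(2) assms(2) imm assms(3)])

lemma mder_eq':
  assumes "(U, \<phi>) \<in> A" "z \<in> \<phi> ` U" "smooth_map A W"
  shows "mder y W (inv_into U \<phi> z) b = tder (loc U \<phi> y) (loc U \<phi> W) z b"
  using mder_eq[OF assms(1) inv_in[OF assms(1,2)] assms(3)] chart_inv[OF assms(1,2)] by simp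

lemma loc_mder:
  assumes "(U, \<phi>) \<in> A" "smooth_map A W" "z \<in> \<phi> ` U"
  shows "loc U \<phi> (\<lambda>q. mder y W q (B q)) z = tder (loc U \<phi> y) (loc U \<phi> W) z (loc U \<phi> B z)"
  using mder_eq'[OF assms(1,3,2)] by simp

lemma smooth_map_mder [smooth_map_intros]:
  assumes "smooth_map A W" "smooth_map A B"
  shows "smooth_map A (\<lambda>q. mder y W q (B q))"
  unfolding smooth_map_def
proof safe
  fix U \<phi> assume ch: "(U, \<phi>) \<in> A"
  interpret immersed_chart "loc U \<phi> y" "\<phi> ` U" by (rule immersed_chart_loc[OF ch imm])
  show "smooth_on (loc U \<phi> (\<lambda>q. mder y W q (B q))) (\<phi> ` U)"
  proof (rule smooth_on_cong[OF open_O])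
    show "smooth_on (\<lambda>z. tder (loc U \<phi> y) (loc U \<phi> W) z (loc U \<phi> B z)) (\<phi> ` U)"
      by (intro smooth_tder smooth_on_loc[OF ch] assms)
  qed (rule loc_mder[OF ch assms(1), symmetric])
qed

lemma mder_zero_outside:
  assumes "smooth_map A W" "closed K" "\<And>q. q \<notin> K \<Longrightarrow> W q = 0" "q \<notin> K"
  shows "mder y W q b = 0"
proof -
  obtain U \<phi> where ch: "(U, \<phi>) \<in> A" "q \<in> U" by (rule covers)
  have "dird (loc U \<phi> W) (\<phi> q) = dird (\<lambda>z. 0) (\<phi> q)"
  proof (rule dird_cong)
    show "open (\<phi> ` (U - K))" using open_U[OF ch(1)] assms(2) by (intro open_image_chart[OF ch(1)]) auto
  qed (use ch assms inv_chart[OF ch(1)] in auto)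
  then show ?thesis by (simp add: mder_eq[OF ch assms(1)] tder_def)
qed

end

text \<open>As a predicate on functions it lets a finite set of bumps serve as its own index set in
  sums.\<close>

definition chart_bump :: "('a \<Rightarrow> real) \<Rightarrow> bool" where
  "chart_bump \<beta> \<longleftrightarrow> smooth_map A \<beta> \<and> (\<forall>q. 0 \<le> \<beta> q) \<and>
    (\<exists>(U, \<phi>)\<in>A. \<exists>C. compact C \<and> C \<subseteq> U \<and> (\<forall>q. q \<notin> C \<longrightarrow> \<beta> q = 0))"

lemma chart_bumpE:
  assumes "chart_bump \<beta>"
  obtains U \<phi> C where "(U, \<phi>) \<in> A" "compact C" "C \<subseteq> U" "\<And>q. q \<notin> C \<Longrightarrow> \<beta> q = 0"
proof -
  obtain c where c: "c \<in> A" "case c of (U, \<phi>) \<Rightarrow> \<exists>C. compact C \<and> C \<subseteq> U \<and> (\<forall>q. q \<notin> C \<longrightarrow> \<beta> q = 0)"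
    using assms unfolding chart_bump_def by (elim conjE bexE)
  obtain U \<phi> where U: "c = (U, \<phi>)" by (cases c)
  from c(2) obtain C where "compact C" "C \<subseteq> U" "\<forall>q. q \<notin> C \<longrightarrow> \<beta> q = 0"
    unfolding U prod.case by (elim exE conjE)
  then show thesis using that[of U \<phi> C] c(1) unfolding U by simp
qed

text \<open>A substitute for a partition of unity: on a compact set positivity of the sum is enough,
  because a field supported there can be divided by it.\<close>

lemma finite_chart_bumps:
  assumes "compact (K :: 'a set)"
  shows "\<exists>I. finite I \<and> I \<subseteq> Collect chart_bump \<and> (\<forall>q\<in>K. 0 < (\<Sum>\<beta>\<in>I. \<beta> q))"
proof -
  have ex: "\<exists>\<beta>. chart_bump \<beta> \<and> 0 < \<beta> q" for q
  proof -
    obtain U \<phi> \<beta> C where "(U, \<phi>) \<in> A" "smooth_map A \<beta>" "\<And>q. 0 \<le> (\<beta> q :: real)" "0 < \<beta> q"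
      "compact C" "C \<subseteq> U" "\<And>q. q \<notin> C \<Longrightarrow> \<beta> q = 0"
      by (rule smooth_bump_at[of q]) (rule that)
    then show ?thesis unfolding chart_bump_def by (intro exI[of _ \<beta>]) blast
  qed
  have cover: "K \<subseteq> (\<Union>\<beta>\<in>Collect chart_bump. {q. 0 < \<beta> q})" using ex by blast
  have op: "open {q. 0 < \<beta> q}" if "\<beta> \<in> Collect chart_bump" for \<beta>
    using smooth_map_continuous[of \<beta>] that unfolding chart_bump_def
    by (intro open_Collect_less continuous_intros) auto
  obtain I where I: "I \<subseteq> Collect chart_bump" "finite I" "K \<subseteq> (\<Union>\<beta>\<in>I. {q. 0 < \<beta> q})"
    using compactE_image[OF assms op cover] by metis
  have "0 < (\<Sum>\<beta>\<in>I. \<beta> q)" if q: "q \<in> K" for q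
  proof -
    obtain \<beta> where "\<beta> \<in> I" "0 < \<beta> q" using I(3) q by blast
    then show ?thesis using I by (intro sum_pos2[of I \<beta>]) (auto simp: chart_bump_def)
  qed
  then show ?thesis using I by blast
qed

text \<open>Supports of finitely many bumps cover \<open>K\<close>, and each is a compact subset of
  one chart, where the volume density is continuous.\<close>

lemma emeasure_vol_compact:
  fixes y :: "'a \<Rightarrow> 'b::euclidean_space"
  assumes imm: "immersion A y" and K: "compact K"
  shows "emeasure (vol A y) K < \<infinity>"
proof -
  obtain I where I: "finite I" "I \<subseteq> Collect chart_bump" "\<forall>q\<in>K. 0 < (\<Sum>\<beta>\<in>I. \<beta> q)"
    using finite_chart_bumps[OF K] by blast
  have "\<forall>\<beta>\<in>I. \<exists>C. compact C \<and> emeasure (vol A y) C < \<infinity> \<and> (\<forall>q. q \<notin> C \<longrightarrow> \<beta> q = 0)"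
  proof
    fix \<beta> assume "\<beta> \<in> I"
    then have "chart_bump \<beta>" using I(2) by auto
    then obtain U \<phi> C where ch: "(U, \<phi>) \<in> A" and C: "compact C" "C \<subseteq> U" "\<And>q. q \<notin> C \<Longrightarrow> \<beta> q = 0"
      by (rule chart_bumpE) (rule that)
    interpret immersed_chart "loc U \<phi> y" "\<phi> ` U" by (rule immersed_chart_loc[OF ch imm])
    have cC: "compact (\<phi> ` C)"
      by (intro compact_continuous_image continuous_on_subset[OF cont_chart[OF ch] C(2)] C(1))
    have "continuous_on (\<phi> ` C) (\<lambda>z. sqrt (det (metric_at (loc U \<phi> y) z)))"
      by (rule continuous_on_subset[OF smooth_on_imp_continuous_on[of _ "\<phi> ` U"]])
        (use C in \<open>auto intro!: smooth_intros open_O smooth_metric metric_pos\<close>)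
    from borel_integrable_compact[OF cC this]
    have int: "integrable lborel (\<lambda>z. indicator (\<phi> ` C) z *\<^sub>R sqrt (det (metric_at (loc U \<phi> y) z)))" .
    have "emeasure (vol A y) C = (\<integral>\<^sup>+z\<in>\<phi> ` C. ennreal (sqrt (det (metric_at (loc U \<phi> y) z))) \<partial>lborel)"
      using compact_imp_closed[OF C(1)] C(2) by (intro is_volD[OF is_vol_vol[OF imm] ch]) auto
    also have "\<dots> = (\<integral>\<^sup>+z. ennreal (norm (indicator (\<phi> ` C) z *\<^sub>R sqrt (det (metric_at (loc U \<phi> y) z)))) \<partial>lborel)"
      using C(2) metric_pos by (intro nn_integral_cong) (auto simp: indicator_def less_imp_le subset_iff)
    also have "\<dots> < \<infinity>"
      using int unfolding integrable_iff_bounded by simp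
    finally show "\<exists>C. compact C \<and> emeasure (vol A y) C < \<infinity> \<and> (\<forall>q. q \<notin> C \<longrightarrow> \<beta> q = 0)"
      using C by blast
  qed
  then obtain C where C: "\<And>\<beta>. \<beta> \<in> I \<Longrightarrow> compact (C \<beta>)" "\<And>\<beta>. \<beta> \<in> I \<Longrightarrow> emeasure (vol A y) (C \<beta>) < \<infinity>"
    "\<And>\<beta> q. \<beta> \<in> I \<Longrightarrow> q \<notin> C \<beta> \<Longrightarrow> \<beta> q = 0"
    using bchoice[of I "\<lambda>\<beta> C. compact C \<and> emeasure (vol A y) C < \<infinity> \<and> (\<forall>q. q \<notin> C \<longrightarrow> \<beta> q = 0)"] by blast
  have "K \<subseteq> (\<Union>\<beta>\<in>I. C \<beta>)"
  proof
    fix q assume "q \<in> K"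
    then have "(\<Sum>\<beta>\<in>I. \<beta> q) \<noteq> 0" using I(3) by force
    then obtain \<beta> where "\<beta> \<in> I" "\<beta> q \<noteq> 0" by (meson sum.neutral)
    then show "q \<in> (\<Union>\<beta>\<in>I. C \<beta>)" using C(3) by blast
  qed
  moreover have mC: "C \<beta> \<in> sets (vol A y)" if "\<beta> \<in> I" for \<beta>
    using compact_imp_closed[OF C(1)[OF that]] by (simp add: sets_vol[OF imm])
  ultimately have "emeasure (vol A y) K \<le> emeasure (vol A y) (\<Union>\<beta>\<in>I. C \<beta>)"
    by (intro emeasure_mono) (auto intro!: sets.finite_UN I(1))
  also have "\<dots> \<le> (\<Sum>\<beta>\<in>I. emeasure (vol A y) (C \<beta>))"
    by (rule emeasure_subadditive_finite) (use I(1) mC in auto)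
  also have "\<dots> < \<infinity>" using C(2) I(1) by simp
  finally show ?thesis .
qed

lemma integrable_compact_support:
  fixes y :: "'a \<Rightarrow> 'b::euclidean_space" and u :: "'a \<Rightarrow> real"
  assumes imm: "immersion A y" and K: "compact K" and u: "continuous_on UNIV u" "\<And>q. q \<notin> K \<Longrightarrow> u q = 0"
  shows "integrable (vol A y) u"
proof -
  have "compact (u ` K)" by (rule compact_continuous_image[OF continuous_on_subset[OF u(1)] K]) simp
  then obtain B where B: "\<And>q. q \<in> K \<Longrightarrow> \<bar>u q\<bar> \<le> B"
    using compact_imp_bounded[of "u ` K"] by (auto simp: bounded_iff)
  have mu: "u \<in> borel_measurable (vol A y)"
    using borel_measurable_continuous_onI[OF u(1)] by (simp cong: measurable_cong_sets add: sets_vol[OF imm])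
  have mK: "K \<in> sets (vol A y)" using compact_imp_closed[OF K] by (simp add: sets_vol[OF imm])
  have "integrable (vol A y) (\<lambda>q. B * indicator K q :: real)"
    using emeasure_vol_compact[OF imm K] mK by (intro integrable_mult_right integrable_real_indicator)
  then show ?thesis
    by (rule Bochner_Integration.integrable_bound[OF _ mu])
      (use B u(2) in \<open>auto simp: indicator_def intro!: AE_I2\<close>, smt (verit) B)
qed

end

section \<open>The divergence theorem\<close>

lemma integrable_continuous_compact_support:
  fixes \<psi> :: "'b::euclidean_space \<Rightarrow> real"
  assumes "continuous_on UNIV \<psi>" "compact K" "\<And>z. z \<notin> K \<Longrightarrow> \<psi> z = 0"
  shows "integrable lborel \<psi>"
proof -
  have "integrable lborel (\<lambda>z. indicator K z *\<^sub>R \<psi> z)"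
    by (rule borel_integrable_compact[OF assms(2) continuous_on_subset[OF assms(1)]]) simp
  moreover have "(\<lambda>z. indicator K z *\<^sub>R \<psi> z) = \<psi>"
  proof
    show "indicator K z *\<^sub>R \<psi> z = \<psi> z" for z using assms(3)[of z] by (cases "z \<in> K") auto
  qed
  ultimately show ?thesis by simp
qed

text \<open>Differentiate the translation invariance of the integral.\<close>

lemma integral_dird_eq_0:
  fixes \<psi> :: "'b::euclidean_space \<Rightarrow> real"
  assumes sm: "smooth_on \<psi> UNIV" and K: "compact K" "\<And>z. z \<notin> K \<Longrightarrow> \<psi> z = 0"
  shows "(\<integral>z. dird \<psi> z k \<partial>lborel) = 0" "integrable lborel (\<lambda>z. dird \<psi> z k)"
proof -
  have cont: "continuous_on UNIV \<psi>" "continuous_on UNIV (\<lambda>z. dird \<psi> z k)"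
    by (intro smooth_on_imp_continuous_on sm smooth_on_dird)+
  have dK: "dird \<psi> z k = 0" if "z \<notin> K" for z
  proof -
    have "dird \<psi> z = dird (\<lambda>z. 0) z"
      by (rule dird_cong[of "- K"]) (use K that compact_imp_closed in auto)
    then show ?thesis by simp
  qed
  show int: "integrable lborel (\<lambda>z. dird \<psi> z k)"
    by (rule integrable_continuous_compact_support[OF cont(2) K(1) dK])
  have int\<psi>: "integrable lborel \<psi>"
    by (rule integrable_continuous_compact_support[OF cont(1) K])
  obtain B where B: "\<And>z. \<bar>dird \<psi> z k\<bar> \<le> B"
  proof -
    have "compact ((\<lambda>z. dird \<psi> z k) ` K)"
      by (rule compact_continuous_image[OF continuous_on_subset[OF cont(2)] K(1)]) simp
    then obtain B where B: "\<And>z. z \<in> K \<Longrightarrow> \<bar>dird \<psi> z k\<bar> \<le> B"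
      using compact_imp_bounded[of "(\<lambda>z. dird \<psi> z k) ` K"] by (auto simp: bounded_iff)
    have "\<bar>dird \<psi> z k\<bar> \<le> \<bar>B\<bar>" for z
      using B[of z] dK[of z] by (cases "z \<in> K") auto
    then show thesis by (rule that)
  qed
  have "0 \<le> B" using B[of 0] by linarith
  define s where "s n = inverse (real (Suc n))" for n
  have s: "0 < s n" "s n \<le> 1" for n by (auto simp: s_def field_simps)
  define q where "q n z = (\<psi> (z + s n *\<^sub>R k) - \<psi> z) / s n" for n z
  have line: "((\<lambda>t. \<psi> (z + t *\<^sub>R k)) has_real_derivative dird \<psi> (z + t *\<^sub>R k) k) (at t)" for z t
  proof -
    have d: "(\<psi> has_derivative dird \<psi> (z + t *\<^sub>R k)) (at (z + t *\<^sub>R k))"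
      by (rule smooth_on_has_derivative[OF sm]) simp
    interpret linear "dird \<psi> (z + t *\<^sub>R k)" using d by (rule has_derivative_linear)
    have "((\<lambda>t. \<psi> (z + t *\<^sub>R k)) has_derivative (\<lambda>h. dird \<psi> (z + t *\<^sub>R k) (h *\<^sub>R k))) (at t)"
      by (rule has_derivative_compose[where g = \<psi> and f = "\<lambda>t. z + t *\<^sub>R k", OF _ d]) (auto intro!: derivative_eq_intros)
    then show ?thesis by (simp add: has_field_derivative_def scale mult_commute_abs)
  qed
  have lim: "(\<lambda>n. q n z) \<longlonglongrightarrow> dird \<psi> z k" for z
  proof -
    have "((\<lambda>h. (\<psi> (z + (0 + h) *\<^sub>R k) - \<psi> (z + 0 *\<^sub>R k)) / h) \<longlongrightarrow> dird \<psi> (z + 0 *\<^sub>R k) k) (at 0)"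
      using line[of z 0] unfolding DERIV_def .
    then have 1: "((\<lambda>h. (\<psi> (z + h *\<^sub>R k) - \<psi> z) / h) \<longlongrightarrow> dird \<psi> z k) (at 0)" by simp
    have "filterlim s (at 0) sequentially"
      unfolding filterlim_at using s(1) LIMSEQ_inverse_real_of_nat
      by (auto simp: s_def[abs_def] less_imp_neq[symmetric])
    from filterlim_compose[OF 1 this] show ?thesis by (simp add: q_def[abs_def])
  qed
  \<comment> \<open>The steps \<open>s n\<close> are at most 1, so every difference quotient
    vanishes off the set swept out by moving \<open>K\<close> back along \<open>k\<close> for times
    in [0, 1]. This gives one dominating function for all \<open>n\<close>.\<close>
  define K' where "K' = (\<lambda>(z, t). z - t *\<^sub>R k) ` (K \<times> {0..1})"
  have K': "compact K'"
    unfolding K'_def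
    by (intro compact_continuous_image compact_Times K compact_Icc) (auto simp: split_def intro!: continuous_intros)
  have bound: "norm (q n z) \<le> B * indicator K' z" for n z
  proof (cases "z \<in> K'")
    case True
    obtain t where t: "\<psi> (z + s n *\<^sub>R k) - \<psi> (z + 0 *\<^sub>R k) = (s n - 0) * dird \<psi> (z + t *\<^sub>R k) k"
      using MVT2[OF s(1)[of n], of "\<lambda>t. \<psi> (z + t *\<^sub>R k)" "\<lambda>t. dird \<psi> (z + t *\<^sub>R k) k"] line by blast
    then have "q n z = dird \<psi> (z + t *\<^sub>R k) k" using s(1)[of n] by (simp add: q_def)
    then show ?thesis using B True by simp
  next
    case False
    have notK: "z + t *\<^sub>R k \<notin> K" if "0 \<le> t" "t \<le> 1" for t
    proof
      assume "z + t *\<^sub>R k \<in> K"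
      then have "(\<lambda>(z, t). z - t *\<^sub>R k) (z + t *\<^sub>R k, t) \<in> K'" unfolding K'_def using that by (intro imageI) auto
      then show False using False by simp
    qed
    have "\<psi> (z + s n *\<^sub>R k) = 0" "\<psi> z = 0"
      using K(2)[OF notK[of "s n"]] K(2)[OF notK[of 0]] s[of n] by auto
    then show ?thesis using False by (simp add: q_def)
  qed
  have intq: "integral\<^sup>L lborel (q n) = 0" for n
  proof -
    have "integral\<^sup>L lborel (\<lambda>z. \<psi> (z + s n *\<^sub>R k)) = integral\<^sup>L (distr lborel borel ((+) (s n *\<^sub>R k))) \<psi>"
      using int\<psi> by (subst integral_distr) (auto simp: add.commute measurable_lborel2)
    also have "\<dots> = integral\<^sup>L lborel \<psi>" by (simp add: lborel_distr_plus)
    finally have 1: "integral\<^sup>L lborel (\<lambda>z. \<psi> (z + s n *\<^sub>R k)) = integral\<^sup>L lborel \<psi>" .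
    have "integrable (distr lborel borel ((+) (s n *\<^sub>R k))) \<psi>" using int\<psi> by (simp add: lborel_distr_plus)
    then have "integrable lborel (\<lambda>z. \<psi> (s n *\<^sub>R k + z))"
      by (subst (asm) integrable_distr_eq) (use int\<psi> in \<open>auto simp: measurable_lborel2\<close>)
    then have 2: "integrable lborel (\<lambda>z. \<psi> (z + s n *\<^sub>R k))" by (simp add: add.commute)
    show ?thesis
      unfolding q_def by (simp add: Bochner_Integration.integral_diff[OF 2 int\<psi>] 1)
  qed
  have "(\<lambda>n. integral\<^sup>L lborel (q n)) \<longlonglongrightarrow> (\<integral>z. dird \<psi> z k \<partial>lborel)"
  proof (rule integral_dominated_convergence)
    show "(\<lambda>z. dird \<psi> z k) \<in> borel_measurable lborel" using int by simp
    have "continuous_on UNIV (q n)" for n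
      unfolding q_def using s(1)[of n]
      by (intro continuous_intros continuous_on_compose2[OF cont(1)]) auto
    then show "q n \<in> borel_measurable lborel" for n
      by (simp add: measurable_lborel2 borel_measurable_continuous_onI)
    show "integrable lborel (\<lambda>z. B * indicator K' z :: real)"
      using K' emeasure_compact_finite[OF K'] compact_imp_closed[OF K']
      by (intro integrable_mult_right integrable_real_indicator) auto
  qed (use lim bound in auto)
  then show "(\<integral>z. dird \<psi> z k \<partial>lborel) = 0"
    using LIMSEQ_unique[OF _ tendsto_const] by (simp add: intq)
qed

context atlas
begin

definition mdiv :: "('a \<Rightarrow> 'b::euclidean_space) \<Rightarrow> ('a \<Rightarrow> 'b) \<Rightarrow> 'a \<Rightarrow> real" where
  "mdiv y W q = (\<Sum>e\<in>Basis. mder y W q e \<bullet> e)"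

definition weight :: "('a \<Rightarrow> 'b::euclidean_space) \<Rightarrow> 'a \<Rightarrow> real" where
  "weight y q = exp (- (1/2) * (norm (y q))\<^sup>2)"

lemma smooth_map_weight: "smooth_map A y \<Longrightarrow> smooth_map A (weight y)"
  unfolding weight_def[abs_def] power2_norm_eq_inner by (intro smooth_map_intros)

lemma weight_pos: "0 < weight y q"
  by (simp add: weight_def)

context
  fixes y :: "'a \<Rightarrow> 'b::euclidean_space"
  assumes imm: "immersion A y"
begin

lemma smooth_map_mdiv: "smooth_map A W \<Longrightarrow> smooth_map A (mdiv y W)"
  unfolding mdiv_def[abs_def] by (intro smooth_map_intros smooth_map_mder[OF imm])

lemma mdiv_loc:
  assumes "(U, \<phi>) \<in> A" "z \<in> \<phi> ` U" "smooth_map A W"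
  shows "mdiv y W (inv_into U \<phi> z) = immersed_chart.divergence (loc U \<phi> y) (loc U \<phi> W) z"
  using mder_eq'[OF imm assms] immersed_chart.divergence_def[OF immersed_chart_loc[OF assms(1) imm]]
  by (simp add: mdiv_def)

text \<open>For tangential \<open>W\<close> this is the divergence of
  \<open>weight y q *\<^sub>R W q\<close>: differentiating the Gaussian along \<open>W\<close> gives
  the term with y q \<bullet> W q.\<close>

definition wdiv :: "('a \<Rightarrow> 'b) \<Rightarrow> 'a \<Rightarrow> real" where
  "wdiv W q = (mdiv y W q - y q \<bullet> W q) * weight y q"

lemma integrable_wdiv:
  assumes W: "smooth_map A W" and K: "compact K" "\<And>q. q \<notin> K \<Longrightarrow> W q = 0"
  shows "integrable (vol A y) (wdiv W)"
proof (rule integrable_compact_support[OF imm K(1)])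
  show "continuous_on UNIV (wdiv W)"
    unfolding wdiv_def[abs_def]
    by (intro smooth_map_continuous smooth_map_intros smooth_map_mdiv smooth_map_weight immersion_smooth imm W)
  show "wdiv W q = 0" if "q \<notin> K" for q
    using mder_zero_outside[OF imm W compact_imp_closed[OF K(1)] K(2) that] K(2)[OF that] by (simp add: wdiv_def mdiv_def)
qed

text \<open>By \<open>divergence_coordinates\<close> the integrand is, in coordinates, a sum of
  partial derivatives of compactly supported smooth functions, each of integral zero.\<close>

lemma divergence_theorem_chart:
  assumes W: "smooth_map A W" "\<And>q. mder y y q (W q) = W q"
    and ch: "(U, \<phi>) \<in> A" and K: "compact K" "K \<subseteq> U" "\<And>q. q \<notin> K \<Longrightarrow> W q = 0"
  shows "(\<integral>q. wdiv W q \<partial>vol A y) = 0"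
proof -
  let ?f = "loc U \<phi> y" and ?W = "loc U \<phi> W"
  interpret immersed_chart ?f "\<phi> ` U" by (rule immersed_chart_loc[OF ch imm])
  have smW: "smooth_on ?W (\<phi> ` U)" by (rule smooth_on_loc[OF ch W(1)])
  have tan: "tproj ?f z (?W z) = ?W z" if "z \<in> \<phi> ` U" for z
    using mder_eq'[OF imm ch that immersion_smooth[OF imm], of "?W z"] W(2)[of "inv_into U \<phi> z"] by simp
  have cK: "compact (\<phi> ` K)"
    by (intro compact_continuous_image continuous_on_subset[OF cont_chart[OF ch] K(2)] K(1))
  have W0: "?W z = 0" if "z \<in> \<phi> ` U" "z \<notin> \<phi> ` K" for z
  proof -
    have "inv_into U \<phi> z \<notin> K"
      using that imageI[of "inv_into U \<phi> z" K \<phi>] chart_inv[OF ch that(1)] by auto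
    then show ?thesis using K(3) by simp
  qed
  \<comment> \<open>Extension by zero to the whole coordinate space; it stays smooth because the
    support is compact inside the open coordinate image.\<close>
  define \<psi> where "\<psi> k z = (if z \<in> \<phi> ` U then wdensity ?f z * (pinv ?f z (?W z) \<bullet> k) else 0)" for k z
  have \<psi>0: "\<psi> k z = 0" if "z \<notin> \<phi> ` K" for k z
    using W0[of z] that by (auto simp: \<psi>_def linear_0[OF lin_pinv])
  have sm\<psi>: "smooth_on (\<psi> k) UNIV" for k
  proof (rule smooth_on_local)
    fix z :: "real^'m"
    have sU: "smooth_on (\<psi> k) (\<phi> ` U)"
    proof (rule smooth_on_cong[OF open_O])
      show "smooth_on (\<lambda>z. wdensity ?f z * (pinv ?f z (?W z) \<bullet> k)) (\<phi> ` U)"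
        by (intro smooth_intros open_O smooth_wdensity smooth_pinv smW)
    qed (simp add: \<psi>_def)
    have sK: "smooth_on (\<psi> k) (- \<phi> ` K)"
      by (rule smooth_on_cong[OF _ _ smooth_on_const[of 0]]) (use \<psi>0 compact_imp_closed[OF cK] in auto)
    show "\<exists>T. open T \<and> z \<in> T \<and> smooth_on (\<psi> k) T"
    proof (cases "z \<in> \<phi> ` K")
      case True
      then have "z \<in> \<phi> ` U" using K(2) by blast
      then show ?thesis using sU open_O by blast
    next
      case False
      then show ?thesis using sK compact_imp_closed[OF cK] by (intro exI[of _ "- \<phi> ` K"]) auto
    qed
  qed
  have d\<psi>: "(\<Sum>k\<in>Basis. dird (\<psi> k) z k) = (if z \<in> \<phi> ` U then
      sqrt (det (metric_at ?f z)) * wdiv W (inv_into U \<phi> z) else 0)" for z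
  proof (cases "z \<in> \<phi> ` U")
    case True
    have "dird (\<psi> k) z = dird (\<lambda>z. wdensity ?f z * (pinv ?f z (?W z) \<bullet> k)) z" for k
      by (rule dird_cong[OF open_O True]) (simp add: \<psi>_def)
    then have "(\<Sum>k\<in>Basis. dird (\<psi> k) z k) = (\<Sum>k\<in>Basis. dird (\<lambda>z. wdensity ?f z * (pinv ?f z (?W z) \<bullet> k)) z k)"
      by (simp only:)
    also have "\<dots> = wdensity ?f z * (divergence ?W z - ?f z \<bullet> ?W z)"
      by (rule divergence_coordinates[OF True smW tan])
    also have "\<dots> = wdensity ?f z * (mdiv y W (inv_into U \<phi> z) - y (inv_into U \<phi> z) \<bullet> W (inv_into U \<phi> z))"
      unfolding mdiv_loc[OF ch True W(1)] o_apply ..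
    finally show ?thesis
      using True by (simp add: wdiv_def weight_def wdensity_def)
  next
    case False
    have "dird (\<psi> k) z = dird (\<lambda>z. 0) z" for k
    proof (rule dird_cong[of "- \<phi> ` K"])
      show "z \<in> - \<phi> ` K" using False K(2) by blast
    qed (use \<psi>0 compact_imp_closed[OF cK] in auto)
    then show ?thesis using False by simp
  qed
  have mU: "U \<in> sets borel" using open_U[OF ch] by simp
  have mw: "wdiv W \<in> borel_measurable borel"
    unfolding wdiv_def[abs_def]
    by (intro smooth_map_measurable smooth_map_intros smooth_map_mdiv smooth_map_weight immersion_smooth imm W)
  have "wdiv W q = indicator U q * wdiv W q" for q
  proof (cases "q \<in> U")
    case False
    then have "q \<notin> K" using K(2) by blast
    then show ?thesis
      using mder_zero_outside[OF imm W(1) compact_imp_closed[OF K(1)] K(3)] K(3)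
      by (simp add: wdiv_def mdiv_def)
  qed simp
  then have "(\<integral>q. wdiv W q \<partial>vol A y) = (\<integral>q. indicator U q * wdiv W q \<partial>vol A y)" by (rule Bochner_Integration.integral_cong[OF refl])
  also have "\<dots> = (\<integral>z. indicator (\<phi> ` U) z * (sqrt (det (metric_at ?f z)) * wdiv W (inv_into U \<phi> z)) \<partial>lborel)"
    by (rule integral_vol_chart[OF imm ch mU order_refl mw])
  also have "\<dots> = (\<integral>z. (\<Sum>k\<in>Basis. dird (\<psi> k) z k) \<partial>lborel)"
    unfolding d\<psi> by (rule Bochner_Integration.integral_cong[OF refl]) (simp add: indicator_def)
  also have "\<dots> = (\<Sum>k\<in>Basis. \<integral>z. dird (\<psi> k) z k \<partial>lborel)"
    by (rule Bochner_Integration.integral_sum) (rule integral_dird_eq_0(2)[OF sm\<psi> cK \<psi>0])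
  also have "\<dots> = 0"
    by (simp add: integral_dird_eq_0(1)[OF sm\<psi> cK \<psi>0])
  finally show ?thesis .
qed

lemma mder_sum:
  assumes "\<And>i. i \<in> I \<Longrightarrow> smooth_map A (W i)"
  shows "mder y (\<lambda>q. \<Sum>i\<in>I. W i q) q b = (\<Sum>i\<in>I. mder y (W i) q b)"
proof -
  obtain U \<phi> where ch: "(U, \<phi>) \<in> A" "q \<in> U" by (rule covers)
  interpret immersed_chart "loc U \<phi> y" "\<phi> ` U" by (rule immersed_chart_loc[OF ch(1) imm])
  have "mder y (\<lambda>q. \<Sum>i\<in>I. W i q) q b = tder (loc U \<phi> y) (\<lambda>z. \<Sum>i\<in>I. loc U \<phi> (W i) z) (\<phi> q) b"
    using mder_eq[OF imm ch smooth_map_sum[OF assms], where b = b] by (simp add: o_def)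
  also have "\<dots> = (\<Sum>i\<in>I. tder (loc U \<phi> y) (loc U \<phi> (W i)) (\<phi> q) b)"
    by (rule tder_sum) (use ch in blast, rule smooth_on_loc[OF ch(1) assms])
  finally show ?thesis using mder_eq[OF imm ch assms] by simp
qed

lemma linear_mder:
  assumes "smooth_map A W"
  shows "linear (mder y W q)"
  unfolding mder_def
  by (rule immersed_chart.linear_tder[OF immersed_chart_loc[OF chart_at(1) imm] smooth_on_loc[OF chart_at(1) assms]])
    (use chart_at in blast)

text \<open>Normalised bumps split \<open>W\<close> into finitely many fields, each compactly
  supported in one chart. The splitting multiplies \<open>W\<close> by scalars only, so the pieces
  remain tangential.\<close>

theorem divergence_theorem:
  assumes W: "smooth_map A W" "\<And>q. mder y y q (W q) = W q"
    and K: "compact K" "\<And>q. q \<notin> K \<Longrightarrow> W q = 0"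
  shows "(\<integral>q. wdiv W q \<partial>vol A y) = 0"
proof -
  obtain I where I: "finite I" "I \<subseteq> Collect chart_bump" "\<forall>q\<in>K. 0 < (\<Sum>\<beta>\<in>I. \<beta> q)"
    using finite_chart_bumps[OF K(1)] by blast
  have smI: "smooth_map A \<beta>" if "\<beta> \<in> I" for \<beta> using that I(2) by (auto simp: chart_bump_def)
  define \<sigma> where "\<sigma> q = (\<Sum>\<beta>\<in>I. \<beta> q)" for q
  define V where "V \<beta> q = \<beta> q *\<^sub>R ((1 / \<sigma> q) *\<^sub>R W q)" for \<beta> and q :: 'a
  have sm\<sigma>: "smooth_map A (\<lambda>q. (1 / \<sigma> q) *\<^sub>R W q)"
    by (rule smooth_map_divide[OF W(1) _ compact_imp_closed[OF K(1)] K(2)])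
      (use I smI in \<open>auto simp: \<sigma>_def[abs_def] intro!: smooth_map_intros\<close>)
  have smV: "smooth_map A (V \<beta>)" if "\<beta> \<in> I" for \<beta>
    unfolding V_def by (rule smooth_map_scaleR[OF smI[OF that] sm\<sigma>])
  have WV: "W q = (\<Sum>\<beta>\<in>I. V \<beta> q)" for q
  proof (cases "q \<in> K")
    case True
    then have "\<sigma> q \<noteq> 0" using I(3) by (auto simp: \<sigma>_def)
    moreover have "(\<Sum>\<beta>\<in>I. V \<beta> q) = (\<sigma> q / \<sigma> q) *\<^sub>R W q"
      by (simp add: V_def flip: scaleR_left.sum sum_divide_distrib) (simp add: \<sigma>_def)
    ultimately show ?thesis by simp
  qed (simp add: V_def K(2))
  have KV: "V \<beta> q = 0" if "q \<notin> K" for \<beta> q using K(2)[OF that] by (simp add: V_def)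
  have "wdiv W q = (\<Sum>\<beta>\<in>I. wdiv (V \<beta>) q)" for q
  proof -
    have "W = (\<lambda>q. \<Sum>\<beta>\<in>I. V \<beta> q)" by (rule ext) (rule WV)
    then have "mder y W q e = (\<Sum>\<beta>\<in>I. mder y (V \<beta>) q e)" for e
      using mder_sum[of I V q e, OF smV] by simp
    then have "mdiv y W q = (\<Sum>\<beta>\<in>I. mdiv y (V \<beta>) q)"
      unfolding mdiv_def by (simp add: inner_sum_left) (rule sum.swap)
    moreover have "y q \<bullet> W q = (\<Sum>\<beta>\<in>I. y q \<bullet> V \<beta> q)"
      unfolding WV[of q] by (rule inner_sum_right)
    ultimately show ?thesis
      unfolding wdiv_def by (simp add: sum_subtractf flip: sum_distrib_right)
  qed
  then have "(\<integral>q. wdiv W q \<partial>vol A y) = (\<integral>q. (\<Sum>\<beta>\<in>I. wdiv (V \<beta>) q) \<partial>vol A y)" by simp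
  also have "\<dots> = (\<Sum>\<beta>\<in>I. \<integral>q. wdiv (V \<beta>) q \<partial>vol A y)"
    by (rule Bochner_Integration.integral_sum) (rule integrable_wdiv[OF smV K(1) KV])
  also have "\<dots> = 0"
  proof (rule sum.neutral, rule ballI)
    fix \<beta> assume b: "\<beta> \<in> I"
    then have "chart_bump \<beta>" using I(2) by auto
    then obtain U \<phi> C where ch: "(U, \<phi>) \<in> A" and C: "compact C" "C \<subseteq> U" "\<And>q. q \<notin> C \<Longrightarrow> \<beta> q = 0"
      by (rule chart_bumpE) (rule that)
    show "(\<integral>q. wdiv (V \<beta>) q \<partial>vol A y) = 0"
    proof (rule divergence_theorem_chart[OF smV[OF b] _ ch C(1,2)])
      show "V \<beta> q = 0" if "q \<notin> C" for q using C(3)[OF that] by (simp add: V_def)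
      interpret linear "mder y y q" for q by (rule linear_mder[OF immersion_smooth[OF imm]])
      show "mder y y q (V \<beta> q) = V \<beta> q" for q by (simp add: V_def scale W(2))
    qed
  qed
  finally show ?thesis .
qed

end

end

section \<open>The second variation\<close>

text \<open>The domain of integration \<open>D\<close> is merely a Borel piece, while the
  surrounding compact set \<open>L\<close> makes the time derivative bounded near \<open>t\<close>.
  The mean value theorem and dominated convergence do the rest.\<close>

lemma leibniz_compact:
  fixes G :: "'e::euclidean_space \<times> real \<Rightarrow> real"
  assumes sm: "smooth_on G (S \<times> J)" and op: "open S" "open J"
    and D: "D \<in> sets borel" "D \<subseteq> L" "compact L" "L \<subseteq> S" and t: "t \<in> J"
  shows "((\<lambda>t. \<integral>z. indicator D z * G (z, t) \<partial>lborel) has_real_derivative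
      (\<integral>z. indicator D z * dird G (z, t) (0, 1) \<partial>lborel)) (at t)"
    and "integrable lborel (\<lambda>z. indicator D z * G (z, t))"
proof -
  have int: "integrable lborel (\<lambda>z. indicator D z * H (z, t) :: real)"
    if "continuous_on (S \<times> J) H" "t \<in> J" for H t
  proof -
    have "continuous_on L (\<lambda>z. H (z, t))"
      by (rule continuous_on_compose2[OF that(1)]) (use D that in \<open>auto intro!: continuous_intros\<close>)
    from borel_integrable_compact[OF D(3) this]
    have "integrable lborel (\<lambda>z. indicator D z *\<^sub>R (indicator L z *\<^sub>R H (z, t)))"
      by (rule integrable_mult_indicator[rotated]) (use D(1) in simp)
    moreover have "indicator D z *\<^sub>R (indicator L z *\<^sub>R H (z, t)) = indicator D z * H (z, t)" for z
      using D(2) by (auto simp: indicator_def)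
    ultimately show ?thesis by (simp only:)
  qed
  define G' where "G' p = dird G p (0, 1)" for p
  have opJ: "open (S \<times> J)" by (intro open_Times op)
  have cG: "continuous_on (S \<times> J) G" and cG': "continuous_on (S \<times> J) G'"
    unfolding G'_def[abs_def] by (intro smooth_on_imp_continuous_on sm smooth_on_dird)+
  show "integrable lborel (\<lambda>z. indicator D z * G (z, t))" by (rule int[OF cG t])
  obtain \<delta> where \<delta>: "\<delta> > 0" "cball t \<delta> \<subseteq> J" using op(2) t open_contains_cball by blast
  have cI: "compact (L \<times> cball t \<delta>)" by (intro compact_Times D) simp
  have sub: "L \<times> cball t \<delta> \<subseteq> S \<times> J" using D \<delta> by auto
  obtain B where B0: "\<forall>v\<in>G' ` (L \<times> cball t \<delta>). norm v \<le> B"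
    using compact_imp_bounded[OF compact_continuous_image[OF continuous_on_subset[OF cG' sub] cI]]
    unfolding bounded_iff by blast
  have B: "\<bar>G' (z, r)\<bar> \<le> B" if "z \<in> L" "r \<in> cball t \<delta>" for z r
    using bspec[OF B0 imageI[of "(z, r)"]] that by simp
  have line: "((\<lambda>r. G (z, r)) has_real_derivative G' (z, r)) (at r)" if "z \<in> S" "r \<in> J" for z r
  proof -
    have d: "(G has_derivative dird G (z, r)) (at (z, r))"
      by (rule smooth_on_has_derivative[OF sm]) (use that in auto)
    interpret linear "dird G (z, r)" using d by (rule has_derivative_linear)
    have "((\<lambda>r. G (z, r)) has_derivative (\<lambda>h. dird G (z, r) (0, h))) (at r)"
      by (rule has_derivative_compose[where g = G and f = "\<lambda>r. (z, r)", OF _ d]) (auto intro!: derivative_eq_intros)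
    moreover have "dird G (z, r) (0, h) = G' (z, r) * h" for h
      using scale[of h "(0, 1)"] by (simp add: G'_def mult.commute)
    ultimately show ?thesis by (simp add: has_field_derivative_def)
  qed
  define F where "F t = (\<integral>z. indicator D z * G (z, t) \<partial>lborel)" for t
  have "((\<lambda>h. (F (t + h) - F t) / h) \<longlongrightarrow> (\<integral>z. indicator D z * G' (z, t) \<partial>lborel)) (at 0)"
    unfolding tendsto_at_iff_sequentially
  proof (intro allI impI)
    fix X :: "nat \<Rightarrow> real" assume X: "\<forall>i. X i \<in> UNIV - {0}" "X \<longlonglongrightarrow> 0"
    obtain N where N: "\<And>n. n \<ge> N \<Longrightarrow> \<bar>X n\<bar> < \<delta>"
      using LIMSEQ_D[OF X(2) \<delta>(1)] by auto
    \<comment> \<open>Dropping the first \<open>N\<close> terms keeps all increments below \<delta>,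
      where the bound \<open>B\<close> is valid.\<close>
    define Y where "Y n = X (n + N)" for n
    have Y: "Y n \<noteq> 0" "\<bar>Y n\<bar> < \<delta>" for n using X(1) N by (auto simp: Y_def)
    have Ylim: "Y \<longlonglongrightarrow> 0" unfolding Y_def using X(2) by (rule LIMSEQ_ignore_initial_segment)
    have inJ: "t + Y n \<in> J" for n
    proof (rule subsetD[OF \<delta>(2)])
      show "t + Y n \<in> cball t \<delta>" using Y(2)[of n] by (simp add: dist_real_def)
    qed
    define q where "q n z = indicator D z * ((G (z, t + Y n) - G (z, t)) / Y n)" for n z
    have "(\<lambda>n. integral\<^sup>L lborel (q n)) \<longlonglongrightarrow> (\<integral>z. indicator D z * G' (z, t) \<partial>lborel)"
    proof (rule integral_dominated_convergence)
      show "(\<lambda>z. indicator D z * G' (z, t)) \<in> borel_measurable lborel" using int[OF cG' t] by simp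
      have q_eq: "q n = (\<lambda>z. (indicator D z * G (z, t + Y n) - indicator D z * G (z, t)) / Y n)" for n
        by (auto simp: q_def algebra_simps diff_divide_distrib)
      show "q n \<in> borel_measurable lborel" for n
        unfolding q_eq using int[OF cG inJ[of n]] int[OF cG t] by simp
      show "integrable lborel (\<lambda>z. B * indicator L z :: real)"
        using emeasure_compact_finite[OF D(3)] compact_imp_closed[OF D(3)]
        by (intro integrable_mult_right integrable_real_indicator) auto
      show "AE z in lborel. (\<lambda>n. q n z) \<longlonglongrightarrow> indicator D z * G' (z, t)"
      proof (rule AE_I2)
        fix z :: 'e
        show "(\<lambda>n. q n z) \<longlonglongrightarrow> indicator D z * G' (z, t)"
        proof (cases "z \<in> D")
          case True
          then have zS: "z \<in> S" using D by blast
          have 1: "((\<lambda>h. (G (z, t + h) - G (z, t)) / h) \<longlongrightarrow> G' (z, t)) (at 0)"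
            using line[OF zS t] unfolding DERIV_def .
          have "filterlim Y (at 0) sequentially"
            unfolding filterlim_at using Y(1) Ylim by auto
          from filterlim_compose[OF 1 this] show ?thesis using True by (simp add: q_def)
        qed (simp add: q_def)
      qed
      show "AE z in lborel. norm (q n z) \<le> B * indicator L z" for n
      proof (rule AE_I2)
        fix z :: 'e
        show "norm (q n z) \<le> B * indicator L z"
        proof (cases "z \<in> D")
          case True
          then have zL: "z \<in> L" and zS: "z \<in> S" using D by auto
          have "\<bar>G (z, t + Y n) - G (z, t)\<bar> \<le> B * \<bar>(t + Y n) - t\<bar>"
          proof -
            have "norm (G (z, t + Y n) - G (z, t)) \<le> B * norm ((t + Y n) - t)"
            proof (rule field_differentiable_bound[where f = "\<lambda>r. G (z, r)" and f' = "\<lambda>r. G' (z, r)" and S = "cball t \<delta>"])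
              show "((\<lambda>r. G (z, r)) has_field_derivative G' (z, r)) (at r within cball t \<delta>)" if "r \<in> cball t \<delta>" for r
                by (rule has_field_derivative_at_within[OF line[OF zS subsetD[OF \<delta>(2) that]]])
              show "norm (G' (z, r)) \<le> B" if "r \<in> cball t \<delta>" for r using B[OF zL that] by simp
            qed (use Y(2)[of n] \<delta>(1) in \<open>auto simp: dist_real_def\<close>)
            then show ?thesis by simp
          qed
          then show ?thesis using True zL Y(1)[of n] by (simp add: q_def abs_mult field_simps)
        next
          case False
          have "0 \<le> B" if "z \<in> L" using B[OF that, of t] \<delta>(1) by (auto simp: cball_def)
          then show ?thesis using False by (simp add: q_def indicator_def)
        qed
      qed
    qed
    moreover have "integral\<^sup>L lborel (q n) = (F (t + Y n) - F t) / Y n" for n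
    proof -
      have "integral\<^sup>L lborel (q n) = (\<integral>z. (indicator D z * G (z, t + Y n) - indicator D z * G (z, t)) / Y n \<partial>lborel)"
        by (intro Bochner_Integration.integral_cong refl) (simp add: q_def algebra_simps diff_divide_distrib)
      also have "\<dots> = (\<integral>z. indicator D z * G (z, t + Y n) - indicator D z * G (z, t) \<partial>lborel) / Y n" by simp
      also have "\<dots> = (F (t + Y n) - F t) / Y n"
        unfolding F_def by (subst Bochner_Integration.integral_diff[OF int[OF cG inJ] int[OF cG t]]) simp
      finally show ?thesis .
    qed
    ultimately have "(\<lambda>n. ((\<lambda>h. (F (t + h) - F t) / h) \<circ> X) (n + N)) \<longlonglongrightarrow> (\<integral>z. indicator D z * G' (z, t) \<partial>lborel)"
      by (simp add: Y_def)
    then show "((\<lambda>h. (F (t + h) - F t) / h) \<circ> X) \<longlonglongrightarrow> (\<integral>z. indicator D z * G' (z, t) \<partial>lborel)"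
      by (rule LIMSEQ_offset)
  qed
  then show "((\<lambda>t. \<integral>z. indicator D z * G (z, t) \<partial>lborel) has_real_derivative
      (\<integral>z. indicator D z * dird G (z, t) (0, 1) \<partial>lborel)) (at t)"
    unfolding DERIV_def F_def G'_def .
qed

text \<open>Differentiation under the integral twice, with the joint derivatives of \<open>G\<close>
  identified with time derivatives \<rho> and \<rho>' computed separately at each point, as
  \<open>second_derivative_wdensity\<close> provides them.\<close>

lemma leibniz_compact_second:
  fixes G :: "'e::euclidean_space \<times> real \<Rightarrow> real"
  assumes sm: "smooth_on G (S \<times> J)" and op: "open S" "open J"
    and D: "D \<in> sets borel" "D \<subseteq> L" "compact L" "L \<subseteq> S" and t: "t \<in> J"
    and d1: "\<And>z r. z \<in> S \<Longrightarrow> r \<in> J \<Longrightarrow> ((\<lambda>r. G (z, r)) has_real_derivative \<rho> z r) (at r)"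
    and d2: "\<And>z. z \<in> S \<Longrightarrow> (\<rho> z has_real_derivative \<rho>' z) (at t)"
  shows "\<exists>F'. (\<forall>r\<in>J. ((\<lambda>t. \<integral>z. indicator D z * G (z, t) \<partial>lborel) has_real_derivative F' r) (at r))
    \<and> (F' has_real_derivative (\<integral>z. indicator D z * \<rho>' z \<partial>lborel)) (at t)"
proof -
  define G' where "G' p = dird G p (0, 1)" for p
  have smG': "smooth_on G' (S \<times> J)" unfolding G'_def[abs_def] by (rule smooth_on_dird[OF sm])
  have line: "((\<lambda>r. H (z, r)) has_real_derivative dird H (z, r) (0, 1)) (at r)"
    if "smooth_on H (S \<times> J)" "z \<in> S" "r \<in> J" for H :: "'e \<times> real \<Rightarrow> real" and z r
  proof -
    have d: "(H has_derivative dird H (z, r)) (at (z, r))"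
      by (rule smooth_on_has_derivative[OF that(1)]) (use that in auto)
    interpret linear "dird H (z, r)" using d by (rule has_derivative_linear)
    have 1: "((\<lambda>r. H (z, r)) has_derivative (\<lambda>h. dird H (z, r) (0, h))) (at r)"
      by (rule has_derivative_compose[where g = H and f = "\<lambda>r. (z, r)", OF _ d]) (auto intro!: derivative_eq_intros)
    have 2: "dird H (z, r) (0, h) = dird H (z, r) (0, 1) * h" for h
      using scale[of h "(0, 1)"] by (simp add: mult.commute)
    show ?thesis
      unfolding has_field_derivative_def by (rule has_derivative_eq_rhs[OF 1], rule ext, rule 2)
  qed
  have eq1: "G' (z, r) = \<rho> z r" if "z \<in> S" "r \<in> J" for z r
    using DERIV_unique[OF line[OF sm that] d1[OF that]] by (simp add: G'_def)
  have eq2: "dird G' (z, t) (0, 1) = \<rho>' z" if "z \<in> S" for z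
  proof -
    have "((\<lambda>r. G' (z, r)) has_real_derivative \<rho>' z) (at t)"
      by (rule has_field_derivative_transform_within_open[OF d2[OF that] op(2) t]) (simp add: eq1[OF that])
    then show ?thesis using DERIV_unique[OF line[OF smG' that t]] by blast
  qed
  have "((\<lambda>t. \<integral>z. indicator D z * G (z, t) \<partial>lborel) has_real_derivative
      (\<integral>z. indicator D z * G' (z, r) \<partial>lborel)) (at r)" if "r \<in> J" for r
    unfolding G'_def by (rule leibniz_compact(1)[OF sm op D that])
  moreover have "((\<lambda>r. \<integral>z. indicator D z * G' (z, r) \<partial>lborel) has_real_derivative
      (\<integral>z. indicator D z * \<rho>' z \<partial>lborel)) (at t)"
  proof -
    have "indicator D z * dird G' (z, t) (0, 1) = indicator D z * \<rho>' z" for z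
      using eq2[of z] D by (auto simp: indicator_def)
    then show ?thesis using leibniz_compact(1)[OF smG' op D t] by (simp only:)
  qed
  ultimately show ?thesis
    by (intro exI[of _ "\<lambda>r. \<integral>z. indicator D z * G' (z, r) \<partial>lborel"] conjI ballI)
qed

text \<open>Cutting a compact set into disjoint Borel pieces avoids smooth weights: the pieces do
  not change with time, and integration needs no smoothness across their boundaries.\<close>

lemma finite_disjoint_cover:
  assumes "finite I" "K \<in> sets M" "\<And>i. i \<in> I \<Longrightarrow> C i \<in> sets M" "K \<subseteq> (\<Union>i\<in>I. C i)"
  shows "\<exists>D. (\<forall>i\<in>I. D i \<in> sets M \<and> D i \<subseteq> C i) \<and> disjoint_family_on D I \<and> (\<Union>i\<in>I. D i) = K"
  using assms
proof (induction I arbitrary: K rule: finite_induct)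
  case empty
  then show ?case by (auto simp: disjoint_family_on_def)
next
  case (insert j I)
  obtain D where D: "\<forall>i\<in>I. D i \<in> sets M \<and> D i \<subseteq> C i" "disjoint_family_on D I" "(\<Union>i\<in>I. D i) = K - C j"
  proof -
    have "K - C j \<subseteq> (\<Union>i\<in>I. C i)" using insert.prems(3) by auto
    moreover have "K - C j \<in> sets M" using insert.prems by auto
    ultimately have "\<exists>D. (\<forall>i\<in>I. D i \<in> sets M \<and> D i \<subseteq> C i) \<and> disjoint_family_on D I \<and> (\<Union>i\<in>I. D i) = K - C j"
      using insert.prems by (intro insert.IH) auto
    then show thesis using that by (elim exE conjE)
  qed
  define D' where "D' = D(j := K \<inter> C j)"
  have eq: "D' i = D i" if "i \<in> I" for i using that insert.hyps by (auto simp: D'_def)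
  have "\<forall>i\<in>insert j I. D' i \<in> sets M \<and> D' i \<subseteq> C i"
    using D(1) insert.prems eq by (auto simp: D'_def)
  moreover have "disjoint_family_on D' (insert j I)"
  proof -
    have "D' j \<inter> D' i = {}" if "i \<in> I" for i
      using D(3) that eq[OF that] by (auto simp: D'_def)
    moreover have "D' i \<inter> D' k = {}" if "i \<in> I" "k \<in> I" "i \<noteq> k" for i k
      using D(2) that eq by (auto simp: disjoint_family_on_def)
    ultimately show ?thesis unfolding disjoint_family_on_def by blast
  qed
  moreover have "(\<Union>i\<in>insert j I. D' i) = K"
  proof -
    have "(\<Union>i\<in>I. D' i) = (\<Union>i\<in>I. D i)" using eq by auto
    then show ?thesis using D(3) by (auto simp: D'_def)
  qed
  ultimately show ?case by blast
qed

text \<open>The varied metric is a polynomial in \<open>t\<close> with coefficients smooth in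
  \<open>z\<close>, so the density is jointly smooth wherever its determinant is positive.\<close>

lemma (in immersed_chart) smooth_wdensity_variation:
  assumes \<eta>: "smooth_on \<eta> \<Omega>" and J: "open J"
    and inj: "\<And>z t. z \<in> \<Omega> \<Longrightarrow> t \<in> J \<Longrightarrow> inj (dird (\<lambda>y. f y + t *\<^sub>R \<eta> y) z)"
  shows "smooth_on (\<lambda>(z, t). wdensity (\<lambda>y. f y + t *\<^sub>R \<eta> y) z) (\<Omega> \<times> J)"
proof -
  have op: "open (\<Omega> \<times> J)" by (intro open_Times open_O J)
  have fst: "smooth_on (\<lambda>p. h (fst p)) (\<Omega> \<times> J)" if "smooth_on h \<Omega>" for h :: "real^'m \<Rightarrow> 'd::real_normed_vector"
    by (rule smooth_on_compose[OF op that smooth_on_fst]) auto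
  define M where "M p = (\<chi> i j. metric_at f (fst p) $ i $ j
      + snd p * (dird f (fst p) (axis i 1) \<bullet> dird \<eta> (fst p) (axis j 1) + dird \<eta> (fst p) (axis i 1) \<bullet> dird f (fst p) (axis j 1))
      + snd p * (snd p * (dird \<eta> (fst p) (axis i 1) \<bullet> dird \<eta> (fst p) (axis j 1))))" for p
  have M: "metric_at (\<lambda>y. f y + t *\<^sub>R \<eta> y) z = M (z, t)" if "z \<in> \<Omega>" for z t
    by (simp add: M_def vec_eq_iff metric_at_def dird_variation[OF that \<eta>] inner_add_left inner_add_right algebra_simps)
  have smM: "smooth_on (\<lambda>p. M p $ i $ j) (\<Omega> \<times> J)" for i j
    unfolding M_def
    by (simp, intro smooth_intros op fst smooth_metric open_O smooth_f \<eta>)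
  have pos: "0 < det (M p)" if "p \<in> \<Omega> \<times> J" for p
  proof -
    define z t where "z = fst p" and "t = snd p"
    have p: "p = (z, t)" "z \<in> \<Omega>" "t \<in> J" using that by (auto simp: z_def t_def)
    have "linear (dird (\<lambda>y. f y + t *\<^sub>R \<eta> y) z)"
      by (intro linear_frechet_derivative smooth_on_imp_differentiable[OF _ p(2)] smooth_intros open_O smooth_f \<eta>)
    from metric_at_pos[OF this inj[OF p(2,3)]] show ?thesis by (simp add: M[OF p(2)] p(1))
  qed
  have "smooth_on (\<lambda>p. sqrt (det (M p)) * exp (- (1/2) * ((f (fst p) + snd p *\<^sub>R \<eta> (fst p)) \<bullet> (f (fst p) + snd p *\<^sub>R \<eta> (fst p))))) (\<Omega> \<times> J)"
    by (intro smooth_intros op smM pos fst smooth_f \<eta>)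
  then show ?thesis
    by (rule smooth_on_cong[OF op, rotated]) (auto simp: wdensity_def M power2_norm_eq_inner)
qed

section \<open>The second variation formula on the manifold\<close>

context atlas
begin

lemma smooth_loc_add_scaleR: "loc U \<phi> (\<lambda>q. V q + t *\<^sub>R W q) = (\<lambda>z. loc U \<phi> V z + t *\<^sub>R loc U \<phi> W z)"
  by (simp add: o_def)

definition mshape :: "('a \<Rightarrow> 'b::euclidean_space) \<Rightarrow> 'a \<Rightarrow> 'b \<Rightarrow> 'b \<Rightarrow> 'b" where
  "mshape x q b c = mder x (\<lambda>p. mder x x p c) q b"

text \<open>For normal \<eta> the tangential part of its derivative is minus the shape operator of
  \<eta>. The full derivative therefore contains one square of it, and subtracting two leaves the
  usual form: the squared normal derivative of \<eta> minus the squared shape operator minus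
  |\<eta>|^2.\<close>

definition qform :: "('a \<Rightarrow> 'b::euclidean_space) \<Rightarrow> ('a \<Rightarrow> 'b) \<Rightarrow> 'a \<Rightarrow> real" where
  "qform x \<eta> q = (\<Sum>e\<in>Basis. (norm (mder x \<eta> q e))\<^sup>2 - 2 * (norm (mshape x q e (\<eta> q)))\<^sup>2) - (norm (\<eta> q))\<^sup>2"

context
  fixes x :: "'a \<Rightarrow> 'b::euclidean_space"
  assumes imm: "immersion A x"
begin

lemma mshape_loc:
  assumes ch: "(U, \<phi>) \<in> A" and z: "z \<in> \<phi> ` U"
  shows "mshape x (inv_into U \<phi> z) b c = immersed_chart.shape (loc U \<phi> x) z b c"
proof -
  interpret immersed_chart "loc U \<phi> x" "\<phi> ` U" by (rule immersed_chart_loc[OF ch imm])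
  have sm: "smooth_map A (\<lambda>p. mder x x p c)"
    by (intro smooth_map_mder[OF imm] smooth_map_const immersion_smooth imm)
  have "mshape x (inv_into U \<phi> z) b c = tder (loc U \<phi> x) (loc U \<phi> (\<lambda>p. mder x x p c)) z b"
    unfolding mshape_def by (rule mder_eq'[OF imm ch z sm])
  also have "\<dots> = shape z b c"
    unfolding shape_def
    by (rule tder_cong[OF open_O z]) (simp add: mder_eq'[OF imm ch _ immersion_smooth[OF imm]])
  finally show ?thesis .
qed

lemma smooth_map_mshape:
  assumes "smooth_map A B" "smooth_map A C"
  shows "smooth_map A (\<lambda>q. mshape x q (B q) (C q))"
  unfolding smooth_map_def
proof safe
  fix U \<phi> assume ch: "(U, \<phi>) \<in> A"
  interpret immersed_chart "loc U \<phi> x" "\<phi> ` U" by (rule immersed_chart_loc[OF ch imm])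
  show "smooth_on (loc U \<phi> (\<lambda>q. mshape x q (B q) (C q))) (\<phi> ` U)"
    by (rule smooth_on_cong[OF open_O _ smooth_shape[OF smooth_on_loc[OF ch assms(1)] smooth_on_loc[OF ch assms(2)]]])
      (simp add: mshape_loc[OF ch])
qed

lemma smooth_map_qform:
  assumes "smooth_map A \<eta>"
  shows "smooth_map A (qform x \<eta>)"
  unfolding qform_def[abs_def] power2_norm_eq_inner
  by (intro smooth_map_intros smooth_map_mder[OF imm] smooth_map_mshape assms)

lemma linear_mshape: "linear (mshape x q b)"
proof -
  obtain U \<phi> where ch: "(U, \<phi>) \<in> A" "q \<in> U" by (rule covers)
  interpret immersed_chart "loc U \<phi> x" "\<phi> ` U" by (rule immersed_chart_loc[OF ch(1) imm])
  have "mshape x q b = shape (\<phi> q) b"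
    by (rule ext) (use mshape_loc[OF ch(1), of "\<phi> q"] ch(2) inv_chart[OF ch] in simp)
  then show ?thesis using linear_shape_right[of "\<phi> q" b] ch(2) by simp
qed

lemma qform_zero_outside:
  assumes "smooth_map A \<eta>" "closed K" "\<And>q. q \<notin> K \<Longrightarrow> \<eta> q = 0" "q \<notin> K"
  shows "qform x \<eta> q = 0"
  using mder_zero_outside[OF imm assms] linear_0[OF linear_mshape] assms(3,4) by (simp add: qform_def)

lemma immersion_variation:
  assumes \<eta>: "smooth_map A \<eta>" and small: "\<And>q. \<bar>t\<bar> * (\<Sum>e\<in>Basis. norm (mder x \<eta> q e)) < 1"
  shows "immersion A (\<lambda>q. x q + t *\<^sub>R \<eta> q)"
  unfolding immersion_def
proof safe
  show "smooth_map A (\<lambda>q. x q + t *\<^sub>R \<eta> q)"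
    by (intro smooth_map_intros immersion_smooth imm \<eta>)
  fix U \<phi> q assume ch: "(U, \<phi>) \<in> A" and q: "q \<in> U"
  interpret immersed_chart "loc U \<phi> x" "\<phi> ` U" by (rule immersed_chart_loc[OF ch imm])
  show "inj (dird (loc U \<phi> (\<lambda>q. x q + t *\<^sub>R \<eta> q)) (\<phi> q))"
    unfolding smooth_loc_add_scaleR
  proof (rule inj_dird_variation[OF _ smooth_on_loc[OF ch \<eta>]])
    show "\<bar>t\<bar> * (\<Sum>e\<in>Basis. norm (tder (loc U \<phi> x) (loc U \<phi> \<eta>) (\<phi> q) e)) < 1"
      using small[of q] by (simp only: mder_eq[OF imm ch q \<eta>])
  qed (use q in blast)
qed

lemma exists_variation_range:
  assumes \<eta>: "smooth_map A \<eta>" and K: "compact K" "\<And>q. q \<notin> K \<Longrightarrow> \<eta> q = 0"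
  shows "\<exists>\<epsilon>>0. \<forall>q t. \<bar>t\<bar> < \<epsilon> \<longrightarrow> \<bar>t\<bar> * (\<Sum>e\<in>Basis. norm (mder x \<eta> q e)) < 1"
proof -
  let ?s = "\<lambda>q. \<Sum>e\<in>Basis. norm (mder x \<eta> q e)"
  have "continuous_on UNIV ?s"
    by (intro continuous_intros smooth_map_continuous smooth_map_mder[OF imm] \<eta> smooth_map_const)
  then have "continuous_on K ?s" by (rule continuous_on_subset) simp
  from compact_imp_bounded[OF compact_continuous_image[OF this K(1)]]
  obtain B where B: "\<forall>v\<in>?s ` K. norm v \<le> B" unfolding bounded_iff ..
  have le: "?s q \<le> \<bar>B\<bar>" for q
  proof (cases "q \<in> K")
    case True
    then have "norm (?s q) \<le> B" using B by blast
    then show ?thesis by (simp add: abs_le_iff)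
  next
    case False
    then show ?thesis by (simp add: mder_zero_outside[OF imm \<eta> compact_imp_closed[OF K(1)] K(2)])
  qed
  have "\<bar>t\<bar> * ?s q < 1" if "\<bar>t\<bar> < 1 / (\<bar>B\<bar> + 1)" for t q
  proof -
    have "\<bar>t\<bar> * ?s q \<le> \<bar>t\<bar> * (\<bar>B\<bar> + 1)" using le[of q] by (intro mult_left_mono) auto
    also have "\<dots> < 1" using that by (simp add: field_simps)
    finally show ?thesis .
  qed
  then show ?thesis by (intro exI[of _ "1 / (\<bar>B\<bar> + 1)"]) auto
qed

end

lemma shrinker_chart_loc:
  assumes "(U, \<phi>) \<in> A" "self_shrinker A x"
  shows "shrinker_chart (loc U \<phi> x) (\<phi> ` U)"
proof -
  have imm: "immersion A x" using assms(2) by (simp add: self_shrinker_def)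
  interpret immersed_chart "loc U \<phi> x" "\<phi> ` U" by (rule immersed_chart_loc[OF assms(1) imm])
  show ?thesis by unfold_locales (use assms in \<open>auto simp: self_shrinker_def\<close>)
qed

lemma nn_integral_vol_agree:
  fixes y y' :: "'a \<Rightarrow> 'b::euclidean_space"
  assumes imm: "immersion A y" "immersion A y'" and G: "open G" "\<And>q. q \<in> G \<Longrightarrow> y q = y' q"
    and [measurable]: "h \<in> borel_measurable borel"
  shows "(\<integral>\<^sup>+q\<in>G. h q \<partial>vol A y) = (\<integral>\<^sup>+q\<in>G. h q \<partial>vol A y')"
proof -
  note [simp] = sets_vol[OF imm(1)] sets_vol[OF imm(2)]
  have [measurable]: "h \<in> borel_measurable (vol A y)" "h \<in> borel_measurable (vol A y')"
    using assms(5) by (simp_all cong: measurable_cong_sets)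
  have mG: "G \<in> sets (vol A y)" "G \<in> sets (vol A y')" using G by auto
  have "density (vol A y) (indicator G) = density (vol A y') (indicator G)"
  proof (rule measure_eqI)
    fix B assume "B \<in> sets (density (vol A y) (indicator G))"
    then have B: "B \<in> sets borel" by simp
    have "emeasure (vol A y) (G \<inter> B) = emeasure (vol A y') (G \<inter> B)"
      by (rule is_vol_agree[OF is_vol_vol[OF imm(1)] is_vol_vol[OF imm(2)] G]) (use B G in auto)
    then show "emeasure (density (vol A y) (indicator G)) B = emeasure (density (vol A y') (indicator G)) B"
      using B mG by (simp add: emeasure_restricted)
  qed simp
  then have "(\<integral>\<^sup>+q. h q \<partial>density (vol A y) (indicator G)) = (\<integral>\<^sup>+q. h q \<partial>density (vol A y') (indicator G))" by simp
  then show ?thesis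
    using mG by (simp add: nn_integral_density mult.commute)
qed

text \<open>The weighted volume splits into a part outside the support, constant in time, and
  finitely many integrals over fixed coordinate sets, each of which is differentiated under the
  integral sign.\<close>

theorem second_variation:
  fixes x :: "'a \<Rightarrow> 'b::euclidean_space"
  assumes shr: "self_shrinker A x" and fin: "V0 A x < \<infinity>"
    and \<eta>: "smooth_map A \<eta>" "\<And>q. mder x x q (\<eta> q) = 0"
    and K: "compact K" "\<And>q. q \<notin> K \<Longrightarrow> \<eta> q = 0"
    and \<epsilon>: "\<epsilon> > 0" "\<And>q t. \<bar>t\<bar> < \<epsilon> \<Longrightarrow> \<bar>t\<bar> * (\<Sum>e\<in>Basis. norm (mder x \<eta> q e)) < 1"
  shows "(deriv ^^ 2) (\<lambda>t. enn2real (V0 A (\<lambda>q. x q + t *\<^sub>R \<eta> q))) 0 = (\<integral>q. qform x \<eta> q * weight x q \<partial>vol A x)"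
proof -
  have imm: "immersion A x" using shr by (simp add: self_shrinker_def)
  define X where "X t q = x q + t *\<^sub>R \<eta> q" for t :: real and q
  define J where "J = {-\<epsilon><..<\<epsilon>}"
  have J: "open J" "0 \<in> J" using \<epsilon>(1) by (auto simp: J_def)
  have X0: "X 0 = x" by (simp add: X_def[abs_def])
  have immX: "immersion A (X t)" if "t \<in> J" for t
    unfolding X_def by (rule immersion_variation[OF imm \<eta>(1) \<epsilon>(2)]) (use that in \<open>auto simp: J_def abs_less_iff\<close>)
  obtain I where I: "finite I" "I \<subseteq> Collect chart_bump" "\<forall>q\<in>K. 0 < (\<Sum>\<beta>\<in>I. \<beta> q)"
    using finite_chart_bumps[OF K(1)] by blast
  have "\<forall>\<beta>\<in>I. \<exists>cC. (fst (fst cC), snd (fst cC)) \<in> A \<and> compact (snd cC) \<and> snd cC \<subseteq> fst (fst cC) \<and> (\<forall>q. q \<notin> snd cC \<longrightarrow> \<beta> q = 0)"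
  proof
    fix \<beta> assume "\<beta> \<in> I"
    then have "chart_bump \<beta>" using I(2) by auto
    then obtain U \<phi> C where "(U, \<phi>) \<in> A" "compact C" "C \<subseteq> U" "\<And>q. q \<notin> C \<Longrightarrow> \<beta> q = 0"
      by (rule chart_bumpE) (rule that)
    then show "\<exists>cC. (fst (fst cC), snd (fst cC)) \<in> A \<and> compact (snd cC) \<and> snd cC \<subseteq> fst (fst cC) \<and> (\<forall>q. q \<notin> snd cC \<longrightarrow> \<beta> q = 0)"
      by (intro exI[of _ "((U, \<phi>), C)"]) auto
  qed
  from bchoice[OF this] obtain g where g: "\<forall>\<beta>\<in>I. (fst (fst (g \<beta>)), snd (fst (g \<beta>))) \<in> A \<and> compact (snd (g \<beta>)) \<and>
      snd (g \<beta>) \<subseteq> fst (fst (g \<beta>)) \<and> (\<forall>q. q \<notin> snd (g \<beta>) \<longrightarrow> \<beta> q = 0)" ..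
  define Us where "Us \<beta> = fst (fst (g \<beta>))" for \<beta>
  define \<phi>s where "\<phi>s \<beta> = snd (fst (g \<beta>))" for \<beta>
  define C where "C \<beta> = snd (g \<beta>)" for \<beta>
  have ch: "(Us \<beta>, \<phi>s \<beta>) \<in> A" and C: "compact (C \<beta>)" "C \<beta> \<subseteq> Us \<beta>" "\<And>q. q \<notin> C \<beta> \<Longrightarrow> \<beta> q = 0"
    if "\<beta> \<in> I" for \<beta>
    using bspec[OF g that] by (auto simp: Us_def \<phi>s_def C_def)
  have KC: "K \<subseteq> (\<Union>\<beta>\<in>I. C \<beta>)"
  proof
    fix q assume "q \<in> K"
    then have "(\<Sum>\<beta>\<in>I. \<beta> q) \<noteq> 0" using I(3) by force
    then obtain \<beta> where "\<beta> \<in> I" "\<beta> q \<noteq> 0" by (meson sum.neutral)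
    then show "q \<in> (\<Union>\<beta>\<in>I. C \<beta>)" using C(3) by blast
  qed
  have clK: "closed K" by (rule compact_imp_closed[OF K(1)])
  \<comment> \<open>Each piece lies in the compact support of one bump, hence in one chart, with
    room for the compact set required by the Leibniz rule.\<close>
  have "\<exists>D. (\<forall>\<beta>\<in>I. D \<beta> \<in> sets borel \<and> D \<beta> \<subseteq> C \<beta>) \<and> disjoint_family_on D I \<and> (\<Union>\<beta>\<in>I. D \<beta>) = K"
    by (rule finite_disjoint_cover[OF I(1) _ _ KC]) (use clK compact_imp_closed[OF C(1)] in auto)
  then obtain D where D: "\<forall>\<beta>\<in>I. D \<beta> \<in> sets borel \<and> D \<beta> \<subseteq> C \<beta>" "disjoint_family_on D I" "(\<Union>\<beta>\<in>I. D \<beta>) = K"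
    by blast
  have D': "D \<beta> \<in> sets borel" "D \<beta> \<subseteq> C \<beta>" "D \<beta> \<subseteq> Us \<beta>" if "\<beta> \<in> I" for \<beta>
    using bspec[OF D(1) that] C(2)[OF that] by auto
  define f where "f \<beta> = loc (Us \<beta>) (\<phi>s \<beta>) x" for \<beta>
  define h where "h \<beta> = loc (Us \<beta>) (\<phi>s \<beta>) \<eta>" for \<beta>
  define S where "S \<beta> = \<phi>s \<beta> ` Us \<beta>" for \<beta>
  define E where "E \<beta> = \<phi>s \<beta> ` D \<beta>" for \<beta>
  define G where "G \<beta> = (\<lambda>(z, t). wdensity (\<lambda>y. f \<beta> y + t *\<^sub>R h \<beta> y) z)" for \<beta>
  have shc: "shrinker_chart (f \<beta>) (S \<beta>)" if "\<beta> \<in> I" for \<beta>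
    unfolding f_def S_def by (rule shrinker_chart_loc[OF ch[OF that] shr])
  have imc: "immersed_chart (f \<beta>) (S \<beta>)" if "\<beta> \<in> I" for \<beta>
    using shc[OF that] by (rule shrinker_chart.axioms)
  have smh: "smooth_on (h \<beta>) (S \<beta>)" if "\<beta> \<in> I" for \<beta>
    unfolding h_def S_def by (rule smooth_on_loc[OF ch[OF that] \<eta>(1)])
  have locX: "loc (Us \<beta>) (\<phi>s \<beta>) (X t) = (\<lambda>y. f \<beta> y + t *\<^sub>R h \<beta> y)" for \<beta> t
    by (simp add: X_def f_def h_def o_def)
  have injX: "inj (dird (\<lambda>y. f \<beta> y + t *\<^sub>R h \<beta> y) z)" if "\<beta> \<in> I" "z \<in> S \<beta>" "t \<in> J" for \<beta> z t
    using immX[OF that(3)] ch[OF that(1)] that(2) unfolding immersion_def locX[symmetric] S_def by blast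
  have smG: "smooth_on (G \<beta>) (S \<beta> \<times> J)" if "\<beta> \<in> I" for \<beta>
    unfolding G_def by (rule immersed_chart.smooth_wdensity_variation[OF imc smh J(1) injX]) (use that in auto)
  have opS: "open (S \<beta>)" if "\<beta> \<in> I" for \<beta>
    unfolding S_def by (rule open_image[OF ch[OF that]])
  have E: "E \<beta> \<in> sets borel" "E \<beta> \<subseteq> \<phi>s \<beta> ` C \<beta>" "compact (\<phi>s \<beta> ` C \<beta>)" "\<phi>s \<beta> ` C \<beta> \<subseteq> S \<beta>" if "\<beta> \<in> I" for \<beta>
    unfolding E_def S_def using D'[OF that] C[OF that] cont_chart[OF ch[OF that]]
    by (auto intro!: borel_image_chart[OF ch[OF that]] compact_continuous_image intro: continuous_on_subset)
  have intG: "integrable lborel (\<lambda>z. indicator (E \<beta>) z * G \<beta> (z, t))" if "\<beta> \<in> I" "t \<in> J" for \<beta> t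
    by (rule leibniz_compact(2)[OF smG opS J(1) E]) (use that in auto)
  have G_nonneg: "0 \<le> G \<beta> (z, t)" if "\<beta> \<in> I" "z \<in> S \<beta>" "t \<in> J" for \<beta> z t
  proof -
    have lin: "linear (dird (\<lambda>y. f \<beta> y + t *\<^sub>R h \<beta> y) z)"
    proof (intro linear_frechet_derivative smooth_on_imp_differentiable[OF _ that(2)])
      show "smooth_on (\<lambda>y. f \<beta> y + t *\<^sub>R h \<beta> y) (S \<beta>)"
        using opS[OF that(1)] immersed_chart.smooth_f[OF imc[OF that(1)]] smh[OF that(1)] by (intro smooth_intros)
    qed
    show ?thesis
      using metric_at_pos[OF lin injX[OF that]] by (simp add: G_def wdensity_def)
  qed
  have m_weight: "(\<lambda>q. ennreal (weight (X t) q)) \<in> borel_measurable borel" if "t \<in> J" for t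
    using smooth_map_measurable[OF smooth_map_weight[OF immersion_smooth[OF immX[OF that]]]] by simp
  have piece: "(\<integral>\<^sup>+q\<in>D \<beta>. ennreal (weight (X t) q) \<partial>vol A (X t)) = ennreal (\<integral>z. indicator (E \<beta>) z * G \<beta> (z, t) \<partial>lborel)"
    if "\<beta> \<in> I" "t \<in> J" for \<beta> t
  proof -
    have "(\<integral>\<^sup>+q\<in>D \<beta>. ennreal (weight (X t) q) \<partial>vol A (X t))
        = (\<integral>\<^sup>+z\<in>\<phi>s \<beta> ` D \<beta>. ennreal (sqrt (det (metric_at (loc (Us \<beta>) (\<phi>s \<beta>) (X t)) z)))
            * ennreal (weight (X t) (inv_into (Us \<beta>) (\<phi>s \<beta>) z)) \<partial>lborel)"
      using nn_integral_vol_chart[OF immX[OF that(2)] ch[OF that(1)] D'(1,3)[OF that(1)] m_weight[OF that(2)]] .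
    also have "\<dots> = (\<integral>\<^sup>+z. ennreal (indicator (E \<beta>) z * G \<beta> (z, t)) \<partial>lborel)"
    proof (rule nn_integral_cong)
      fix z
      have "ennreal (sqrt (det (metric_at (loc (Us \<beta>) (\<phi>s \<beta>) (X t)) z))) * ennreal (weight (X t) (inv_into (Us \<beta>) (\<phi>s \<beta>) z))
          = ennreal (G \<beta> (z, t))"
        unfolding locX by (simp add: G_def wdensity_def weight_def X_def f_def h_def flip: ennreal_mult'')
      then show "ennreal (sqrt (det (metric_at (loc (Us \<beta>) (\<phi>s \<beta>) (X t)) z)))
            * ennreal (weight (X t) (inv_into (Us \<beta>) (\<phi>s \<beta>) z)) * indicator (\<phi>s \<beta> ` D \<beta>) z
          = ennreal (indicator (E \<beta>) z * G \<beta> (z, t))"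
        by (simp add: E_def indicator_def)
    qed
    also have "\<dots> = ennreal (\<integral>z. indicator (E \<beta>) z * G \<beta> (z, t) \<partial>lborel)"
    proof (rule nn_integral_eq_integral[OF intG[OF that]], rule AE_I2)
      show "0 \<le> indicator (E \<beta>) z * G \<beta> (z, t)" for z
        using G_nonneg[OF that(1) _ that(2), of z] E(2,4)[OF that(1)] by (auto simp: indicator_def)
    qed
    finally show ?thesis .
  qed
  \<comment> \<open>The weighted mass off the support. It is finite because \<open>V0 A x\<close>
    is, so passing to real numbers with \<open>enn2real\<close> respects the decomposition.\<close>
  define c0 where "c0 = (\<integral>\<^sup>+q\<in>- K. ennreal (weight x q) \<partial>vol A x)"
  have V0_weight: "V0 A y = (\<integral>\<^sup>+q. ennreal (weight y q) \<partial>vol A y)" for y :: "'a \<Rightarrow> 'b"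
    by (simp add: V0_def weight_def)
  have c0: "c0 < \<infinity>"
  proof -
    have "c0 \<le> V0 A x" unfolding c0_def V0_weight by (rule nn_integral_mono) (auto simp: indicator_def)
    then show ?thesis using fin by (rule le_less_trans)
  qed
  define P where "P t = enn2real c0 + (\<Sum>\<beta>\<in>I. \<integral>z. indicator (E \<beta>) z * G \<beta> (z, t) \<partial>lborel)" for t
  have V0_eq: "enn2real (V0 A (X t)) = P t" if t: "t \<in> J" for t
  proof -
    let ?w = "\<lambda>q. ennreal (weight (X t) q)"
    have mw [measurable]: "?w \<in> borel_measurable (vol A (X t))"
      using m_weight[OF t] by (simp cong: measurable_cong_sets add: sets_vol[OF immX[OF t]])
    have mD: "D \<beta> \<in> sets (vol A (X t))" if "\<beta> \<in> I" for \<beta>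
      using D'(1)[OF that] by (simp add: sets_vol[OF immX[OF t]])
    have mK: "- K \<in> sets (vol A (X t))"
      using clK by (simp add: sets_vol[OF immX[OF t]])
    have split: "?w q = ?w q * indicator (- K) q + (\<Sum>\<beta>\<in>I. ?w q * indicator (D \<beta>) q)" for q
    proof -
      have "(\<Sum>\<beta>\<in>I. indicator (D \<beta>) q) = (indicator K q :: ennreal)"
        unfolding D(3)[symmetric] by (rule indicator_UN_disjoint[OF I(1) D(2), symmetric])
      then have "(\<Sum>\<beta>\<in>I. ?w q * indicator (D \<beta>) q) = ?w q * indicator K q"
        by (simp flip: sum_distrib_left)
      then show ?thesis by (simp add: indicator_def)
    qed
    have "V0 A (X t) = (\<integral>\<^sup>+q. ?w q * indicator (- K) q + (\<Sum>\<beta>\<in>I. ?w q * indicator (D \<beta>) q) \<partial>vol A (X t))"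
      unfolding V0_weight using split by (intro nn_integral_cong) blast
    also have "\<dots> = (\<integral>\<^sup>+q\<in>- K. ?w q \<partial>vol A (X t)) + (\<Sum>\<beta>\<in>I. \<integral>\<^sup>+q\<in>D \<beta>. ?w q \<partial>vol A (X t))"
      using mD mK by (subst nn_integral_add) (auto simp: nn_integral_sum intro!: borel_measurable_sum)
    also have "(\<integral>\<^sup>+q\<in>- K. ?w q \<partial>vol A (X t)) = (\<integral>\<^sup>+q\<in>- K. ?w q \<partial>vol A x)"
      by (rule nn_integral_vol_agree[OF immX[OF t] imm _ _ m_weight[OF t]]) (use clK K(2) in \<open>auto simp: X_def\<close>)
    also have "\<dots> = c0"
      unfolding c0_def by (rule nn_integral_cong) (auto simp: indicator_def weight_def X_def K(2))
    also have "(\<Sum>\<beta>\<in>I. \<integral>\<^sup>+q\<in>D \<beta>. ?w q \<partial>vol A (X t)) = (\<Sum>\<beta>\<in>I. ennreal (\<integral>z. indicator (E \<beta>) z * G \<beta> (z, t) \<partial>lborel))"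
      by (rule sum.cong[OF refl]) (rule piece[OF _ t])
    finally have *: "V0 A (X t) = c0 + (\<Sum>\<beta>\<in>I. ennreal (\<integral>z. indicator (E \<beta>) z * G \<beta> (z, t) \<partial>lborel))" .
    have nonneg: "0 \<le> (\<integral>z. indicator (E \<beta>) z * G \<beta> (z, t) \<partial>lborel)" if "\<beta> \<in> I" for \<beta>
    proof (rule Bochner_Integration.integral_nonneg)
      show "0 \<le> indicator (E \<beta>) z * G \<beta> (z, t)" for z
        using G_nonneg[OF that _ t, of z] E(2,4)[OF that] by (auto simp: indicator_def)
    qed
    have "V0 A (X t) = ennreal (P t)"
      unfolding * P_def using c0 nonneg by (simp add: ennreal_plus sum_nonneg flip: sum_ennreal)
    moreover have "0 \<le> P t" unfolding P_def using nonneg by (intro add_nonneg_nonneg sum_nonneg) auto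
    ultimately show ?thesis by simp
  qed
  define u where "u q = qform x \<eta> q * weight x q" for q
  have ex: "\<exists>F'. (\<forall>r\<in>J. ((\<lambda>t. \<integral>z. indicator (E \<beta>) z * G \<beta> (z, t) \<partial>lborel) has_real_derivative F' r) (at r))
    \<and> (F' has_real_derivative (\<integral>q. indicator (D \<beta>) q * u q \<partial>vol A x)) (at 0)" if b: "\<beta> \<in> I" for \<beta>
  proof -
    interpret shrinker_chart "f \<beta>" "S \<beta>" by (rule shc[OF b])
    define q where "q z = (\<Sum>e\<in>Basis. (norm (tder (f \<beta>) (h \<beta>) z e))\<^sup>2 - 2 * (norm (shape z e (h \<beta> z)))\<^sup>2) - (norm (h \<beta> z))\<^sup>2" for z
    have normal: "tproj (f \<beta>) y (h \<beta> y) = 0" if "y \<in> S \<beta>" for y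
      using mder_eq'[OF imm ch[OF b] _ immersion_smooth[OF imm], of y] \<eta>(2)[of "inv_into (Us \<beta>) (\<phi>s \<beta>) y"] that
      by (simp add: f_def h_def S_def)
    have "\<forall>z\<in>S \<beta>. \<exists>\<rho>. (\<forall>t\<in>J. ((\<lambda>t. G \<beta> (z, t)) has_real_derivative \<rho> t) (at t)) \<and>
        (\<rho> has_real_derivative wdensity (f \<beta>) z * q z) (at 0)"
    proof
      fix z assume z: "z \<in> S \<beta>"
      obtain \<rho> where \<rho>: "\<And>t. t \<in> J \<Longrightarrow> ((\<lambda>t. wdensity (\<lambda>y. f \<beta> y + t *\<^sub>R h \<beta> y) z) has_real_derivative \<rho> t) (at t)"
        "(\<rho> has_real_derivative wdensity (f \<beta>) z * q z) (at 0)"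
        by (rule second_derivative_wdensity[OF z smh[OF b] normal J injX[OF b z], folded q_def]) (assumption | rule that)+
      then show "\<exists>\<rho>. (\<forall>t\<in>J. ((\<lambda>t. G \<beta> (z, t)) has_real_derivative \<rho> t) (at t)) \<and>
        (\<rho> has_real_derivative wdensity (f \<beta>) z * q z) (at 0)"
        by (intro exI[of _ \<rho>]) (simp add: G_def)
    qed
    from bchoice[OF this] obtain \<rho> where
      \<rho>: "\<forall>z\<in>S \<beta>. (\<forall>t\<in>J. ((\<lambda>t. G \<beta> (z, t)) has_real_derivative \<rho> z t) (at t)) \<and>
        (\<rho> z has_real_derivative wdensity (f \<beta>) z * q z) (at 0)" ..
    have "(\<integral>z. indicator (E \<beta>) z * (wdensity (f \<beta>) z * q z) \<partial>lborel) = (\<integral>p. indicator (D \<beta>) p * u p \<partial>vol A x)"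
    proof -
      have mu: "u \<in> borel_measurable borel"
        unfolding u_def[abs_def]
        by (intro smooth_map_measurable smooth_map_intros smooth_map_qform[OF imm] smooth_map_weight immersion_smooth imm \<eta>)
      have "(\<integral>p. indicator (D \<beta>) p * u p \<partial>vol A x) = (\<integral>z. indicator (\<phi>s \<beta> ` D \<beta>) z *
          (sqrt (det (metric_at (loc (Us \<beta>) (\<phi>s \<beta>) x) z)) * u (inv_into (Us \<beta>) (\<phi>s \<beta>) z)) \<partial>lborel)"
        by (rule integral_vol_chart[OF imm ch[OF b] D'(1,3)[OF b] mu])
      also have "\<dots> = (\<integral>z. indicator (E \<beta>) z * (wdensity (f \<beta>) z * q z) \<partial>lborel)"
      proof (rule Bochner_Integration.integral_cong[OF refl])
        fix z
        show "indicator (\<phi>s \<beta> ` D \<beta>) z *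
          (sqrt (det (metric_at (loc (Us \<beta>) (\<phi>s \<beta>) x) z)) * u (inv_into (Us \<beta>) (\<phi>s \<beta>) z))
          = indicator (E \<beta>) z * (wdensity (f \<beta>) z * q z)"
        proof (cases "z \<in> E \<beta>")
          case True
          then have z: "z \<in> \<phi>s \<beta> ` Us \<beta>" using E(2,4)[OF b] by (auto simp: S_def)
          have "qform x \<eta> (inv_into (Us \<beta>) (\<phi>s \<beta>) z) = q z"
            unfolding qform_def q_def f_def h_def
            by (simp add: mder_eq'[OF imm ch[OF b] z \<eta>(1)] mshape_loc[OF imm ch[OF b] z])
          then show ?thesis by (simp add: u_def weight_def wdensity_def f_def E_def)
        qed (simp add: E_def)
      qed
      finally show ?thesis ..
    qed
    then show ?thesis
      using leibniz_compact_second[OF smG[OF b] opS[OF b] J(1) E[OF b] J(2), of \<rho> "\<lambda>z. wdensity (f \<beta>) z * q z"] \<rho>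
      by simp
  qed
  have "\<forall>\<beta>\<in>I. \<exists>F'. (\<forall>r\<in>J. ((\<lambda>t. \<integral>z. indicator (E \<beta>) z * G \<beta> (z, t) \<partial>lborel) has_real_derivative F' r) (at r))
    \<and> (F' has_real_derivative (\<integral>q. indicator (D \<beta>) q * u q \<partial>vol A x)) (at 0)"
    using ex by (rule ballI)
  from bchoice[OF this] obtain F' where
    F': "\<forall>\<beta>\<in>I. (\<forall>r\<in>J. ((\<lambda>t. \<integral>z. indicator (E \<beta>) z * G \<beta> (z, t) \<partial>lborel) has_real_derivative F' \<beta> r) (at r))
    \<and> (F' \<beta> has_real_derivative (\<integral>q. indicator (D \<beta>) q * u q \<partial>vol A x)) (at 0)" ..
  have dP: "(P has_real_derivative (\<Sum>\<beta>\<in>I. F' \<beta> r)) (at r)" if "r \<in> J" for r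
  proof -
    have "((\<lambda>t. enn2real c0 + (\<Sum>\<beta>\<in>I. \<integral>z. indicator (E \<beta>) z * G \<beta> (z, t) \<partial>lborel)) has_real_derivative 0 + (\<Sum>\<beta>\<in>I. F' \<beta> r)) (at r)"
      by (intro DERIV_add DERIV_const DERIV_sum) (use F' that in blast)
    then show ?thesis by (simp add: P_def[abs_def])
  qed
  let ?V = "\<lambda>t. enn2real (V0 A (X t))"
  \<comment> \<open>The first derivative must be known on all of \<open>J\<close> and not just at 0,
    because \<open>deriv ?V\<close> is itself differentiated next.\<close>
  have dV: "deriv ?V r = (\<Sum>\<beta>\<in>I. F' \<beta> r)" if "r \<in> J" for r
    by (rule DERIV_imp_deriv, rule has_field_derivative_transform_within_open[OF dP[OF that] J(1) that]) (simp add: V0_eq)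
  have "((\<lambda>r. \<Sum>\<beta>\<in>I. F' \<beta> r) has_real_derivative (\<Sum>\<beta>\<in>I. \<integral>q. indicator (D \<beta>) q * u q \<partial>vol A x)) (at 0)"
    by (intro DERIV_sum) (use F' in blast)
  then have "(deriv ?V has_real_derivative (\<Sum>\<beta>\<in>I. \<integral>q. indicator (D \<beta>) q * u q \<partial>vol A x)) (at 0)"
    by (rule has_field_derivative_transform_within_open[OF _ J]) (simp add: dV)
  then have "deriv (deriv ?V) 0 = (\<Sum>\<beta>\<in>I. \<integral>q. indicator (D \<beta>) q * u q \<partial>vol A x)"
    by (rule DERIV_imp_deriv)
  also have "\<dots> = (\<integral>q. (\<Sum>\<beta>\<in>I. indicator (D \<beta>) q * u q) \<partial>vol A x)"
  proof (rule Bochner_Integration.integral_sum[symmetric])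
    fix \<beta> assume b: "\<beta> \<in> I"
    have "integrable (vol A x) u"
    proof (rule integrable_compact_support[OF imm K(1)])
      show "continuous_on UNIV u"
        unfolding u_def[abs_def]
        by (intro smooth_map_continuous smooth_map_intros smooth_map_qform[OF imm] smooth_map_weight immersion_smooth imm \<eta>)
      show "u q = 0" if "q \<notin> K" for q
        using qform_zero_outside[OF imm \<eta>(1) clK K(2) that] by (simp add: u_def)
    qed
    from integrable_mult_indicator[OF _ this, of "D \<beta>"]
    show "integrable (vol A x) (\<lambda>q. indicator (D \<beta>) q * u q)"
      using D'(1)[OF b] by (simp add: sets_vol[OF imm])
  qed
  also have "\<dots> = (\<integral>q. u q \<partial>vol A x)"
  proof (rule Bochner_Integration.integral_cong[OF refl])
    fix q
    have "(\<Sum>\<beta>\<in>I. indicator (D \<beta>) q) = (indicator K q :: real)"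
      unfolding D(3)[symmetric] by (rule indicator_UN_disjoint[OF I(1) D(2), symmetric])
    then have "(\<Sum>\<beta>\<in>I. indicator (D \<beta>) q * u q) = indicator K q * u q"
      by (simp flip: sum_distrib_right)
    also have "\<dots> = u q"
      using qform_zero_outside[OF imm \<eta>(1) clK K(2), of q] by (cases "q \<in> K") (auto simp: u_def)
    finally show "(\<Sum>\<beta>\<in>I. indicator (D \<beta>) q * u q) = u q" .
  qed
  finally show ?thesis by (simp add: numeral_2_eq_2 X_def[abs_def] u_def)
qed

end

section \<open>Parallel normal fields and test variations\<close>

context atlas
begin

text \<open>Every coordinate direction is \<open>pinv\<close> of a tangent vector, so the coordinate
  derivative vanishes and \<open>u\<close> is constant on a coordinate ball; connectedness makes it
  constant globally.\<close>

lemma locally_constant_of_mder_zero: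
  fixes x :: "'a \<Rightarrow> 'b::euclidean_space" and u :: "'a \<Rightarrow> 'c::euclidean_space"
  assumes imm: "immersion A x" and conn: "connected (UNIV :: 'a set)"
    and u: "smooth_map A u" "\<And>q b. mder x u q b = 0"
  shows "u p = u q"
proof -
  have "\<exists>T. openin (top_of_set UNIV) T \<and> p \<in> T \<and> (\<forall>q\<in>T. u q = u p)" for p
  proof -
    obtain U \<phi> where ch: "(U, \<phi>) \<in> A" "p \<in> U" by (rule covers)
    interpret immersed_chart "loc U \<phi> x" "\<phi> ` U" by (rule immersed_chart_loc[OF ch(1) imm])
    obtain r where r: "r > 0" "ball (\<phi> p) r \<subseteq> \<phi> ` U"
      using open_O ch(2) open_contains_ball by blast
    have d0: "dird (loc U \<phi> u) z v = 0" if "z \<in> \<phi> ` U" for z v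
    proof -
      have "dird (loc U \<phi> u) z v = tder (loc U \<phi> x) (loc U \<phi> u) z (dird (loc U \<phi> x) z v)"
        by (simp add: tder_def pinv_dird'[OF that])
      then show ?thesis using u(2) mder_eq'[OF imm ch(1) that u(1)] by simp
    qed
    have "(loc U \<phi> u has_derivative (\<lambda>h. 0)) (at z within ball (\<phi> p) r)" if "z \<in> ball (\<phi> p) r" for z
    proof -
      have z: "z \<in> \<phi> ` U" using that r(2) by blast
      have "(loc U \<phi> u has_derivative dird (loc U \<phi> u) z) (at z)"
        by (rule smooth_on_has_derivative[OF smooth_on_loc[OF ch(1) u(1)] z])
      moreover have "dird (loc U \<phi> u) z = (\<lambda>h. 0)" using d0[OF z] by (rule ext)
      ultimately show ?thesis by (simp add: has_derivative_at_withinI)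
    qed
    then have const: "loc U \<phi> u z = loc U \<phi> u (\<phi> p)" if "z \<in> ball (\<phi> p) r" for z
      using has_derivative_zero_constant[of "ball (\<phi> p) r" "loc U \<phi> u"] that r(1)
      by (metis convex_ball centre_in_ball)
    let ?T = "inv_into U \<phi> ` ball (\<phi> p) r"
    have opT: "openin (top_of_set UNIV) ?T"
    proof -
      have "?T = U \<inter> \<phi> -` ball (\<phi> p) r"
      proof
        show "?T \<subseteq> U \<inter> \<phi> -` ball (\<phi> p) r"
          using r(2) inv_in[OF ch(1)] chart_inv[OF ch(1)] by auto
        show "U \<inter> \<phi> -` ball (\<phi> p) r \<subseteq> ?T"
          using inv_chart[OF ch(1)] by (auto intro!: image_eqI[OF sym])
      qed
      then show ?thesis
        using continuous_open_preimage[OF cont_chart[OF ch(1)] open_U[OF ch(1)] open_ball]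
        by (simp only: subtopology_UNIV open_openin)
    qed
    have pT: "p \<in> ?T" using r(1) inv_chart[OF ch] by (intro image_eqI[of _ _ "\<phi> p"]) auto
    have uT: "u q = u p" if qT: "q \<in> ?T" for q
    proof -
      obtain z where z: "z \<in> ball (\<phi> p) r" "q = inv_into U \<phi> z" using qT by blast
      show ?thesis using const[OF z(1)] inv_chart[OF ch] z(2) by simp
    qed
    show ?thesis by (rule exI[of _ ?T], intro conjI opT pT ballI uT)
  qed
  then have "u constant_on UNIV"
    by (intro locally_constant_imp_constant[OF conn])
  then show ?thesis by (auto simp: constant_on_def)
qed

section \<open>Projections and parallel normal fields\<close>

context
  fixes x :: "'a \<Rightarrow> 'b::euclidean_space"
  assumes imm: "immersion A x"
begin

lemma smx: "smooth_map A x"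
  by (rule immersion_smooth[OF imm])

lemma lin_proj: "linear (mder x x q)"
  by (rule linear_mder[OF imm smx])

lemma chart_point:
  obtains U \<phi> where "(U, \<phi>) \<in> A" "q \<in> U" "\<phi> q \<in> \<phi> ` U" "immersed_chart (loc U \<phi> x) (\<phi> ` U)"
proof -
  obtain U \<phi> where ch: "(U, \<phi>) \<in> A" "q \<in> U" by (rule covers)
  then show thesis using that[OF ch _ immersed_chart_loc[OF ch(1) imm]] by blast
qed

lemma proj_idem: "mder x x q (mder x x q b) = mder x x q b"
  and proj_sym: "mder x x q b \<bullet> c = b \<bullet> mder x x q c"
proof -
  obtain U \<phi> where ch: "(U, \<phi>) \<in> A" "q \<in> U" "\<phi> q \<in> \<phi> ` U" "immersed_chart (loc U \<phi> x) (\<phi> ` U)"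
    by (rule chart_point)
  interpret immersed_chart "loc U \<phi> x" "\<phi> ` U" by (rule ch(4))
  show "mder x x q (mder x x q b) = mder x x q b" "mder x x q b \<bullet> c = b \<bullet> mder x x q c"
    unfolding mder_eq[OF imm ch(1,2) smx] by (rule tproj_idem[OF ch(3)], rule tproj_symm[OF ch(3)])
qed

lemma norm_normal_le: "norm (a - mder x x q a) \<le> norm a"
proof -
  have "(norm (a - mder x x q a))\<^sup>2 = a \<bullet> a - mder x x q a \<bullet> mder x x q a"
    using proj_sym[of q "mder x x q a" a] proj_sym[of q a a]
    by (simp add: power2_norm_eq_inner inner_diff_left inner_diff_right proj_idem inner_commute)
  also have "\<dots> \<le> (norm a)\<^sup>2" by (simp add: power2_norm_eq_inner)
  finally show ?thesis by (rule power2_le_imp_le) simp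
qed

lemma mder_inner:
  assumes "smooth_map A V" "smooth_map A W"
  shows "mder x (\<lambda>p. V p \<bullet> W p) q b = V q \<bullet> mder x W q b + mder x V q b \<bullet> W q"
proof -
  obtain U \<phi> where ch: "(U, \<phi>) \<in> A" "q \<in> U" "\<phi> q \<in> \<phi> ` U" "immersed_chart (loc U \<phi> x) (\<phi> ` U)"
    by (rule chart_point)
  interpret immersed_chart "loc U \<phi> x" "\<phi> ` U" by (rule ch(4))
  have "loc U \<phi> (\<lambda>p. V p \<bullet> W p) = (\<lambda>z. loc U \<phi> V z \<bullet> loc U \<phi> W z)" by (simp add: o_def)
  then show ?thesis
    using tder_inner[OF ch(3) smooth_on_loc[OF ch(1) assms(1)] smooth_on_loc[OF ch(1) assms(2)], of b]
    by (simp add: mder_eq[OF imm ch(1,2)] assms smooth_map_inner inv_chart[OF ch(1,2)])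
qed

text \<open>A vanishing normal derivative means that the ambient derivative is tangential. This form
  mentions no charts and no normal connection.\<close>

lemma parallel_iff:
  "parallel_normal_field A x N \<longleftrightarrow> smooth_map A N \<and> (\<forall>q. mder x x q (N q) = 0) \<and>
    (\<forall>q b. mder x x q (mder x N q b) = mder x N q b)" (is "?L \<longleftrightarrow> ?R")
proof
  assume L: ?L
  then have N: "smooth_map A N" by (simp add: parallel_normal_field_def normal_field_def)
  have "mder x x q (N q) = 0 \<and> mder x x q (mder x N q b) = mder x N q b" for q b
  proof -
    obtain U \<phi> where ch: "(U, \<phi>) \<in> A" "q \<in> U" "\<phi> q \<in> \<phi> ` U" "immersed_chart (loc U \<phi> x) (\<phi> ` U)"
      by (rule chart_point)
    interpret immersed_chart "loc U \<phi> x" "\<phi> ` U" by (rule ch(4))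
    have "\<forall>z\<in>\<phi> ` U. loc U \<phi> N z \<in> (tangent_at (loc U \<phi> x) z)\<^sup>\<bottom>"
      using L ch(1) unfolding parallel_normal_field_def normal_field_def by blast
    from bspec[OF this ch(3)] have 1: "tproj (loc U \<phi> x) (\<phi> q) (N q) = 0"
      by (simp add: normal_iff'[OF ch(3)] inv_chart[OF ch(1,2)])
    have "\<forall>z\<in>\<phi> ` U. \<forall>v. normal_conn (loc U \<phi> x) (\<lambda>_. v) (loc U \<phi> N) z = 0"
      using L ch(1) unfolding parallel_normal_field_def by blast
    from bspec[OF this ch(3)]
    have "normal_part (loc U \<phi> x) (\<phi> q) (tder (loc U \<phi> x) (loc U \<phi> N) (\<phi> q) b) = 0"
      by (simp only: normal_conn_def tder_def)
    then show ?thesis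
      using 1 unfolding mder_eq[OF imm ch(1,2) smx] mder_eq[OF imm ch(1,2) N] normal_part_eq'[OF ch(3)] by simp
  qed
  then show ?R using N by blast
next
  assume R: ?R
  then have N: "smooth_map A N" and R0: "\<And>q. mder x x q (N q) = 0"
    and R1: "\<And>q b. mder x x q (mder x N q b) = mder x N q b" by blast+
  have "loc U \<phi> N z \<in> (tangent_at (loc U \<phi> x) z)\<^sup>\<bottom> \<and> normal_conn (loc U \<phi> x) (\<lambda>_. v) (loc U \<phi> N) z = 0"
    if ch: "(U, \<phi>) \<in> A" and z: "z \<in> \<phi> ` U" for U \<phi> z v
  proof -
    interpret immersed_chart "loc U \<phi> x" "\<phi> ` U" by (rule immersed_chart_loc[OF ch imm])
    have 1: "tproj (loc U \<phi> x) z (loc U \<phi> N z) = 0"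
      using R0[of "inv_into U \<phi> z"] unfolding mder_eq'[OF imm ch z smx] by simp
    have 2: "tproj (loc U \<phi> x) z (tder (loc U \<phi> x) (loc U \<phi> N) z b) = tder (loc U \<phi> x) (loc U \<phi> N) z b" for b
      using R1[of "inv_into U \<phi> z" b] unfolding mder_eq'[OF imm ch z smx] mder_eq'[OF imm ch z N] .
    have "dird (loc U \<phi> N) z v = tder (loc U \<phi> x) (loc U \<phi> N) z (dird (loc U \<phi> x) z v)"
      by (simp add: tder_def pinv_dird'[OF z])
    then have "normal_conn (loc U \<phi> x) (\<lambda>_. v) (loc U \<phi> N) z = 0"
      using 2 unfolding normal_conn_def normal_part_eq'[OF z] by simp
    with 1 show ?thesis unfolding normal_iff'[OF z] by blast
  qed
  then show ?L
    using N unfolding parallel_normal_field_def normal_field_def by (intro conjI ballI allI) (auto simp del: o_apply)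
qed

lemma parallel_combination:
  assumes "\<And>i. i \<in> I \<Longrightarrow> parallel_normal_field A x (N i)"
  shows "parallel_normal_field A x (\<lambda>q. \<Sum>i\<in>I. c i *\<^sub>R N i q)"
proof -
  have sm: "smooth_map A (\<lambda>q. c i *\<^sub>R N i q)" if "i \<in> I" for i
    using assms[OF that] unfolding parallel_iff by (intro smooth_map_intros) blast
  have der: "mder x (\<lambda>q. c i *\<^sub>R N i q) q b = c i *\<^sub>R mder x (N i) q b" if i: "i \<in> I" for i q b
  proof -
    obtain U \<phi> where ch: "(U, \<phi>) \<in> A" "q \<in> U" "\<phi> q \<in> \<phi> ` U" "immersed_chart (loc U \<phi> x) (\<phi> ` U)"
      by (rule chart_point)
    interpret immersed_chart "loc U \<phi> x" "\<phi> ` U" by (rule ch(4))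
    have N: "smooth_map A (N i)" using assms[OF i] unfolding parallel_iff by blast
    have "loc U \<phi> (\<lambda>q. c i *\<^sub>R N i q) = (\<lambda>z. c i *\<^sub>R loc U \<phi> (N i) z)" by (simp add: o_def)
    then show ?thesis
      using tder_linear[OF bounded_linear_scaleR_right ch(3) smooth_on_loc[OF ch(1) N], of "c i" b]
      by (simp add: mder_eq[OF imm ch(1,2)] sm[OF i] N)
  qed
  interpret p: linear "mder x x q" for q by (rule lin_proj)
  show ?thesis
    unfolding parallel_iff
  proof (intro conjI allI)
    show "smooth_map A (\<lambda>q. \<Sum>i\<in>I. c i *\<^sub>R N i q)" by (intro smooth_map_sum sm)
    show "mder x x q (\<Sum>i\<in>I. c i *\<^sub>R N i q) = 0" for q
      unfolding p.sum p.scale using assms unfolding parallel_iff by (intro sum.neutral) auto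
    show "mder x x q (mder x (\<lambda>q. \<Sum>i\<in>I. c i *\<^sub>R N i q) q b) = mder x (\<lambda>q. \<Sum>i\<in>I. c i *\<^sub>R N i q) q b" for q b
    proof -
      have "mder x (\<lambda>q. \<Sum>i\<in>I. c i *\<^sub>R N i q) q b = (\<Sum>i\<in>I. c i *\<^sub>R mder x (N i) q b)"
        by (subst mder_sum[OF imm sm]) (auto intro!: sum.cong der)
      moreover have "mder x x q (c i *\<^sub>R mder x (N i) q b) = c i *\<^sub>R mder x (N i) q b" if "i \<in> I" for i
        unfolding p.scale using assms[OF that] unfolding parallel_iff by simp
      ultimately show ?thesis by (simp add: p.sum)
    qed
  qed
qed

text \<open>In the product rule a normal field is always paired with the tangential derivative of a
  parallel one, so the inner product has derivative zero.\<close>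

lemma parallel_inner_const:
  assumes conn: "connected (UNIV :: 'a set)" and "parallel_normal_field A x M" "parallel_normal_field A x N"
  shows "M p \<bullet> N p = M q \<bullet> N q"
proof (rule locally_constant_of_mder_zero[OF imm conn])
  have par: "smooth_map A L" "mder x x q (L q) = 0" "mder x x q (mder x L q b) = mder x L q b"
    if "L \<in> {M, N}" for L q b
    using that assms(2,3) unfolding parallel_iff by auto
  show "smooth_map A (\<lambda>p. M p \<bullet> N p)" by (intro smooth_map_intros par) auto
  fix q b
  have "L' q \<bullet> mder x L q b = 0" if "L \<in> {M, N}" "L' \<in> {M, N}" for L L'
    using proj_sym[of q "L' q" "mder x L q b"] par[OF that(1)] par[OF that(2)] by simp
  from this[of M N] this[of N M] show "mder x (\<lambda>p. M p \<bullet> N p) q b = 0"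
    by (simp add: mder_inner[OF par(1) par(1)] inner_commute)
qed

text \<open>Inner products of parallel fields are constant, so a parallel field is determined by its
  value at one point. Evaluation there identifies these fields with a subspace of the ambient space,
  and an orthonormal basis at the point stays orthonormal everywhere.\<close>

lemma parallel_frame:
  assumes conn: "connected (UNIV :: 'a set)"
  shows "\<exists>(B :: 'b set) F. finite B \<and> (\<forall>b\<in>B. parallel_normal_field A x (F b)) \<and>
    (\<forall>b\<in>B. \<forall>c\<in>B. \<forall>q. F b q \<bullet> F c q = (if b = c then 1 else 0)) \<and>
    (\<forall>N. parallel_normal_field A x N \<longrightarrow> (\<exists>k. \<forall>q. N q = (\<Sum>b\<in>B. k b *\<^sub>R F b q)))"
proof -
  fix q0 :: 'a
  define E where "E = {N q0 | N. parallel_normal_field A x N}"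
  have comb: "parallel_normal_field A x (\<lambda>q. c *\<^sub>R M q + d *\<^sub>R N q)"
    if "parallel_normal_field A x M" "parallel_normal_field A x N" for c d M N
    using parallel_combination[of "{True, False}" "\<lambda>i. if i then M else N" "\<lambda>i. if i then c else d"] that by simp
  have zero: "parallel_normal_field A x (\<lambda>q. 0)" using parallel_combination[of "{}"] by simp
  have "subspace E"
    unfolding subspace_def
  proof (intro conjI ballI allI)
    show "0 \<in> E" using zero by (auto simp: E_def)
    show "u + v \<in> E" if uv: "u \<in> E" "v \<in> E" for u v
    proof -
      obtain M N where MN: "parallel_normal_field A x M" "u = M q0" "parallel_normal_field A x N" "v = N q0"
        using uv by (auto simp: E_def)
      then show ?thesis using comb[OF MN(1,3), of 1 1] unfolding E_def
        by (intro CollectI exI[of _ "\<lambda>q. M q + N q"]) simp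
    qed
    show "c *\<^sub>R u \<in> E" if u: "u \<in> E" for c u
    proof -
      obtain M where M: "parallel_normal_field A x M" "u = M q0" using u by (auto simp: E_def)
      then show ?thesis using comb[OF M(1) zero, of c 0] unfolding E_def
        by (intro CollectI exI[of _ "\<lambda>q. c *\<^sub>R M q"]) simp
    qed
  qed
  then obtain B where B: "B \<subseteq> E" "pairwise orthogonal B" "\<And>b. b \<in> B \<Longrightarrow> norm b = 1" "independent B" "span B = E"
    using orthonormal_basis_subspace by metis
  have finB: "finite B" using B(4) independent_imp_finite by blast
  have "\<forall>b\<in>B. \<exists>N. parallel_normal_field A x N \<and> N q0 = b" using B(1) by (auto simp: E_def)
  from bchoice[OF this] obtain F where F: "\<forall>b\<in>B. parallel_normal_field A x (F b) \<and> F b q0 = b" ..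
  have orth: "F b q \<bullet> F c q = (if b = c then 1 else 0)" if bc: "b \<in> B" "c \<in> B" for b c q
  proof -
    have "F b q \<bullet> F c q = F b q0 \<bullet> F c q0"
      by (rule parallel_inner_const[OF conn]) (use F bc in auto)
    also have "\<dots> = b \<bullet> c" using F bc by simp
    also have "\<dots> = (if b = c then 1 else 0)"
      using B(2) B(3)[OF bc(1)] bc by (auto simp: pairwise_def orthogonal_def dot_square_norm)
    finally show ?thesis .
  qed
  have expand: "N q = (\<Sum>b\<in>B. (N q0 \<bullet> b) *\<^sub>R F b q)" if N: "parallel_normal_field A x N" for N q
  proof -
    \<comment> \<open>The difference is parallel, so its length is constant, and it vanishes at
      \<open>q0\<close>.\<close>
    define M where "M q = N q - (\<Sum>b\<in>B. (N q0 \<bullet> b) *\<^sub>R F b q)" for q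
    have "parallel_normal_field A x (\<lambda>q. \<Sum>b\<in>B. (N q0 \<bullet> b) *\<^sub>R F b q)"
      by (rule parallel_combination) (use F in auto)
    from comb[OF N this, of 1 "-1"] have M: "parallel_normal_field A x M"
      by (simp add: M_def[abs_def])
    have "N q0 \<in> span B" using N unfolding B(5) E_def by blast
    then have "(\<Sum>b\<in>B. (N q0 \<bullet> b) *\<^sub>R b) = N q0"
      by (intro orthonormal_basis_expand B(2,3) finB)
    then have "M q0 = 0" using F by (simp add: M_def)
    then have "M q \<bullet> M q = 0" using parallel_inner_const[OF conn M M, of q q0] by simp
    then show ?thesis by (simp add: M_def)
  qed
  show ?thesis
    by (rule exI[of _ B], rule exI[of _ F], intro conjI)
      (use finB F orth expand in \<open>blast | auto\<close>)+
qed

end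

text \<open>The pointwise inequality \<open>second_variation_le\<close> carried from a chart to the
  manifold, together with the facts that the stability inequality and the divergence theorem ask of
  \<zeta> and \<open>W\<close>.\<close>

lemma qform_le:
  fixes x :: "'a \<Rightarrow> 'b::euclidean_space" and a :: 'b and \<phi> :: "'a \<Rightarrow> real"
  assumes shr: "self_shrinker A x" and N: "parallel_normal_field A x N" and \<phi>: "smooth_map A \<phi>"
  defines "\<zeta> \<equiv> \<lambda>q. a - mder x x q a + N q"
    and "\<kappa> \<equiv> \<lambda>q. a - mder x x q a + 2 *\<^sub>R N q"
  defines "W \<equiv> \<lambda>q. (\<phi> q)\<^sup>2 *\<^sub>R mshape x q a (\<kappa> q)"
  shows "qform x (\<lambda>q. \<phi> q *\<^sub>R \<zeta> q) q \<le> (\<Sum>e\<in>Basis. (mder x \<phi> q e)\<^sup>2) * ((norm (\<zeta> q))\<^sup>2 + (norm a)\<^sup>2)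
      - (\<phi> q)\<^sup>2 * (norm (\<zeta> q))\<^sup>2 - (mdiv x W q - x q \<bullet> W q)"
    and "mder x x q (\<zeta> q) = 0" and "mder x x q (W q) = W q"
    and "smooth_map A \<zeta>" and "smooth_map A W"
proof -
  have imm: "immersion A x" using shr by (simp add: self_shrinker_def)
  note smx = immersion_smooth[OF imm]
  have smN: "smooth_map A N" and N0: "\<And>q. mder x x q (N q) = 0"
    and Npar: "\<And>q b. mder x x q (mder x N q b) = mder x N q b"
    using N unfolding parallel_iff[OF imm] by blast+
  have smp: "smooth_map A (\<lambda>q. mder x x q a)" by (intro smooth_map_mder[OF imm] smx smooth_map_const)
  show sm\<zeta>: "smooth_map A \<zeta>" unfolding \<zeta>_def by (intro smooth_map_intros smp smN)
  have sm\<kappa>: "smooth_map A \<kappa>" unfolding \<kappa>_def by (intro smooth_map_intros smp smN)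
  show smW: "smooth_map A W"
    unfolding W_def power2_eq_square by (intro smooth_map_intros smooth_map_mshape[OF imm] \<phi> sm\<kappa>)
  have sm\<eta>: "smooth_map A (\<lambda>q. \<phi> q *\<^sub>R \<zeta> q)" by (intro smooth_map_intros \<phi> sm\<zeta>)
  interpret p: linear "mder x x q" for q by (rule linear_mder[OF imm smx])
  show "mder x x q (\<zeta> q) = 0"
    by (simp add: \<zeta>_def p.add p.diff proj_idem[OF imm] N0)
  have \<kappa>0: "mder x x q (\<kappa> q) = 0" for q
    by (simp add: \<kappa>_def p.add p.diff p.scale proj_idem[OF imm] N0)
  obtain U \<psi> where ch: "(U, \<psi>) \<in> A" "q \<in> U" by (rule covers)
  let ?f = "loc U \<psi> x" and ?z = "\<psi> q"
  have z: "?z \<in> \<psi> ` U" using ch(2) by blast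
  interpret shrinker_chart ?f "\<psi> ` U" by (rule shrinker_chart_loc[OF ch(1) shr])
  have proj: "mder x x (inv_into U \<psi> y) b = tproj ?f y b" if "y \<in> \<psi> ` U" for y b
    by (rule mder_eq'[OF imm ch(1) that smx])
  have lN: "tproj ?f y (loc U \<psi> N y) = 0" if "y \<in> \<psi> ` U" for y
    using N0[of "inv_into U \<psi> y"] proj[OF that] by simp
  \<comment> \<open>The derivative of a parallel field is tangential, and the Weingarten formula
    \<open>tder_normal\<close> determines the tangential part.\<close>
  have lpar: "tder ?f (loc U \<psi> N) y b = - shape y b (loc U \<psi> N y)" if y: "y \<in> \<psi> ` U" for y b
  proof -
    have A: "tproj ?f y (tder ?f (loc U \<psi> N) y b) = tder ?f (loc U \<psi> N) y b"
      using Npar[of "inv_into U \<psi> y" b] unfolding proj[OF y] mder_eq'[OF imm ch(1) y smN] .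
    have "tproj ?f y (tder ?f (loc U \<psi> N) y b) = - shape y b (loc U \<psi> N y)"
      by (rule tder_normal[OF y smooth_on_loc[OF ch(1) smN] lN])
    then show ?thesis unfolding A .
  qed
  define Z where "Z = (\<lambda>y. a - tproj ?f y a + loc U \<psi> N y)"
  define Kp where "Kp = (\<lambda>y. a - tproj ?f y a + 2 *\<^sub>R loc U \<psi> N y)"
  define H where "H = (\<lambda>y. loc U \<psi> \<phi> y *\<^sub>R Z y)"
  define V where "V = (\<lambda>y. (loc U \<psi> \<phi> y)\<^sup>2 *\<^sub>R shape y a (Kp y))"
  have main: "(\<Sum>e\<in>Basis. (norm (tder ?f H ?z e))\<^sup>2 - 2 * (norm (shape ?z e (H ?z)))\<^sup>2) - (norm (H ?z))\<^sup>2
    \<le> (\<Sum>e\<in>Basis. (tder ?f (loc U \<psi> \<phi>) ?z e)\<^sup>2) * ((norm (Z ?z))\<^sup>2 + (norm a)\<^sup>2) - (loc U \<psi> \<phi> ?z)\<^sup>2 * (norm (Z ?z))\<^sup>2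
      - (divergence V ?z - ?f ?z \<bullet> V ?z)"
    unfolding H_def V_def Z_def Kp_def
    by (rule second_variation_le[OF z smooth_on_loc[OF ch(1) smN] lN lpar smooth_on_loc[OF ch(1) \<phi>]])
  have lZ: "loc U \<psi> \<zeta> y = Z y" and lV: "loc U \<psi> W y = V y"
    and lH: "loc U \<psi> (\<lambda>q. \<phi> q *\<^sub>R \<zeta> q) y = H y" if "y \<in> \<psi> ` U" for y
    using proj[OF that] mshape_loc[OF imm ch(1) that] by (simp_all add: \<zeta>_def Z_def W_def V_def H_def Kp_def \<kappa>_def)
  have iq: "inv_into U \<psi> ?z = q" by (rule inv_chart[OF ch])
  have 1: "mder x (\<lambda>q. \<phi> q *\<^sub>R \<zeta> q) q e = tder ?f H ?z e" for e
    unfolding mder_eq[OF imm ch sm\<eta>] by (rule tder_cong[OF open_O z lH])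
  have 2: "mdiv x W q = divergence V ?z"
    unfolding mdiv_def divergence_def mder_eq[OF imm ch smW]
    by (intro sum.cong refl arg_cong2[of _ _ _ _ "(\<bullet>)"] tder_cong[OF open_O z lV])
  have 3: "mshape x q b c = shape ?z b c" for b c
    using mshape_loc[OF imm ch(1) z, of b c] iq by simp
  have 4: "\<zeta> q = Z ?z" "W q = V ?z" "\<phi> q *\<^sub>R Z ?z = H ?z" "loc U \<psi> \<phi> ?z = \<phi> q" "?f ?z = x q"
    using lZ[OF z] lV[OF z] iq by (simp_all add: H_def)
  show "qform x (\<lambda>q. \<phi> q *\<^sub>R \<zeta> q) q \<le> (\<Sum>e\<in>Basis. (mder x \<phi> q e)\<^sup>2) * ((norm (\<zeta> q))\<^sup>2 + (norm a)\<^sup>2)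
      - (\<phi> q)\<^sup>2 * (norm (\<zeta> q))\<^sup>2 - (mdiv x W q - x q \<bullet> W q)"
    using main unfolding qform_def 1 2 3 4 mder_eq[OF imm ch \<phi>] .
  have "tproj ?f ?z (Kp ?z) = 0"
    using \<kappa>0[of q] proj[OF z] iq by (simp add: \<kappa>_def Kp_def)
  then have "tproj ?f ?z (shape ?z a (Kp ?z)) = shape ?z a (Kp ?z)" by (rule shape_normal_tangent[OF z])
  then have "tproj ?f ?z (V ?z) = V ?z" by (simp add: V_def linear_scale[OF lin_tproj[OF z]])
  then show "mder x x q (W q) = W q"
    using proj[OF z, of "W q"] by (simp add: iq 4(2))
qed

lemma vol_open_pos:
  fixes y :: "'a \<Rightarrow> 'b::euclidean_space"
  assumes imm: "immersion A y" and G: "open G" "q \<in> G"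
  shows "emeasure (vol A y) G \<noteq> 0"
proof
  assume 0: "emeasure (vol A y) G = 0"
  obtain U \<phi> where ch: "(U, \<phi>) \<in> A" "q \<in> U" by (rule covers)
  interpret immersed_chart "loc U \<phi> y" "\<phi> ` U" by (rule immersed_chart_loc[OF ch(1) imm])
  let ?d = "\<lambda>z. ennreal (sqrt (det (metric_at (loc U \<phi> y) z)))"
  have opG: "open (G \<inter> U)" using G(1) open_U[OF ch(1)] by blast
  have opI: "open (\<phi> ` (G \<inter> U))" by (rule open_image_chart[OF ch(1) opG]) auto
  have "emeasure (vol A y) (G \<inter> U) \<le> emeasure (vol A y) G"
    using G(1) by (intro emeasure_mono) (auto simp: sets_vol[OF imm])
  then have "emeasure (vol A y) (G \<inter> U) = 0" using 0 by simp
  then have "(\<integral>\<^sup>+z\<in>\<phi> ` (G \<inter> U). ?d z \<partial>lborel) = 0"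
    using is_volD[OF is_vol_vol[OF imm] ch(1), of "G \<inter> U"] opG by simp
  moreover have m: "(\<lambda>z. ?d z * indicator (\<phi> ` (G \<inter> U)) z) \<in> borel_measurable lborel"
  proof -
    have "(\<lambda>z. ennreal (indicator (\<phi> ` U) z * sqrt (det (metric_at (loc U \<phi> y) z))) * indicator (\<phi> ` (G \<inter> U)) z) \<in> borel_measurable lborel"
      using chart_density_measurable[OF imm ch(1)] opI by simp
    moreover have "ennreal (indicator (\<phi> ` U) z * sqrt (det (metric_at (loc U \<phi> y) z))) * indicator (\<phi> ` (G \<inter> U)) z
        = ?d z * indicator (\<phi> ` (G \<inter> U)) z" for z
      by (auto simp: indicator_def)
    ultimately show ?thesis by (simp only:)
  qed
  ultimately have "AE z in lborel. ?d z * indicator (\<phi> ` (G \<inter> U)) z = 0"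
    by (simp only: nn_integral_0_iff_AE)
  then have "AE z in lborel. z \<notin> \<phi> ` (G \<inter> U)"
  proof (rule AE_mp, intro AE_I2 impI notI)
    fix z assume z: "?d z * indicator (\<phi> ` (G \<inter> U)) z = 0" "z \<in> \<phi> ` (G \<inter> U)"
    then have "0 < det (metric_at (loc U \<phi> y) z)" by (intro metric_pos) auto
    then show False using z by (simp add: ennreal_eq_0_iff)
  qed
  then have "\<phi> ` (G \<inter> U) \<in> null_sets lborel"
    using opI by (subst AE_iff_null_sets) auto
  then have "negligible (\<phi> ` (G \<inter> U))"
    using null_sets_completionI by (simp add: negligible_iff_null_sets)
  moreover have "\<phi> ` (G \<inter> U) \<noteq> {}" using G(2) ch(2) by blast
  ultimately show False using open_not_negligible[OF opI] by blast
qed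

lemma integral_vol_pos:
  fixes y :: "'a \<Rightarrow> 'b::euclidean_space" and u :: "'a \<Rightarrow> real"
  assumes imm: "immersion A y" and G: "open G" "q \<in> G" and u: "integrable (vol A y) u" "\<And>p. 0 \<le> u p"
    "\<And>p. p \<in> G \<Longrightarrow> 0 < u p"
  shows "0 < (\<integral>p. u p \<partial>vol A y)"
proof -
  have "(\<integral>p. u p \<partial>vol A y) \<noteq> 0"
  proof
    assume "(\<integral>p. u p \<partial>vol A y) = 0"
    then have "AE p in vol A y. u p = 0"
      using integral_nonneg_eq_0_iff_AE[OF u(1)] u(2) by simp
    then have "AE p in vol A y. p \<notin> G"
    proof (rule AE_mp, intro AE_I2 impI notI)
      show False if "u p = 0" "p \<in> G" for p using u(3)[OF that(2)] that(1) by simp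
    qed
    then have "G \<in> null_sets (vol A y)"
      using G(1) by (subst AE_iff_null_sets) (auto simp: sets_vol[OF imm])
    then show False using vol_open_pos[OF imm G] by auto
  qed
  moreover have "0 \<le> (\<integral>p. u p \<partial>vol A y)" by (intro Bochner_Integration.integral_nonneg u(2))
  ultimately show ?thesis by simp
qed

text \<open>Moving linearly along \<eta> has velocity \<eta> at every time and acceleration zero, so
  the SN condition holds by construction and VP is a condition on \<eta> alone.\<close>

lemma VP_variation_linear:
  fixes x :: "'a \<Rightarrow> 'b::euclidean_space"
  assumes imm: "immersion A x" and \<eta>: "smooth_map A \<eta>" "\<And>q. mder x x q (\<eta> q) = 0"
    and \<epsilon>: "\<epsilon> > 0" "\<And>q t. \<bar>t\<bar> < \<epsilon> \<Longrightarrow> \<bar>t\<bar> * (\<Sum>e\<in>Basis. norm (mder x \<eta> q e)) < 1"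
    and VP: "\<And>N. parallel_normal_field A x N \<Longrightarrow> (\<integral>q. (\<eta> q \<bullet> N q) * weight x q \<partial>vol A x) = 0"
  shows "VP_variation A x \<epsilon> (\<lambda>q t. x q + t *\<^sub>R \<eta> q)"
    and "var_vel (\<lambda>q t. x q + t *\<^sub>R \<eta> q) q t = \<eta> q"
proof -
  let ?F = "\<lambda>q t. x q + t *\<^sub>R \<eta> q"
  have vel: "var_vel ?F q t = \<eta> q" for q t
    unfolding var_vel_def by (rule vector_derivative_at) (auto intro!: derivative_eq_intros)
  then show "var_vel ?F q t = \<eta> q" .
  have "smooth_on (\<lambda>(z, t). ?F (inv_into U \<phi> z) t) (\<phi> ` U \<times> {-\<epsilon><..<\<epsilon>})" if ch: "(U, \<phi>) \<in> A" for U \<phi>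
  proof -
    have op: "open (\<phi> ` U \<times> {-\<epsilon><..<\<epsilon>})" by (intro open_Times open_image[OF ch] open_greaterThanLessThan)
    have fst: "smooth_on (\<lambda>p. loc U \<phi> h (fst p)) (\<phi> ` U \<times> {-\<epsilon><..<\<epsilon>})" if "smooth_map A h" for h :: "'a \<Rightarrow> 'b"
      by (rule smooth_on_compose[OF op smooth_on_loc[OF ch that] smooth_on_fst]) auto
    have "smooth_on (\<lambda>p. loc U \<phi> x (fst p) + snd p *\<^sub>R loc U \<phi> \<eta> (fst p)) (\<phi> ` U \<times> {-\<epsilon><..<\<epsilon>})"
      by (intro smooth_intros op fst \<eta>(1) immersion_smooth imm)
    then show ?thesis by (simp add: split_def)
  qed
  moreover have "immersion A (\<lambda>q. ?F q t)" if "t \<in> {-\<epsilon><..<\<epsilon>}" for t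
    by (rule immersion_variation[OF imm \<eta>(1) \<epsilon>(2)]) (use that in \<open>auto simp: abs_less_iff\<close>)
  ultimately have "variation A x \<epsilon> ?F"
    unfolding variation_def using \<epsilon>(1) by auto
  moreover have "normal_field A x \<eta>"
    unfolding normal_field_def
  proof (intro conjI \<eta>(1) ballI)
    fix c assume "c \<in> A"
    then obtain U \<phi> where ch: "c = (U, \<phi>)" "(U, \<phi>) \<in> A" by (cases c) auto
    interpret immersed_chart "loc U \<phi> x" "\<phi> ` U" by (rule immersed_chart_loc[OF ch(2) imm])
    have "loc U \<phi> \<eta> z \<in> (tangent_at (loc U \<phi> x) z)\<^sup>\<bottom>" if z: "z \<in> \<phi> ` U" for z
      using \<eta>(2)[of "inv_into U \<phi> z"] unfolding mder_eq'[OF imm ch(2) z immersion_smooth[OF imm]] normal_iff'[OF z] by simp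
    then show "case c of (U, \<phi>) \<Rightarrow> \<forall>z\<in>\<phi> ` U. loc U \<phi> \<eta> z \<in> (tangent_at (loc U \<phi> x) z)\<^sup>\<bottom>"
      unfolding ch(1) prod.case by (rule ballI)
  qed
  moreover have "vector_derivative (var_vel ?F q) (at 0) = 0" for q
    unfolding vel[abs_def] by (rule vector_derivative_const_at)
  ultimately have "SN_variation A x \<epsilon> ?F"
    unfolding SN_variation_def vel by blast
  then show "VP_variation A x \<epsilon> ?F"
    unfolding VP_variation_def vel using VP by (simp add: weight_def)
qed

lemma stability_inequality:
  fixes x :: "'a \<Rightarrow> 'b::euclidean_space"
  assumes shr: "self_shrinker A x" and stab: "W_stable A x"
    and \<eta>: "smooth_map A \<eta>" "\<And>q. mder x x q (\<eta> q) = 0"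
    and K: "compact K" "\<And>q. q \<notin> K \<Longrightarrow> \<eta> q = 0" and G: "open G" "compact (closure G)" "K \<subseteq> G"
    and VP: "\<And>N. parallel_normal_field A x N \<Longrightarrow> (\<integral>q. (\<eta> q \<bullet> N q) * weight x q \<partial>vol A x) = 0"
  shows "0 \<le> (\<integral>q. qform x \<eta> q * weight x q \<partial>vol A x)"
proof -
  have imm: "immersion A x" using shr by (simp add: self_shrinker_def)
  obtain \<epsilon> where \<epsilon>: "\<epsilon> > 0" "\<And>q t. \<bar>t\<bar> < \<epsilon> \<Longrightarrow> \<bar>t\<bar> * (\<Sum>e\<in>Basis. norm (mder x \<eta> q e)) < 1"
    using exists_variation_range[OF imm \<eta>(1) K] by blast
  let ?F = "\<lambda>q t. x q + t *\<^sub>R \<eta> q"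
  have vp: "VP_variation A x \<epsilon> ?F" and vel: "\<And>q t. var_vel ?F q t = \<eta> q"
    by (rule VP_variation_linear[OF imm \<eta> \<epsilon> VP], assumption+)+
  have "closure {q. \<eta> q \<noteq> 0} \<subseteq> G"
  proof -
    have "{q. \<eta> q \<noteq> 0} \<subseteq> K" using K(2) by blast
    then have "closure {q. \<eta> q \<noteq> 0} \<subseteq> K" by (rule closure_minimal) (rule compact_imp_closed[OF K(1)])
    then show ?thesis using G(3) by blast
  qed
  then have "compact_variation \<epsilon> ?F"
    unfolding compact_variation_def vel using G(1,2) by blast
  then have "0 \<le> (deriv ^^ 2) (\<lambda>t. enn2real (V0 A (\<lambda>q. ?F q t))) 0"
    using stab vp unfolding W_stable_def by blast
  then show ?thesis
    using second_variation[OF shr _ \<eta> K \<epsilon>] stab unfolding W_stable_def by simp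
qed

text \<open>The order of quantifiers is the point: \<open>C\<close> is fixed before the cutoff,
  while the number \<open>c\<close>, the length of the correcting parallel field, may depend on it.
  This is what permits the cutoff radius to grow later.\<close>

lemma stability_estimate:
  fixes x :: "'a \<Rightarrow> 'b::euclidean_space" and a :: 'b
  assumes conn: "connected (UNIV :: 'a set)" and shr: "self_shrinker A x" and stab: "W_stable A x"
  shows "\<exists>C\<ge>0. \<forall>\<phi> K G. smooth_map A \<phi> \<longrightarrow> (\<forall>q. 0 \<le> \<phi> q) \<longrightarrow> compact K \<longrightarrow> (\<forall>q. q \<notin> K \<longrightarrow> \<phi> q = 0) \<longrightarrow>
    open G \<longrightarrow> compact (closure G) \<longrightarrow> K \<subseteq> G \<longrightarrow> 0 < (\<integral>q. \<phi> q * weight x q \<partial>vol A x) \<longrightarrow>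
    (\<exists>c. (\<integral>q. (\<phi> q)\<^sup>2 * (norm (a - mder x x q a) - c)\<^sup>2 * weight x q \<partial>vol A x)
      \<le> C * (\<integral>q. (\<Sum>e\<in>Basis. (mder x \<phi> q e)\<^sup>2) * weight x q \<partial>vol A x))"
proof -
  have imm: "immersion A x" using shr by (simp add: self_shrinker_def)
  note smx = immersion_smooth[OF imm]
  let ?w = "weight x" and ?M = "vol A x"
  obtain B :: "'b set" and F where B: "finite B" "\<forall>b\<in>B. parallel_normal_field A x (F b)"
    "\<forall>b\<in>B. \<forall>c\<in>B. \<forall>q. F b q \<bullet> F c q = (if b = c then 1 else 0)"
    "\<forall>N. parallel_normal_field A x N \<longrightarrow> (\<exists>k. \<forall>q. N q = (\<Sum>b\<in>B. k b *\<^sub>R F b q))"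
    using parallel_frame[OF imm conn] by (elim exE conjE)
  \<comment> \<open>A bound for |\<zeta>|^2 + |a|^2: the length of \<zeta> is at most |a| + c, the
    square of this sum is at most 2 |a|^2 + 2 c^2, and c^2 is at most \<open>card B\<close> times
    |a|^2.\<close>
  define C where "C = (2 + 2 * real (card B)) * (norm a)\<^sup>2 + (norm a)\<^sup>2"
  have smF: "smooth_map A (F b)" and F0: "mder x x q (F b q) = 0" if "b \<in> B" for b q
    using B(2) that unfolding parallel_iff[OF imm] by blast+
  have nF: "norm (F b q) = 1" if "b \<in> B" for b q
    using B(3) that by (simp add: norm_eq_sqrt_inner)
  have smp: "smooth_map A (\<lambda>q. mder x x q a)" by (intro smooth_map_mder[OF imm] smx smooth_map_const)
  have smw: "smooth_map A ?w" by (rule smooth_map_weight[OF smx])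
  have w0: "0 \<le> ?w q" for q using weight_pos[of x q] by simp
  have main: "\<exists>c. (\<integral>q. (\<phi> q)\<^sup>2 * (norm (a - mder x x q a) - c)\<^sup>2 * ?w q \<partial>?M)
      \<le> C * (\<integral>q. (\<Sum>e\<in>Basis. (mder x \<phi> q e)\<^sup>2) * ?w q \<partial>?M)"
    if \<phi>: "smooth_map A \<phi>" "\<And>q. 0 \<le> \<phi> q" and K: "compact K" "\<And>q. q \<notin> K \<Longrightarrow> \<phi> q = 0"
      and G: "open G" "compact (closure G)" "K \<subseteq> G" and m: "0 < (\<integral>q. \<phi> q * ?w q \<partial>?M)" for \<phi> K G
  proof -
    have int: "integrable ?M u" if "continuous_on UNIV u" "\<And>q. q \<notin> K \<Longrightarrow> u q = 0" for u :: "'a \<Rightarrow> real"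
      by (rule integrable_compact_support[OF imm K(1) that])
    define m where "m = (\<integral>q. \<phi> q * ?w q \<partial>?M)"
    define l where "l b = (\<integral>q. \<phi> q * (a \<bullet> F b q) * ?w q \<partial>?M)" for b
    \<comment> \<open>Minus the average of a \<bullet> F b with respect to the measure with density
      \<phi> times the Gaussian weight. It makes the test field orthogonal to each frame field, and
      being an average of numbers of size at most |a| it is bounded independently of \<phi>.\<close>
    define k where "k b = - l b / m" for b
    define N where "N q = (\<Sum>b\<in>B. k b *\<^sub>R F b q)" for q
    define c where "c = sqrt (\<Sum>b\<in>B. (k b)\<^sup>2)"
    have m_pos: "0 < m" using m by (simp add: m_def)
    have int_m: "integrable ?M (\<lambda>q. \<phi> q * ?w q)"
      by (rule int) (auto intro!: smooth_map_continuous smooth_map_intros \<phi> smw simp: K)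
    have int_l: "integrable ?M (\<lambda>q. \<phi> q * (a \<bullet> F b q) * ?w q)" if "b \<in> B" for b
      by (rule int) (auto intro!: smooth_map_continuous smooth_map_intros \<phi> smw smF that simp: K)
    have NF: "N q \<bullet> F b q = k b" if b: "b \<in> B" for b q
    proof -
      have "N q \<bullet> F b q = (\<Sum>c\<in>B. k c * (if c = b then 1 else 0))"
        unfolding N_def inner_sum_left using B(3) b by (intro sum.cong refl) simp
      also have "\<dots> = k b" using B(1) b by (simp add: sum.delta' mult_delta_right)
      finally show ?thesis .
    qed
    have normN: "norm (N q) = c" for q
    proof -
      have "N q \<bullet> N q = (\<Sum>b\<in>B. k b * (N q \<bullet> F b q))"
        by (subst (2) N_def) (simp add: inner_sum_right)
      also have "\<dots> = (\<Sum>b\<in>B. (k b)\<^sup>2)" by (intro sum.cong refl) (simp add: NF power2_eq_square)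
      finally show ?thesis by (simp add: norm_eq_sqrt_inner c_def)
    qed
    have c_le: "c\<^sup>2 \<le> real (card B) * (norm a)\<^sup>2"
    proof -
      have "(k b)\<^sup>2 \<le> (norm a)\<^sup>2" if b: "b \<in> B" for b
      proof -
        have "\<bar>l b\<bar> \<le> (\<integral>q. \<bar>\<phi> q * (a \<bullet> F b q) * ?w q\<bar> \<partial>?M)"
          unfolding l_def by (rule integral_abs_bound)
        also have "\<dots> \<le> (\<integral>q. norm a * (\<phi> q * ?w q) \<partial>?M)"
        proof (rule Bochner_Integration.integral_mono)
          show "integrable ?M (\<lambda>q. \<bar>\<phi> q * (a \<bullet> F b q) * ?w q\<bar>)" using int_l[OF b] by (rule integrable_abs)
          show "integrable ?M (\<lambda>q. norm a * (\<phi> q * ?w q))" using int_m by (rule integrable_mult_right)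
          fix q
          have "\<bar>a \<bullet> F b q\<bar> \<le> norm a" using Cauchy_Schwarz_ineq2[of a "F b q"] nF[OF b] by simp
          then have "\<phi> q * ?w q * \<bar>a \<bullet> F b q\<bar> \<le> \<phi> q * ?w q * norm a"
            using \<phi>(2)[of q] w0[of q] by (intro mult_left_mono) auto
          then show "\<bar>\<phi> q * (a \<bullet> F b q) * ?w q\<bar> \<le> norm a * (\<phi> q * ?w q)"
            using \<phi>(2)[of q] w0[of q] by (simp add: abs_mult mult_ac)
        qed
        also have "\<dots> = norm a * m" by (simp add: m_def)
        finally have "\<bar>k b\<bar> \<le> norm a" using m_pos by (simp add: k_def abs_divide field_simps)
        then show ?thesis by (simp add: abs_le_square_iff[symmetric])
      qed
      then have "(\<Sum>b\<in>B. (k b)\<^sup>2) \<le> real (card B) * (norm a)\<^sup>2"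
        by (rule sum_bounded_above)
      moreover have "c\<^sup>2 = (\<Sum>b\<in>B. (k b)\<^sup>2)" by (simp add: c_def sum_nonneg)
      ultimately show ?thesis by simp
    qed
    have parN: "parallel_normal_field A x N"
      unfolding N_def[abs_def] by (rule parallel_combination[OF imm]) (use B(2) in blast)
    define \<zeta> where "\<zeta> = (\<lambda>q. a - mder x x q a + N q)"
    define W where "W = (\<lambda>q. (\<phi> q)\<^sup>2 *\<^sub>R mshape x q a (a - mder x x q a + 2 *\<^sub>R N q))"
    have ql: "qform x (\<lambda>q. \<phi> q *\<^sub>R \<zeta> q) q \<le> (\<Sum>e\<in>Basis. (mder x \<phi> q e)\<^sup>2) * ((norm (\<zeta> q))\<^sup>2 + (norm a)\<^sup>2)
        - (\<phi> q)\<^sup>2 * (norm (\<zeta> q))\<^sup>2 - (mdiv x W q - x q \<bullet> W q)"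
      "mder x x q (\<zeta> q) = 0" "mder x x q (W q) = W q" "smooth_map A \<zeta>" "smooth_map A W" for q
      unfolding \<zeta>_def W_def by (rule qform_le[OF shr parN \<phi>(1)])+
    have sm\<eta>: "smooth_map A (\<lambda>q. \<phi> q *\<^sub>R \<zeta> q)" by (intro smooth_map_intros \<phi> ql(4))
    have \<eta>0: "mder x x q (\<phi> q *\<^sub>R \<zeta> q) = 0" for q
      by (simp add: linear_scale[OF lin_proj[OF imm]] ql(2))
    have K\<eta>: "\<phi> q *\<^sub>R \<zeta> q = 0" if "q \<notin> K" for q using K(2)[OF that] by simp
    have VP: "(\<integral>q. ((\<phi> q *\<^sub>R \<zeta> q) \<bullet> N' q) * ?w q \<partial>?M) = 0" if N': "parallel_normal_field A x N'" for N'
    proof -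
      obtain k' where k': "\<forall>q. N' q = (\<Sum>b\<in>B. k' b *\<^sub>R F b q)" using B(4) N' by blast
      have \<zeta>F: "\<zeta> q \<bullet> F b q = a \<bullet> F b q + k b" if b: "b \<in> B" for b q
        using proj_sym[OF imm, of q a "F b q"] F0[OF b, of q]
        by (simp add: \<zeta>_def inner_add_left inner_diff_left NF[OF b])
      have "((\<phi> q *\<^sub>R \<zeta> q) \<bullet> N' q) * ?w q
          = (\<Sum>b\<in>B. k' b * (\<phi> q * (a \<bullet> F b q) * ?w q + k b * (\<phi> q * ?w q)))" for q
        unfolding k'[rule_format] inner_sum_right sum_distrib_right
        by (intro sum.cong refl) (simp add: \<zeta>F algebra_simps)
      then have "(\<integral>q. ((\<phi> q *\<^sub>R \<zeta> q) \<bullet> N' q) * ?w q \<partial>?M)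
          = (\<integral>q. (\<Sum>b\<in>B. k' b * (\<phi> q * (a \<bullet> F b q) * ?w q + k b * (\<phi> q * ?w q))) \<partial>?M)" by simp
      also have "\<dots> = (\<Sum>b\<in>B. \<integral>q. k' b * (\<phi> q * (a \<bullet> F b q) * ?w q + k b * (\<phi> q * ?w q)) \<partial>?M)"
        by (rule Bochner_Integration.integral_sum)
          (intro integrable_mult_right Bochner_Integration.integrable_add int_l int_m)
      also have "\<dots> = (\<Sum>b\<in>B. k' b * (l b + k b * m))"
        by (intro sum.cong refl)
          (simp add: l_def m_def Bochner_Integration.integral_add[OF int_l integrable_mult_right[OF int_m]])
      also have "\<dots> = 0" using m_pos by (intro sum.neutral) (simp add: k_def)
      finally show ?thesis .
    qed
    let ?g = "\<lambda>q. \<Sum>e\<in>Basis. (mder x \<phi> q e)\<^sup>2"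
    have cg: "continuous_on UNIV ?g"
      by (intro continuous_intros smooth_map_continuous smooth_map_mder[OF imm] \<phi> smooth_map_const)
    have g0: "?g q = 0" if "q \<notin> K" for q
      using mder_zero_outside[OF imm \<phi>(1) compact_imp_closed[OF K(1)] K(2) that] by simp
    have c\<zeta>: "continuous_on UNIV \<zeta>" by (rule smooth_map_continuous[OF ql(4)])
    note cont = smooth_map_continuous[OF smw] smooth_map_continuous[OF \<phi>(1)] smooth_map_continuous[OF smp] c\<zeta> cg
      smooth_map_continuous[OF smooth_map_qform[OF imm sm\<eta>]]
    have int1: "integrable ?M (\<lambda>q. ?g q * ((norm (\<zeta> q))\<^sup>2 + (norm a)\<^sup>2) * ?w q)"
      by (rule int, intro continuous_intros cont, simp add: g0)
    have int2: "integrable ?M (\<lambda>q. (\<phi> q)\<^sup>2 * (norm (\<zeta> q))\<^sup>2 * ?w q)"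
      by (rule int, intro continuous_intros cont, simp add: K)
    have int3: "integrable ?M (wdiv x W)"
      by (rule integrable_wdiv[OF imm ql(5) K(1)]) (simp add: W_def K)
    have int4: "integrable ?M (\<lambda>q. qform x (\<lambda>q. \<phi> q *\<^sub>R \<zeta> q) q * ?w q)"
      by (rule int, intro continuous_intros cont,
          simp add: qform_zero_outside[OF imm sm\<eta> compact_imp_closed[OF K(1)] K\<eta>])
    have int5: "integrable ?M (\<lambda>q. (\<phi> q)\<^sup>2 * (norm (a - mder x x q a) - c)\<^sup>2 * ?w q)"
      by (rule int, intro continuous_intros cont, simp add: K)
    have int6: "integrable ?M (\<lambda>q. ?g q * ?w q)"
      by (rule int, intro continuous_intros cont, simp add: g0)
    have "0 \<le> (\<integral>q. qform x (\<lambda>q. \<phi> q *\<^sub>R \<zeta> q) q * ?w q \<partial>?M)"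
      by (rule stability_inequality[OF shr stab sm\<eta> \<eta>0 K(1) K\<eta> G VP])
    also have "\<dots> \<le> (\<integral>q. ?g q * ((norm (\<zeta> q))\<^sup>2 + (norm a)\<^sup>2) * ?w q - (\<phi> q)\<^sup>2 * (norm (\<zeta> q))\<^sup>2 * ?w q - wdiv x W q \<partial>?M)"
    proof (rule Bochner_Integration.integral_mono[OF int4])
      show "integrable ?M (\<lambda>q. ?g q * ((norm (\<zeta> q))\<^sup>2 + (norm a)\<^sup>2) * ?w q - (\<phi> q)\<^sup>2 * (norm (\<zeta> q))\<^sup>2 * ?w q - wdiv x W q)"
        by (intro Bochner_Integration.integrable_diff int1 int2 int3)
      fix q
      show "qform x (\<lambda>q. \<phi> q *\<^sub>R \<zeta> q) q * ?w q
          \<le> ?g q * ((norm (\<zeta> q))\<^sup>2 + (norm a)\<^sup>2) * ?w q - (\<phi> q)\<^sup>2 * (norm (\<zeta> q))\<^sup>2 * ?w q - wdiv x W q"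
        using mult_right_mono[OF ql(1) w0, of q q] by (simp add: wdiv_def[OF imm] left_diff_distrib)
    qed
    also have "\<dots> = (\<integral>q. ?g q * ((norm (\<zeta> q))\<^sup>2 + (norm a)\<^sup>2) * ?w q \<partial>?M) - (\<integral>q. (\<phi> q)\<^sup>2 * (norm (\<zeta> q))\<^sup>2 * ?w q \<partial>?M)
        - (\<integral>q. wdiv x W q \<partial>?M)"
      by (simp only: Bochner_Integration.integral_diff[OF Bochner_Integration.integrable_diff[OF int1 int2] int3]
          Bochner_Integration.integral_diff[OF int1 int2])
    also have "(\<integral>q. wdiv x W q \<partial>?M) = 0"
      by (rule divergence_theorem[OF imm ql(5) ql(3) K(1)]) (simp add: W_def K)
    finally have est: "(\<integral>q. (\<phi> q)\<^sup>2 * (norm (\<zeta> q))\<^sup>2 * ?w q \<partial>?M) \<le> (\<integral>q. ?g q * ((norm (\<zeta> q))\<^sup>2 + (norm a)\<^sup>2) * ?w q \<partial>?M)"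
      by simp
    have "(\<integral>q. (\<phi> q)\<^sup>2 * (norm (a - mder x x q a) - c)\<^sup>2 * ?w q \<partial>?M) \<le> (\<integral>q. (\<phi> q)\<^sup>2 * (norm (\<zeta> q))\<^sup>2 * ?w q \<partial>?M)"
    proof (rule Bochner_Integration.integral_mono[OF int5 int2])
      fix q
      have "\<bar>norm (a - mder x x q a) - c\<bar> \<le> norm (\<zeta> q)"
        using norm_triangle_ineq3[of "a - mder x x q a" "- N q"] by (simp add: \<zeta>_def normN)
      then have "(norm (a - mder x x q a) - c)\<^sup>2 \<le> (norm (\<zeta> q))\<^sup>2"
        by (simp add: abs_le_square_iff[symmetric])
      then show "(\<phi> q)\<^sup>2 * (norm (a - mder x x q a) - c)\<^sup>2 * ?w q \<le> (\<phi> q)\<^sup>2 * (norm (\<zeta> q))\<^sup>2 * ?w q"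
        by (intro mult_right_mono mult_left_mono w0) auto
    qed
    also note est
    also have "(\<integral>q. ?g q * ((norm (\<zeta> q))\<^sup>2 + (norm a)\<^sup>2) * ?w q \<partial>?M) \<le> (\<integral>q. C * (?g q * ?w q) \<partial>?M)"
    proof (rule Bochner_Integration.integral_mono[OF int1 integrable_mult_right[OF int6]])
      fix q
      have "norm (\<zeta> q) \<le> norm a + c"
        using norm_triangle_ineq[of "a - mder x x q a" "N q"] norm_normal_le[OF imm, of a q] by (simp add: \<zeta>_def normN)
      then have "(norm (\<zeta> q))\<^sup>2 \<le> (norm a + c)\<^sup>2" by (intro power_mono) auto
      also have "\<dots> \<le> 2 * (norm a)\<^sup>2 + 2 * c\<^sup>2"
        using zero_le_power2[of "norm a - c"] by (simp add: power2_eq_square algebra_simps)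
      finally have "(norm (\<zeta> q))\<^sup>2 + (norm a)\<^sup>2 \<le> C" using c_le by (simp add: C_def algebra_simps)
      then have "?g q * ((norm (\<zeta> q))\<^sup>2 + (norm a)\<^sup>2) * ?w q \<le> ?g q * C * ?w q"
        by (intro mult_right_mono mult_left_mono w0 sum_nonneg) auto
      then show "?g q * ((norm (\<zeta> q))\<^sup>2 + (norm a)\<^sup>2) * ?w q \<le> C * (?g q * ?w q)" by (simp add: mult_ac)
    qed
    finally show ?thesis by (intro exI[of _ c]) simp
  qed
  show ?thesis
    by (rule exI[of _ C], intro conjI allI impI)
      (simp add: C_def, rule main, auto)
qed

section \<open>Radial cutoff functions\<close>

lemma mder_chain_real:
  fixes x :: "'a \<Rightarrow> 'b::euclidean_space" and u :: "'a \<Rightarrow> real"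
  assumes imm: "immersion A x" and u: "smooth_map A u" and g: "smooth_on g (UNIV :: real set)"
    and gu: "smooth_map A (\<lambda>q. g (u q))"
  shows "mder x (\<lambda>q. g (u q)) q e = dird g (u q) (mder x u q e)"
proof -
  obtain U \<phi> where ch: "(U, \<phi>) \<in> A" "q \<in> U" by (rule covers)
  have z: "\<phi> q \<in> \<phi> ` U" using ch(2) by blast
  have du: "loc U \<phi> u differentiable (at (\<phi> q))"
    by (rule smooth_on_imp_differentiable[OF smooth_on_loc[OF ch(1) u] z])
  have dg: "g differentiable (at (loc U \<phi> u (\<phi> q)))"
    by (rule smooth_on_imp_differentiable[OF g]) simp
  have "mder x (\<lambda>q. g (u q)) q e = dird (\<lambda>z. g (loc U \<phi> u z)) (\<phi> q) (pinv (loc U \<phi> x) (\<phi> q) e)"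
    unfolding mder_eq[OF imm ch gu] tder_def by (simp add: o_def)
  also have "\<dots> = dird g (loc U \<phi> u (\<phi> q)) (dird (loc U \<phi> u) (\<phi> q) (pinv (loc U \<phi> x) (\<phi> q) e))"
    by (rule dird_compose[OF du dg])
  finally show ?thesis
    unfolding mder_eq[OF imm ch u] tder_def loc_eq[OF ch] .
qed

text \<open>The cutoff depends on the Euclidean distance from the origin. The tangential gradient of
  |x|^2 is twice the tangential part of x, of length at most 2 |x|, and |x| is at most R on the
  support; division by R^2 leaves a gradient of order 1/R.\<close>

lemma cutoff_gradient:
  fixes x :: "'a \<Rightarrow> 'b::euclidean_space"
  assumes imm: "immersion A x"
  shows "\<exists>B\<ge>0. \<forall>R>0. \<forall>q. (\<Sum>e\<in>Basis. (mder x (\<lambda>q. bump (1 - (x q \<bullet> x q) / R\<^sup>2)) q e)\<^sup>2) \<le> B / R\<^sup>2"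
proof -
  note smx = immersion_smooth[OF imm]
  have "continuous_on {0..1} (\<lambda>s. dird bump s 1)"
    by (rule continuous_on_subset[OF smooth_on_imp_continuous_on[OF smooth_on_dird[OF smooth_on_bump_UNIV]]]) simp
  from compact_imp_bounded[OF compact_continuous_image[OF this compact_Icc]]
  obtain b where b: "\<forall>v\<in>(\<lambda>s. dird bump s 1) ` {0..1}. norm v \<le> b" unfolding bounded_iff ..
  have "(\<Sum>e\<in>Basis. (mder x (\<lambda>q. bump (1 - (x q \<bullet> x q) / R\<^sup>2)) q e)\<^sup>2) \<le> 4 * b\<^sup>2 / R\<^sup>2" if R: "R > 0" for R q
  proof -
    define u where "u q = 1 - (x q \<bullet> x q) / R\<^sup>2" for q
    define b0 where "b0 = dird bump (u q) 1"
    have u_eq: "u = (\<lambda>q. 1 - (1 / R\<^sup>2) * (x q \<bullet> x q))" by (auto simp: u_def)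
    have smu: "smooth_map A u" unfolding u_eq by (intro smooth_map_intros smx)
    have smd: "bump differentiable (at (u q))"
      by (rule smooth_on_imp_differentiable[OF smooth_on_bump_UNIV]) simp
    have du: "mder x u q e = - (2 / R\<^sup>2) * (mder x x q (x q) \<bullet> e)" for e
    proof -
      obtain U \<phi> where ch: "(U, \<phi>) \<in> A" "q \<in> U" "\<phi> q \<in> \<phi> ` U" "immersed_chart (loc U \<phi> x) (\<phi> ` U)"
        by (rule chart_point[OF imm])
      interpret immersed_chart "loc U \<phi> x" "\<phi> ` U" by (rule ch(4))
      have s1: "smooth_on (\<lambda>z. loc U \<phi> x z \<bullet> loc U \<phi> x z) (\<phi> ` U)" by (intro smooth_intros open_O smooth_f)
      have s2: "smooth_on (\<lambda>z. (1 / R\<^sup>2) * (loc U \<phi> x z \<bullet> loc U \<phi> x z)) (\<phi> ` U)" by (intro smooth_intros open_O smooth_f)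
      have "loc U \<phi> u = (\<lambda>z. 1 - (1 / R\<^sup>2) * (loc U \<phi> x z \<bullet> loc U \<phi> x z))" by (simp add: u_eq o_def)
      then have "mder x u q e = tder (loc U \<phi> x) (\<lambda>z. 1 - (1 / R\<^sup>2) * (loc U \<phi> x z \<bullet> loc U \<phi> x z)) (\<phi> q) e"
        unfolding mder_eq[OF imm ch(1,2) smu] by (simp only:)
      also have "\<dots> = - ((1 / R\<^sup>2) * (2 * (tproj (loc U \<phi> x) (\<phi> q) e \<bullet> x q)))"
        unfolding tder_diff[OF ch(3) smooth_on_const s2] tder_const
          tder_linear[OF bounded_linear_mult_right ch(3) s1] tder_inner[OF ch(3) smooth_f smooth_f]
        by (simp add: inner_commute inv_chart[OF ch(1,2)])
      also have "tproj (loc U \<phi> x) (\<phi> q) e = mder x x q e" by (rule mder_eq[OF imm ch(1,2) smx, symmetric])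
      finally show ?thesis using proj_sym[OF imm, of q "x q" e] by (simp add: inner_commute)
    qed
    have "mder x (\<lambda>q. bump (u q)) q e = dird bump (u q) (mder x u q e)" for e
      by (rule mder_chain_real[OF imm smu smooth_on_bump_UNIV smooth_map_bump[OF smu]])
    also have "dird bump (u q) (mder x u q e) = mder x u q e * b0" for e
      using linear_scale[OF linear_frechet_derivative[OF smd], of "mder x u q e" 1] by (simp add: b0_def)
    finally have d: "mder x (\<lambda>q. bump (u q)) q e = - (2 * b0 / R\<^sup>2) * (mder x x q (x q) \<bullet> e)" for e
      by (simp add: du)
    have "(\<Sum>e\<in>Basis. (mder x (\<lambda>q. bump (u q)) q e)\<^sup>2)
        = (2 * b0 / R\<^sup>2)\<^sup>2 * (mder x x q (x q) \<bullet> mder x x q (x q))"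
      unfolding d power_mult_distrib euclidean_inner[of "mder x x q (x q)" "mder x x q (x q)"]
      by (simp add: sum_distrib_left power2_eq_square)
    also have "\<dots> \<le> (2 * b0 / R\<^sup>2)\<^sup>2 * (x q \<bullet> x q)"
    proof (rule mult_left_mono)
      have "mder x x q (x q) \<bullet> mder x x q (x q) = x q \<bullet> mder x x q (x q)"
        using proj_sym[OF imm, of q "x q" "mder x x q (x q)"] by (simp add: proj_idem[OF imm])
      moreover have "0 \<le> (x q - mder x x q (x q)) \<bullet> (x q - mder x x q (x q))" by simp
      ultimately show "mder x x q (x q) \<bullet> mder x x q (x q) \<le> x q \<bullet> x q"
        by (simp add: inner_diff_left inner_diff_right inner_commute)
    qed simp
    \<comment> \<open>Either the argument of \<open>bump\<close> lies in [0, 1], where its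
      derivative is at most \<open>b\<close> and |x| is at most R, or it is negative and the
      derivative vanishes.\<close>
    also have "\<dots> \<le> 4 * b\<^sup>2 / R\<^sup>2"
    proof (cases "0 \<le> u q")
      case True
      then have xR: "x q \<bullet> x q \<le> R\<^sup>2" using R by (simp add: u_def field_simps)
      have "u q \<le> 1" using R by (simp add: u_def)
      then have "\<bar>b0\<bar> \<le> b" using b True by (simp add: b0_def)
      then have "b0\<^sup>2 \<le> b\<^sup>2" using abs_le_square_iff[of b0 b] by simp
      then have "(2 * b0 / R\<^sup>2)\<^sup>2 * (x q \<bullet> x q) \<le> (4 * b\<^sup>2 / (R\<^sup>2)\<^sup>2) * R\<^sup>2"
        using xR by (intro mult_mono) (auto simp: power_divide power_mult_distrib intro!: divide_right_mono)
      also have "\<dots> = 4 * b\<^sup>2 / R\<^sup>2" using R by (simp add: power2_eq_square)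
      finally show ?thesis .
    next
      case False
      have "dird bump (u q) = dird (\<lambda>s. 0) (u q)"
        by (rule dird_cong[of "{..<0}"]) (use False in auto)
      then have "b0 = 0" by (simp add: b0_def)
      then show ?thesis by simp
    qed
    finally show ?thesis unfolding u_def .
  qed
  then show ?thesis by (intro exI[of _ "4 * b\<^sup>2"]) simp
qed

end

section \<open>Stable shrinkers are planes\<close>

context atlas
begin

text \<open>Suppose the length takes two values at distance \<delta>. Whatever number
  \<open>c\<close> the estimate produces, it is at least \<delta>/2 away from one of them, so the
  left side is bounded below independently of the radius, while the right side is of order 1/R^2 by
  \<open>cutoff_gradient\<close> and the finite weighted volume.\<close>

lemma norm_normal_const:
  fixes x :: "'a \<Rightarrow> 'b::euclidean_space" and a :: 'b
  assumes conn: "connected (UNIV :: 'a set)" and shr: "self_shrinker A x" and stab: "W_stable A x"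
    and proper: "\<And>R. compact {q. norm (x q) \<le> R}"
  shows "norm (a - mder x x p a) = norm (a - mder x x q a)"
proof (rule ccontr)
  assume neq: "norm (a - mder x x p a) \<noteq> norm (a - mder x x q a)"
  have imm: "immersion A x" using shr by (simp add: self_shrinker_def)
  note smx = immersion_smooth[OF imm]
  let ?w = "weight x" and ?M = "vol A x"
  define \<nu> where "\<nu> r = norm (a - mder x x r a)" for r
  define \<delta> where "\<delta> = \<bar>\<nu> p - \<nu> q\<bar>"
  have \<delta>: "\<delta> > 0" using neq by (simp add: \<delta>_def \<nu>_def)
  have cx: "continuous_on UNIV x" by (rule smooth_map_continuous[OF smx])
  have cw: "continuous_on UNIV ?w" by (rule smooth_map_continuous[OF smooth_map_weight[OF smx]])
  have c\<nu>: "continuous_on UNIV \<nu>"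
    unfolding \<nu>_def[abs_def]
    by (intro continuous_intros smooth_map_continuous smooth_map_mder[OF imm] smx smooth_map_const)
  have wpos: "0 < ?w r" for r by (rule weight_pos)
  have mM: "u \<in> borel_measurable ?M" if "u \<in> borel_measurable borel" for u :: "'a \<Rightarrow> real"
    using that by (simp cong: measurable_cong_sets add: sets_vol[OF imm])
  have int_w: "integrable ?M ?w"
  proof (rule integrableI_nonneg)
    show "?w \<in> borel_measurable ?M" by (intro mM borel_measurable_continuous_onI cw)
    show "(\<integral>\<^sup>+ r. ennreal (?w r) \<partial>?M) < \<infinity>"
      using stab by (simp add: W_stable_def V0_def weight_def)
  qed (use wpos in \<open>auto intro: less_imp_le\<close>)
  define V where "V = (\<integral>r. ?w r \<partial>?M)"
  have V0: "0 \<le> V" unfolding V_def by (rule Bochner_Integration.integral_nonneg) (simp add: less_imp_le[OF wpos])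
  obtain C where C: "C \<ge> 0" and est: "\<And>\<phi> K G. smooth_map A \<phi> \<Longrightarrow> (\<forall>q. 0 \<le> \<phi> q) \<Longrightarrow> compact K \<Longrightarrow> (\<forall>q. q \<notin> K \<longrightarrow> \<phi> q = 0) \<Longrightarrow>
    open G \<Longrightarrow> compact (closure G) \<Longrightarrow> K \<subseteq> G \<Longrightarrow> 0 < (\<integral>q. \<phi> q * ?w q \<partial>?M) \<Longrightarrow>
    (\<exists>c. (\<integral>q. (\<phi> q)\<^sup>2 * (\<nu> q - c)\<^sup>2 * ?w q \<partial>?M)
      \<le> C * (\<integral>q. (\<Sum>e\<in>Basis. (mder x \<phi> q e)\<^sup>2) * ?w q \<partial>?M))"
    using stability_estimate[OF conn shr stab, of a] unfolding \<nu>_def by (elim exE conjE) blast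
  obtain B where B: "B \<ge> 0" and grad: "\<And>R q. R > 0 \<Longrightarrow>
      (\<Sum>e\<in>Basis. (mder x (\<lambda>q. bump (1 - (x q \<bullet> x q) / R\<^sup>2)) q e)\<^sup>2) \<le> B / R\<^sup>2"
    using cutoff_gradient[OF imm] by blast
  define r0 where "r0 = norm (x p) + norm (x q) + 1"
  have r0: "r0 \<ge> 1" "norm (x p) < r0" "norm (x q) < r0"
    unfolding r0_def using norm_ge_zero[of "x p"] norm_ge_zero[of "x q"] by linarith+
  \<comment> \<open>On \<open>N s\<close> the length stays within \<delta>/4 of its value at
    \<open>s\<close>, which leaves a distance \<delta>/4 to \<open>c\<close>. The bound
    \<open>r0\<close> keeps the set where the cutoff is not small.\<close>
  define N where "N s = {r. \<bar>\<nu> r - \<nu> s\<bar> < \<delta> / 4 \<and> norm (x r) < r0}" for s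
  define I where "I s = (\<integral>r. indicator (N s) r * ?w r \<partial>?M)" for s
  have opN: "open (N s)" for s
    unfolding N_def by (intro open_Collect_conj open_Collect_less continuous_intros c\<nu> cx)
  have int_N: "integrable ?M (\<lambda>r. indicator (N s) r * ?w r)" for s
    using integrable_mult_indicator[OF _ int_w, of "N s"] opN by (simp add: sets_vol[OF imm])
  have I_pos: "0 < I s" if "s \<in> {p, q}" for s
    unfolding I_def
  proof (rule integral_vol_pos[OF imm opN _ int_N])
    show "s \<in> N s" using that \<delta> r0 by (auto simp: N_def)
  qed (auto simp: indicator_def wpos less_imp_le[OF wpos])
  \<comment> \<open>The lower bound for the left side, valid for both possible centres: the minimum
    makes it independent of which of \<open>p\<close> and \<open>q\<close> the number
    \<open>c\<close> avoids.\<close>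
  define k where "k = (bump (1/2))\<^sup>2 * (\<delta> / 4)\<^sup>2 * min (I p) (I q)"
  have b_pos: "0 < bump (1/2)" by simp
  have k_pos: "0 < k"
    unfolding k_def using \<delta> I_pos[of p] I_pos[of q] by (intro mult_pos_pos zero_less_power b_pos) auto
  \<comment> \<open>R \<ge> 2 r0 puts the cutoff above \<open>bump (1/2)\<close> on both sets
    \<open>N s\<close>. The second summand makes R exceed C B V / k, while the estimate will give
    R^2 \<le> C B V / k, which is impossible as R \<ge> 1.\<close>
  define R where "R = 2 * r0 + C * B * V / k"
  have CBV: "0 \<le> C * B * V / k" using C B V0 k_pos by simp
  have R: "R \<ge> 2 * r0" "R \<ge> 1" using CBV r0 by (auto simp: R_def)
  define \<phi> where "\<phi> r = bump (1 - (x r \<bullet> x r) / R\<^sup>2)" for r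
  define K where "K = {r. norm (x r) \<le> R}"
  define G where "G = {r. norm (x r) < R + 1}"
  have sm\<phi>: "smooth_map A \<phi>"
  proof -
    have "smooth_map A (\<lambda>r. bump (1 - (1 / R\<^sup>2) * (x r \<bullet> x r)))" by (intro smooth_map_intros smx)
    then show ?thesis by (simp add: \<phi>_def[abs_def])
  qed
  have \<phi>0: "\<phi> r = 0" if "r \<notin> K" for r
  proof -
    have "R\<^sup>2 \<le> (norm (x r))\<^sup>2" using that R by (intro power_mono) (auto simp: K_def)
    then have "1 \<le> (x r \<bullet> x r) / R\<^sup>2" using R by (simp add: power2_norm_eq_inner)
    then show ?thesis by (simp add: \<phi>_def)
  qed
  have cG: "compact (closure G)"
  proof -
    have "closure G \<subseteq> {r. norm (x r) \<le> R + 1}"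
      by (rule closure_minimal) (auto simp: G_def intro!: closed_Collect_le continuous_intros cx)
    then have "{r. norm (x r) \<le> R + 1} \<inter> closure G = closure G" by blast
    then show ?thesis using compact_Int_closed[OF proper[of "R + 1"] closed_closure[of G]] by simp
  qed
  have c\<phi>: "continuous_on UNIV \<phi>" by (rule smooth_map_continuous[OF sm\<phi>])
  have \<phi>_nonneg: "0 \<le> \<phi> r" for r by (simp add: \<phi>_def)
  have cK: "compact K" unfolding K_def by (rule proper)
  have int: "integrable ?M u" if "continuous_on UNIV u" "\<And>r. r \<notin> K \<Longrightarrow> u r = 0" for u :: "'a \<Rightarrow> real"
    by (rule integrable_compact_support[OF imm cK that])
  have half: "bump (1/2) \<le> \<phi> r" if "norm (x r) < r0" for r
  proof -
    have "(norm (x r))\<^sup>2 \<le> (R / 2)\<^sup>2" using that R by (intro power_mono) auto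
    also have "\<dots> \<le> R\<^sup>2 / 2" by (simp add: power2_eq_square)
    finally have "(x r \<bullet> x r) / R\<^sup>2 \<le> 1 / 2" using R by (simp add: power2_norm_eq_inner field_simps)
    then show ?thesis unfolding \<phi>_def by (intro bump_mono) simp
  qed
  have m: "0 < (\<integral>r. \<phi> r * ?w r \<partial>?M)"
  proof (rule integral_vol_pos[OF imm opN[of p]])
    show "p \<in> N p" using \<delta> r0 by (simp add: N_def)
    show "integrable ?M (\<lambda>r. \<phi> r * ?w r)" by (rule int) (auto intro!: continuous_intros c\<phi> cw simp: \<phi>0)
    show "0 < \<phi> r * ?w r" if "r \<in> N p" for r
      using half[of r] that wpos[of r] b_pos by (intro mult_pos_pos) (auto simp: N_def simp del: bump_pos_iff)
  qed (use \<phi>_nonneg wpos in \<open>auto simp: less_imp_le\<close>)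
  have KG: "K \<subseteq> G" by (auto simp: K_def G_def)
  have opG: "open G" unfolding G_def by (intro open_Collect_less continuous_intros cx)
  have \<phi>': "\<forall>r. 0 \<le> \<phi> r" "\<forall>r. r \<notin> K \<longrightarrow> \<phi> r = 0" using \<phi>_nonneg \<phi>0 by simp_all
  obtain c where c: "(\<integral>r. (\<phi> r)\<^sup>2 * (\<nu> r - c)\<^sup>2 * ?w r \<partial>?M)
      \<le> C * (\<integral>r. (\<Sum>e\<in>Basis. (mder x \<phi> r e)\<^sup>2) * ?w r \<partial>?M)"
    using est[OF sm\<phi> \<phi>'(1) cK \<phi>'(2) opG cG KG m] by (elim exE)
  have "\<delta> \<le> \<bar>c - \<nu> p\<bar> + \<bar>c - \<nu> q\<bar>" unfolding \<delta>_def by linarith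
  then have "\<delta> / 2 \<le> \<bar>c - \<nu> p\<bar> \<or> \<delta> / 2 \<le> \<bar>c - \<nu> q\<bar>" by linarith
  then obtain s where s: "s \<in> {p, q}" "\<delta> / 2 \<le> \<bar>c - \<nu> s\<bar>" by (elim disjE) (rule that[of p], simp, assumption, rule that[of q], simp, assumption)
  define l where "l = (bump (1/2))\<^sup>2 * (\<delta> / 4)\<^sup>2"
  have l: "0 \<le> l" by (simp add: l_def)
  have "k \<le> l * I s" unfolding k_def l_def[symmetric] using s(1) l by (intro mult_left_mono) auto
  also have "\<dots> = (\<integral>r. l * (indicator (N s) r * ?w r) \<partial>?M)" by (simp add: I_def)
  also have "\<dots> \<le> (\<integral>r. (\<phi> r)\<^sup>2 * (\<nu> r - c)\<^sup>2 * ?w r \<partial>?M)"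
  proof (rule Bochner_Integration.integral_mono)
    show "integrable ?M (\<lambda>r. l * (indicator (N s) r * ?w r))" by (rule integrable_mult_right[OF int_N])
    show "integrable ?M (\<lambda>r. (\<phi> r)\<^sup>2 * (\<nu> r - c)\<^sup>2 * ?w r)"
      by (rule int) (auto intro!: continuous_intros c\<phi> c\<nu> cw simp: \<phi>0)
    fix r
    show "l * (indicator (N s) r * ?w r) \<le> (\<phi> r)\<^sup>2 * (\<nu> r - c)\<^sup>2 * ?w r"
    proof (cases "r \<in> N s")
      case True
      have "(bump (1/2))\<^sup>2 \<le> (\<phi> r)\<^sup>2" using half[of r] True by (intro power_mono) (auto simp: N_def)
      moreover have "(\<delta> / 4)\<^sup>2 \<le> (\<nu> r - c)\<^sup>2"
      proof -
        have "\<bar>\<nu> r - \<nu> s\<bar> < \<delta> / 4" using True by (simp add: N_def)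
        then have "\<delta> / 4 \<le> \<bar>\<nu> r - c\<bar>" using s(2) by linarith
        then have "(\<delta> / 4)\<^sup>2 \<le> \<bar>\<nu> r - c\<bar>\<^sup>2" using \<delta> by (intro power_mono) auto
        then show ?thesis by simp
      qed
      ultimately have "l \<le> (\<phi> r)\<^sup>2 * (\<nu> r - c)\<^sup>2" unfolding l_def by (intro mult_mono) auto
      then show ?thesis using True wpos[of r] by (simp add: mult_right_mono)
    qed (use wpos[of r] in simp)
  qed
  also note c
  also have "C * (\<integral>r. (\<Sum>e\<in>Basis. (mder x \<phi> r e)\<^sup>2) * ?w r \<partial>?M) \<le> C * (B / R\<^sup>2 * V)"
  proof (rule mult_left_mono[OF _ C])
    have "(\<integral>r. (\<Sum>e\<in>Basis. (mder x \<phi> r e)\<^sup>2) * ?w r \<partial>?M) \<le> (\<integral>r. B / R\<^sup>2 * ?w r \<partial>?M)"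
    proof (rule Bochner_Integration.integral_mono)
      show "integrable ?M (\<lambda>r. (\<Sum>e\<in>Basis. (mder x \<phi> r e)\<^sup>2) * ?w r)"
      proof (rule int)
        show "continuous_on UNIV (\<lambda>r. (\<Sum>e\<in>Basis. (mder x \<phi> r e)\<^sup>2) * ?w r)"
          by (intro continuous_intros cw smooth_map_continuous smooth_map_mder[OF imm] sm\<phi> smooth_map_const)
        show "(\<Sum>e\<in>Basis. (mder x \<phi> r e)\<^sup>2) * ?w r = 0" if "r \<notin> K" for r
          using mder_zero_outside[OF imm sm\<phi> compact_imp_closed[OF cK] \<phi>0 that] by simp
      qed
      show "integrable ?M (\<lambda>r. B / R\<^sup>2 * ?w r)" by (rule integrable_mult_right[OF int_w])
      fix r
      have "(\<Sum>e\<in>Basis. (mder x \<phi> r e)\<^sup>2) \<le> B / R\<^sup>2"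
        unfolding \<phi>_def[abs_def] by (rule grad) (use R in simp)
      then show "(\<Sum>e\<in>Basis. (mder x \<phi> r e)\<^sup>2) * ?w r \<le> B / R\<^sup>2 * ?w r"
        using wpos[of r] by (intro mult_right_mono) auto
    qed
    then show "(\<integral>r. (\<Sum>e\<in>Basis. (mder x \<phi> r e)\<^sup>2) * ?w r \<partial>?M) \<le> B / R\<^sup>2 * V" by (simp add: V_def)
  qed
  finally have "k \<le> C * (B / R\<^sup>2 * V)" .
  then have "k * R\<^sup>2 \<le> C * B * V" using R by (simp add: field_simps)
  then have "R\<^sup>2 \<le> C * B * V / k" using k_pos by (simp add: field_simps)
  also have "\<dots> < R" using r0 by (simp add: R_def)
  also have "R \<le> R\<^sup>2" using R by (intro self_le_power) auto
  finally show False by simp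
qed

text \<open>The squared length of the normal part of \<open>a\<close> is |a|^2 - a \<bullet> P a, so
  the quadratic form of the projection P is the same at all points; P is symmetric and polarisation
  recovers it.\<close>

lemma projection_const:
  fixes x :: "'a \<Rightarrow> 'b::euclidean_space"
  assumes "connected (UNIV :: 'a set)" "self_shrinker A x" "W_stable A x"
    and "\<And>R. compact {q. norm (x q) \<le> R}"
  shows "mder x x p a = mder x x q a"
proof -
  have imm: "immersion A x" using assms(2) by (simp add: self_shrinker_def)
  have quad: "a \<bullet> mder x x p a = a \<bullet> mder x x q a" for a
  proof -
    have "(norm (a - mder x x r a))\<^sup>2 = a \<bullet> a - a \<bullet> mder x x r a" for r
      using proj_sym[OF imm, of r a "mder x x r a"] proj_idem[OF imm, of r a]
      by (simp add: power2_norm_eq_inner inner_diff_left inner_diff_right inner_commute)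
    then show ?thesis using norm_normal_const[OF assms, of a p q] by (metis diff_left_imp_eq)
  qed
  have "b \<bullet> mder x x p a = b \<bullet> mder x x q a" for b
  proof -
    have "(a + b) \<bullet> mder x x r (a + b) = a \<bullet> mder x x r a + b \<bullet> mder x x r b + 2 * (b \<bullet> mder x x r a)" for r
      using proj_sym[OF imm, of r b a]
      by (simp add: linear_add[OF lin_proj[OF imm]] inner_add_left inner_add_right inner_commute)
    then show ?thesis using quad[of a] quad[of b] quad[of "a + b"] by simp
  qed
  then show ?thesis by (metis inner_commute vector_eq_rdot)
qed

text \<open>A constant projection has derivative zero, so \<open>shape\<close> and with it the mean
  curvature vanish. The shrinker equation is then the assertion.\<close>

lemma projection_fixes_position:
  fixes x :: "'a \<Rightarrow> 'b::euclidean_space"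
  assumes shr: "self_shrinker A x" and const: "\<And>p q a. mder x x p a = mder x x q a"
  shows "mder x x q (x q) = x q"
proof -
  have imm: "immersion A x" using shr by (simp add: self_shrinker_def)
  obtain U \<phi> where ch: "(U, \<phi>) \<in> A" "q \<in> U" by (rule covers)
  have z: "\<phi> q \<in> \<phi> ` U" using ch(2) by blast
  interpret shrinker_chart "loc U \<phi> x" "\<phi> ` U" by (rule shrinker_chart_loc[OF ch(1) shr])
  have "mshape x (inv_into U \<phi> (\<phi> q)) b c = 0" for b c
  proof -
    have "(\<lambda>p. mder x x p c) = (\<lambda>p. mder x x q c)" by (rule ext) (rule const)
    then have "mshape x (inv_into U \<phi> (\<phi> q)) b c = tder (loc U \<phi> x) (loc U \<phi> (\<lambda>p. mder x x q c)) (\<phi> q) b"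
      unfolding mshape_def by (simp only: mder_eq'[OF imm ch(1) z smooth_map_const])
    then show ?thesis unfolding comp_def[of "\<lambda>p. mder x x q c"] tder_const .
  qed
  then have "mean (\<phi> q) = 0"
    unfolding mean_def by (simp add: mshape_loc[OF imm ch(1) z])
  then have "tproj (loc U \<phi> x) (\<phi> q) (loc U \<phi> x (\<phi> q)) = loc U \<phi> x (\<phi> q)"
    using mean_eq[OF z] by simp
  then show ?thesis
    using mder_eq[OF imm ch immersion_smooth[OF imm]] by (simp only: loc_eq[OF ch])
qed

text \<open>The image is open and closed in the range of the common projection, which is connected
  as a subspace and has the dimension of any tangent space.\<close>

lemma range_immersion_subspace:
  fixes x :: "'a \<Rightarrow> 'b::euclidean_space"
  assumes imm: "immersion A x" and P: "\<And>q a. mder x x q a = P a" "\<And>q. P (x q) = x q"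
    and closed: "closed (range x)"
  shows "range x = range P" "subspace (range P)" "dim (range P) = CARD('m)"
proof -
  fix q0 :: 'a
  have P_eq: "P = mder x x q0" by (rule ext) (simp add: P(1))
  have linP: "linear P" unfolding P_eq by (rule lin_proj[OF imm])
  have idem: "P (P a) = P a" for a unfolding P_eq by (rule proj_idem[OF imm])
  have P_range: "P w = w" if "w \<in> range P" for w using that idem by auto
  show sub: "subspace (range P)" by (rule linear_subspace_image[OF linP subspace_UNIV])
  have tproj_eq: "P = tproj (loc U \<phi> x) (\<phi> q)" if "(U, \<phi>) \<in> A" "q \<in> U" for U \<phi> q
    by (rule ext) (simp only: P(1)[of q, symmetric] mder_eq[OF imm that immersion_smooth[OF imm]])
  have tangent: "range P = range (dird (loc U \<phi> x) (\<phi> q))" if ch: "(U, \<phi>) \<in> A" "q \<in> U" for U \<phi> q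
  proof -
    interpret immersed_chart "loc U \<phi> x" "\<phi> ` U" by (rule immersed_chart_loc[OF ch(1) imm])
    have z: "\<phi> q \<in> \<phi> ` U" using ch(2) by blast
    have "P w \<in> range (dird (loc U \<phi> x) (\<phi> q))" for w
      unfolding tproj_eq[OF ch] tder_def by blast
    moreover have "dird (loc U \<phi> x) (\<phi> q) v = P (dird (loc U \<phi> x) (\<phi> q) v)" for v
      unfolding tproj_eq[OF ch] by (rule tproj_dird'[OF z, symmetric])
    ultimately show ?thesis by blast
  qed
  show "dim (range P) = CARD('m)"
  proof -
    obtain U \<phi> where ch: "(U, \<phi>) \<in> A" "q0 \<in> U" by (rule covers)
    interpret immersed_chart "loc U \<phi> x" "\<phi> ` U" by (rule immersed_chart_loc[OF ch(1) imm])
    have z: "\<phi> q0 \<in> \<phi> ` U" using ch(2) by blast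
    show ?thesis unfolding tangent[OF ch]
      using dim_image_eq[OF lin_f[OF z], of UNIV] inj_f[OF z] by simp
  qed
  have xP: "range x \<subseteq> range P" using P(2) by (metis image_subsetI rangeI)
  have "openin (top_of_set (range P)) (range x)"
  proof (subst openin_subopen, intro ballI)
    fix w assume "w \<in> range x"
    then obtain q where q: "w = x q" by blast
    obtain U \<phi> where ch: "(U, \<phi>) \<in> A" "q \<in> U" by (rule covers)
    interpret immersed_chart "loc U \<phi> x" "\<phi> ` U" by (rule immersed_chart_loc[OF ch(1) imm])
    have z: "\<phi> q \<in> \<phi> ` U" using ch(2) by blast
    let ?L = "pinv (loc U \<phi> x) (\<phi> q)" and ?f = "loc U \<phi> x"
    have blL: "bounded_linear ?L" using lin_pinv[OF z] by (simp add: linear_conv_bounded_linear)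
    have contL: "continuous_on S ?L" for S by (rule linear_continuous_on[OF blL])
    \<comment> \<open>On the range of \<open>P\<close> the map \<open>pinv\<close> loses nothing:
      applying the differential of the immersion to it returns the projection, which fixes these
      vectors.\<close>
    have L_inj: "u = v" if "u \<in> range P" "v \<in> range P" "?L u = ?L v" for u v
    proof -
      have "P u = P v" unfolding tproj_eq[OF ch] tder_def using that(3) by simp
      then show ?thesis by (simp only: P_range[OF that(1)] P_range[OF that(2)])
    qed
    have "(?f has_derivative dird ?f (\<phi> q)) (at (\<phi> q))" by (rule smooth_on_has_derivative[OF smooth_f z])
    then have "((\<lambda>y. ?L (?f y)) has_derivative (\<lambda>v. ?L (dird ?f (\<phi> q) v))) (at (\<phi> q))"
      by (rule bounded_linear.has_derivative[OF blL])
    then have der: "((\<lambda>y. ?L (?f y)) has_derivative (\<lambda>v. v)) (at (\<phi> q))" by (simp only: pinv_dird'[OF z])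
    have cont: "continuous_on (\<phi> ` U) (\<lambda>y. ?L (?f y))"
      by (rule continuous_on_compose2[OF contL[of UNIV] smooth_on_imp_continuous_on[OF smooth_f]]) simp
    let ?G = "interior ((\<lambda>y. ?L (?f y)) ` \<phi> ` U)"
    \<comment> \<open>In the coordinates given by \<open>?L\<close> the immersion has the identity
      as derivative at this point, so the open mapping theorem gives an interior point of the image;
      injectivity of \<open>?L\<close> carries this back to the subspace.\<close>
    have "?L (?f (\<phi> q)) \<in> ?G"
      by (rule sussmann_open_mapping[OF open_O cont z der bounded_linear_ident])
        (auto simp: interior_open[OF open_O] z o_def ch(2))
    then have w: "w \<in> range P \<inter> ?L -` ?G" using xP q by (auto simp: loc_eq[OF ch] simp del: o_apply)
    have "range P \<inter> ?L -` ?G \<subseteq> range x"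
    proof
      fix u assume u: "u \<in> range P \<inter> ?L -` ?G"
      then obtain y where y: "?L u = ?L (?f y)" using interior_subset by blast
      have "?f y \<in> range P" using xP by auto
      then have "u = ?f y" using L_inj u y by blast
      then show "u \<in> range x" by simp
    qed
    moreover have "openin (top_of_set (range P)) (range P \<inter> ?L -` ?G)"
      by (rule continuous_openin_preimage_gen[OF contL open_interior])
    ultimately show "\<exists>T. openin (top_of_set (range P)) T \<and> w \<in> T \<and> T \<subseteq> range x" using w by (intro exI conjI)
  qed
  moreover have "closedin (top_of_set (range P)) (range x)" by (rule closed_subset[OF xP closed])
  moreover have "connected (range P)" by (rule convex_connected[OF subspace_imp_convex[OF sub]])
  ultimately show "range x = range P" unfolding connected_clopen by blast
qed

end

theorem corollary7p3:
  fixes A :: "('a::{t2_space, second_countable_topology}, 'm::finite) chart set"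
    and x :: "'a \<Rightarrow> real^('m + 'p::finite)"
  assumes "smooth_atlas A"
    and "connected (UNIV :: 'a set)"
    and "self_shrinker A x"
    and "proper_map euclidean euclidean x"
    and "complete_immersion A x"
    and "W_stable A x"
    and "flat_normal_bundle A x"
  shows "affine (range x) \<and> aff_dim (range x) = int CARD('m) \<and> 0 \<in> range x"
proof -
  interpret atlas A by (rule atlas.intro) (rule assms(1))
  have imm: "immersion A x" using assms(3) by (simp add: self_shrinker_def)
  \<comment> \<open>Properness makes the preimages of closed Euclidean balls compact, so cutoffs in
    |x| have compact support; it also makes the image closed.\<close>
  have proper: "compact {q. norm (x q) \<le> R}" for R
    using compactin_proper_map_preimage[OF assms(4), of "cball 0 R"] by simp
  have closed: "closed (range x)"
    using proper_imp_closed_map[OF assms(4)] by (auto simp: closed_map_def)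
  fix q0 :: 'a
  define P where "P = mder x x q0"
  have const: "mder x x p a = mder x x q a" for p q a
    by (rule projection_const[OF assms(2,3,6) proper])
  have P: "mder x x q a = P a" "P (x q) = x q" for q a
    using projection_fixes_position[OF assms(3) const, of q]
    unfolding P_def const[of q0 _ q] by simp_all
  note rng = range_immersion_subspace[OF imm P closed]
  have "subspace (range x)" "dim (range x) = CARD('m)" unfolding rng(1) by (fact rng)+
  then show ?thesis
    by (simp add: subspace_imp_affine aff_dim_subspace subspace_0)
qed

end
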